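(* Let $b_p$ ($p\in J_+$) be constants, all but finitely many zero. For a $\mathcal B$-valued function $Q=Q(x)$, $\mathcal B=\{X\in\mathfrak g^0\mid(d\mid X)=0\}$, put $$M=rh\sum_{p\in J_+}\left(b_p-\frac{\delta_{p1}}{rh}x\right)\left(e^{\mathrm{ad}_{U(Q)}}\Lambda_p\right)_{\ge0},$$ and consider the equation $$\left[\frac{\partial}{\partial x}+\Lambda_1+Q,\ -d+M\right]=0.\qquad(\mathrm{Red})$$ For $i=0,1,\dots,\ell$ let $$\theta_i=\frac{k_i^\vee}{k_i}(\alpha_i^\vee\mid Q),\qquad\chi_i=\frac{k_i}{k_i^\vee}-(\alpha_i^\vee\mid M),\qquad\varphi_i=\frac1\nu(f_i\mid M).$$ (One has $\sum_{i}k_i\theta_i=0$ and $\sum_ik_i^\vee\chi_i=h$; $(\theta_1,\dots,\theta_\ell)$ are coordinates on $\mathcal B$, and $\chi_i,\varphi_i$ are polynomials of $x$ and of $\theta_1,\dots,\theta_\ell$ and their $x$-derivatives.) Then: (i) Equation (Red) implies that the $\chi_i$ are constant functions. (ii) For a fixed set of constants $\chi_0,\dots,\chi_\ell$ with $\sum_{i=0}^\ell k_i^\vee\chi_i=h$, equation (Red) (with these values of $\chi_i$) can be represented as the system of ODEs for the unknown functions $\theta_1,\dots,\theta_\ell$ $$\varphi_i'+\theta_i\varphi_i+\chi_i=0,\qquad i=0,1,\dots,\ell.$$ (iii) Denote $\xi_j=\chi_j/(\nu\varphi_j)$ for $j=0,1,\dots,\ell$. Then equation (Red) has the Bäcklund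 transformations $$\mathscr R_j:(Q,M)\mapsto(\tilde Q,\tilde M),\qquad j=0,1,\dots,\ell,$$ defined by $$\frac{\partial}{\partial x}+\tilde Q+\Lambda_1=e^{-\xi_j\mathrm{ad}_{f_j}}\left(\frac{\partial}{\partial x}+Q+\Lambda_1\right)-\frac{\nu k_j}{hk_j^\vee}\xi_j\,c,\qquad -d+\tilde M=e^{-\xi_j\mathrm{ad}_{f_j}}\left(-d+M\right)-\frac{\chi_j}h\,c.$$ More explicitly, for $i,j=0,1,\dots,\ell$, $$\mathscr R_j(\chi_i)=\chi_i-a_{ij}\chi_j,\qquad\mathscr R_j(\theta_i)=\theta_i+a_{ji}\frac{\chi_j}{\varphi_j},\qquad\mathscr R_j(\varphi_i)=\frac1\nu\left(e^{\xi_j\mathrm{ad}_{f_j}}f_i\mid M\right).$$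
   Context: $A=(a_{ij})_{0\le i,j\le\ell}$ is a generalized Cartan matrix of affine type $X_{\ell'}^{(r)}$ ($r\in\{1,2,3\}$), with Kac labels $k_i$ and dual Kac labels $k_i^\vee$. $\mathfrak g(A)$ is the complex affine Kac-Moody algebra with Chevalley generators $e_i,f_i$, simple coroots $\alpha_i^\vee=[e_i,f_i]$, $[\alpha_i^\vee,e_j]=a_{ij}e_j$, Cartan subalgebra $\mathfrak h=\bigoplus_i\mathbb C\alpha_i^\vee\oplus\mathbb C d$, $[d,e_i]=e_i$, $[d,f_i]=-f_i$; $\mathfrak g=[\mathfrak g(A),\mathfrak g(A)]$; $c=\sum_i k_i^\vee\alpha_i^\vee$ is central. $(\cdot\mid\cdot)$ is the invariant symmetric bilinear form with $(\alpha_i^\vee\mid\alpha_j^\vee)=a_{ij}k_j/k_j^\vee$, $(d\mid\alpha_j^\vee)=k_j/k_j^\vee$, $(d\mid d)=0$. $h=\sum_i k_i=(d\mid c)$. $\mathfrak g^k=\{X\in\mathfrak g\mid[d,X]=kX\}$ is the principal gradation; subscripts $<0$, $\ge0$ here denote projections with respect to it. With $\Lambda=\sum_i e_i$, $\mathcal H=\{X\in\mathfrak g\mid[\Lambda,X]\in\mathbb Cc\}$ has a basis consisting of $c$ and $\Lambda_j\in\mathfrak g^j$ ($j\in J$, the (multi)set of exponents, $J=J+rh\mathbb Z$), $[\Lambda_i,\Lambda_j]=i\delta_{i,-j}c$; $J_+$ denotes positive exponents; $\Lambda_1=\nu\Lambda$ with a nonzero constant $\nu$. For a $\mathcal B$-valued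 function $Q$ of $x$, $U(Q)$ is the unique function valued in (the completion $\prod_{k<0}\mathfrak g^k$ of) $\mathfrak g^{<0}$ such that $e^{-\mathrm{ad}_{U(Q)}}(\partial_x+\Lambda_1+Q)=\partial_x+\Lambda_1+H(Q)$ with $H(Q)$ valued in (the completion of) $\mathcal H\cap\mathfrak g^{<0}$, and $(d\mid e^{\mathrm{ad}_{U(Q)}}\Lambda_j)=0$ for all $j\in J_+$; its components are differential polynomials of $Q$. The brackets involving $\partial_x$ are taken in $\mathbb C\partial_x\ltimes C^\infty(\mathbb R,\mathfrak g(A))$. A Bäcklund transformation of the equation (Red), $[\partial_x+\Lambda_1+Q,\,-d+M]=0$, is a map taking a solution $(Q,M)$ to a solution $(\tilde Q,\tilde M)$ of the same form, i.e. $\tilde Q$ is $\mathcal B$-valued, $\tilde M=rh\sum_{p\in J_+}\left(b_p-\frac{\delta_{p1}}{rh}x\right)\left(e^{\mathrm{ad}_{U(\tilde Q)}}\Lambda_p\right)_{\ge0}$ (same $b_p$), and $[\partial_x+\Lambda_1+\tilde Q,\,-d+\tilde M]=0$; $\mathscr R_j$ is defined when $\varphi_j\not\equiv0$, and $\mathscr R_j(\chi_i),\mathscr R_j(\theta_i),\mathscr R_j(\varphi_i)$ denote the quantities $\chi_i,\theta_i,\varphi_i$ computed from $(\tilde Q,\tilde M)$. *)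

theory Defs
  imports
    "HOL-Analysis.Analysis"
    "HOL-Combinatorics.Permutations"
    "HOL-Library.Function_Algebras"
    "HOL-Library.FuncSet"
begin

section \<open>Affine generalized Cartan matrices\<close>

text \<open>Matrices are indexed by \<open>0, \<dots>, l\<close>; entries with an index above \<open>l\<close> are irrelevant.\<close>

definition gen_cartan_matrix :: "nat \<Rightarrow> (nat \<Rightarrow> nat \<Rightarrow> int) \<Rightarrow> bool" where
  "gen_cartan_matrix l A \<longleftrightarrow>
     (\<forall>i\<le>l. A i i = 2) \<and>
     (\<forall>i\<le>l. \<forall>j\<le>l. i \<noteq> j \<longrightarrow> A i j \<le> 0 \<and> (A i j = 0 \<longleftrightarrow> A j i = 0))"

definition indecomposable_matrix :: "nat \<Rightarrow> (nat \<Rightarrow> nat \<Rightarrow> int) \<Rightarrow> bool" where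
  "indecomposable_matrix l A \<longleftrightarrow>
     (\<forall>S. S \<noteq> {} \<and> S \<subset> {..l} \<longrightarrow> (\<exists>i\<in>S. \<exists>j\<in>{..l} - S. A i j \<noteq> 0))"

text \<open>Positive coprime integers spanning the kernel.\<close>

definition kac_labels :: "nat \<Rightarrow> (nat \<Rightarrow> nat \<Rightarrow> int) \<Rightarrow> (nat \<Rightarrow> nat) \<Rightarrow> bool" where
  "kac_labels l A k \<longleftrightarrow>
     (\<forall>i\<le>l. 0 < k i) \<and> (\<forall>i\<le>l. (\<Sum>j\<le>l. A i j * int (k j)) = 0) \<and> Gcd (k ` {..l}) = 1"

text \<open>A link \<open>(i, j, m, n)\<close> of a diagram encodes \<open>a\<^sub>i\<^sub>j = - m\<close> and \<open>a\<^sub>j\<^sub>i = - n\<close>.\<close>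

definition link_matrix :: "(nat \<times> nat \<times> nat \<times> nat) list \<Rightarrow> nat \<Rightarrow> nat \<Rightarrow> int" where
  "link_matrix L i j =
     (if i = j then 2
      else - int (\<Sum>(p, q, m, n)\<leftarrow>L.
              if p = i \<and> q = j then m else if p = j \<and> q = i then n else 0))"

definition chain :: "nat \<Rightarrow> nat \<Rightarrow> (nat \<times> nat \<times> nat \<times> nat) list" where
  "chain p q = map (\<lambda>i. (i, Suc i, 1, 1)) [p..<q]"

text \<open>
  Kac's tables Aff 1--3 with his numbering of vertices.  In \<open>affine_diagram l r L\<close> the number
  \<open>r\<close> is the upper index of the name \<open>X\<^sup>(\<^sup>r\<^sup>)\<close> and the matrix has size \<open>l + 1\<close>.
\<close>

inductive affine_diagram :: "nat \<Rightarrow> nat \<Rightarrow> (nat \<times> nat \<times> nat \<times> nat) list \<Rightarrow> bool" where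
  A1_1: "affine_diagram 1 1 [(0, 1, 2, 2)]"
| Al_1: "2 \<le> l \<Longrightarrow> affine_diagram l 1 (chain 0 l @ [(l, 0, 1, 1)])"
| Bl_1: "3 \<le> l \<Longrightarrow> affine_diagram l 1 ((0, 2, 1, 1) # chain 1 (l - 1) @ [(l - 1, l, 1, 2)])"
| Cl_1: "2 \<le> l \<Longrightarrow> affine_diagram l 1 ((0, 1, 1, 2) # chain 1 (l - 1) @ [(l - 1, l, 2, 1)])"
| Dl_1: "4 \<le> l \<Longrightarrow> affine_diagram l 1 ((0, 2, 1, 1) # chain 1 (l - 1) @ [(l - 2, l, 1, 1)])"
| E6_1: "affine_diagram 6 1 (chain 1 5 @ [(3, 6, 1, 1), (6, 0, 1, 1)])"
| E7_1: "affine_diagram 7 1 (chain 0 6 @ [(3, 7, 1, 1)])"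
| E8_1: "affine_diagram 8 1 (chain 0 7 @ [(5, 8, 1, 1)])"
| F4_1: "affine_diagram 4 1 (chain 0 2 @ [(2, 3, 1, 2), (3, 4, 1, 1)])"
| G2_1: "affine_diagram 2 1 [(0, 1, 1, 1), (1, 2, 1, 3)]"
| A2_2: "affine_diagram 1 2 [(0, 1, 4, 1)]"
| A2l_2: "2 \<le> l \<Longrightarrow> affine_diagram l 2 ((0, 1, 2, 1) # chain 1 (l - 1) @ [(l - 1, l, 2, 1)])"
| A2l_minus_1_2:
    "3 \<le> l \<Longrightarrow> affine_diagram l 2 ((0, 2, 1, 1) # chain 1 (l - 1) @ [(l - 1, l, 2, 1)])"
| Dl_plus_1_2:
    "2 \<le> l \<Longrightarrow> affine_diagram l 2 ((0, 1, 2, 1) # chain 1 (l - 1) @ [(l - 1, l, 1, 2)])"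
| E6_2: "affine_diagram 4 2 (chain 0 2 @ [(2, 3, 2, 1), (3, 4, 1, 1)])"
| D4_3: "affine_diagram 2 3 [(0, 1, 1, 1), (1, 2, 3, 1)]"

text \<open>
  The last conjunct attaches \<open>r\<close> to an affine matrix through its name in the tables (up to
  renumbering); the others are the intrinsic definition of affine type.
\<close>

definition affine_cartan_matrix :: "nat \<Rightarrow> nat \<Rightarrow> (nat \<Rightarrow> nat \<Rightarrow> int) \<Rightarrow> bool" where
  "affine_cartan_matrix l r A \<longleftrightarrow>
     gen_cartan_matrix l A \<and> indecomposable_matrix l A \<and>
     (\<exists>u. (\<forall>i\<le>l. 0 < u i) \<and> (\<forall>i\<le>l. (\<Sum>j\<le>l. A i j * u j) = 0)) \<and>
     (\<exists>L \<pi>. affine_diagram l r L \<and> \<pi> permutes {..l} \<and>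
        (\<forall>i\<le>l. \<forall>j\<le>l. A (\<pi> i) (\<pi> j) = link_matrix L i j))"


section \<open>Affine Kac--Moody algebras and their principal Heisenberg subalgebras\<close>

text \<open>
  The whole type \<open>'g\<close> is the algebra \<open>\<gg>(A)\<close>, a complex vector space under \<open>scl\<close>.  The exponents
  form a multiset, given by its multiplicity function \<open>emult\<close>; its elements are the pairs \<open>(m, a)\<close>
  with \<open>a < emult m\<close>, of value \<open>m\<close>, and \<open>- (m, a)\<close> is \<open>(- m, a)\<close>.
\<close>

record 'g affine_data =
  ell :: nat
  twist :: nat
  cartan :: "nat \<Rightarrow> nat \<Rightarrow> int"
  lab :: "nat \<Rightarrow> nat"
  dlab :: "nat \<Rightarrow> nat"
  scl :: "complex \<Rightarrow> 'g \<Rightarrow> 'g"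
  brk :: "'g \<Rightarrow> 'g \<Rightarrow> 'g"
  chev_e :: "nat \<Rightarrow> 'g"
  chev_f :: "nat \<Rightarrow> 'g"
  coroot :: "nat \<Rightarrow> 'g"
  grad_d :: 'g
  form :: "'g \<Rightarrow> 'g \<Rightarrow> complex"
  emult :: "int \<Rightarrow> nat"
  Lam :: "int \<times> nat \<Rightarrow> 'g"
  nu :: complex

definition lie_algebra ::
    "(complex \<Rightarrow> 'g::ab_group_add \<Rightarrow> 'g) \<Rightarrow> ('g \<Rightarrow> 'g \<Rightarrow> 'g) \<Rightarrow> bool" where
  "lie_algebra sc br \<longleftrightarrow>
     vector_space sc \<and>
     (\<forall>X. Vector_Spaces.linear sc sc (br X)) \<and>
     (\<forall>Y. Vector_Spaces.linear sc sc (\<lambda>X. br X Y)) \<and>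
     (\<forall>X. br X X = 0) \<and>
     (\<forall>X Y Z. br X (br Y Z) + br Y (br Z X) + br Z (br X Y) = 0)"

definition cartan_subalgebra :: "'g::ab_group_add affine_data \<Rightarrow> 'g set" where
  "cartan_subalgebra G = module.span (scl G) (insert (grad_d G) (coroot G ` {..ell G}))"

text \<open>
  Kac's characterization of \<open>\<gg>(A)\<close> by a realization, generators, relations, and the absence of
  nonzero ideals meeting the Cartan subalgebra trivially.
\<close>

definition kac_moody_algebra :: "'g::ab_group_add affine_data \<Rightarrow> bool" where
  "kac_moody_algebra G \<longleftrightarrow>
     lie_algebra (scl G) (brk G) \<and>
     inj_on (coroot G) {..ell G} \<and> grad_d G \<notin> coroot G ` {..ell G} \<and>
     \<not> module.dependent (scl G) (insert (grad_d G) (coroot G ` {..ell G})) \<and>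
     (\<forall>i\<le>ell G. \<forall>j\<le>ell G.
        brk G (coroot G i) (coroot G j) = 0 \<and>
        brk G (coroot G i) (chev_e G j) = scl G (of_int (cartan G i j)) (chev_e G j) \<and>
        brk G (coroot G i) (chev_f G j) = scl G (- of_int (cartan G i j)) (chev_f G j) \<and>
        brk G (chev_e G i) (chev_f G j) = (if i = j then coroot G i else 0)) \<and>
     (\<forall>i\<le>ell G.
        brk G (grad_d G) (coroot G i) = 0 \<and>
        brk G (grad_d G) (chev_e G i) = chev_e G i \<and>
        brk G (grad_d G) (chev_f G i) = - chev_f G i) \<and>
     (\<forall>S. module.subspace (scl G) S \<and> (\<forall>X\<in>S. \<forall>Y\<in>S. brk G X Y \<in> S) \<and>
        cartan_subalgebra G \<union> chev_e G ` {..ell G} \<union> chev_f G ` {..ell G} \<subseteq> S \<longrightarrow> S = UNIV) \<and>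
     (\<forall>I. module.subspace (scl G) I \<and> (\<forall>X. \<forall>Y\<in>I. brk G X Y \<in> I) \<and>
        I \<inter> cartan_subalgebra G = {0} \<longrightarrow> I = {0})"

definition label_ratio :: "'g affine_data \<Rightarrow> nat \<Rightarrow> complex" where
  "label_ratio G i = of_nat (lab G i) / of_nat (dlab G i)"

definition invariant_form :: "'g::ab_group_add affine_data \<Rightarrow> bool" where
  "invariant_form G \<longleftrightarrow>
     (\<forall>X. Vector_Spaces.linear (scl G) (*) (form G X)) \<and>
     (\<forall>X Y. form G X Y = form G Y X) \<and>
     (\<forall>X Y Z. form G (brk G X Y) Z = form G X (brk G Y Z)) \<and>
     (\<forall>i\<le>ell G. \<forall>j\<le>ell G.
        form G (coroot G i) (coroot G j) = of_int (cartan G i j) * label_ratio G j) \<and>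
     (\<forall>j\<le>ell G. form G (grad_d G) (coroot G j) = label_ratio G j) \<and>
     form G (grad_d G) (grad_d G) = 0"

definition derived_algebra :: "'g::ab_group_add affine_data \<Rightarrow> 'g set" where
  "derived_algebra G = module.span (scl G) {brk G X Y |X Y. True}"

definition gdeg :: "'g::ab_group_add affine_data \<Rightarrow> int \<Rightarrow> 'g set" where
  "gdeg G k = {X \<in> derived_algebra G. brk G (grad_d G) X = scl G (of_int k) X}"

definition central :: "'g::ab_group_add affine_data \<Rightarrow> 'g" where
  "central G = (\<Sum>i\<le>ell G. scl G (of_nat (dlab G i)) (coroot G i))"

definition cox :: "'g affine_data \<Rightarrow> nat" where
  "cox G = (\<Sum>i\<le>ell G. lab G i)"

definition Lam_sum :: "'g::ab_group_add affine_data \<Rightarrow> 'g" where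
  "Lam_sum G = (\<Sum>i\<le>ell G. chev_e G i)"

definition heis :: "'g::ab_group_add affine_data \<Rightarrow> 'g set" where
  "heis G = {X \<in> derived_algebra G. brk G (Lam_sum G) X \<in> module.span (scl G) {central G}}"

definition exponents :: "'g affine_data \<Rightarrow> (int \<times> nat) set" where
  "exponents G = {(m, a). a < emult G m}"

definition pos_exponents :: "'g affine_data \<Rightarrow> (int \<times> nat) set" where
  "pos_exponents G = {p \<in> exponents G. 0 < fst p}"

text \<open>The exponent 1 has multiplicity one, so \<open>(1, 0)\<close> is the element 1 of the multiset.\<close>

abbreviation Lam1 :: "'g affine_data \<Rightarrow> 'g" where
  "Lam1 G \<equiv> Lam G (1, 0)"

definition heisenberg_basis :: "'g::ab_group_add affine_data \<Rightarrow> bool" where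
  "heisenberg_basis G \<longleftrightarrow>
     (\<forall>m. emult G (m + int (twist G * cox G)) = emult G m) \<and>
     (\<forall>m. emult G (- m) = emult G m) \<and>
     (\<forall>p\<in>exponents G. Lam G p \<in> gdeg G (fst p)) \<and>
     inj_on (Lam G) (exponents G) \<and> central G \<notin> Lam G ` exponents G \<and>
     \<not> module.dependent (scl G) (insert (central G) (Lam G ` exponents G)) \<and>
     module.span (scl G) (insert (central G) (Lam G ` exponents G)) = heis G \<and>
     (\<forall>p\<in>exponents G. \<forall>q\<in>exponents G. brk G (Lam G p) (Lam G q) =
        (if fst q = - fst p \<and> snd q = snd p then scl G (of_int (fst p)) (central G) else 0)) \<and>
     nu G \<noteq> 0 \<and> Lam1 G = scl G (nu G) (Lam_sum G)"

locale drinfeld_sokolov_data =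
  fixes G :: "'g::ab_group_add affine_data"
  assumes affine: "affine_cartan_matrix (ell G) (twist G) (cartan G)"
    and labels: "kac_labels (ell G) (cartan G) (lab G)"
    and dual_labels: "kac_labels (ell G) (\<lambda>i j. cartan G j i) (dlab G)"
    and algebra: "kac_moody_algebra G"
    and inv_form: "invariant_form G"
    and heis_basis: "heisenberg_basis G"

definition Bspace :: "'g::ab_group_add affine_data \<Rightarrow> 'g set" where
  "Bspace G = {X \<in> gdeg G 0. form G (grad_d G) X = 0}"


section \<open>Smooth curves, and operators in one variable\<close>

text \<open>
  Functions of \<open>x\<close> live on an open set \<open>D\<close> of reals and are extended by 0, so that equality of
  functions on \<open>D\<close> is equality.
\<close>

definition restr :: "real set \<Rightarrow> (real \<Rightarrow> 'v::zero) \<Rightarrow> real \<Rightarrow> 'v" where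
  "restr D P = (\<lambda>x. if x \<in> D then P x else 0)"

definition smooth_scalar :: "real set \<Rightarrow> (real \<Rightarrow> complex) \<Rightarrow> bool" where
  "smooth_scalar D u \<longleftrightarrow>
     (\<exists>F. (\<forall>x\<in>D. F (0::nat) x = u x) \<and>
          (\<forall>n. \<forall>x\<in>D. (F n has_vector_derivative F (Suc n) x) (at x)))"

text \<open>\<open>C\<^sup>\<infinity>(D) \<otimes> \<gg>(A)\<close>: smooth with values in a finite-dimensional subspace.\<close>

definition smooth_curve :: "'g::ab_group_add affine_data \<Rightarrow> real set \<Rightarrow> (real \<Rightarrow> 'g) \<Rightarrow> bool" where
  "smooth_curve G D P \<longleftrightarrow>
     (\<forall>x. x \<notin> D \<longrightarrow> P x = 0) \<and>
     (\<exists>S u. finite S \<and> (\<forall>v\<in>S. smooth_scalar D (u v)) \<and>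
            (\<forall>x\<in>D. P x = (\<Sum>v\<in>S. scl G (u v x) v)))"

definition curve_deriv :: "'g::ab_group_add affine_data \<Rightarrow> real set \<Rightarrow> (real \<Rightarrow> 'g) \<Rightarrow> real \<Rightarrow> 'g" where
  "curve_deriv G D P = restr D (\<lambda>x. THE Y. \<forall>w. Vector_Spaces.linear (scl G) (*) w \<longrightarrow>
     ((\<lambda>t. w (P t)) has_vector_derivative w Y) (at x))"

text \<open>The pair \<open>(a, P)\<close> stands for \<open>a \<partial>\<^sub>x + P\<close> in \<open>\<complex> \<partial>\<^sub>x \<ltimes> C\<^sup>\<infinity>(D, \<gg>(A))\<close>.\<close>

type_synonym 'g dop = "complex \<times> (real \<Rightarrow> 'g)"

definition op_scale :: "'g affine_data \<Rightarrow> complex \<Rightarrow> 'g dop \<Rightarrow> 'g dop" where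
  "op_scale G z = (\<lambda>(a, P). (z * a, \<lambda>x. scl G z (P x)))"

definition op_brk :: "'g::ab_group_add affine_data \<Rightarrow> real set \<Rightarrow> 'g dop \<Rightarrow> 'g dop \<Rightarrow> 'g dop" where
  "op_brk G D = (\<lambda>(a, P) (b, R).
     (0, \<lambda>x. scl G a (curve_deriv G D R x) - scl G b (curve_deriv G D P x) + brk G (P x) (R x)))"

text \<open>
  \<open>\<Sum>\<^sub>n T\<^sup>n y / n!\<close>, used when \<open>T\<^sup>n y\<close> vanishes for all but finitely many \<open>n\<close>.
\<close>

definition exp_nil :: "(complex \<Rightarrow> 'v \<Rightarrow> 'v) \<Rightarrow> ('v \<Rightarrow> 'v) \<Rightarrow> 'v \<Rightarrow> 'v::ab_group_add" where
  "exp_nil s T y = (\<Sum>n | (T ^^ n) y \<noteq> 0. s (1 / fact n) ((T ^^ n) y))"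

text \<open>
  Completion in the direction of negative degrees: \<open>Z k\<close> is the component of principal degree \<open>k\<close>
  (with \<open>\<partial>\<^sub>x\<close> in degree 0), and \<open>Z k = 0\<close> for large \<open>k\<close>.  The sums below are then finite: every
  component of \<open>ad\<^sub>U\<^sup>n Z\<close> vanishes for large \<open>n\<close> if \<open>U\<close> has only negative components.
\<close>

type_synonym 'g dser = "int \<Rightarrow> 'g dop"

definition ser_brk :: "'g::ab_group_add affine_data \<Rightarrow> real set \<Rightarrow> 'g dser \<Rightarrow> 'g dser \<Rightarrow> 'g dser" where
  "ser_brk G D Z W = (\<lambda>n. \<Sum>k | op_brk G D (Z k) (W (n - k)) \<noteq> 0. op_brk G D (Z k) (W (n - k)))"

definition exp_ser :: "'g::ab_group_add affine_data \<Rightarrow> ('g dser \<Rightarrow> 'g dser) \<Rightarrow> 'g dser \<Rightarrow> 'g dser" where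
  "exp_ser G T Z =
     (\<lambda>k. \<Sum>n | (T ^^ n) Z k \<noteq> 0. op_scale G (1 / fact n) ((T ^^ n) Z k))"

definition homog :: "int \<Rightarrow> 'g::ab_group_add dop \<Rightarrow> 'g dser" where
  "homog m Z = (\<lambda>k. if k = m then Z else 0)"

definition curve_ser :: "(int \<Rightarrow> real \<Rightarrow> 'g) \<Rightarrow> 'g dser" where
  "curve_ser U = (\<lambda>k. (0, U k))"

definition nonneg_part :: "'g::ab_group_add dser \<Rightarrow> 'g dop" where
  "nonneg_part Z = (\<Sum>k | 0 \<le> k \<and> Z k \<noteq> 0. Z k)"


section \<open>The dressing element, the similarity reduction and the quantities attached to it\<close>

definition B_curve :: "'g::ab_group_add affine_data \<Rightarrow> real set \<Rightarrow> (real \<Rightarrow> 'g) \<Rightarrow> bool" where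
  "B_curve G D Q \<longleftrightarrow> smooth_curve G D Q \<and> (\<forall>x\<in>D. Q x \<in> Bspace G)"

text \<open>Smooth functions valued in the completion of \<open>V \<inter> \<gg>\<^sup><\<^sup>0\<close>, given by their components.\<close>

definition neg_curves ::
    "'g::ab_group_add affine_data \<Rightarrow> real set \<Rightarrow> 'g set \<Rightarrow> (int \<Rightarrow> real \<Rightarrow> 'g) set" where
  "neg_curves G D V = {U. \<forall>k. smooth_curve G D (U k) \<and>
     (if k < 0 then \<forall>x. U k x \<in> V \<inter> gdeg G k else U k = 0)}"

text \<open>
  In \<open>(d | e\<^sup>a\<^sup>d\<^sup>U \<Lambda>\<^sub>j) = 0\<close> only the component of degree 0 pairs nontrivially with \<open>d\<close>.
\<close>

definition dressing ::
    "'g::ab_group_add affine_data \<Rightarrow> real set \<Rightarrow> (real \<Rightarrow> 'g) \<Rightarrow> (int \<Rightarrow> real \<Rightarrow> 'g) \<Rightarrow> bool" where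
  "dressing G D Q U \<longleftrightarrow>
     U \<in> neg_curves G D UNIV \<and>
     (\<exists>H \<in> neg_curves G D (heis G).
        exp_ser G (\<lambda>Z. - ser_brk G D (curve_ser U) Z)
          (homog 0 (1, Q) + homog 1 (0, restr D (\<lambda>_. Lam1 G))) =
        homog 0 (1, 0) + homog 1 (0, restr D (\<lambda>_. Lam1 G)) + curve_ser H) \<and>
     (\<forall>p\<in>pos_exponents G. \<forall>x\<in>D.
        form G (grad_d G)
          (snd (exp_ser G (ser_brk G D (curve_ser U))
                  (homog (fst p) (0, restr D (\<lambda>_. Lam G p))) 0) x) = 0)"

definition dress :: "'g::ab_group_add affine_data \<Rightarrow> real set \<Rightarrow> (real \<Rightarrow> 'g) \<Rightarrow> int \<Rightarrow> real \<Rightarrow> 'g" where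
  "dress G D Q = (THE U. dressing G D Q U)"

text \<open>\<open>(e\<^sup>a\<^sup>d\<^sup>U\<^sup>(\<^sup>Q\<^sup>) \<Lambda>\<^sub>p)\<^sub>\<ge>\<^sub>0\<close>, a function valued in the (uncompleted) algebra.\<close>

definition dressed_Lam ::
    "'g::ab_group_add affine_data \<Rightarrow> real set \<Rightarrow> (real \<Rightarrow> 'g) \<Rightarrow> int \<times> nat \<Rightarrow> real \<Rightarrow> 'g" where
  "dressed_Lam G D Q p =
     snd (nonneg_part (exp_ser G (ser_brk G D (curve_ser (dress G D Q)))
            (homog (fst p) (0, restr D (\<lambda>_. Lam G p)))))"

text \<open>The summation set contains all \<open>p\<close> with nonzero coefficient.\<close>

definition Mfun :: "'g::ab_group_add affine_data \<Rightarrow> (int \<times> nat \<Rightarrow> complex) \<Rightarrow> real set \<Rightarrow>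
    (real \<Rightarrow> 'g) \<Rightarrow> real \<Rightarrow> 'g" where
  "Mfun G b D Q = (\<lambda>x. let rh = of_nat (twist G) * of_nat (cox G) in
     scl G rh (\<Sum>p | p \<in> pos_exponents G \<and> (b p \<noteq> 0 \<or> p = (1, 0)).
       scl G (b p - (if p = (1, 0) then 1 else 0) / rh * complex_of_real x)
         (dressed_Lam G D Q p x)))"

definition lax_L :: "'g::ab_group_add affine_data \<Rightarrow> real set \<Rightarrow> (real \<Rightarrow> 'g) \<Rightarrow> 'g dop" where
  "lax_L G D Q = (1, restr D (\<lambda>x. Lam1 G + Q x))"

definition lax_M :: "'g::ab_group_add affine_data \<Rightarrow> real set \<Rightarrow> (real \<Rightarrow> 'g) \<Rightarrow> 'g dop" where
  "lax_M G D M = (0, restr D (\<lambda>x. - grad_d G + M x))"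

definition red_solution :: "'g::ab_group_add affine_data \<Rightarrow> (int \<times> nat \<Rightarrow> complex) \<Rightarrow> real set \<Rightarrow>
    (real \<Rightarrow> 'g) \<Rightarrow> (real \<Rightarrow> 'g) \<Rightarrow> bool" where
  "red_solution G b D Q M \<longleftrightarrow>
     B_curve G D Q \<and> M = Mfun G b D Q \<and> op_brk G D (lax_L G D Q) (lax_M G D M) = 0"

definition theta :: "'g affine_data \<Rightarrow> (real \<Rightarrow> 'g) \<Rightarrow> nat \<Rightarrow> real \<Rightarrow> complex" where
  "theta G Q i x = of_nat (dlab G i) / of_nat (lab G i) * form G (coroot G i) (Q x)"

definition chi :: "'g affine_data \<Rightarrow> (real \<Rightarrow> 'g) \<Rightarrow> nat \<Rightarrow> real \<Rightarrow> complex" where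
  "chi G M i x = label_ratio G i - form G (coroot G i) (M x)"

definition phi :: "'g affine_data \<Rightarrow> (real \<Rightarrow> 'g) \<Rightarrow> nat \<Rightarrow> real \<Rightarrow> complex" where
  "phi G M i x = 1 / nu G * form G (chev_f G i) (M x)"

definition xi :: "'g affine_data \<Rightarrow> (real \<Rightarrow> 'g) \<Rightarrow> nat \<Rightarrow> real \<Rightarrow> complex" where
  "xi G M j x = chi G M j x / (nu G * phi G M j x)"

text \<open>
  Polynomials in \<open>x\<close> and the jet variables \<open>u i m\<close> (standing for the \<open>m\<close>-th derivative of the
  \<open>i\<close>-th unknown), \<open>1 \<le> i \<le> l\<close>, with constant complex coefficients.
\<close>

inductive diff_poly :: "nat \<Rightarrow> (real \<Rightarrow> (nat \<Rightarrow> nat \<Rightarrow> complex) \<Rightarrow> complex) \<Rightarrow> bool"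
  for l :: nat where
  "diff_poly l (\<lambda>x u. z)"
| "diff_poly l (\<lambda>x u. complex_of_real x)"
| "i \<in> {1..l} \<Longrightarrow> diff_poly l (\<lambda>x u. u i m)"
| "diff_poly l P \<Longrightarrow> diff_poly l R \<Longrightarrow> diff_poly l (\<lambda>x u. P x u + R x u)"
| "diff_poly l P \<Longrightarrow> diff_poly l R \<Longrightarrow> diff_poly l (\<lambda>x u. P x u * R x u)"

definition theta_jet :: "'g affine_data \<Rightarrow> (real \<Rightarrow> 'g) \<Rightarrow> real \<Rightarrow> nat \<Rightarrow> nat \<Rightarrow> complex" where
  "theta_jet G Q x i m = ((\<lambda>u t. vector_derivative u (at t)) ^^ m) (theta G Q i) x"


section \<open>The Baecklund transformations\<close>

text \<open>
  A solution on \<open>D\<close> is mapped to one on the open subset where \<open>\<phi>\<^sub>j\<close> does not vanish.  In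
  \<open>e\<^sup>-\<^sup>\<xi>\<^sup>a\<^sup>d\<^sup>f\<close> applied to operators, \<open>\<xi> ad\<^sub>f\<close> is \<open>ad\<close> of the function \<open>\<xi> f\<close>,
  whose bracket with \<open>\<partial>\<^sub>x\<close> is \<open>- \<xi>' f\<close>.
\<close>

definition regular_set :: "'g affine_data \<Rightarrow> real set \<Rightarrow> (real \<Rightarrow> 'g) \<Rightarrow> nat \<Rightarrow> real set" where
  "regular_set G D M j = {x \<in> D. phi G M j x \<noteq> 0}"

definition gauge :: "'g::ab_group_add affine_data \<Rightarrow> real set \<Rightarrow> (real \<Rightarrow> 'g) \<Rightarrow> nat \<Rightarrow> 'g dop \<Rightarrow> 'g dop" where
  "gauge G D M j =
     exp_nil (op_scale G) (\<lambda>Z. - op_brk G D (0, restr D (\<lambda>x. scl G (xi G M j x) (chev_f G j))) Z)"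

definition backlund :: "'g::ab_group_add affine_data \<Rightarrow> real set \<Rightarrow> nat \<Rightarrow> (real \<Rightarrow> 'g) \<Rightarrow> (real \<Rightarrow> 'g) \<Rightarrow>
    (real \<Rightarrow> 'g) \<Rightarrow> (real \<Rightarrow> 'g) \<Rightarrow> bool" where
  "backlund G D j Q M Qt Mt \<longleftrightarrow> (let D' = regular_set G D M j in
     (\<forall>x. x \<notin> D' \<longrightarrow> Qt x = 0 \<and> Mt x = 0) \<and>
     lax_L G D' Qt = gauge G D' M j (lax_L G D' Q) -
       (0, restr D' (\<lambda>x. scl G (nu G * of_nat (lab G j) / (of_nat (cox G) * of_nat (dlab G j)) *
                                 xi G M j x) (central G))) \<and>
     lax_M G D' Mt = gauge G D' M j (lax_M G D' M) -
       (0, restr D' (\<lambda>x. scl G (chi G M j x / of_nat (cox G)) (central G))))"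

end

theory Submission
  imports Defs "HOL-Library.Groups_Big_Fun"
begin

text \<open>
  For \<open>k < 0\<close> nondegeneracy of the form gives \<open>\<gg>\<^sup>k = [\<Lambda>\<^sub>1, \<gg>\<^sup>k\<^sup>-\<^sup>1] \<oplus> \<H>\<^sup>k\<close>, so \<open>U(Q)\<close> is determined and constructed
  degree by degree, each component being a differential polynomial of \<open>Q\<close>.  With \<open>R\<^sub>p = e\<^sup>a\<^sup>d\<^sup>U \<Lambda>\<^sub>p\<close> the
  operator \<open>\<partial>\<^sub>x + \<Lambda>\<^sub>1 + Q\<close> commutes with \<open>R\<^sub>p\<close> up to the center, hence \<open>[\<partial>\<^sub>x + \<Lambda>\<^sub>1 + Q, - d + M]\<close> always
  reduces to the derivative of the degree 0 component of \<open>M\<close>, that is, to the derivatives of the \<open>\<chi>\<^sub>i\<close>.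
  The degree 1 component paired with \<open>f\<^sub>i\<close> yields \<open>\<phi>\<^sub>i' + \<theta>\<^sub>i \<phi>\<^sub>i + \<chi>\<^sub>i = 0\<close> for every \<open>Q\<close>.

  For the transformations, \<open>e\<^sup>-\<^sup>\<xi>\<^sup>a\<^sup>d\<^sup>f e\<^sup>a\<^sup>d\<^sup>U e\<^sup>a\<^sup>d\<^sup>W\<close> with \<open>W\<close> valued in \<open>\<H>\<close> is the identity up to lower degrees.
  Such an automorphism is an exponential \<open>e\<^sup>a\<^sup>d\<^sup>V\<close> because the degree derivation is inner.  The normalization
  \<open>(d | e\<^sup>a\<^sup>d\<^sup>V \<Lambda>\<^sub>p) = 0\<close> fixes \<open>W\<close>, and then \<open>V\<close> is the dressing element of the transformed \<open>Q\<close>.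
\<close>

section \<open>Linear functionals and kernels of affine matrices\<close>

text \<open>The algebra is given by a realization, generators, relations and the absence of ideals.
  The triangular decomposition, finite-dimensional degrees, nondegeneracy and the Serre relations
  are derived from this, with the one-dimensional kernel of an affine matrix.

  Why the exponent is xi_j f_j: conjugating the first operator leaves in degree -1 a multiple of f_j
  that vanishes exactly when xi' = theta_j xi + nu xi^2. This Riccati equation follows from the ODE
  of phi_j and the constancy of chi_j. The degree -1 part of the conjugated -d + M vanishes because
  nu xi phi_j = chi_j, which is why conjugation is compatible with the projection to degrees >= 0.
  The multiples of c restore (d | Q) = 0 and (d | M) = 0 in degree 0, which explains the divisor h =
  (d | c).

  An obstacle is that phi_j may have zeros: the image lives on a smaller open set, while M is built
  from a dressing element on a given set. Restriction is harmless because every component is a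
  differential polynomial chosen uniformly for all open sets and all Q.\<close>

lemma (in vector_space) functional_in_span:
  fixes g :: "'i \<Rightarrow> 'b \<Rightarrow> 'a"
  assumes "finite S" "subspace V" "Vector_Spaces.linear scale (*) f"
    "\<And>i. i \<in> S \<Longrightarrow> Vector_Spaces.linear scale (*) (g i)"
    "\<And>v. v \<in> V \<Longrightarrow> (\<forall>i\<in>S. g i v = 0) \<Longrightarrow> f v = 0"
  shows "\<exists>c. \<forall>v\<in>V. f v = (\<Sum>i\<in>S. c i * g i v)"
  using assms
proof (induction S arbitrary: V rule: finite_induct)
  case empty
  then show ?case by auto
next
  case (insert a S)
  interpret ga: Vector_Spaces.linear scale "(*)" "g a" using insert.prems by simp
  interpret f: Vector_Spaces.linear scale "(*)" f using insert.prems by simp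
  \<comment> \<open>On the kernel of \<open>g a\<close> the hypothesis holds for the remaining
    functionals. One vector outside this kernel then determines the coefficient \<open>t\<close> of
    \<open>g a\<close>; \<open>V\<close> may have infinite dimension.\<close>
  define W where "W = {v \<in> V. g a v = 0}"
  have W: "subspace W"
    using insert.prems(1) unfolding W_def subspace_def by (auto simp: ga.add ga.scale)
  obtain c where c: "\<forall>v\<in>W. f v = (\<Sum>i\<in>S. c i * g i v)"
    using insert.IH[OF W insert.prems(2)] insert.prems(3,4) unfolding W_def by auto
  show ?case
  proof (cases "\<exists>v\<in>V. g a v \<noteq> 0")
    case False
    then have "W = V" unfolding W_def by auto
    with c False insert.hyps have "\<forall>v\<in>V. f v = (\<Sum>i\<in>insert a S. c i * g i v)" by auto
    then show ?thesis by blast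
  next
    case True
    then obtain v0 where v0: "v0 \<in> V" "g a v0 \<noteq> 0" by blast
    define t where "t = (f v0 - (\<Sum>i\<in>S. c i * g i v0)) / g a v0"
    define c' where "c' = c(a := t)"
    have "f v = (\<Sum>i\<in>insert a S. c' i * g i v)" if v: "v \<in> V" for v
    proof -
      define r where "r = g a v / g a v0"
      define w where "w = v - scale r v0"
      have "w \<in> W"
        unfolding W_def w_def r_def using v v0 insert.prems(1)
        by (auto simp: ga.diff ga.scale subspace_diff subspace_scale)
      then have "f w = (\<Sum>i\<in>S. c i * g i w)" using c by blast
      moreover have "g i w = g i v - r * g i v0" if "i \<in> S" for i
      proof -
        interpret gi: Vector_Spaces.linear scale "(*)" "g i" using insert.prems(3) that by simp
        show ?thesis unfolding w_def by (simp add: gi.diff gi.scale)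
      qed
      ultimately have "f v - r * f v0 = (\<Sum>i\<in>S. c i * (g i v - r * g i v0))"
        unfolding w_def by (simp add: f.diff f.scale)
      also have "\<dots> = (\<Sum>i\<in>S. c i * g i v) - r * (\<Sum>i\<in>S. c i * g i v0)"
        by (simp add: right_diff_distrib sum_subtractf sum_distrib_left mult_ac)
      finally have "f v = (\<Sum>i\<in>S. c i * g i v) + r * (f v0 - (\<Sum>i\<in>S. c i * g i v0))"
        by (simp add: algebra_simps)
      also have "r * (f v0 - (\<Sum>i\<in>S. c i * g i v0)) = t * g a v"
        unfolding r_def t_def by simp
      finally have "f v = (\<Sum>i\<in>S. c i * g i v) + t * g a v" .
      moreover have "(\<Sum>i\<in>S. c' i * g i v) = (\<Sum>i\<in>S. c i * g i v)"
        using insert.hyps unfolding c'_def by (intro sum.cong) auto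
      ultimately show ?thesis using insert.hyps unfolding c'_def by simp
    qed
    then show ?thesis by blast
  qed
qed

text \<open>The algebra carries no topology, so derivatives of curves are tested by linear
  functionals; separation makes such a derivative unique.\<close>

lemma (in vector_space) functionals_separate:
  assumes "\<And>w. Vector_Spaces.linear scale (*) w \<Longrightarrow> w x = w y"
  shows "x = y"
proof (rule ccontr)
  assume "x \<noteq> y"
  interpret vs: vector_space_pair scale "(*) :: 'a \<Rightarrow> 'a \<Rightarrow> 'a"
    by unfold_locales (auto simp: algebra_simps)
  have "independent {x - y}" using \<open>x \<noteq> y\<close> by simp
  then obtain w where w: "Vector_Spaces.linear scale (*) w" "w (x - y) = 1"
    using vs.linear_independent_extend[of "{x - y}" "\<lambda>_. 1"] by auto
  interpret w: Vector_Spaces.linear scale "(*)" w by fact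
  show False using w(2) assms[OF w(1)] by (simp add: w.diff)
qed

lemma gen_cartan_matrix_transpose:
  "gen_cartan_matrix l A \<Longrightarrow> gen_cartan_matrix l (\<lambda>i j. A j i)"
  unfolding gen_cartan_matrix_def by (intro conjI allI impI) (simp, blast, blast)

lemma indecomposable_matrix_transpose:
  assumes "indecomposable_matrix l A"
  shows "indecomposable_matrix l (\<lambda>i j. A j i)"
  unfolding indecomposable_matrix_def
proof (intro allI impI)
  fix S assume S: "S \<noteq> {} \<and> S \<subset> {..l}"
  then have "{..l} - S \<noteq> {} \<and> {..l} - S \<subset> {..l}" by blast
  then have "\<exists>i\<in>{..l} - S. \<exists>j\<in>{..l} - ({..l} - S). A i j \<noteq> 0"
    using assms unfolding indecomposable_matrix_def by (meson)
  then show "\<exists>i\<in>S. \<exists>j\<in>{..l} - S. A j i \<noteq> 0" by auto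
qed

text \<open>A discrete maximum principle. Subtracting the least ratio \<open>t\<close> leaves a
  nonnegative kernel vector \<open>w\<close> with a zero. At a zero \<open>i\<close> the equation of
  row \<open>i\<close> is a vanishing sum of nonpositive terms, so \<open>w\<close> vanishes at all
  neighbours of \<open>i\<close>, and indecomposability spreads the zeros everywhere.\<close>

lemma affine_kernel_real:
  fixes v :: "nat \<Rightarrow> real"
  assumes A: "gen_cartan_matrix l A" "indecomposable_matrix l A" "kac_labels l A k"
    and v: "\<And>i. i \<le> l \<Longrightarrow> (\<Sum>j\<le>l. of_int (A i j) * v j) = 0"
  shows "\<exists>t. \<forall>i\<le>l. v i = t * of_nat (k i)"
proof -
  define t where "t = Min ((\<lambda>i. v i / of_nat (k i)) ` {..l})"
  define w where "w i = v i - t * of_nat (k i)" for i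
  have k: "0 < k i" if "i \<le> l" for i using A(3) that unfolding kac_labels_def by blast
  have w0: "0 \<le> w i" if "i \<le> l" for i
  proof -
    have "t \<le> v i / of_nat (k i)" unfolding t_def using that by simp
    then show ?thesis unfolding w_def using k[OF that] by (simp add: field_simps)
  qed
  have "t \<in> (\<lambda>i. v i / of_nat (k i)) ` {..l}" unfolding t_def by (rule Min_in) auto
  then obtain i0 where i0: "i0 \<le> l" "t = v i0 / of_nat (k i0)" by auto
  then have wi0: "w i0 = 0" unfolding w_def using k[OF i0(1)] by simp
  have wk: "(\<Sum>j\<le>l. of_int (A i j) * w j) = 0" if "i \<le> l" for i
  proof -
    have "(\<Sum>j\<le>l. A i j * int (k j)) = 0" using A(3) that unfolding kac_labels_def by blast
    then have "real_of_int (\<Sum>j\<le>l. A i j * int (k j)) = 0" by simp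
    then have "(\<Sum>j\<le>l. of_int (A i j) * real (k j)) = 0" by simp
    moreover have "(\<Sum>j\<le>l. of_int (A i j) * (t * real (k j))) = t * (\<Sum>j\<le>l. of_int (A i j) * real (k j))"
      by (simp add: sum_distrib_left mult_ac)
    ultimately have "(\<Sum>j\<le>l. of_int (A i j) * (t * real (k j))) = 0" by simp
    then show ?thesis using v[OF that] unfolding w_def
      by (simp add: right_diff_distrib sum_subtractf)
  qed
  define S where "S = {i. i \<le> l \<and> w i = 0}"
  have "S = {..l}"
  proof (rule ccontr)
    assume "S \<noteq> {..l}"
    then have "S \<noteq> {} \<and> S \<subset> {..l}" unfolding S_def using i0 wi0 by auto
    then obtain i j where ij: "i \<in> S" "j \<in> {..l} - S" "A i j \<noteq> 0"
      using A(2)[unfolded indecomposable_matrix_def, rule_format, of S] by auto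
    have neg: "of_int (A i m) * w m \<le> 0" if "m \<le> l" for m
    proof (cases "m = i")
      case True then show ?thesis using ij(1) S_def by simp
    next
      case False
      then have "A i m \<le> 0" using A(1) ij(1) that unfolding gen_cartan_matrix_def S_def by auto
      then show ?thesis using w0[OF that] by (simp add: mult_nonpos_nonneg)
    qed
    have "j \<noteq> i" using ij by auto
    then have "A i j \<le> 0" using A(1) ij unfolding gen_cartan_matrix_def S_def by auto
    then have "A i j < 0" using ij(3) by simp
    moreover have "0 < w j" using w0[of j] ij(2) unfolding S_def by auto
    ultimately have "of_int (A i j) * w j < 0" by (simp add: mult_neg_pos)
    then have "(\<Sum>m\<le>l. of_int (A i m) * w m) < (\<Sum>m\<le>l. 0::real)"
      using neg ij(2) by (intro sum_strict_mono_ex1) auto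
    then show False using wk[of i] ij(1) S_def by auto
  qed
  then show ?thesis unfolding S_def w_def by auto
qed

lemma affine_kernel:
  fixes v :: "nat \<Rightarrow> complex"
  assumes A: "gen_cartan_matrix l A" "indecomposable_matrix l A" "kac_labels l A k"
    and v: "\<And>i. i \<le> l \<Longrightarrow> (\<Sum>j\<le>l. of_int (A i j) * v j) = 0"
  shows "\<exists>t. \<forall>i\<le>l. v i = t * of_nat (k i)"
proof -
  have "(\<Sum>j\<le>l. of_int (A i j) * Re (v j)) = 0" "(\<Sum>j\<le>l. of_int (A i j) * Im (v j)) = 0"
    if "i \<le> l" for i
    using arg_cong[OF v[OF that], of Re] arg_cong[OF v[OF that], of Im] by auto
  then obtain a b where ab: "\<forall>i\<le>l. Re (v i) = a * of_nat (k i)" "\<forall>i\<le>l. Im (v i) = b * of_nat (k i)"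
    using affine_kernel_real[OF A, of "\<lambda>i. Re (v i)"] affine_kernel_real[OF A, of "\<lambda>i. Im (v i)"]
    by blast
  have "\<forall>i\<le>l. v i = Complex a b * of_nat (k i)"
    using ab by (auto simp: complex_eq_iff)
  then show ?thesis by blast
qed

text \<open>Positivity of \<open>r\<close> makes the normalizing factor \<open>rh\<close> of
  \<open>M\<close> invertible.\<close>

lemma affine_diagram_twist: "affine_diagram l r L \<Longrightarrow> 0 < r"
  by (erule affine_diagram.cases) simp_all

section \<open>The affine algebra and its principal Heisenberg subalgebra\<close>

context drinfeld_sokolov_data
begin

abbreviation "sc \<equiv> scl G"
abbreviation "br \<equiv> brk G"
abbreviation "fm \<equiv> form G"
abbreviation "dd \<equiv> grad_d G"
abbreviation "ee \<equiv> chev_e G"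
abbreviation "ff \<equiv> chev_f G"
abbreviation "hh \<equiv> coroot G"
abbreviation "ll \<equiv> ell G"
abbreviation aa :: "nat \<Rightarrow> nat \<Rightarrow> complex" where "aa i j \<equiv> of_int (cartan G i j)"
abbreviation "cc \<equiv> central G"
abbreviation "rat \<equiv> label_ratio G"
abbreviation "LS \<equiv> Lam_sum G"
abbreviation "cox_c \<equiv> complex_of_nat (cox G)"

section \<open>Elementary rules for the bracket, the invariant form and the generators\<close>

lemma lie: "lie_algebra sc br"
  using algebra unfolding kac_moody_algebra_def by blast

lemma vector_space_sc: "vector_space sc"
  using lie unfolding lie_algebra_def by blast

sublocale vs: vector_space sc by (rule vector_space_sc)

lemma linear_br_right: "Vector_Spaces.linear sc sc (br X)"
  using lie unfolding lie_algebra_def by blast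

lemma linear_br_left: "Vector_Spaces.linear sc sc (\<lambda>X. br X Y)"
  using lie unfolding lie_algebra_def by blast

lemma br_self [simp]: "br X X = 0"
  using lie unfolding lie_algebra_def by blast

lemma jacobi_cyclic: "br X (br Y Z) + br Y (br Z X) + br Z (br X Y) = 0"
  using lie unfolding lie_algebra_def by blast

lemma br_add_right: "br X (Y + Z) = br X Y + br X Z"
  and br_scale_right: "br X (sc a Y) = sc a (br X Y)"
  using linear_br_right[of X] by (auto simp: Vector_Spaces.linear_iff)

lemma br_add_left: "br (X + Y) Z = br X Z + br Y Z"
  and br_scale_left: "br (sc a X) Z = sc a (br X Z)"
  using linear_br_left[of Z] by (auto simp: Vector_Spaces.linear_iff)

lemma br_zero_right [simp]: "br X 0 = 0" using br_scale_right[of X 0 0] by simp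
lemma br_zero_left [simp]: "br 0 X = 0" using br_scale_left[of 0 0 X] by simp

lemma br_minus_right: "br X (- Y) = - br X Y"
  using br_scale_right[of X "-1" Y] by simp
lemma br_minus_left: "br (- X) Y = - br X Y"
  using br_scale_left[of "-1" X Y] by simp
lemma br_diff_right: "br X (Y - Z) = br X Y - br X Z"
  using br_add_right[of X Y "- Z"] by (simp add: br_minus_right)
lemma br_diff_left: "br (X - Y) Z = br X Z - br Y Z"
  using br_add_left[of X "- Y" Z] by (simp add: br_minus_left)
lemma br_sum_right: "br X (sum F S) = (\<Sum>i\<in>S. br X (F i))"
  by (induction S rule: infinite_finite_induct) (auto simp: br_add_right)
lemma br_sum_left: "br (sum F S) X = (\<Sum>i\<in>S. br (F i) X)"
  by (induction S rule: infinite_finite_induct) (auto simp: br_add_left)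

lemma br_anti: "br X Y = - br Y X"
proof -
  have "br (X + Y) (X + Y) = 0" by simp
  then have "(br X X + br Y X) + (br X Y + br Y Y) = 0" by (simp only: br_add_left br_add_right)
  then have "br X Y + br Y X = 0" by (simp add: add.commute)
  then show ?thesis by (simp add: eq_neg_iff_add_eq_0)
qed

lemma jacobi: "br X (br Y Z) = br (br X Y) Z + br Y (br X Z)"
proof -
  have "br X (br Y Z) + br Y (br Z X) + br Z (br X Y) = 0" by (rule jacobi_cyclic)
  moreover have "br Y (br Z X) = - br Y (br X Z)"
    using br_anti[of Z X] by (simp add: br_minus_right)
  moreover have "br Z (br X Y) = - br (br X Y) Z" by (rule br_anti)
  ultimately show ?thesis by (simp add: algebra_simps)
qed

lemma linear_form: "Vector_Spaces.linear sc (*) (fm X)"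
  using inv_form unfolding invariant_form_def by blast

lemma form_sym: "fm X Y = fm Y X"
  using inv_form unfolding invariant_form_def by blast

lemma form_inv: "fm (br X Y) Z = fm X (br Y Z)"
  using inv_form unfolding invariant_form_def by blast

lemma form_hh: "i \<le> ll \<Longrightarrow> j \<le> ll \<Longrightarrow> fm (hh i) (hh j) = aa i j * rat j"
  and form_dh: "j \<le> ll \<Longrightarrow> fm dd (hh j) = rat j"
  and form_dd: "fm dd dd = 0"
  using inv_form unfolding invariant_form_def by blast+

lemma form_add_right: "fm X (Y + Z) = fm X Y + fm X Z"
  and form_scale_right: "fm X (sc a Y) = a * fm X Y"
  using linear_form[of X] by (auto simp: Vector_Spaces.linear_iff)
lemma form_add_left: "fm (X + Y) Z = fm X Z + fm Y Z"
  and form_scale_left: "fm (sc a X) Z = a * fm X Z"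
  using form_add_right[of Z X Y] form_scale_right[of Z a X]
  by (metis form_sym)+
lemma form_zero_right [simp]: "fm X 0 = 0" using form_scale_right[of X 0 0] by simp
lemma form_zero_left [simp]: "fm 0 X = 0" using form_scale_left[of 0 0 X] by simp
lemma form_minus_right: "fm X (- Y) = - fm X Y" using form_scale_right[of X "-1" Y] by simp
lemma form_minus_left: "fm (- X) Y = - fm X Y" using form_scale_left[of "-1" X Y] by simp
lemma form_diff_right: "fm X (Y - Z) = fm X Y - fm X Z"
  using form_add_right[of X Y "- Z"] by (simp add: form_minus_right)
lemma form_sum_right: "fm X (sum F S) = (\<Sum>i\<in>S. fm X (F i))"
  by (induction S rule: infinite_finite_induct) (auto simp: form_add_right)
lemma form_sum_left: "fm (sum F S) X = (\<Sum>i\<in>S. fm (F i) X)"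
  by (induction S rule: infinite_finite_induct) (auto simp: form_add_left)

lemma form_ad: "fm (br X Y) Z = - fm Y (br X Z)"
  using form_inv[of Y X Z] br_anti[of X Y] by (simp add: form_minus_left)

lemma relations:
  assumes "i \<le> ll" "j \<le> ll"
  shows br_hh: "br (hh i) (hh j) = 0"
    and br_he: "br (hh i) (ee j) = sc (aa i j) (ee j)"
    and br_hf: "br (hh i) (ff j) = sc (- aa i j) (ff j)"
    and br_ef: "br (ee i) (ff j) = (if i = j then hh i else 0)"
  using algebra assms unfolding kac_moody_algebra_def by blast+

lemma br_fe: "i \<le> ll \<Longrightarrow> j \<le> ll \<Longrightarrow> br (ff i) (ee j) = (if i = j then - hh i else 0)"
  using br_ef[of j i] br_anti[of "ff i" "ee j"] by auto

lemma br_dh: "i \<le> ll \<Longrightarrow> br dd (hh i) = 0"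
  and br_de: "i \<le> ll \<Longrightarrow> br dd (ee i) = ee i"
  and br_df: "i \<le> ll \<Longrightarrow> br dd (ff i) = - ff i"
  using algebra unfolding kac_moody_algebra_def by blast+

definition hset where "hset = insert dd (hh ` {..ll})"

lemma hset_independent: "vs.independent hset"
  and inj_hh: "inj_on hh {..ll}" and dd_notin: "dd \<notin> hh ` {..ll}"
  using algebra unfolding kac_moody_algebra_def hset_def by simp_all

lemma generated:
  assumes "vs.subspace S" "\<And>X Y. X \<in> S \<Longrightarrow> Y \<in> S \<Longrightarrow> br X Y \<in> S"
    "dd \<in> S" "\<And>i. i \<le> ll \<Longrightarrow> hh i \<in> S \<and> ee i \<in> S \<and> ff i \<in> S"
  shows "S = UNIV"
proof -
  have "cartan_subalgebra G \<subseteq> S"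
    unfolding cartan_subalgebra_def using assms by (intro vs.span_minimal) auto
  then have "cartan_subalgebra G \<union> ee ` {..ll} \<union> ff ` {..ll} \<subseteq> S" using assms(4) by auto
  moreover have "\<forall>S. vs.subspace S \<and> (\<forall>X\<in>S. \<forall>Y\<in>S. br X Y \<in> S) \<and>
      cartan_subalgebra G \<union> ee ` {..ll} \<union> ff ` {..ll} \<subseteq> S \<longrightarrow> S = UNIV"
    using algebra unfolding kac_moody_algebra_def by (elim conjE)
  ultimately show ?thesis using assms(1,2) by simp
qed

lemma no_ideal:
  assumes "vs.subspace I" "\<And>X Y. Y \<in> I \<Longrightarrow> br X Y \<in> I" "I \<inter> vs.span hset = {0}"
  shows "I = {0}"
proof -
  have "\<forall>I. vs.subspace I \<and> (\<forall>X. \<forall>Y\<in>I. br X Y \<in> I) \<and> I \<inter> cartan_subalgebra G = {0} \<longrightarrow> I = {0}"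
    using algebra unfolding kac_moody_algebra_def by (elim conjE)
  then show ?thesis using assms unfolding cartan_subalgebra_def hset_def by simp
qed

section \<open>The principal gradation by eigenspaces of ad \<open>dd\<close>\<close>

definition Eig :: "int \<Rightarrow> 'g set" where "Eig k = {X. br dd X = sc (of_int k) X}"

lemma subspace_Eig: "vs.subspace (Eig k)"
  unfolding Eig_def by (rule vs.subspaceI)
    (auto simp: br_add_right br_scale_right vs.scale_right_distrib mult.commute)

lemma Eig_br: "X \<in> Eig k \<Longrightarrow> Y \<in> Eig m \<Longrightarrow> br X Y \<in> Eig (k + m)"
  unfolding Eig_def using jacobi[of dd X Y]
  by (simp add: br_scale_left br_scale_right vs.scale_left_distrib)

lemma Eig_gens: "i \<le> ll \<Longrightarrow> ee i \<in> Eig 1" "i \<le> ll \<Longrightarrow> ff i \<in> Eig (-1)" "i \<le> ll \<Longrightarrow> hh i \<in> Eig 0"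
  "dd \<in> Eig 0"
  unfolding Eig_def by (auto simp: br_de br_df br_dh)

lemma form_Eig:
  assumes "X \<in> Eig k" "Y \<in> Eig m" "k + m \<noteq> 0"
  shows "fm X Y = 0"
proof -
  have "of_int k * fm X Y = - (of_int m * fm X Y)"
    using form_ad[of dd X Y] assms(1,2) unfolding Eig_def by (simp add: form_scale_left form_scale_right)
  then have "of_int (k + m) * fm X Y = 0" by (simp add: algebra_simps)
  moreover have "complex_of_int (k + m) \<noteq> 0" using assms(3) by (simp only: of_int_eq_0_iff not_False_eq_True)
  ultimately show ?thesis by simp
qed

lemma Eig_sum_zero:
  assumes "finite K" "\<And>k. k \<in> K \<Longrightarrow> F k \<in> Eig k" "(\<Sum>k\<in>K. F k) = 0" "k \<in> K"
  shows "F k = 0"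
  using assms
proof (induction K arbitrary: F k rule: finite_induct)
  case empty then show ?case by simp
next
  case (insert m K)
  have bF: "br dd (F k) = sc (of_int k) (F k)" if "k \<in> insert m K" for k
    using insert.prems(1)[OF that] unfolding Eig_def by simp
  have "(\<Sum>k\<in>insert m K. br dd (F k) - sc (of_int m) (F k)) = br dd (sum F (insert m K)) - sc (of_int m) (sum F (insert m K))"
    by (simp only: sum_subtractf br_sum_right vs.scale_sum_right)
  also have "\<dots> = 0" using insert.prems(2) by simp
  finally have "(\<Sum>k\<in>insert m K. br dd (F k) - sc (of_int m) (F k)) = 0" .
  moreover have "(\<Sum>k\<in>insert m K. br dd (F k) - sc (of_int m) (F k)) = (\<Sum>k\<in>insert m K. sc (of_int (k - m)) (F k))"
    by (rule sum.cong) (simp_all only: bF of_int_diff vs.scale_left_diff_distrib)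
  ultimately have "(\<Sum>k\<in>K. sc (of_int (k - m)) (F k)) = 0"
    using insert.hyps by simp
  then have *: "sc (of_int (k - m)) (F k) = 0" if "k \<in> K" for k
    using insert.IH[of "\<lambda>k. sc (of_int (k - m)) (F k)" k] that insert.prems(1)
    by (simp add: vs.subspace_scale[OF subspace_Eig])
  have zero: "F k = 0" if "k \<in> K" for k
  proof -
    have "k \<noteq> m" using that insert.hyps by auto
    then have "k - m \<noteq> 0" by simp
    then have "complex_of_int (k - m) \<noteq> 0" by (simp only: of_int_eq_0_iff not_False_eq_True)
    then show ?thesis using *[OF that] by simp
  qed
  then have "F m = 0" using insert.prems(2) insert.hyps by simp
  then show ?case using zero insert.prems(3) by auto
qed

section \<open>Triangular decomposition and finite spanning sets of the degrees\<close>

primrec words :: "(nat \<Rightarrow> 'g) \<Rightarrow> nat \<Rightarrow> 'g set" where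
  "words u 0 = u ` {..ll}"
| "words u (Suc n) = (\<lambda>(i, w). br (u i) w) ` ({..ll} \<times> words u n)"

lemma finite_words: "finite (words u n)" by (induction n) auto

text \<open>The index of \<open>words\<close> is one below the number of letters:
  \<open>words u 0\<close> consists of the generators themselves, hence the factor
  \<open>Suc n\<close>.\<close>

lemma words_Eig:
  assumes "\<And>i. i \<le> ll \<Longrightarrow> u i \<in> Eig s"
  shows "w \<in> words u n \<Longrightarrow> w \<in> Eig (s * int (Suc n))"
proof (induction n arbitrary: w)
  case 0 then show ?case using assms by auto
next
  case (Suc n)
  then obtain i v where "i \<le> ll" "v \<in> words u n" "w = br (u i) v" by auto
  then have "w \<in> Eig (s + s * int (Suc n))" using Eig_br[OF assms Suc.IH] by simp
  then show ?case by (simp add: algebra_simps)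
qed

definition allw where "allw u = (\<Union>n. words u n)"

lemma words_weight:
  assumes "\<And>i j. i \<le> ll \<Longrightarrow> j \<le> ll \<Longrightarrow> br (hh i) (u j) = sc (s * aa i j) (u j)" "i \<le> ll"
  shows "w \<in> words u n \<Longrightarrow> \<exists>t. br (hh i) w = sc t w"
proof (induction n arbitrary: w)
  case 0 then show ?case using assms by auto
next
  case (Suc n)
  then obtain j v where v: "j \<le> ll" "v \<in> words u n" "w = br (u j) v" by auto
  obtain t where "br (hh i) v = sc t v" using Suc.IH[OF v(2)] by blast
  then have "br (hh i) w = sc (s * aa i j + t) w"
    unfolding v(3) jacobi[of "hh i"] using assms v(1)
    by (simp add: br_scale_left br_scale_right vs.scale_left_distrib)
  then show ?case by blast
qed

text \<open>Both halves of the decomposition at once: \<open>u\<close> and \<open>v\<close> are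
  opposite families of generators, \<open>s\<close> is the sign of the weights of \<open>u\<close>,
  and \<open>r\<close> the sign in the bracket of \<open>v i\<close> with \<open>u i\<close>. The
  opposite generator removes one letter from a word and sends a single letter into the Cartan
  subalgebra.\<close>

lemma words_lower:
  assumes u: "\<And>i j. i \<le> ll \<Longrightarrow> j \<le> ll \<Longrightarrow> br (hh i) (u j) = sc (s * aa i j) (u j)"
    and v: "\<And>i j. i \<le> ll \<Longrightarrow> j \<le> ll \<Longrightarrow> br (v i) (u j) = (if i = j then sc r (hh i) else 0)"
    and du: "\<And>j. j \<le> ll \<Longrightarrow> br dd (u j) = sc s (u j)"
    and i: "i \<le> ll"
  shows "w \<in> words u n \<Longrightarrow> br (v i) w \<in> (if n = 0 then vs.span hset else vs.span (words u (n - 1)))"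
proof (induction n arbitrary: w)
  case 0
  then obtain j where "j \<le> ll" "w = u j" by auto
  moreover have "hh i \<in> vs.span hset" using i by (auto intro: vs.span_base simp: hset_def)
  ultimately show ?case using v[OF i, of j] i by (auto intro: vs.span_zero vs.span_scale)
next
  case (Suc n)
  then obtain j x where x: "j \<le> ll" "x \<in> words u n" "w = br (u j) x" by auto
  have 1: "br (br (v i) (u j)) x \<in> vs.span (words u n)"
  proof -
    obtain t where "br (hh i) x = sc t x" using words_weight[OF u i x(2)] by blast
    then have "br (br (v i) (u j)) x = sc (if i = j then r * t else 0) x"
      using v[OF i x(1)] by (auto simp: br_scale_left)
    then show ?thesis using x(2) by (simp add: vs.span_scale vs.span_base)
  qed
  \<comment> \<open>If \<open>x\<close> is a single letter, \<open>v i\<close> has already moved it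
    into the Cartan subalgebra, and \<open>u j\<close> brings that back to a multiple of itself.
    Otherwise \<open>u j\<close> restores the letter that \<open>v i\<close> removed.\<close>
  have 2: "br (u j) (br (v i) x) \<in> vs.span (words u n)"
  proof (cases n)
    case 0
    have uj: "u j \<in> vs.span (words u 0)" using \<open>j \<le> ll\<close> by (auto intro: vs.span_base)
    have "br (u j) y \<in> vs.span (words u 0)" if "y \<in> vs.span hset" for y
      using that
    proof (induction rule: vs.span_induct_alt)
      case base then show ?case by (simp add: vs.span_zero)
    next
      case (step c x y)
      have "br (u j) x \<in> vs.span (words u 0)"
      proof (cases "x = dd")
        case True
        then have "br (u j) x = sc (- s) (u j)" using du[OF \<open>j \<le> ll\<close>] br_anti[of "u j" dd] by simp
        then show ?thesis using uj vs.span_scale by presburger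
      next
        case False
        then obtain m where "m \<le> ll" "x = hh m" using step(1) by (auto simp: hset_def)
        then have "br (u j) x = sc (- (s * aa m j)) (u j)"
          using u[of m j] br_anti[of "u j" x] \<open>j \<le> ll\<close> by simp
        then show ?thesis using uj vs.span_scale by presburger
      qed
      then show ?case using step by (simp add: br_add_right br_scale_right vs.span_add vs.span_scale)
    qed
    then show ?thesis using Suc.IH[OF x(2)] 0 by simp
  next
    case (Suc m)
    have "br (u j) y \<in> vs.span (words u (Suc m))" if "y \<in> vs.span (words u m)" for y
      using that
    proof (induction rule: vs.span_induct_alt)
      case base then show ?case by (simp add: vs.span_zero)
    next
      case (step c x y)
      then have "br (u j) x \<in> words u (Suc m)" using \<open>j \<le> ll\<close> by force
      then show ?case using step by (simp add: br_add_right br_scale_right vs.span_add vs.span_scale vs.span_base)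
    qed
    then show ?thesis using Suc.IH[OF x(2)] Suc by simp
  qed
  show ?case unfolding x(3) jacobi[of "v i"] using 1 2 by (simp add: vs.span_add)
qed

definition triang where "triang = vs.span (hset \<union> allw ee \<union> allw ff)"

lemma triang_facts:
  shows "vs.subspace triang" "w \<in> words ee n \<Longrightarrow> w \<in> triang" "w \<in> words ff n \<Longrightarrow> w \<in> triang"
    "w \<in> hset \<Longrightarrow> w \<in> triang" "vs.span hset \<subseteq> triang" "vs.span (words ee n) \<subseteq> triang"
    "vs.span (words ff n) \<subseteq> triang"
proof -
  have sub: "words ee n \<subseteq> triang" "words ff n \<subseteq> triang" "hset \<subseteq> triang" for n
    unfolding triang_def using vs.span_superset[of "hset \<union> allw ee \<union> allw ff"] allw_def by blast+
  show T: "vs.subspace triang" unfolding triang_def by (rule vs.subspace_span)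
  show "w \<in> words ee n \<Longrightarrow> w \<in> triang" "w \<in> words ff n \<Longrightarrow> w \<in> triang" "w \<in> hset \<Longrightarrow> w \<in> triang"
    using sub by blast+
  show "vs.span hset \<subseteq> triang" "vs.span (words ee n) \<subseteq> triang" "vs.span (words ff n) \<subseteq> triang"
    using sub by (simp_all add: vs.span_minimal T)
qed

lemma br_ee_weight: "i \<le> ll \<Longrightarrow> j \<le> ll \<Longrightarrow> br (hh i) (ee j) = sc (1 * aa i j) (ee j)"
  and br_ff_weight: "i \<le> ll \<Longrightarrow> j \<le> ll \<Longrightarrow> br (hh i) (ff j) = sc ((-1) * aa i j) (ff j)"
  by (simp_all add: br_he br_hf)

lemma ee_lower:
  assumes "i \<le> ll" "w \<in> words ee n"
  shows "br (ff i) w \<in> (if n = 0 then vs.span hset else vs.span (words ee (n - 1)))"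
  by (rule words_lower[where s = 1 and r = "-1"]) (use assms in \<open>auto simp: br_he br_fe br_de\<close>)

lemma ff_lower:
  assumes "i \<le> ll" "w \<in> words ff n"
  shows "br (ee i) w \<in> (if n = 0 then vs.span hset else vs.span (words ff (n - 1)))"
  by (rule words_lower[where s = "-1" and r = 1]) (use assms in \<open>auto simp: br_hf br_ef br_df\<close>)

lemma words_dd:
  "w \<in> words ee n \<Longrightarrow> br dd w = sc (of_int (int (Suc n))) w"
  "w \<in> words ff n \<Longrightarrow> br dd w = sc (of_int (- int (Suc n))) w"
  using words_Eig[of ee 1 w n] words_Eig[of ff "-1" w n] Eig_gens unfolding Eig_def by auto

lemma br_gens_hset:
  assumes "w \<in> hset" "i \<le> ll"
  shows "br dd w = 0" "br (hh i) w = 0" "\<exists>t. br (ee i) w = sc t (ee i)" "\<exists>t. br (ff i) w = sc t (ff i)"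
proof -
  consider "w = dd" | j where "j \<le> ll" "w = hh j" using assms(1) unfolding hset_def by auto
  note c = this
  have "br (hh i) dd = 0" using br_anti[of "hh i" dd] br_dh[OF assms(2)] by simp
  then show "br dd w = 0" "br (hh i) w = 0"
    using c br_dh br_hh assms(2) br_self by metis+
  show "\<exists>t. br (ee i) w = sc t (ee i)" using c
  proof cases
    case 1 then show ?thesis using br_anti[of "ee i" dd] br_de[OF assms(2)] by (intro exI[of _ "-1"]) simp
  next
    case 2 then show ?thesis using br_anti[of "ee i" w] br_he[of j i] assms(2)
      by (intro exI[of _ "- aa j i"]) simp
  qed
  show "\<exists>t. br (ff i) w = sc t (ff i)" using c
  proof cases
    case 1 then show ?thesis using br_anti[of "ff i" dd] br_df[OF assms(2)] by (intro exI[of _ "1"]) simp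
  next
    case 2 then show ?thesis using br_anti[of "ff i" w] br_hf[of j i] assms(2)
      by (intro exI[of _ "aa j i"]) simp
  qed
qed

lemma triang_invariant:
  assumes "Y \<in> triang" "X = dd \<or> (\<exists>i\<le>ll. X = hh i \<or> X = ee i \<or> X = ff i)"
  shows "br X Y \<in> triang"
  using assms(1) unfolding triang_def
proof (induction Y rule: vs.span_induct_alt)
  case base then show ?case by (simp add: vs.span_zero)
next
  case (step c x y)
  note t = triang_facts[unfolded triang_def]
  have "br X x \<in> vs.span (hset \<union> allw ee \<union> allw ff)"
  proof -
    consider "x \<in> hset" | n where "x \<in> words ee n" | n where "x \<in> words ff n"
      using step(1) unfolding allw_def by auto
    then show ?thesis
    proof cases
      case 1
      have "ee i \<in> words ee 0" "ff i \<in> words ff 0" if "i \<le> ll" for i using that by auto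
      then have m: "sc a (ee i) \<in> vs.span (hset \<union> allw ee \<union> allw ff)"
        "sc a (ff i) \<in> vs.span (hset \<union> allw ee \<union> allw ff)" if "i \<le> ll" for i a
        using t(2,3) that by (meson vs.span_scale)+
      have dd: "br dd x = 0" using br_gens_hset(1)[OF 1, of 0] by simp
      from assms(2) show ?thesis
      proof (elim disjE exE conjE)
        assume "X = dd" then show ?thesis using dd by (simp add: vs.span_zero)
      next
        fix i assume "i \<le> ll" "X = hh i" then show ?thesis using br_gens_hset(2)[OF 1] by (simp add: vs.span_zero)
      next
        fix i assume "i \<le> ll" "X = ee i" then show ?thesis using br_gens_hset(3)[OF 1, of i] m by auto
      next
        fix i assume "i \<le> ll" "X = ff i" then show ?thesis using br_gens_hset(4)[OF 1, of i] m by auto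
      qed
    next
      case 2
      from assms(2) show ?thesis
      proof (elim disjE exE conjE)
        assume "X = dd" then show ?thesis using words_dd(1)[OF 2] t(2)[OF 2] by (simp add: vs.span_scale)
      next
        fix i assume i: "i \<le> ll" "X = hh i"
        then show ?thesis using words_weight[of ee 1, OF br_ee_weight i(1) 2] t(2)[OF 2] vs.span_scale by auto
      next
        fix i assume i: "i \<le> ll" "X = ee i"
        then have "br X x \<in> words ee (Suc n)" using 2 by force
        then show ?thesis using t(2) by blast
      next
        fix i assume i: "i \<le> ll" "X = ff i"
        then show ?thesis using ee_lower[OF i(1) 2] t(5,6) by (auto split: if_splits)
      qed
    next
      case 3
      from assms(2) show ?thesis
      proof (elim disjE exE conjE)
        assume "X = dd" then show ?thesis using words_dd(2)[OF 3] t(3)[OF 3] by (simp add: vs.span_scale vs.span_neg)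
      next
        fix i assume i: "i \<le> ll" "X = hh i"
        then show ?thesis using words_weight[of ff "-1", OF br_ff_weight i(1) 3] t(3)[OF 3] vs.span_scale by auto
      next
        fix i assume i: "i \<le> ll" "X = ff i"
        then have "br X x \<in> words ff (Suc n)" using 3 by force
        then show ?thesis using t(3) by blast
      next
        fix i assume i: "i \<le> ll" "X = ee i"
        then show ?thesis using ff_lower[OF i(1) 3] t(5,7) by (auto split: if_splits)
      qed
    qed
  qed
  then show ?case using step by (simp add: br_add_right br_scale_right vs.span_add vs.span_scale)
qed

text \<open>The elements whose bracket preserves \<open>triang\<close> form a subalgebra
  \<open>N\<close> by the Jacobi identity. It contains the generators, so it is everything; hence
  \<open>triang\<close> is itself a subalgebra containing the generators.\<close>

lemma triang_UNIV: "triang = UNIV"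
proof -
  note T = triang_facts(1)
  have gens: "dd \<in> triang" "i \<le> ll \<Longrightarrow> hh i \<in> triang" "i \<le> ll \<Longrightarrow> ee i \<in> triang"
      "i \<le> ll \<Longrightarrow> ff i \<in> triang" for i
    using triang_facts(4) triang_facts(2)[of "ee i" 0] triang_facts(3)[of "ff i" 0]
    by (auto simp: hset_def)
  define N where "N = {X. \<forall>Y\<in>triang. br X Y \<in> triang}"
  have "N = UNIV"
  proof (rule generated)
    show "vs.subspace N" unfolding N_def
      by (rule vs.subspaceI) (auto simp: br_add_left br_scale_left intro: vs.subspace_0 vs.subspace_add
          vs.subspace_scale T)
    show "br X Y \<in> N" if "X \<in> N" "Y \<in> N" for X Y
    proof -
      have "br (br X Y) Z = br X (br Y Z) - br Y (br X Z)" for Z using jacobi[of X Y Z] by simp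
      then show ?thesis using that unfolding N_def by (auto intro: vs.subspace_diff T)
    qed
    show "dd \<in> N" unfolding N_def using triang_invariant by blast
    show "hh i \<in> N \<and> ee i \<in> N \<and> ff i \<in> N" if "i \<le> ll" for i
      unfolding N_def using triang_invariant that by blast
  qed
  then have "br X Y \<in> triang" if "X \<in> triang" "Y \<in> triang" for X Y
    using that unfolding N_def by auto
  then show ?thesis using generated[OF T] gens by blast
qed

text \<open>Finiteness of these sets is what later makes functionals on \<open>Eig k\<close>
  representable by the form. The shift by one matches the indexing of \<open>words\<close>.\<close>

definition Gen :: "int \<Rightarrow> 'g set" where
  "Gen k = (if k > 0 then words ee (nat (k - 1)) else if k < 0 then words ff (nat (- k - 1)) else hset)"

lemma finite_Gen: "finite (Gen k)" unfolding Gen_def by (auto simp: finite_words hset_def)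

lemma Gen_Eig: "x \<in> Gen k \<Longrightarrow> x \<in> Eig k"
  using words_dd[of x] br_gens_hset(1)[of x 0] unfolding Gen_def Eig_def by (auto split: if_splits)

lemma span_Gen_Eig: "vs.span (Gen k) \<subseteq> Eig k"
  by (rule vs.span_minimal) (auto simp: Gen_Eig subspace_Eig)

lemma Gen_UNIV: "vs.span (\<Union>k. Gen k) = UNIV"
proof -
  have "words ee n = Gen (int n + 1)" "words ff n = Gen (- int n - 1)" "hset = Gen 0" for n
    unfolding Gen_def by auto
  then have "hset \<union> allw ee \<union> allw ff \<subseteq> (\<Union>k. Gen k)" unfolding allw_def by blast
  then show ?thesis using vs.span_mono triang_UNIV unfolding triang_def by blast
qed

lemma graded_decomposition:
  assumes "X \<in> vs.span (\<Union>k. P k)"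
  shows "\<exists>F :: int \<Rightarrow> 'g. finite {k. F k \<noteq> 0} \<and> (\<forall>k. F k \<in> vs.span (P k)) \<and> X = (\<Sum>k | F k \<noteq> 0. F k)"
proof -
  from assms show ?thesis
  proof (induction X rule: vs.span_induct_alt)
    case base then show ?case by (intro exI[of _ "\<lambda>_. 0"]) (simp add: vs.span_zero)
  next
    case (step c x y)
    then obtain F m where F: "finite {k. F k \<noteq> 0}" "\<forall>k. F k \<in> vs.span (P k)" "y = (\<Sum>k | F k \<noteq> 0. F k)"
      and m: "x \<in> P m" by blast
    define F' where "F' = F(m := sc c x + F m)"
    define K where "K = insert m {k. F k \<noteq> 0}"
    have K: "finite K" "m \<in> K" unfolding K_def using F(1) by auto
    have sub: "{k. F' k \<noteq> 0} \<subseteq> K" unfolding F'_def K_def by auto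
    have "(\<Sum>k | F' k \<noteq> 0. F' k) = (\<Sum>k\<in>K. F' k)"
      by (rule sum.mono_neutral_left) (use K sub in auto)
    also have "\<dots> = sc c x + (\<Sum>k\<in>K. F k)"
      using K by (simp add: sum.remove[OF K] F'_def add.assoc)
    also have "(\<Sum>k\<in>K. F k) = y" unfolding F(3)
      by (rule sum.mono_neutral_right) (use K in \<open>auto simp: K_def\<close>)
    finally have "sc c x + y = (\<Sum>k | F' k \<noteq> 0. F' k)" by simp
    moreover have "\<forall>k. F' k \<in> vs.span (P k)"
      using F(2) m unfolding F'_def by (auto intro: vs.span_add vs.span_scale vs.span_base)
    ultimately show ?case using finite_subset[OF sub K(1)] by blast
  qed
qed

lemma graded_span:
  assumes P: "\<And>k. P k \<subseteq> Eig k" and X: "X \<in> vs.span (\<Union>k. P k)" "X \<in> Eig k"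
  shows "X \<in> vs.span (P k)"
proof -
  have PE: "vs.span (P k) \<subseteq> Eig k" for k
    using P by (intro vs.span_minimal subspace_Eig)
  obtain F where F: "finite {k. F k \<noteq> 0}" "\<forall>k. F k \<in> vs.span (P k)" "X = (\<Sum>k | F k \<noteq> 0. F k)"
    using graded_decomposition[OF X(1)] by blast
  define K where "K = insert k {k. F k \<noteq> 0}"
  have K: "finite K" "k \<in> K" unfolding K_def using F(1) by auto
  \<comment> \<open>Absorbing \<open>X\<close> into the component of its own degree turns the
    decomposition into a vanishing sum of homogeneous elements, to which \<open>Eig_sum_zero\<close>
    applies.\<close>
  define F' where "F' = F(k := F k - X)"
  have "X = (\<Sum>k\<in>K. F k)" unfolding F(3)
    by (rule sum.mono_neutral_left) (use K in \<open>auto simp: K_def\<close>)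
  then have "(\<Sum>k\<in>K. F' k) = 0"
    using K by (simp add: sum.remove[OF K] F'_def)
  moreover have "F' m \<in> Eig m" for m
    using F(2) PE X unfolding F'_def by (auto intro: vs.subspace_diff[OF subspace_Eig])
  ultimately have "F' k = 0" using Eig_sum_zero[OF K(1), of F' k] K(2) by blast
  then show "X \<in> vs.span (P k)" using F(2) unfolding F'_def by auto
qed

lemma Eig_eq_span: "Eig k = vs.span (Gen k)"
  using span_Gen_Eig graded_span[of Gen _ k] Gen_Eig Gen_UNIV by blast

lemma orthogonal_UNIV:
  assumes "\<And>k Z. Z \<in> Gen k \<Longrightarrow> fm X Z = 0"
  shows "fm X Y = 0"
proof -
  have "Y \<in> vs.span (\<Union>k. Gen k)" using Gen_UNIV by simp
  then show ?thesis
    by (induction Y rule: vs.span_induct_alt) (auto simp: form_add_right form_scale_right assms)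
qed

section \<open>The Cartan subalgebra and nondegeneracy of the form\<close>

lemma cartan_facts: "gen_cartan_matrix ll (cartan G)" "indecomposable_matrix ll (cartan G)"
  using affine unfolding affine_cartan_matrix_def by simp_all

lemma twist_pos: "0 < twist G"
proof -
  obtain L where "affine_diagram ll (twist G) L" using affine unfolding affine_cartan_matrix_def by auto
  then show ?thesis by (rule affine_diagram_twist)
qed

lemma lab_pos: "i \<le> ll \<Longrightarrow> 0 < lab G i" and dlab_pos: "i \<le> ll \<Longrightarrow> 0 < dlab G i"
  using labels dual_labels unfolding kac_labels_def by simp_all

lemma dlab_kernel: "j \<le> ll \<Longrightarrow> (\<Sum>i\<le>ll. of_nat (dlab G i) * aa i j) = 0"
proof -
  assume "j \<le> ll"
  then have "(\<Sum>i\<le>ll. cartan G i j * int (dlab G i)) = 0" using dual_labels unfolding kac_labels_def by simp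
  then have "complex_of_int (\<Sum>i\<le>ll. cartan G i j * int (dlab G i)) = 0" by simp
  then show ?thesis by (simp add: mult.commute)
qed

lemma kernel_dlab:
  assumes "\<And>j. j \<le> ll \<Longrightarrow> (\<Sum>i\<le>ll. v i * aa i j) = 0"
  shows "\<exists>t. \<forall>i\<le>ll. v i = t * of_nat (dlab G i)"
  using affine_kernel[OF gen_cartan_matrix_transpose[OF cartan_facts(1)]
      indecomposable_matrix_transpose[OF cartan_facts(2)] dual_labels, of v] assms
  by (simp add: mult.commute)

lemma rat_nz: "i \<le> ll \<Longrightarrow> rat i \<noteq> 0"
  using lab_pos[of i] dlab_pos[of i] unfolding label_ratio_def by simp

lemma cox_pos: "0 < cox G"
  unfolding cox_def using lab_pos by (intro sum_pos) auto

lemma cox_nz: "cox_c \<noteq> 0" using cox_pos by simp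

lemma aa_sym: "i \<le> ll \<Longrightarrow> j \<le> ll \<Longrightarrow> aa i j * rat j = aa j i * rat i"
  using form_hh[of i j] form_hh[of j i] form_sym[of "hh i" "hh j"] by simp

lemma aa_diag: "i \<le> ll \<Longrightarrow> aa i i = 2"
  using cartan_facts(1) unfolding gen_cartan_matrix_def by simp

definition Hspan where "Hspan = vs.span (hh ` {..ll})"

lemma Hspan_iff: "X \<in> Hspan \<longleftrightarrow> (\<exists>x. X = (\<Sum>i\<le>ll. sc (x i) (hh i)))"
proof
  assume "X \<in> Hspan"
  then show "\<exists>x. X = (\<Sum>i\<le>ll. sc (x i) (hh i))" unfolding Hspan_def
  proof (induction X rule: vs.span_induct_alt)
    case base then show ?case by (intro exI[of _ "\<lambda>_. 0"]) simp
  next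
    case (step c y z)
    then obtain x m where x: "z = (\<Sum>i\<le>ll. sc (x i) (hh i))" and m: "m \<le> ll" "y = hh m" by auto
    have "(\<Sum>i\<le>ll. sc ((if i = m then c else 0) + x i) (hh i)) =
      (\<Sum>i\<le>ll. if i = m then sc c (hh m) else 0) + z"
      unfolding x sum.distrib[symmetric] by (rule sum.cong) (auto simp: vs.scale_left_distrib)
    also have "(\<Sum>i\<le>ll. if i = m then sc c (hh m) else 0) = sc c y" using m by simp
    finally show ?case by metis
  qed
next
  assume "\<exists>x. X = (\<Sum>i\<le>ll. sc (x i) (hh i))"
  then show "X \<in> Hspan" unfolding Hspan_def
    by (auto intro: vs.span_sum vs.span_scale vs.span_base)
qed

lemma subspace_Hspan: "vs.subspace Hspan" unfolding Hspan_def by (rule vs.subspace_span)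

lemma Hspan_hh: "i \<le> ll \<Longrightarrow> hh i \<in> Hspan"
  unfolding Hspan_def by (auto intro: vs.span_base)

lemma span_hset_split:
  assumes "X \<in> vs.span hset" shows "\<exists>Y\<in>Hspan. \<exists>y. X = Y + sc y dd"
proof -
  obtain k where "X - sc k dd \<in> vs.span (hh ` {..ll})"
    using assms vs.span_breakdown_eq unfolding hset_def by blast
  then show ?thesis unfolding Hspan_def by (metis add.commute diff_add_cancel)
qed

lemma Hspan_subset: "Hspan \<subseteq> vs.span hset"
  unfolding Hspan_def hset_def by (intro vs.span_mono) auto

lemma cc_Hspan: "cc \<in> Hspan"
  unfolding central_def Hspan_def by (auto intro: vs.span_sum vs.span_scale vs.span_base)

lemma form_cc_hh: "j \<le> ll \<Longrightarrow> fm cc (hh j) = 0"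
proof -
  assume j: "j \<le> ll"
  have "fm cc (hh j) = (\<Sum>i\<le>ll. of_nat (dlab G i) * aa i j) * rat j"
    unfolding central_def form_sum_left sum_distrib_right
    by (rule sum.cong) (use j in \<open>auto simp: form_scale_left form_hh\<close>)
  then show ?thesis using dlab_kernel[OF j] by simp
qed

lemma form_dd_cc: "fm dd cc = cox_c"
proof -
  have "fm dd cc = (\<Sum>i\<le>ll. of_nat (lab G i))"
    unfolding central_def form_sum_right
    by (rule sum.cong) (use dlab_pos in \<open>auto simp: form_scale_right form_dh label_ratio_def\<close>)
  then show ?thesis unfolding cox_def by simp
qed

lemma form_Hspan_cc: "X \<in> Hspan \<Longrightarrow> fm X cc = 0"
  unfolding Hspan_iff by (auto simp: form_sym[of X cc] form_sum_right form_scale_right form_cc_hh)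

text \<open>The Gram matrix of the coroots is the Cartan matrix with rescaled columns, so its
  radical is the kernel of the transposed affine matrix, which is spanned by the dual
  labels.\<close>

lemma Hspan_radical:
  assumes X: "X \<in> Hspan" and 0: "\<And>j. j \<le> ll \<Longrightarrow> fm X (hh j) = 0"
  shows "\<exists>t. X = sc t cc"
proof -
  obtain x where x: "X = (\<Sum>i\<le>ll. sc (x i) (hh i))" using X Hspan_iff by blast
  have "(\<Sum>i\<le>ll. x i * aa i j) = 0" if j: "j \<le> ll" for j
  proof -
    have "fm X (hh j) = (\<Sum>i\<le>ll. x i * aa i j) * rat j"
      unfolding x form_sum_left sum_distrib_right
      by (rule sum.cong) (use j in \<open>auto simp: form_scale_left form_hh\<close>)
    then show ?thesis using 0[OF j] rat_nz[OF j] by simp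
  qed
  then obtain t where "\<forall>i\<le>ll. x i = t * of_nat (dlab G i)" using kernel_dlab by blast
  then have "X = sc t cc" unfolding x central_def vs.scale_sum_right
    by (intro sum.cong) auto
  then show ?thesis by blast
qed

text \<open>Pairing with \<open>cc\<close> removes the component along \<open>dd\<close>; pairing
  with \<open>dd\<close> removes the multiple of \<open>cc\<close> that is left. Both use (d | c) =
  h, which is nonzero.\<close>

lemma cartan_radical:
  assumes X: "X \<in> vs.span hset" and 0: "\<And>Y. fm X Y = 0"
  shows "X = 0"
proof -
  obtain Y y where Y: "Y \<in> Hspan" "X = Y + sc y dd" using span_hset_split[OF X] by blast
  have "y * cox_c = 0"
    using 0[of cc] form_Hspan_cc[OF Y(1)] unfolding Y(2) by (simp add: form_add_left form_scale_left form_dd_cc)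
  then have y: "y = 0" using cox_nz by simp
  then obtain t where t: "X = sc t cc" using Hspan_radical[of X] Y 0 by auto
  then have "t * cox_c = 0"
    using 0[of dd] by (simp add: form_scale_left form_dd_cc form_sym[of cc dd])
  then show ?thesis using t cox_nz by simp
qed

text \<open>The radical of an invariant form is an ideal. By \<open>cartan_radical\<close> it meets
  the Cartan subalgebra trivially, and such ideals are zero.\<close>

lemma form_nondegenerate:
  assumes "\<And>Y. fm X Y = 0" shows "X = 0"
proof -
  define I where "I = {X. \<forall>Y. fm X Y = 0}"
  have "I = {0}"
  proof (rule no_ideal)
    show "vs.subspace I" unfolding I_def by (rule vs.subspaceI) (auto simp: form_add_left form_scale_left)
    show "br X Y \<in> I" if "Y \<in> I" for X Y using that unfolding I_def by (simp add: form_ad)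
    show "I \<inter> vs.span hset = {0}" using cartan_radical vs.span_zero unfolding I_def by auto
  qed
  then show ?thesis using assms unfolding I_def by blast
qed

lemma Gen_form_zero:
  assumes "X \<in> Eig k" "\<And>Z. Z \<in> Gen (- k) \<Longrightarrow> fm X Z = 0"
  shows "X = 0"
proof (rule form_nondegenerate, rule orthogonal_UNIV)
  fix m Z assume Z: "Z \<in> Gen m"
  show "fm X Z = 0"
  proof (cases "k + m = 0")
    case True then have "m = - k" by simp
    then show ?thesis using assms(2) Z by simp
  next
    case False then show ?thesis using form_Eig[OF assms(1) Gen_Eig[OF Z]] by simp
  qed
qed

text \<open>Since the form pairs degree \<open>k\<close> only with degree \<open>- k\<close>,
  nondegeneracy can be tested within these two degrees.\<close>

lemma Eig_form_zero:
  assumes "X \<in> Eig k" "\<And>Z. Z \<in> Eig (- k) \<Longrightarrow> fm X Z = 0"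
  shows "X = 0"
  using Gen_form_zero[OF assms(1)] assms(2) Gen_Eig by blast

section \<open>The center and the derived algebra\<close>

lemma br_hh_cc: "br cc (hh i) = 0" if "i \<le> ll"
  unfolding central_def br_sum_left using that by (intro sum.neutral) (auto simp: br_scale_left br_hh)

text \<open>The centralizer of \<open>cc\<close> is a subalgebra, so generators suffice. On the
  \<open>ee j\<close> and \<open>ff j\<close> the weight of \<open>cc\<close> is the kernel equation
  of the dual labels.\<close>

lemma br_cc [simp]: "br cc X = 0"
proof -
  have 1: "br cc (ee j) = 0" if "j \<le> ll" for j
  proof -
    have "br cc (ee j) = sc (\<Sum>i\<le>ll. of_nat (dlab G i) * aa i j) (ee j)"
      unfolding central_def br_sum_left vs.scale_sum_left
      by (rule sum.cong) (use that in \<open>auto simp: br_scale_left br_he\<close>)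
    then show ?thesis using dlab_kernel[OF that] by simp
  qed
  have 2: "br cc (ff j) = 0" if "j \<le> ll" for j
  proof -
    have "br cc (ff j) = sc (- (\<Sum>i\<le>ll. of_nat (dlab G i) * aa i j)) (ff j)"
      unfolding central_def br_sum_left vs.scale_sum_left sum_negf[symmetric]
      by (rule sum.cong) (use that in \<open>auto simp: br_scale_left br_hf\<close>)
    then show ?thesis using dlab_kernel[OF that] by simp
  qed
  have 3: "br cc dd = 0"
  proof -
    have "br dd cc = 0" unfolding central_def br_sum_right
      by (intro sum.neutral) (auto simp: br_scale_right br_dh)
    then show ?thesis using br_anti[of cc dd] by simp
  qed
  have "{X. br cc X = 0} = UNIV"
  proof (rule generated)
    show "vs.subspace {X. br cc X = 0}" by (rule vs.subspaceI) (auto simp: br_add_right br_scale_right)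
    show "br X Y \<in> {X. br cc X = 0}" if "X \<in> {X. br cc X = 0}" "Y \<in> {X. br cc X = 0}" for X Y
      using that jacobi[of cc X Y] by simp
  qed (use 1 2 3 br_hh_cc in auto)
  then show ?thesis by auto
qed

lemma br_cc_right [simp]: "br X cc = 0" using br_anti[of X cc] by simp

text \<open>By invariance and centrality. As (d | c) is nonzero, orthogonality to \<open>cc\<close>
  is the test that keeps \<open>dd\<close> out of the derived algebra.\<close>

lemma derived_form_cc: "X \<in> derived_algebra G \<Longrightarrow> fm X cc = 0"
  unfolding derived_algebra_def
  by (induction X rule: vs.span_induct_alt) (auto simp: form_add_left form_scale_left form_inv)

lemma subspace_derived: "vs.subspace (derived_algebra G)"
  unfolding derived_algebra_def by (rule vs.subspace_span)

lemma br_derived: "br X Y \<in> derived_algebra G"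
  unfolding derived_algebra_def by (rule vs.span_base) auto

text \<open>In degree \<open>k\<close> every element is \<open>1 / k\<close> times its bracket with
  \<open>dd\<close>, hence lies in the derived algebra. The two gradations differ only in degree 0,
  where \<open>Eig 0\<close> also contains \<open>dd\<close>.\<close>

lemma gdeg_eq: "k \<noteq> 0 \<Longrightarrow> gdeg G k = Eig k"
proof -
  assume k: "k \<noteq> 0"
  have "X \<in> derived_algebra G" if "X \<in> Eig k" for X
  proof -
    have "X = sc (1 / of_int k) (br dd X)" using that k unfolding Eig_def by simp
    then show ?thesis using vs.subspace_scale[OF subspace_derived br_derived] by metis
  qed
  then show ?thesis unfolding gdeg_def Eig_def by auto
qed

lemma Eig0: "Eig 0 = vs.span hset" unfolding Eig_eq_span Gen_def by simp

lemma gdeg0: "gdeg G 0 = Hspan"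
proof
  show "gdeg G 0 \<subseteq> Hspan"
  proof
    fix X assume X: "X \<in> gdeg G 0"
    then have "X \<in> Eig 0" "fm X cc = 0" using derived_form_cc unfolding gdeg_def Eig_def by auto
    then obtain Y y where Y: "Y \<in> Hspan" "X = Y + sc y dd" using span_hset_split Eig0 by blast
    then have "y * cox_c = 0" using \<open>fm X cc = 0\<close> form_Hspan_cc[OF Y(1)]
      by (simp add: form_add_left form_scale_left form_dd_cc)
    then show "X \<in> Hspan" using Y cox_nz by simp
  qed
  have "hh i \<in> derived_algebra G" if "i \<le> ll" for i using br_derived[of "ee i" "ff i"] br_ef[of i i] that by simp
  then have "Hspan \<subseteq> derived_algebra G" unfolding Hspan_def by (intro vs.span_minimal subspace_derived) auto
  then show "Hspan \<subseteq> gdeg G 0" using Hspan_subset Eig0 unfolding gdeg_def Eig_def by auto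
qed

lemma Bspace_iff: "X \<in> Bspace G \<longleftrightarrow> X \<in> Hspan \<and> fm dd X = 0"
  unfolding Bspace_def gdeg0 by auto

lemma gdeg_Eig: "X \<in> gdeg G k \<Longrightarrow> X \<in> Eig k" unfolding gdeg_def Eig_def by simp

lemma Hspan_Eig: "X \<in> Hspan \<Longrightarrow> X \<in> Eig 0" using gdeg0 gdeg_Eig by blast

lemma LS_Eig: "LS \<in> Eig 1"
  unfolding Lam_sum_def by (rule vs.subspace_sum[OF subspace_Eig]) (auto simp: Eig_gens)

lemma Eig_inter: "X \<in> Eig k \<Longrightarrow> X \<in> Eig m \<Longrightarrow> k \<noteq> m \<Longrightarrow> X = 0"
proof -
  assume "X \<in> Eig k" "X \<in> Eig m" "k \<noteq> m"
  then have "sc (of_int (k - m)) X = 0" unfolding Eig_def by (simp add: vs.scale_left_diff_distrib)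
  moreover have "complex_of_int (k - m) \<noteq> 0" using \<open>k \<noteq> m\<close> by simp
  ultimately show ?thesis by simp
qed

lemma span_cc: "X \<in> vs.span {cc} \<longleftrightarrow> (\<exists>t. X = sc t cc)"
  by (auto simp: vs.span_singleton)

lemma cc_Eig: "cc \<in> Eig 0" by (rule Hspan_Eig[OF cc_Hspan])

lemma span_cc_Eig: "X \<in> vs.span {cc} \<Longrightarrow> X \<in> Eig k \<Longrightarrow> k \<noteq> 0 \<Longrightarrow> X = 0"
  using Eig_inter[of X 0 k] vs.subspace_scale[OF subspace_Eig cc_Eig] unfolding span_cc by auto

section \<open>The principal Heisenberg subalgebra\<close>

lemma heis_facts:
  shows emult_minus: "emult G (- m) = emult G m"
    and Lam_gdeg: "p \<in> exponents G \<Longrightarrow> Lam G p \<in> gdeg G (fst p)"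
    and inj_Lam: "inj_on (Lam G) (exponents G)"
    and heis_independent: "vs.independent (insert cc (Lam G ` exponents G))"
    and heis_span: "vs.span (insert cc (Lam G ` exponents G)) = heis G"
    and cc_notin_Lam: "cc \<notin> Lam G ` exponents G"
    and nu_nz: "nu G \<noteq> 0" and Lam1_eq: "Lam1 G = sc (nu G) LS"
  using heis_basis unfolding heisenberg_basis_def by simp_all

lemma br_Lam: "p \<in> exponents G \<Longrightarrow> q \<in> exponents G \<Longrightarrow> br (Lam G p) (Lam G q) =
        (if fst q = - fst p \<and> snd q = snd p then sc (of_int (fst p)) cc else 0)"
  using heis_basis unfolding heisenberg_basis_def by simp

lemma Lam_Eig: "p \<in> exponents G \<Longrightarrow> Lam G p \<in> Eig (fst p)" using Lam_gdeg gdeg_Eig by blast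

lemma Lam_heis: "p \<in> exponents G \<Longrightarrow> Lam G p \<in> heis G"
  unfolding heis_span[symmetric] by (rule vs.span_base) simp

lemma subspace_heis: "vs.subspace (heis G)" unfolding heis_span[symmetric] by (rule vs.subspace_span)

lemma heis_derived: "X \<in> heis G \<Longrightarrow> X \<in> derived_algebra G" unfolding heis_def by simp

lemma heisI: "X \<in> Eig k \<Longrightarrow> k \<noteq> 0 \<Longrightarrow> br LS X = 0 \<Longrightarrow> X \<in> heis G"
  using gdeg_eq[of k] vs.span_zero unfolding heis_def gdeg_def by auto

text \<open>The bracket with \<open>LS\<close> is a multiple of \<open>cc\<close>, which has degree
  0, and it is also of degree \<open>k + 1\<close>; a nonzero value is possible only for
  \<open>k = -1\<close>.\<close>

lemma heis_LS: "X \<in> heis G \<Longrightarrow> X \<in> Eig k \<Longrightarrow> k \<noteq> -1 \<Longrightarrow> br LS X = 0"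
  using span_cc_Eig[of "br LS X" "1 + k"] Eig_br[OF LS_Eig] unfolding heis_def by auto

lemma exponents_pair: "(m, a) \<in> exponents G \<longleftrightarrow> a < emult G m" unfolding exponents_def by simp

lemma exponents_neg: "(m, a) \<in> exponents G \<Longrightarrow> (- m, a) \<in> exponents G"
  by (simp add: exponents_pair emult_minus)

lemma heis_Eig_span:
  assumes "X \<in> heis G" "X \<in> Eig m" "m \<noteq> 0"
  shows "X \<in> vs.span (Lam G ` {p \<in> exponents G. fst p = m})"
proof -
  define P where "P k = (if k = 0 then {cc} else {}) \<union> Lam G ` {p \<in> exponents G. fst p = k}" for k
  have "(\<Union>k. P k) = insert cc (Lam G ` exponents G)" unfolding P_def by (auto split: if_splits)
  then have "X \<in> vs.span (\<Union>k. P k)" using assms(1) heis_span by simp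
  moreover have "P k \<subseteq> Eig k" for k unfolding P_def using cc_Eig Lam_Eig by (auto split: if_splits)
  ultimately have "X \<in> vs.span (P m)" using graded_span assms(2) by blast
  then show ?thesis unfolding P_def using assms(3) by simp
qed

lemma heis_br:
  assumes "X \<in> heis G" "Y \<in> heis G" shows "br X Y \<in> vs.span {cc}"
proof -
  have 1: "br (Lam G p) Z \<in> vs.span {cc}" if p: "p \<in> exponents G" and Z: "Z \<in> heis G" for p Z
    using Z unfolding heis_span[symmetric]
  proof (induction Z rule: vs.span_induct_alt)
    case base then show ?case by (simp add: vs.span_zero)
  next
    case (step c x y)
    have "br (Lam G p) x \<in> vs.span {cc}"
    proof (cases "x = cc")
      case True then show ?thesis by (simp add: vs.span_zero)
    next
      case False
      then obtain q where q: "q \<in> exponents G" "x = Lam G q" using step(1) by auto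
      have "br (Lam G p) x = sc (if fst q = - fst p \<and> snd q = snd p then of_int (fst p) else 0) cc"
        unfolding q(2) br_Lam[OF p q(1)] by simp
      then show ?thesis unfolding span_cc by blast
    qed
    then show ?case using step(2) by (simp add: br_add_right br_scale_right vs.span_add vs.span_scale)
  qed
  show ?thesis using assms(1) unfolding heis_span[symmetric]
  proof (induction X rule: vs.span_induct_alt)
    case base then show ?case by (simp add: vs.span_zero)
  next
    case (step c x y)
    have "br x Y \<in> vs.span {cc}" using step(1) 1 assms(2) by (auto intro: vs.span_zero)
    then show ?case using step(2) by (simp add: br_add_left br_scale_left vs.span_add vs.span_scale)
  qed
qed

text \<open>Pair \<open>dd\<close> with the bracket of the two elements: invariance produces the
  form times the degree, the Heisenberg relation produces the degree times (d | c) = h.\<close>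

lemma form_Lam:
  assumes "p \<in> exponents G" "q \<in> exponents G" "fst p \<noteq> 0" "fst q = - fst p"
  shows "fm (Lam G p) (Lam G q) = (if snd p = snd q then cox_c else 0)"
proof -
  have "fm dd (br (Lam G p) (Lam G q)) = of_int (fst p) * fm (Lam G p) (Lam G q)"
    using form_inv[of dd "Lam G p" "Lam G q"] Lam_Eig[OF assms(1)] unfolding Eig_def
    by (simp add: form_scale_left)
  moreover have "fm dd (br (Lam G p) (Lam G q)) = (if snd p = snd q then of_int (fst p) * cox_c else 0)"
    using br_Lam[OF assms(1,2)] assms(4) by (simp add: form_scale_right form_dd_cc)
  ultimately show ?thesis using assms(3) by auto
qed

text \<open>By \<open>form_Lam\<close> the vectors in degree \<open>- m\<close> are, up to the
  factor h, a dual basis for those in degree \<open>m\<close>.\<close>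

lemma heis_expansion:
  assumes X: "X \<in> heis G" "X \<in> Eig m" "m \<noteq> 0"
  shows "X = (\<Sum>a<emult G m. sc (fm X (Lam G (- m, a)) / cox_c) (Lam G (m, a)))"
proof -
  have "X \<in> vs.span (Lam G ` {p \<in> exponents G. fst p = m})" by (rule heis_Eig_span[OF X])
  then show ?thesis
  proof (induction X rule: vs.span_induct_alt)
    case base then show ?case by simp
  next
    case (step c x y)
    then obtain b where b: "b < emult G m" "x = Lam G (m, b)" by (auto simp: exponents_pair)
    have "fm x (Lam G (- m, a)) = (if b = a then cox_c else 0)" if "a < emult G m" for a
      using form_Lam[of "(m, b)" "(- m, a)"] that b X(3) by (simp add: exponents_pair emult_minus)
    then have "(\<Sum>a<emult G m. sc (fm x (Lam G (- m, a)) / cox_c) (Lam G (m, a))) =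
        (\<Sum>a<emult G m. if b = a then Lam G (m, a) else 0)"
      using cox_nz by (intro sum.cong) auto
    also have "\<dots> = x" using b by simp
    finally have x: "x = (\<Sum>a<emult G m. sc (fm x (Lam G (- m, a)) / cox_c) (Lam G (m, a)))" by simp
    have eq: "sc c x + y = (\<Sum>a<emult G m. sc (c * (fm x (Lam G (- m, a)) / cox_c)) (Lam G (m, a))) +
       (\<Sum>a<emult G m. sc (fm y (Lam G (- m, a)) / cox_c) (Lam G (m, a)))"
      using arg_cong[OF x, of "sc c"] step(2) by (simp add: vs.scale_sum_right)
    have rhs: "(\<Sum>a<emult G m. sc (fm (sc c x + y) (Lam G (- m, a)) / cox_c) (Lam G (m, a))) =
      (\<Sum>a<emult G m. sc (c * (fm x (Lam G (- m, a)) / cox_c)) (Lam G (m, a))) +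
       (\<Sum>a<emult G m. sc (fm y (Lam G (- m, a)) / cox_c) (Lam G (m, a)))"
      by (simp add: form_add_left form_scale_left vs.scale_left_distrib add_divide_distrib sum.distrib)
    show ?case by (rule trans[OF eq rhs[symmetric]])
  qed
qed

lemma hh_nz: "i \<le> ll \<Longrightarrow> hh i \<noteq> 0"
  using hset_independent vs.dependent_zero[of hset] unfolding hset_def by auto

lemma br_ff_sum_ee:
  assumes "i \<le> ll" shows "br (ff i) (\<Sum>j\<le>ll. sc (x j) (ee j)) = - sc (x i) (hh i)"
proof -
  have "br (ff i) (\<Sum>j\<le>ll. sc (x j) (ee j)) = (\<Sum>j\<le>ll. if i = j then - sc (x j) (hh j) else 0)"
    unfolding br_sum_right by (rule sum.cong) (use assms in \<open>auto simp: br_scale_right br_fe\<close>)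
  then show ?thesis using assms by simp
qed

lemma ee_independent:
  assumes "(\<Sum>j\<le>ll. sc (x j) (ee j)) = 0" "i \<le> ll" shows "x i = 0"
  using br_ff_sum_ee[OF assms(2), of x] assms hh_nz by simp

lemma LS_sum: "LS = (\<Sum>j\<le>ll. sc 1 (ee j))" unfolding Lam_sum_def by simp

lemma LS_nz: "LS \<noteq> 0" using ee_independent[of "\<lambda>_. 1" 0] LS_sum by auto

lemma LS_heis: "LS \<in> heis G"
  using heisI[OF LS_Eig] by simp

lemma span_image_atMost:
  assumes "X \<in> vs.span (u ` {..ll})" shows "\<exists>x. X = (\<Sum>i\<le>ll. sc (x i) (u i))"
  using assms
proof (induction X rule: vs.span_induct_alt)
  case base then show ?case by (intro exI[of _ "\<lambda>_. 0"]) simp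
next
  case (step c y z)
  then obtain x m where x: "z = (\<Sum>i\<le>ll. sc (x i) (u i))" and m: "m \<le> ll" "y = u m" by auto
  have "(\<Sum>i\<le>ll. sc ((if i = m then c else 0) + x i) (u i)) =
    (\<Sum>i\<le>ll. if i = m then sc c (u m) else 0) + z"
    unfolding x sum.distrib[symmetric] by (rule sum.cong) (auto simp: vs.scale_left_distrib)
  also have "(\<Sum>i\<le>ll. if i = m then sc c (u m) else 0) = sc c y" using m by simp
  finally show ?case by metis
qed

lemma Eig1_expansion: "X \<in> Eig 1 \<Longrightarrow> \<exists>x. X = (\<Sum>i\<le>ll. sc (x i) (ee i))"
  using span_image_atMost[of X ee] unfolding Eig_eq_span Gen_def by simp

text \<open>Applying ad of \<open>ff i\<close> to the relation \<open>br LS X = 0\<close> gives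
  \<open>(x i - x j) * aa i j = 0\<close> for all \<open>j\<close>. So the coefficients agree along
  edges of the Dynkin diagram, which is connected.\<close>

lemma centralizer_degree_one:
  assumes X: "X \<in> Eig 1" "br LS X = 0" shows "\<exists>t. X = sc t LS"
proof -
  obtain x where x: "X = (\<Sum>i\<le>ll. sc (x i) (ee i))" using Eig1_expansion[OF X(1)] by blast
  have h: "br (hh i) (\<Sum>j\<le>ll. sc (y j) (ee j)) = (\<Sum>j\<le>ll. sc (y j * aa i j) (ee j))" if "i \<le> ll" for i y
    unfolding br_sum_right by (rule sum.cong) (use that in \<open>auto simp: br_scale_right br_he\<close>)
  have link: "x i = x j" if ij: "i \<le> ll" "j \<le> ll" "cartan G i j \<noteq> 0" for i j
  proof -
    have "0 = br (ff i) (br LS X)" using X(2) by simp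
    also have "\<dots> = br (br (ff i) LS) X + br LS (br (ff i) X)" by (rule jacobi)
    also have "br (ff i) LS = - hh i" unfolding LS_sum br_ff_sum_ee[OF ij(1)] by simp
    also have "br (ff i) X = - sc (x i) (hh i)" unfolding x br_ff_sum_ee[OF ij(1)] by simp
    also have "br (- hh i) X + br LS (- sc (x i) (hh i)) = - br (hh i) X + sc (x i) (br (hh i) LS)"
      using br_anti[of LS "hh i"] by (simp add: br_minus_left br_minus_right br_scale_right)
    also have "\<dots> = (\<Sum>j\<le>ll. sc ((x i - x j) * aa i j) (ee j))"
      unfolding x LS_sum h[OF ij(1)] vs.scale_sum_right sum_negf[symmetric] sum.distrib[symmetric]
      by (rule sum.cong) (auto simp: left_diff_distrib vs.scale_left_diff_distrib)
    finally have "(x i - x j) * aa i j = 0" using ee_independent[OF _ ij(2)] by metis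
    then show ?thesis using ij(3) by simp
  qed
  have x0: "x i = x 0" if "i \<le> ll" for i
  proof (rule ccontr)
    assume "x i \<noteq> x 0"
    define S where "S = {i. i \<le> ll \<and> x i = x 0}"
    have "0 \<in> S" "i \<notin> S" "S \<subseteq> {..ll}" using \<open>x i \<noteq> x 0\<close> unfolding S_def by auto
    then have "S \<noteq> {} \<and> S \<subset> {..ll}" using that by auto
    then obtain a b where "a \<in> S" "b \<in> {..ll} - S" "cartan G a b \<noteq> 0"
      using cartan_facts(2)[unfolded indecomposable_matrix_def, rule_format, of S] by auto
    then show False using link[of a b] unfolding S_def by auto
  qed
  have "X = sc (x 0) LS" unfolding x Lam_sum_def vs.scale_sum_right
    by (rule sum.cong[OF refl]) (metis x0 atMost_iff)
  then show ?thesis by blast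
qed

text \<open>Multiplicity zero would force \<open>LS = 0\<close>. A second basis vector of degree 1
  would be a multiple of \<open>Lam1 G\<close> by \<open>centralizer_degree_one\<close>, but pairing
  with \<open>Lam G (-1, 1)\<close> tells the two apart.\<close>

lemma emult_1: "emult G 1 = 1"
proof -
  have "emult G 1 \<noteq> 0"
  proof
    assume "emult G 1 = 0"
    then have "LS = 0" using heis_expansion[OF LS_heis LS_Eig] by (simp only: lessThan_0 sum.empty)
    then show False using LS_nz by simp
  qed
  moreover have "\<not> 1 < emult G 1"
  proof
    assume a: "1 < emult G 1"
    then have e: "(1, 1) \<in> exponents G" "(1, 0) \<in> exponents G" "(-1, 1) \<in> exponents G"
      using exponents_neg[of 1 1] by (auto simp: exponents_pair)
    obtain t where "Lam G (1, 1) = sc t LS"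
      using centralizer_degree_one[of "Lam G (1, 1)"] Lam_Eig[OF e(1)] heis_LS[OF Lam_heis[OF e(1)] Lam_Eig[OF e(1)]]
      by auto
    then have "Lam G (1, 1) = sc (t / nu G) (Lam1 G)" using Lam1_eq nu_nz by simp
    then have "fm (Lam G (1, 1)) (Lam G (-1, 1)) = t / nu G * fm (Lam1 G) (Lam G (-1, 1))"
      by (simp add: form_scale_left)
    then show False using form_Lam[OF e(1) e(3)] form_Lam[OF e(2) e(3)] cox_nz by simp
  qed
  ultimately show ?thesis by simp
qed

lemma one_exponent: "(1, 0) \<in> exponents G" "(1, 0) \<in> pos_exponents G"
  unfolding pos_exponents_def by (simp_all add: exponents_pair emult_1)

lemma Lam1_Eig: "Lam1 G \<in> Eig 1" using Lam_Eig[OF one_exponent(1)] by simp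
lemma Lam1_heis: "Lam1 G \<in> heis G" using Lam_heis[OF one_exponent(1)] .

lemma br_Lam1: "br (Lam1 G) X = sc (nu G) (br LS X)" unfolding Lam1_eq br_scale_left ..

lemma br_Lam1_zero: "X \<in> heis G \<Longrightarrow> X \<in> Eig k \<Longrightarrow> k \<noteq> -1 \<Longrightarrow> br (Lam1 G) X = 0"
  using heis_LS unfolding br_Lam1 by simp

section \<open>Splitting negative degrees into the image of ad Lambda and the Heisenberg
  part\<close>

lemma functional_separating_subspace:
  assumes "vs.subspace W" "x \<notin> W"
  shows "\<exists>w. Vector_Spaces.linear sc (*) w \<and> (\<forall>y\<in>W. w y = 0) \<and> w x = 1"
proof -
  interpret vp: vector_space_pair sc "(*) :: complex \<Rightarrow> complex \<Rightarrow> complex"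
    by unfold_locales (auto simp: algebra_simps)
  obtain B where B: "B \<subseteq> W" "vs.independent B" "W \<subseteq> vs.span B" using vs.maximal_independent_subset by blast
  have "vs.span B \<subseteq> W" using B(1) assms(1) by (rule vs.span_minimal)
  then have x: "x \<notin> vs.span B" using assms(2) by auto
  then have "vs.independent (insert x B)" using B(2) by (rule vs.independent_insertI)
  then obtain w where w: "Vector_Spaces.linear sc (*) w" "\<forall>y\<in>insert x B. w y = (if y = x then 1 else 0)"
    using vp.linear_independent_extend[of "insert x B" "\<lambda>y. if y = x then 1 else 0"] by blast
  interpret w: Vector_Spaces.linear sc "(*)" w by fact
  have "x \<notin> B" using x vs.span_base by blast
  have "w y = 0" if "y \<in> vs.span B" for y
    using that
  proof (induction y rule: vs.span_induct_alt)
    case base then show ?case by simp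
  next
    case (step c a b)
    then have "w a = 0" using w(2) \<open>x \<notin> B\<close> by (metis insertCI)
    then show ?case using step by (simp add: w.add w.scale)
  qed
  then show ?thesis using w B(3) by (intro exI[of _ w]) auto
qed

text \<open>Duality. If \<open>X\<close> were outside the sum \<open>W\<close>, a functional
  vanishing on \<open>W\<close> but not at \<open>X\<close> would be the pairing with some
  \<open>Z\<close> of degree \<open>- k\<close>. Orthogonality to the image of ad \<open>LS\<close>
  puts \<open>Z\<close> into the Heisenberg subalgebra, and orthogonality to the Heisenberg vectors
  of degree \<open>k\<close> makes it zero.\<close>

lemma Eig_decompose:
  assumes k: "k < 0" and X: "X \<in> Eig k"
  shows "\<exists>Y\<in>Eig (k - 1). \<exists>Z\<in>heis G \<inter> Eig k. X = br LS Y + Z"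
proof (rule ccontr)
  assume no: "\<not> ?thesis"
  define W where "W = {br LS Y + Z |Y Z. Y \<in> Eig (k - 1) \<and> Z \<in> heis G \<inter> Eig k}"
  have W: "vs.subspace W"
    unfolding vs.subspace_def
  proof (intro conjI allI ballI)
    have "0 = br LS 0 + 0 \<and> 0 \<in> Eig (k - 1) \<and> 0 \<in> heis G \<inter> Eig k"
      using vs.subspace_0 subspace_Eig subspace_heis by auto
    then show "0 \<in> W" unfolding W_def by blast
  next
    fix x y assume "x \<in> W" "y \<in> W"
    then obtain a b c d where "x = br LS a + b" "y = br LS c + d" "a \<in> Eig (k-1)" "c \<in> Eig (k-1)"
      "b \<in> heis G \<inter> Eig k" "d \<in> heis G \<inter> Eig k" unfolding W_def by blast
    then have "x + y = br LS (a + c) + (b + d) \<and> a + c \<in> Eig (k-1) \<and> b + d \<in> heis G \<inter> Eig k"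
      using vs.subspace_add subspace_Eig subspace_heis by (auto simp: br_add_right)
    then show "x + y \<in> W" unfolding W_def by blast
  next
    fix t x assume "x \<in> W"
    then obtain a b where "x = br LS a + b" "a \<in> Eig (k-1)" "b \<in> heis G \<inter> Eig k" unfolding W_def by blast
    then have "sc t x = br LS (sc t a) + sc t b \<and> sc t a \<in> Eig (k-1) \<and> sc t b \<in> heis G \<inter> Eig k"
      using vs.subspace_scale subspace_Eig subspace_heis by (auto simp: br_scale_right vs.scale_right_distrib)
    then show "sc t x \<in> W" unfolding W_def by blast
  qed
  have "X \<notin> W" using no unfolding W_def by blast
  then obtain w where w: "Vector_Spaces.linear sc (*) w" "\<forall>y\<in>W. w y = 0" "w X = 1"
    using functional_separating_subspace[OF W] by blast
  interpret w: Vector_Spaces.linear sc "(*)" w by fact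
  \<comment> \<open>The finitely many pairings with \<open>Gen (- k)\<close> separate the points of
    \<open>Eig k\<close>, so \<open>w\<close> is a combination of them.\<close>
  have "\<exists>c. \<forall>v\<in>Eig k. w v = (\<Sum>z\<in>Gen (- k). c z * fm z v)"
  proof (rule vs.functional_in_span[OF finite_Gen subspace_Eig w(1) linear_form])
    fix v assume v: "v \<in> Eig k" "\<forall>z\<in>Gen (- k). fm z v = 0"
    then have "v = 0" using Gen_form_zero[OF v(1)] form_sym by metis
    then show "w v = 0" by simp
  qed
  then obtain c where c: "\<forall>v\<in>Eig k. w v = (\<Sum>z\<in>Gen (- k). c z * fm z v)" by blast
  define Z where "Z = (\<Sum>z\<in>Gen (- k). sc (c z) z)"
  have Z: "Z \<in> Eig (- k)" unfolding Z_def
    by (intro vs.subspace_sum[OF subspace_Eig] vs.subspace_scale[OF subspace_Eig] Gen_Eig)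
  have wZ: "w v = fm Z v" if "v \<in> Eig k" for v
    using c that unfolding Z_def by (simp add: form_sum_left form_scale_left)
  have LZ: "br LS Z = 0"
  proof (rule Eig_form_zero[OF Eig_br[OF LS_Eig Z]])
    fix Y assume "Y \<in> Eig (- (1 + - k))"
    then have Y: "Y \<in> Eig (k - 1)" by simp
    then have "br LS Y \<in> Eig k" using Eig_br[OF LS_Eig Y] by simp
    moreover have "br LS Y = br LS Y + 0 \<and> 0 \<in> heis G \<inter> Eig k"
      using vs.subspace_0 subspace_Eig subspace_heis by auto
    then have "br LS Y \<in> W" unfolding W_def using Y by blast
    ultimately have "fm Z (br LS Y) = 0" using wZ w(2) by metis
    then show "fm (br LS Z) Y = 0" by (simp add: form_ad)
  qed
  then have Zh: "Z \<in> heis G" using heisI[OF Z] k by simp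
  have "fm Z (Lam G (k, a)) = 0" if "a < emult G k" for a
  proof -
    have e: "(k, a) \<in> exponents G" using that by (simp add: exponents_pair)
    have "Lam G (k, a) \<in> Eig k" "Lam G (k, a) \<in> heis G" using Lam_Eig[OF e] Lam_heis[OF e] by auto
    moreover have "Lam G (k, a) = br LS 0 + Lam G (k, a) \<and> 0 \<in> Eig (k - 1)"
      using vs.subspace_0 subspace_Eig by auto
    ultimately have "Lam G (k, a) \<in> W" unfolding W_def by blast
    then show ?thesis using w(2) wZ \<open>Lam G (k, a) \<in> Eig k\<close> by metis
  qed
  then have "Z = 0" using heis_expansion[OF Zh Z] k by (simp add: emult_minus)
  then show False using wZ[OF X] w(3) by simp
qed

text \<open>The projection to the Heisenberg part along the image of ad \<open>LS\<close>. Degree 0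
  gets the value 0 because there all of \<open>Hspan\<close>, including \<open>cc\<close>, lies in
  the image by \<open>Hspan_image\<close>.\<close>

definition hproj :: "int \<Rightarrow> 'g \<Rightarrow> 'g" where
  "hproj k X = (if k = 0 then 0 else (\<Sum>a<emult G k. sc (fm X (Lam G (- k, a)) / cox_c) (Lam G (k, a))))"

lemma linear_hproj: "Vector_Spaces.linear sc sc (hproj k)"
  unfolding Vector_Spaces.linear_iff hproj_def
  by (auto simp: vector_space_sc form_add_left form_scale_left vs.scale_left_distrib add_divide_distrib
      sum.distrib vs.scale_sum_right)

lemma hproj_heis: "hproj k X \<in> heis G"
  unfolding hproj_def using vs.subspace_0[OF subspace_heis]
  by (auto intro!: vs.subspace_sum[OF subspace_heis] vs.subspace_scale[OF subspace_heis] Lam_heis simp: exponents_pair)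

text \<open>The vectors paired with have positive degree \<open>- k\<close>, so they commute with
  \<open>LS\<close> and invariance makes the pairing vanish.\<close>

lemma hproj_image_LS:
  assumes "k < 0" "Y \<in> Eig (k - 1)" shows "hproj k (br LS Y) = 0"
proof -
  have "fm (br LS Y) (Lam G (- k, a)) = 0" if "a < emult G k" for a
  proof -
    have e: "(- k, a) \<in> exponents G" using that by (simp add: exponents_pair emult_minus)
    have "br LS (Lam G (- k, a)) = 0" using heis_LS[OF Lam_heis[OF e] Lam_Eig[OF e]] assms(1) by simp
    then show ?thesis by (simp add: form_ad)
  qed
  then show ?thesis unfolding hproj_def by (auto intro: sum.neutral)
qed

lemma hproj_id: "X \<in> heis G \<Longrightarrow> X \<in> Eig k \<Longrightarrow> k \<noteq> 0 \<Longrightarrow> hproj k X = X"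
  unfolding hproj_def using heis_expansion by simp

lemma Eig_decompose_hproj:
  assumes k: "k < 0" and X: "X \<in> Eig k"
  shows "\<exists>Y\<in>Eig (k - 1). X - hproj k X = br (Lam1 G) Y"
proof -
  obtain Y Z where Y: "Y \<in> Eig (k - 1)" and Z: "Z \<in> heis G" "Z \<in> Eig k" and e: "X = br LS Y + Z"
    using Eig_decompose[OF assms] by blast
  interpret h: Vector_Spaces.linear sc sc "hproj k" by (rule linear_hproj)
  have "hproj k X = Z" unfolding e h.add using hproj_image_LS[OF k Y] hproj_id[OF Z] k by simp
  then have "X - hproj k X = br (Lam1 G) (sc (1 / nu G) Y)" using nu_nz
    unfolding e by (simp add: br_Lam1 br_scale_right)
  then show ?thesis using Y vs.subspace_scale[OF subspace_Eig] by blast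
qed

text \<open>The bracket of \<open>LS\<close> with \<open>ff i\<close> is \<open>hh i\<close>. This
  is why the dressing can remove all of \<open>Q\<close> from degree 0.\<close>

lemma Hspan_image: "X \<in> Hspan \<Longrightarrow> \<exists>Y\<in>Eig (-1). X = br (Lam1 G) Y"
proof -
  assume "X \<in> Hspan"
  then obtain x where x: "X = (\<Sum>i\<le>ll. sc (x i) (hh i))" using Hspan_iff by blast
  define Y where "Y = (\<Sum>i\<le>ll. sc (x i / nu G) (ff i))"
  have LSff: "br LS (ff i) = hh i" if "i \<le> ll" for i
    using br_ff_sum_ee[OF that, of "\<lambda>_. 1"] br_anti[of LS "ff i"] unfolding LS_sum by simp
  have "br (Lam1 G) Y = X" unfolding Y_def x br_Lam1 br_sum_right vs.scale_sum_right
    by (rule sum.cong) (auto simp: br_scale_right LSff nu_nz)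
  moreover have "Y \<in> Eig (-1)" unfolding Y_def
    by (intro vs.subspace_sum[OF subspace_Eig] vs.subspace_scale[OF subspace_Eig]) (auto intro: Eig_gens)
  ultimately show ?thesis by blast
qed

lemma right_inverse_exists:
  "\<exists>g. Vector_Spaces.linear sc sc g \<and> (\<forall>X. g X \<in> Eig (k - 1)) \<and>
     (\<forall>Y\<in>Eig (k - 1). br (Lam1 G) (g (br (Lam1 G) Y)) = br (Lam1 G) Y)"
proof -
  interpret vp: vector_space_pair sc sc by unfold_locales
  obtain g where g: "range g \<subseteq> Eig (k - 1)" "Vector_Spaces.linear sc sc g"
    "\<forall>v\<in>br (Lam1 G) ` Eig (k - 1). br (Lam1 G) (g v) = v"
    using vp.linear_exists_right_inverse_on[OF linear_br_right[of "Lam1 G"] subspace_Eig[of "k - 1"]]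
    by (elim exE conjE)
  then show ?thesis by (intro exI[of _ g]) auto
qed

text \<open>
  Fixing the inverse once, independently of \<open>x\<close>, makes the components of the dressing element
  differential polynomials.
\<close>

definition rinv :: "int \<Rightarrow> 'g \<Rightarrow> 'g" where
  "rinv k = (SOME g. Vector_Spaces.linear sc sc g \<and> (\<forall>X. g X \<in> Eig (k - 1)) \<and>
     (\<forall>Y\<in>Eig (k - 1). br (Lam1 G) (g (br (Lam1 G) Y)) = br (Lam1 G) Y))"

lemma rinv: "Vector_Spaces.linear sc sc (rinv k)" "rinv k X \<in> Eig (k - 1)"
  "Y \<in> Eig (k - 1) \<Longrightarrow> br (Lam1 G) (rinv k (br (Lam1 G) Y)) = br (Lam1 G) Y"
  using someI_ex[OF right_inverse_exists[of k]] unfolding rinv_def by simp_all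

definition solve where "solve k X = rinv k (X - hproj k X)"

lemma linear_solve: "Vector_Spaces.linear sc sc (solve k)"
proof -
  interpret h: Vector_Spaces.linear sc sc "hproj k" by (rule linear_hproj)
  interpret r: Vector_Spaces.linear sc sc "rinv k" by (rule rinv)
  show ?thesis unfolding Vector_Spaces.linear_iff solve_def
    by (auto simp: vector_space_sc h.add h.scale r.add r.scale r.diff algebra_simps
        simp flip: vs.scale_right_diff_distrib)
qed

lemma solve_Eig: "solve k X \<in> Eig (k - 1)" unfolding solve_def by (rule rinv)

lemma br_solve:
  assumes "k < 0 \<and> X \<in> Eig k \<or> k = 0 \<and> X \<in> Hspan"
  shows "br (Lam1 G) (solve k X) = X - hproj k X"
proof -
  have "\<exists>Y\<in>Eig (k - 1). X - hproj k X = br (Lam1 G) Y"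
    using assms Eig_decompose_hproj Hspan_image by (auto simp: hproj_def)
  then show ?thesis unfolding solve_def using rinv(3) by metis
qed

section \<open>Serre relations and local nilpotency of ad \<open>ff j\<close>\<close>

lemma form_ee_ff: "i \<le> ll \<Longrightarrow> j \<le> ll \<Longrightarrow> fm (ee i) (ff j) = (if i = j then rat j else 0)"
  using form_inv[of dd "ee i" "ff j"] by (simp add: br_de br_ef form_dh)

lemma form_ff_ee: "i \<le> ll \<Longrightarrow> j \<le> ll \<Longrightarrow> fm (ff i) (ee j) = (if i = j then rat j else 0)"
  using form_ee_ff[of j i] by (auto simp: form_sym[of "ff i"])

text \<open>The opposite degree is spanned by brackets of some \<open>ee m\<close> with a shorter
  word; invariance moves \<open>ee m\<close> onto \<open>X\<close>. The bound on the degree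
  guarantees that these words have at least two letters.\<close>

lemma Eig_killed_zero:
  assumes X: "X \<in> Eig (- int (Suc (Suc n)))" and 0: "\<And>m. m \<le> ll \<Longrightarrow> br (ee m) X = 0"
  shows "X = 0"
proof (rule Gen_form_zero[OF X])
  fix Z assume "Z \<in> Gen (- (- int (Suc (Suc n))))"
  then have "Z \<in> words ee (Suc n)" unfolding Gen_def by (simp add: nat_add_distrib)
  then obtain m w where m: "m \<le> ll" "Z = br (ee m) w" by auto
  have "fm (br (ee m) w) X = - fm w (br (ee m) X)" by (rule form_ad)
  then show "fm X Z = 0" using m 0[OF m(1)] by (simp add: form_sym[of X])
qed

text \<open>The vector \<open>Y N\<close> with N = 1 - a_ji is killed by every \<open>ee m\<close>,
  hence zero by \<open>Eig_killed_zero\<close>. It is this nilpotency that makes the exponential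
  acting on \<open>ff i\<close> in the formula for the transformed phi_i a finite sum.\<close>

lemma serre:
  assumes ij: "i \<le> ll" "j \<le> ll" "i \<noteq> j"
  shows "(br (ff j) ^^ nat (1 - cartan G j i)) (ff i) = 0"
proof -
  define Y where "Y n = (br (ff j) ^^ n) (ff i)" for n
  have YS: "Y (Suc n) = br (ff j) (Y n)" for n unfolding Y_def by simp
  have Y0: "Y 0 = ff i" unfolding Y_def by simp
  have h: "br (hh j) (Y n) = sc (- (2 * of_nat n + aa j i)) (Y n)" for n
  proof (induction n)
    case 0 then show ?case using br_hf[of j i] ij by (simp add: Y0)
  next
    case (Suc n)
    have "br (hh j) (Y (Suc n)) = sc (- 2) (Y (Suc n)) + sc (- (2 * of_nat n + aa j i)) (Y (Suc n))"
      unfolding YS jacobi[of "hh j" "ff j"] Suc using br_hf[of j j] ij aa_diag[of j]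
      by (simp add: br_scale_left br_scale_right br_minus_left br_minus_right)
    then show ?case by (simp only: vs.scale_left_distrib[symmetric]) (simp add: algebra_simps)
  qed
  \<comment> \<open>The usual sl2 computation; the coefficient vanishes at n = 1 - a_ji. At
    \<open>n = 0\<close> the truncated index \<open>n - 1\<close> is accompanied by the coefficient
    0.\<close>
  have e: "br (ee j) (Y n) = sc (of_nat n * (1 - of_nat n - aa j i)) (Y (n - 1))" for n
  proof (induction n)
    case 0 then show ?case using br_ef[of j i] ij by (simp add: Y0)
  next
    case (Suc n)
    have "br (ee j) (Y (Suc n)) = br (hh j) (Y n) + br (ff j) (br (ee j) (Y n))"
      unfolding YS jacobi[of "ee j" "ff j"] using br_ef[of j j] ij by simp
    also have "br (ff j) (br (ee j) (Y n)) = sc (of_nat n * (1 - of_nat n - aa j i)) (Y n)"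
      unfolding Suc using YS[of "n - 1"] by (cases n) (simp_all add: br_scale_right)
    finally show ?case unfolding h
      by (simp only: vs.scale_left_distrib[symmetric]) (simp add: algebra_simps)
  qed
  have ei: "br (ee i) (Y (Suc n)) = (br (ff j) ^^ Suc n) (hh i)" for n
  proof (induction n)
    case 0
    have "br (ee i) (br (ff j) (ff i)) = br (ff j) (hh i)"
      unfolding jacobi[of "ee i" "ff j"] using br_ef[of i j] br_ef[of i i] ij by simp
    then show ?case unfolding YS Y0 by simp
  next
    case (Suc n)
    have "br (ee i) (Y (Suc (Suc n))) = br (ff j) (br (ee i) (Y (Suc n)))"
      unfolding YS[of "Suc n"] jacobi[of "ee i" "ff j"] using br_ef[of i j] ij by simp
    then show ?case using Suc by simp
  qed
  have fh: "br (ff j) (hh i) = sc (aa i j) (ff j)"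
    using br_anti[of "ff j" "hh i"] br_hf[of i j] ij by simp
  then have fh2: "(br (ff j) ^^ Suc (Suc n)) (hh i) = 0" for n
  proof -
    have "(br (ff j) ^^ m) 0 = 0" for m by (induction m) auto
    then show ?thesis using fh by (simp add: br_scale_right funpow_Suc_right del: funpow.simps)
  qed
  have em: "br (ee m) (Y n) = 0" if "m \<le> ll" "m \<noteq> i" "m \<noteq> j" for m n
  proof (induction n)
    case 0 then show ?case using br_ef[of m i] that ij by (simp add: Y0)
  next
    case (Suc n)
    then show ?case unfolding YS jacobi[of "ee m" "ff j"] using br_ef[of m j] that ij by simp
  qed
  have Yd: "Y n \<in> Eig (- int (Suc n))" for n
  proof (induction n)
    case 0 then show ?case using Eig_gens ij by (simp add: Y0)
  next
    case (Suc n)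
    then show ?case using Eig_br[OF Eig_gens(2)[OF ij(2)] Suc] by (simp add: YS)
  qed
  have neg: "cartan G j i \<le> 0" "cartan G j i = 0 \<longleftrightarrow> cartan G i j = 0"
    using cartan_facts(1) ij unfolding gen_cartan_matrix_def by auto
  define N where "N = nat (1 - cartan G j i)"
  have "of_nat N = 1 - aa j i" unfolding N_def using neg by (simp add: of_nat_nat)
  moreover obtain n where n: "N = Suc n" unfolding N_def using neg(1) by (cases "nat (1 - cartan G j i)") auto
  ultimately have "br (ee j) (Y (Suc n)) = 0" using e[of N] by simp
  \<comment> \<open>Two applications of ad \<open>ff j\<close> already kill \<open>hh i\<close>. If
    there is only one, then a_ji = 0, hence a_ij = 0 and the first application gives zero.\<close>
  moreover have "br (ee i) (Y (Suc n)) = 0"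
  proof (cases n)
    case 0
    then have "cartan G j i = 0" using n neg(1) unfolding N_def by auto
    then show ?thesis using ei[of 0] fh neg(2) 0 by simp
  next
    case (Suc m) then show ?thesis using ei[of n] fh2[of m] by simp
  qed
  ultimately have "br (ee m) (Y (Suc n)) = 0" if "m \<le> ll" for m using em that by blast
  then have "Y (Suc n) = 0" using Eig_killed_zero[OF Yd] by blast
  then show ?thesis using n unfolding Y_def N_def by simp
qed

lemma ff_nilpotent_ff: "i \<le> ll \<Longrightarrow> j \<le> ll \<Longrightarrow> \<exists>N. (br (ff j) ^^ N) (ff i) = 0"
proof (cases "i = j")
  case True then show ?thesis by (intro exI[of _ 1]) simp
next
  case False
  assume "i \<le> ll" "j \<le> ll"
  then show ?thesis using serre False by blast
qed

text \<open>The nilradical of the minimal parabolic subalgebra attached to the \<open>j\<close>-th simple root.\<close>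

definition nilrad :: "nat \<Rightarrow> 'g set" where
  "nilrad j = vs.span (ee ` ({..ll} - {j}) \<union> (\<Union>n. words ee (Suc n)))"

lemma subspace_nilrad: "vs.subspace (nilrad j)" unfolding nilrad_def by (rule vs.subspace_span)

lemma nilrad_base: "w \<in> words ee (Suc n) \<Longrightarrow> w \<in> nilrad j" "i \<le> ll \<Longrightarrow> i \<noteq> j \<Longrightarrow> ee i \<in> nilrad j"
  unfolding nilrad_def by (rule vs.span_base, fastforce)+

lemma br_ee_nilrad:
  assumes "X \<in> nilrad j" "i \<le> ll" shows "br (ee i) X \<in> nilrad j"
  using assms(1) unfolding nilrad_def
proof (induction X rule: vs.span_induct_alt)
  case base then show ?case by (simp add: vs.span_zero)
next
  case (step c x y)
  then have "\<exists>n. x \<in> words ee n" by (metis DiffD1 UN_E UnE image_eqI imageE words.simps(1))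
  then obtain n where "x \<in> words ee n" by blast
  then have "br (ee i) x \<in> words ee (Suc n)" using assms(2) by force
  then have "br (ee i) x \<in> nilrad j" using nilrad_base by blast
  then show ?case using step(2) unfolding nilrad_def
    by (simp add: br_add_right br_scale_right vs.span_add vs.span_scale)
qed

text \<open>The point is that lowering never produces \<open>ee j\<close>: among two-letter words
  this could only come from \<open>ee j\<close> bracketed with itself. For longer words
  \<open>ff j\<close> either turns the first letter into \<open>hh j\<close>, acting by a weight, or
  passes to the tail.\<close>

lemma br_ff_words_nilrad:
  assumes j: "j \<le> ll"
  shows "w \<in> words ee (Suc n) \<Longrightarrow> br (ff j) w \<in> nilrad j"
proof (induction n arbitrary: w)
  case 0
  then obtain a b where ab: "a \<le> ll" "b \<le> ll" "w = br (ee a) (ee b)" by auto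
  have e: "br (ff j) w = br (br (ff j) (ee a)) (ee b) + br (ee a) (br (ff j) (ee b))"
    unfolding ab(3) by (rule jacobi)
  consider "a = b" | "a \<noteq> b" "a = j" | "a \<noteq> b" "b = j" | "a \<noteq> j" "b \<noteq> j" by blast
  then show ?case
  proof cases
    case 1 then show ?thesis unfolding ab(3) using vs.subspace_0[OF subspace_nilrad] by simp
  next
    case 2
    have "br (ff j) w = sc (- aa j b) (ee b)" unfolding e using 2 ab j
      by (simp add: br_fe br_minus_left br_he)
    moreover have "ee b \<in> nilrad j" using nilrad_base(2)[of b j] 2 ab by simp
    ultimately show ?thesis using vs.subspace_scale[OF subspace_nilrad] by metis
  next
    case 3
    have "br (ff j) w = sc (aa j a) (ee a)" unfolding e using 3 ab j br_anti[of "ee a" "hh j"]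
      by (simp add: br_fe br_minus_left br_minus_right br_he)
    moreover have "ee a \<in> nilrad j" using nilrad_base(2)[of a j] 3 ab by simp
    ultimately show ?thesis using vs.subspace_scale[OF subspace_nilrad] by metis
  next
    case 4
    have "br (ff j) w = 0" unfolding e using 4 ab j by (simp add: br_fe)
    then show ?thesis using vs.subspace_0[OF subspace_nilrad] by simp
  qed
next
  case (Suc n)
  then obtain a v where av: "a \<le> ll" "v \<in> words ee (Suc n)" "w = br (ee a) v"
    unfolding words.simps(2)[of ee "Suc n"] by (elim imageE SigmaE) simp
  have e: "br (ff j) w = br (br (ff j) (ee a)) v + br (ee a) (br (ff j) v)"
    unfolding av(3) by (rule jacobi)
  obtain t where "br (hh j) v = sc t v" using words_weight[of ee 1, OF br_ee_weight j av(2)] by blast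
  then have "br (br (ff j) (ee a)) v = sc (if a = j then - t else 0) v"
    using j av(1) by (auto simp: br_fe br_minus_left)
  then have "br (br (ff j) (ee a)) v \<in> nilrad j"
    using vs.subspace_scale[OF subspace_nilrad nilrad_base(1)[OF av(2)]] by metis
  moreover have "br (ee a) (br (ff j) v) \<in> nilrad j" using br_ee_nilrad Suc.IH[OF av(2)] av(1) by blast
  ultimately show ?case unfolding e by (rule vs.subspace_add[OF subspace_nilrad])
qed

lemma br_ff_nilrad:
  assumes j: "j \<le> ll" and X: "X \<in> nilrad j" shows "br (ff j) X \<in> nilrad j"
  using X unfolding nilrad_def
proof (induction X rule: vs.span_induct_alt)
  case base then show ?case by (simp add: vs.span_zero)
next
  case (step c x y)
  have "br (ff j) x \<in> nilrad j"
  proof (cases "x \<in> ee ` ({..ll} - {j})")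
    case True
    then have "br (ff j) x = 0" using br_fe[OF j] by (auto split: if_splits)
    then show ?thesis using vs.subspace_0[OF subspace_nilrad] by simp
  next
    case False
    then obtain n where "x \<in> words ee (Suc n)" using step(1) by blast
    then show ?thesis using br_ff_words_nilrad[OF j] by blast
  qed
  then show ?case using step(2) unfolding nilrad_def
    by (simp add: br_add_right br_scale_right vs.span_add vs.span_scale)
qed

lemma nilrad_Eig_zero:
  assumes "X \<in> nilrad j" "X \<in> Eig k" "k \<le> 0" shows "X = 0"
proof -
  define P where "P k = (if k = 1 then ee ` ({..ll} - {j}) else if k > 1 then words ee (nat (k - 1)) else {})" for k :: int
  have "words ee (Suc n) = P (int n + 2)" for n unfolding P_def by (simp add: nat_add_distrib)
  then have "ee ` ({..ll} - {j}) \<union> (\<Union>n. words ee (Suc n)) \<subseteq> (\<Union>k. P k)"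
    unfolding P_def[of 1, simplified, symmetric] by blast
  then have "X \<in> vs.span (\<Union>k. P k)" using assms(1) vs.span_mono unfolding nilrad_def by blast
  moreover have "P k \<subseteq> Eig k" for k
    using words_dd(1) Eig_gens unfolding P_def Eig_def by (auto split: if_splits)
  ultimately have "X \<in> vs.span (P k)" using graded_span assms(2) by blast
  then show ?thesis using assms(3) unfolding P_def by simp
qed

lemma nilrad_funpow:
  assumes "X \<in> nilrad j" "X \<in> Eig k" "j \<le> ll"
  shows "(br (ff j) ^^ n) X \<in> nilrad j" "(br (ff j) ^^ n) X \<in> Eig (k - int n)"
proof -
  show "(br (ff j) ^^ n) X \<in> nilrad j" by (induction n) (simp_all add: assms br_ff_nilrad)
  show "(br (ff j) ^^ n) X \<in> Eig (k - int n)"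
  proof (induction n)
    case (Suc n) then show ?case using Eig_br[OF Eig_gens(2)[OF assms(3)] Suc] by (simp add: algebra_simps)
  qed (simp add: assms)
qed

text \<open>Each application of ad \<open>ff j\<close> lowers the degree by one without leaving
  \<open>nilrad j\<close>, which has no elements in degrees at most 0; so \<open>k\<close> steps
  exhaust degree \<open>k\<close>.\<close>

lemma nilrad_nilpotent:
  assumes "X \<in> nilrad j" "X \<in> Eig k" "j \<le> ll" "k \<le> int n"
  shows "(br (ff j) ^^ n) X = 0"
  using nilrad_Eig_zero[OF nilrad_funpow[OF assms(1-3), of n]] assms(4) by simp

lemma Eig_nilrad: "X \<in> Eig k \<Longrightarrow> 2 \<le> k \<Longrightarrow> X \<in> nilrad j"
proof -
  assume X: "X \<in> Eig k" "2 \<le> k"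
  define m where "m = nat (k - 2)"
  have "nat (k - 1) = Suc m" unfolding m_def using X(2) by simp
  then have "X \<in> vs.span (words ee (Suc m))" using X unfolding Eig_eq_span Gen_def by simp
  moreover have "vs.span (words ee (Suc m)) \<subseteq> nilrad j"
    by (rule vs.span_minimal[OF _ subspace_nilrad]) (use nilrad_base in blast)
  ultimately show ?thesis by blast
qed

lemma Eig1_nilrad:
  assumes "X \<in> Eig 1" "j \<le> ll" shows "X - sc (fm (ff j) X / rat j) (ee j) \<in> nilrad j"
proof -
  obtain x where x: "X = (\<Sum>i\<le>ll. sc (x i) (ee i))" using Eig1_expansion[OF assms(1)] by blast
  have "fm (ff j) X = (\<Sum>i\<le>ll. if j = i then x i * rat i else 0)"
    unfolding x form_sum_right by (rule sum.cong) (use assms(2) in \<open>auto simp: form_scale_right form_ff_ee\<close>)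
  then have "fm (ff j) X / rat j = x j" using assms(2) rat_nz by simp
  moreover have "X = sc (x j) (ee j) + (\<Sum>i\<in>{..ll} - {j}. sc (x i) (ee i))"
    unfolding x using assms(2) by (subst sum.remove[of _ j]) auto
  moreover have "(\<Sum>i\<in>{..ll} - {j}. sc (x i) (ee i)) \<in> nilrad j"
    by (intro vs.subspace_sum[OF subspace_nilrad] vs.subspace_scale[OF subspace_nilrad]) (auto intro: nilrad_base)
  ultimately show ?thesis by simp
qed

end

section \<open>Exponentials in completed graded Lie algebras\<close>

text \<open>
  A graded Lie algebra is completed in the direction of negative degrees.  The homogeneous
  components \<open>C k\<close> are carriers: outside of them the bracket may be junk.
\<close>

locale graded_lie = vector_space s
  for s :: "complex \<Rightarrow> 'a::ab_group_add \<Rightarrow> 'a" +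
  fixes b :: "'a \<Rightarrow> 'a \<Rightarrow> 'a" and C :: "int \<Rightarrow> 'a set"
  assumes subspace_C: "subspace (C k)"
    and b_C: "x \<in> C k \<Longrightarrow> y \<in> C m \<Longrightarrow> b x y \<in> C (k + m)"
    and b_add_left: "x \<in> C k \<Longrightarrow> x' \<in> C k \<Longrightarrow> y \<in> C m \<Longrightarrow> b (x + x') y = b x y + b x' y"
    and b_add_right: "x \<in> C k \<Longrightarrow> y \<in> C m \<Longrightarrow> y' \<in> C m \<Longrightarrow> b x (y + y') = b x y + b x y'"
    and b_scale_left: "x \<in> C k \<Longrightarrow> y \<in> C m \<Longrightarrow> b (s a x) y = s a (b x y)"
    and b_scale_right: "x \<in> C k \<Longrightarrow> y \<in> C m \<Longrightarrow> b x (s a y) = s a (b x y)"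
    and b_leibniz: "x \<in> C i \<Longrightarrow> y \<in> C j \<Longrightarrow> z \<in> C k \<Longrightarrow> b x (b y z) = b (b x y) z + b y (b x z)"
begin

lemma C_zero [simp]: "0 \<in> C k" using subspace_0[OF subspace_C] .
lemma C_add: "x \<in> C k \<Longrightarrow> y \<in> C k \<Longrightarrow> x + y \<in> C k" using subspace_add[OF subspace_C] .
lemma C_scale: "x \<in> C k \<Longrightarrow> s a x \<in> C k" using subspace_scale[OF subspace_C] .
lemma C_diff: "x \<in> C k \<Longrightarrow> y \<in> C k \<Longrightarrow> x - y \<in> C k" using subspace_diff[OF subspace_C] .
lemma C_minus: "x \<in> C k \<Longrightarrow> - x \<in> C k" using subspace_neg[OF subspace_C] .
lemma C_sum: "(\<And>i. i \<in> S \<Longrightarrow> F i \<in> C k) \<Longrightarrow> sum F S \<in> C k" using subspace_sum[OF subspace_C] .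

lemma b_zero_left: "y \<in> C m \<Longrightarrow> b 0 y = 0"
  using b_scale_left[of 0 0 y m 0] by simp
lemma b_zero_right: "x \<in> C k \<Longrightarrow> b x 0 = 0"
  using b_scale_right[of x k 0 0 0] by simp
lemma b_minus_left: "x \<in> C k \<Longrightarrow> y \<in> C m \<Longrightarrow> b (- x) y = - b x y"
  using b_scale_left[of x k y m "-1"] by simp
lemma b_diff_left: "x \<in> C k \<Longrightarrow> x' \<in> C k \<Longrightarrow> y \<in> C m \<Longrightarrow> b (x - x') y = b x y - b x' y"
  using b_add_left[of x k "- x'" y m] b_minus_left[of x' k y m] C_minus[of x' k] by simp

lemma b_sum_right:
  assumes "x \<in> C k" "\<And>i. i \<in> S \<Longrightarrow> F i \<in> C m"
  shows "b x (sum F S) = (\<Sum>i\<in>S. b x (F i))"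
  using assms(2)
  by (induction S rule: infinite_finite_induct)
    (auto simp: b_zero_right[OF assms(1)] b_add_right[OF assms(1), of _ m] C_sum)

lemma b_sum_left:
  assumes "y \<in> C m" "\<And>i. i \<in> S \<Longrightarrow> F i \<in> C k"
  shows "b (sum F S) y = (\<Sum>i\<in>S. b (F i) y)"
  using assms(2)
  by (induction S rule: infinite_finite_induct)
    (auto simp: b_zero_left[OF assms(1)] b_add_left[of _ k _ y m] assms(1) C_sum)

section \<open>Series bounded above in degree, and their bracket\<close>

definition Ser :: "int \<Rightarrow> (int \<Rightarrow> 'a) set" where
  "Ser K = {Z. (\<forall>k. Z k \<in> C k) \<and> (\<forall>k>K. Z k = 0)}"

lemma SerD: "Z \<in> Ser K \<Longrightarrow> Z k \<in> C k" "Z \<in> Ser K \<Longrightarrow> K < k \<Longrightarrow> Z k = 0"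
  unfolding Ser_def by auto

lemma SerI: "(\<And>k. Z k \<in> C k) \<Longrightarrow> (\<And>k. K < k \<Longrightarrow> Z k = 0) \<Longrightarrow> Z \<in> Ser K"
  unfolding Ser_def by auto

lemma Ser_mono: "Z \<in> Ser K \<Longrightarrow> K \<le> L \<Longrightarrow> Z \<in> Ser L" unfolding Ser_def by auto

lemma Ser_add: "Z \<in> Ser K \<Longrightarrow> W \<in> Ser K \<Longrightarrow> Z + W \<in> Ser K"
  unfolding Ser_def by (auto simp: C_add)
lemma Ser_scale: "Z \<in> Ser K \<Longrightarrow> (\<lambda>k. s a (Z k)) \<in> Ser K"
  unfolding Ser_def by (auto simp: C_scale)
lemma Ser_minus: "Z \<in> Ser K \<Longrightarrow> - Z \<in> Ser K"
  unfolding Ser_def by (auto simp: C_minus)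

definition sbr :: "(int \<Rightarrow> 'a) \<Rightarrow> (int \<Rightarrow> 'a) \<Rightarrow> int \<Rightarrow> 'a" where
  "sbr Z W = (\<lambda>n. \<Sum>k | b (Z k) (W (n - k)) \<noteq> 0. b (Z k) (W (n - k)))"

lemma sbr_Sum_any: "sbr Z W n = Sum_any (\<lambda>k. b (Z k) (W (n - k)))"
  unfolding sbr_def Sum_any.expand_set ..

lemma sbr_terms:
  assumes "Z \<in> Ser K" "W \<in> Ser L"
  shows "b (Z k) (W m) \<in> C (k + m)" "K < k \<Longrightarrow> b (Z k) (W m) = 0" "L < m \<Longrightarrow> b (Z k) (W m) = 0"
  using b_C SerD[OF assms(1)] SerD[OF assms(2)] b_zero_left b_zero_right by metis+

lemma sbr_eq:
  assumes "Z \<in> Ser K" "W \<in> Ser L" "finite A" "{n - L..K} \<subseteq> A"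
  shows "sbr Z W n = (\<Sum>k\<in>A. b (Z k) (W (n - k)))"
  unfolding sbr_Sum_any
proof (rule Sum_any.expand_superset[OF assms(3)])
  show "{k. b (Z k) (W (n - k)) \<noteq> 0} \<subseteq> A"
  proof
    fix k assume k: "k \<in> {k. b (Z k) (W (n - k)) \<noteq> 0}"
    have "\<not> K < k" using sbr_terms(2)[OF assms(1,2), of k "n - k"] k by auto
    moreover have "\<not> L < n - k" using sbr_terms(3)[OF assms(1,2), of "n - k" k] k by auto
    ultimately show "k \<in> A" using assms(4) by auto
  qed
qed

lemma sbr_C: "Z \<in> Ser K \<Longrightarrow> W \<in> Ser L \<Longrightarrow> sbr Z W n \<in> C n"
proof -
  assume a: "Z \<in> Ser K" "W \<in> Ser L"
  have "b (Z k) (W (n - k)) \<in> C n" for k using sbr_terms(1)[OF a, of k "n - k"] by simp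
  then show ?thesis unfolding sbr_def by (auto intro: C_sum)
qed

lemma sbr_Ser: "Z \<in> Ser K \<Longrightarrow> W \<in> Ser L \<Longrightarrow> sbr Z W \<in> Ser (K + L)"
proof (rule SerI)
  fix n assume a: "Z \<in> Ser K" "W \<in> Ser L" and "K + L < n"
  then have "{n - L..K} = {}" by auto
  then show "sbr Z W n = 0" using sbr_eq[OF a, of "{}"] by simp
qed (rule sbr_C)

lemma sbr_add_right:
  assumes "Z \<in> Ser K" "W \<in> Ser L" "W' \<in> Ser L" shows "sbr Z (W + W') = sbr Z W + sbr Z W'"
proof
  fix n
  have "b (Z k) ((W + W') m) = b (Z k) (W m) + b (Z k) (W' m)" for k m
    using b_add_right[OF SerD(1)[OF assms(1)] SerD(1)[OF assms(2)] SerD(1)[OF assms(3)]] by simp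
  then show "sbr Z (W + W') n = (sbr Z W + sbr Z W') n"
    using sbr_eq[OF assms(1) Ser_add[OF assms(2,3)], of "{n - L..K}" n]
      sbr_eq[OF assms(1,2), of "{n - L..K}" n] sbr_eq[OF assms(1,3), of "{n - L..K}" n]
    by (simp add: sum.distrib)
qed

lemma sbr_scale_left:
  assumes "Z \<in> Ser K" "W \<in> Ser L" shows "sbr (\<lambda>k. s a (Z k)) W = (\<lambda>k. s a (sbr Z W k))"
proof
  fix n
  have "b (s a (Z k)) (W m) = s a (b (Z k) (W m))" for k m
    by (rule b_scale_left[OF SerD(1)[OF assms(1)] SerD(1)[OF assms(2)]])
  then show "sbr (\<lambda>k. s a (Z k)) W n = s a (sbr Z W n)"
    using sbr_eq[OF Ser_scale[OF assms(1)] assms(2), of "{n - L..K}" n]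
      sbr_eq[OF assms, of "{n - L..K}" n]
    by (simp add: scale_sum_right)
qed

lemma sbr_scale_right:
  assumes "Z \<in> Ser K" "W \<in> Ser L" shows "sbr Z (\<lambda>k. s a (W k)) = (\<lambda>k. s a (sbr Z W k))"
proof
  fix n
  have "b (Z k) (s a (W m)) = s a (b (Z k) (W m))" for k m
    by (rule b_scale_right[OF SerD(1)[OF assms(1)] SerD(1)[OF assms(2)]])
  then show "sbr Z (\<lambda>k. s a (W k)) n = s a (sbr Z W n)"
    using sbr_eq[OF assms(1) Ser_scale[OF assms(2)], of "{n - L..K}" n]
      sbr_eq[OF assms, of "{n - L..K}" n]
    by (simp add: scale_sum_right)
qed

text \<open>In a fixed degree \<open>n\<close> all three iterated sums live on a finite box. The
  ranges \<open>A\<close> and \<open>B\<close> bound the degrees taken from \<open>X\<close> and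
  \<open>Y\<close> independently of each other, so each sum can be put in the form of a double sum
  over \<open>A\<close> and \<open>B\<close>, where the identity holds term by term.\<close>

lemma sbr_leibniz:
  assumes X: "X \<in> Ser K" and Y: "Y \<in> Ser L" and Z: "Z \<in> Ser M"
  shows "sbr X (sbr Y Z) = sbr (sbr X Y) Z + sbr Y (sbr X Z)"
proof
  fix n
  note c = SerD(1)[OF X] SerD(1)[OF Y] SerD(1)[OF Z]
  define A where "A = {n - L - M..K}"
  define B where "B = {n - K - M..L}"
  have fin: "finite A" "finite B" unfolding A_def B_def by auto
  have 1: "sbr X (sbr Y Z) n = (\<Sum>i\<in>A. \<Sum>j\<in>B. b (X i) (b (Y j) (Z (n - i - j))))"
  proof -
    have "sbr X (sbr Y Z) n = (\<Sum>i\<in>A. b (X i) (sbr Y Z (n - i)))"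
      by (rule sbr_eq[OF X sbr_Ser[OF Y Z] fin(1)]) (simp add: A_def)
    also have "\<dots> = (\<Sum>i\<in>A. \<Sum>j\<in>B. b (X i) (b (Y j) (Z (n - i - j))))"
    proof (rule sum.cong[OF refl])
      fix i assume "i \<in> A"
      then have "sbr Y Z (n - i) = (\<Sum>j\<in>B. b (Y j) (Z (n - i - j)))"
        by (intro sbr_eq[OF Y Z fin(2)]) (auto simp: A_def B_def)
      moreover have "b (Y j) (Z (n - i - j)) \<in> C (n - i)" for j
        using sbr_terms(1)[OF Y Z, of j "n - i - j"] by simp
      ultimately show "b (X i) (sbr Y Z (n - i)) = (\<Sum>j\<in>B. b (X i) (b (Y j) (Z (n - i - j))))"
        using b_sum_right[OF c(1), of B _ "n - i"] by simp
    qed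
    finally show ?thesis .
  qed
  have 2: "sbr Y (sbr X Z) n = (\<Sum>j\<in>B. \<Sum>i\<in>A. b (Y j) (b (X i) (Z (n - j - i))))"
  proof -
    have "sbr Y (sbr X Z) n = (\<Sum>j\<in>B. b (Y j) (sbr X Z (n - j)))"
      by (rule sbr_eq[OF Y sbr_Ser[OF X Z] fin(2)]) (simp add: B_def)
    also have "\<dots> = (\<Sum>j\<in>B. \<Sum>i\<in>A. b (Y j) (b (X i) (Z (n - j - i))))"
    proof (rule sum.cong[OF refl])
      fix j assume "j \<in> B"
      then have "sbr X Z (n - j) = (\<Sum>i\<in>A. b (X i) (Z (n - j - i)))"
        by (intro sbr_eq[OF X Z fin(1)]) (auto simp: A_def B_def)
      moreover have "b (X i) (Z (n - j - i)) \<in> C (n - j)" for i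
        using sbr_terms(1)[OF X Z, of i "n - j - i"] by simp
      ultimately show "b (Y j) (sbr X Z (n - j)) = (\<Sum>i\<in>A. b (Y j) (b (X i) (Z (n - j - i))))"
        using b_sum_right[OF c(2), of A _ "n - j"] by simp
    qed
    finally show ?thesis .
  qed
  define D where "D = {n - M..K + L}"
  have 3: "sbr (sbr X Y) Z n = (\<Sum>i\<in>A. \<Sum>j\<in>B. b (b (X i) (Y j)) (Z (n - i - j)))"
  proof -
    have "sbr (sbr X Y) Z n = (\<Sum>m\<in>D. b (sbr X Y m) (Z (n - m)))"
      by (rule sbr_eq[OF sbr_Ser[OF X Y] Z]) (simp_all add: D_def)
    also have "\<dots> = (\<Sum>m\<in>D. \<Sum>i\<in>A. b (b (X i) (Y (m - i))) (Z (n - m)))"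
    proof (rule sum.cong[OF refl])
      fix m assume "m \<in> D"
      then have "sbr X Y m = (\<Sum>i\<in>A. b (X i) (Y (m - i)))"
        by (intro sbr_eq[OF X Y fin(1)]) (auto simp: A_def D_def)
      moreover have "b (X i) (Y (m - i)) \<in> C m" for i
        using sbr_terms(1)[OF X Y, of i "m - i"] by simp
      ultimately show "b (sbr X Y m) (Z (n - m)) = (\<Sum>i\<in>A. b (b (X i) (Y (m - i))) (Z (n - m)))"
        using b_sum_left[OF c(3), of A _ m] by simp
    qed
    also have "\<dots> = (\<Sum>i\<in>A. \<Sum>m\<in>D. b (b (X i) (Y (m - i))) (Z (n - m)))" by (rule sum.swap)
    also have "\<dots> = (\<Sum>i\<in>A. \<Sum>j\<in>B. b (b (X i) (Y j)) (Z (n - i - j)))"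
    proof (rule sum.cong[OF refl])
      fix i assume i: "i \<in> A"
      have z: "b (b (X i) (Y j)) (Z m) = 0" if "j > L \<or> m > M" for j m
        using that sbr_terms(3)[OF X Y, of j i] SerD(2)[OF Z, of m] b_zero_left[OF c(3)] b_zero_right[OF b_C[OF c(1,2)]]
        by auto
      have "(\<Sum>m\<in>D. b (b (X i) (Y (m - i))) (Z (n - m))) = (\<Sum>m\<in>D \<inter> {m. m - i \<in> B}. b (b (X i) (Y (m - i))) (Z (n - m)))"
      proof (rule sum.mono_neutral_right)
        show "\<forall>m\<in>D - D \<inter> {m. m - i \<in> B}. b (b (X i) (Y (m - i))) (Z (n - m)) = 0"
          using i by (auto intro!: z simp: D_def B_def A_def)
      qed (auto simp: D_def)
      also have "\<dots> = (\<Sum>j\<in>B \<inter> {j. i + j \<in> D}. b (b (X i) (Y j)) (Z (n - i - j)))"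
        by (rule sum.reindex_bij_witness[where i = "\<lambda>j. i + j" and j = "\<lambda>m. m - i"])
          (auto simp: algebra_simps)
      also have "\<dots> = (\<Sum>j\<in>B. b (b (X i) (Y j)) (Z (n - i - j)))"
      proof (rule sum.mono_neutral_left)
        show "\<forall>j\<in>B - B \<inter> {j. i + j \<in> D}. b (b (X i) (Y j)) (Z (n - i - j)) = 0"
          using i by (auto intro!: z simp: D_def B_def A_def)
      qed (auto simp: fin)
      finally show "(\<Sum>m\<in>D. b (b (X i) (Y (m - i))) (Z (n - m))) = (\<Sum>j\<in>B. b (b (X i) (Y j)) (Z (n - i - j)))" .
    qed
    finally show ?thesis .
  qed
  have "(\<Sum>j\<in>B. \<Sum>i\<in>A. b (Y j) (b (X i) (Z (n - j - i)))) = (\<Sum>i\<in>A. \<Sum>j\<in>B. b (Y j) (b (X i) (Z (n - i - j))))"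
    by (subst sum.swap) (simp add: algebra_simps)
  moreover have "b (X i) (b (Y j) z) = b (b (X i) (Y j)) z + b (Y j) (b (X i) z)" if "z \<in> C k" for i j k z
    by (rule b_leibniz[OF c(1,2) that])
  then have "b (X i) (b (Y j) (Z m)) = b (b (X i) (Y j)) (Z m) + b (Y j) (b (X i) (Z m))" for i j m
    using c(3) by blast
  ultimately show "sbr X (sbr Y Z) n = (sbr (sbr X Y) Z + sbr Y (sbr X Z)) n"
    unfolding plus_fun_def 1 2 3 by (simp add: sum.distrib)
qed

section \<open>Exponentials of ad of negative series\<close>

definition expo :: "((int \<Rightarrow> 'a) \<Rightarrow> int \<Rightarrow> 'a) \<Rightarrow> (int \<Rightarrow> 'a) \<Rightarrow> int \<Rightarrow> 'a" where
  "expo T Z = (\<lambda>k. \<Sum>n | (T ^^ n) Z k \<noteq> 0. s (1 / fact n) ((T ^^ n) Z k))"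

lemma funpow_Ser: "U \<in> Ser (-1) \<Longrightarrow> Z \<in> Ser K \<Longrightarrow> (sbr U ^^ n) Z \<in> Ser (K - int n)"
proof (induction n)
  case (Suc n) then show ?case using sbr_Ser[OF Suc.prems(1) Suc.IH[OF Suc.prems]] by (simp add: algebra_simps)
qed simp

lemma funpow_zero: "U \<in> Ser (-1) \<Longrightarrow> Z \<in> Ser K \<Longrightarrow> K < k + int n \<Longrightarrow> (sbr U ^^ n) Z k = 0"
  using SerD(2)[OF funpow_Ser] by force

lemma expo_eq:
  assumes "U \<in> Ser (-1)" "Z \<in> Ser K" "K - k \<le> int N"
  shows "expo (sbr U) Z k = (\<Sum>n\<le>N. s (1 / fact n) ((sbr U ^^ n) Z k))"
  unfolding expo_def
proof (rule sum.mono_neutral_cong_left)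
  show "{n. (sbr U ^^ n) Z k \<noteq> 0} \<subseteq> {..N}"
  proof
    fix n assume "n \<in> {n. (sbr U ^^ n) Z k \<noteq> 0}"
    then have "\<not> K < k + int n" using funpow_zero[OF assms(1,2)] by blast
    then show "n \<in> {..N}" using assms(3) by simp
  qed
qed auto

lemma expo_Ser: "U \<in> Ser (-1) \<Longrightarrow> Z \<in> Ser K \<Longrightarrow> expo (sbr U) Z \<in> Ser K"
proof (rule SerI)
  fix k assume a: "U \<in> Ser (-1)" "Z \<in> Ser K"
  have "expo (sbr U) Z k = (\<Sum>n\<le>nat (K - k). s (1 / fact n) ((sbr U ^^ n) Z k))"
    by (rule expo_eq[OF a]) simp
  then show "expo (sbr U) Z k \<in> C k" using SerD(1)[OF funpow_Ser[OF a]] by (auto intro!: C_sum C_scale)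
  assume "K < k"
  then show "expo (sbr U) Z k = 0" using expo_eq[OF a, of k 0] SerD(2)[OF a(2)] by simp
qed

lemma expo_lead: "U \<in> Ser (-1) \<Longrightarrow> Z \<in> Ser K \<Longrightarrow> expo (sbr U) Z K = Z K"
  using expo_eq[of U Z K K 0] by simp

lemma funpow_add:
  assumes U: "U \<in> Ser (-1)" and Z: "Z \<in> Ser K" and W: "W \<in> Ser K"
  shows "(sbr U ^^ n) (Z + W) = (sbr U ^^ n) Z + (sbr U ^^ n) W"
proof (induction n)
  case (Suc n)
  have "(sbr U ^^ Suc n) (Z + W) = sbr U ((sbr U ^^ n) Z + (sbr U ^^ n) W)"
    using Suc by (simp only: funpow.simps o_apply)
  also have "\<dots> = sbr U ((sbr U ^^ n) Z) + sbr U ((sbr U ^^ n) W)"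
    by (rule sbr_add_right[OF U funpow_Ser[OF U Z] funpow_Ser[OF U W]])
  finally show ?case by (simp only: funpow.simps o_apply)
qed (simp only: funpow.simps id_apply)

lemma funpow_scale:
  assumes U: "U \<in> Ser (-1)" and Z: "Z \<in> Ser K"
  shows "(sbr U ^^ n) (\<lambda>k. s a (Z k)) = (\<lambda>k. s a ((sbr U ^^ n) Z k))"
proof (induction n)
  case (Suc n)
  have "(sbr U ^^ Suc n) (\<lambda>k. s a (Z k)) = sbr U (\<lambda>k. s a ((sbr U ^^ n) Z k))"
    using Suc by (simp only: funpow.simps o_apply)
  also have "\<dots> = (\<lambda>k. s a (sbr U ((sbr U ^^ n) Z) k))"
    by (rule sbr_scale_right[OF U funpow_Ser[OF U Z]])
  finally show ?case by (simp only: funpow.simps o_apply)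
qed (simp only: funpow.simps id_apply)

lemma expo_add:
  assumes "U \<in> Ser (-1)" "Z \<in> Ser K" "W \<in> Ser K"
  shows "expo (sbr U) (Z + W) = expo (sbr U) Z + expo (sbr U) W"
proof
  fix k
  note e = expo_eq[OF assms(1), where N = "nat (K - k)" and k = k]
  have "expo (sbr U) (Z + W) k = (\<Sum>n\<le>nat (K - k). s (1 / fact n) ((sbr U ^^ n) (Z + W) k))"
    by (rule e[OF Ser_add[OF assms(2,3)]]) simp
  then show "expo (sbr U) (Z + W) k = (expo (sbr U) Z + expo (sbr U) W) k"
    using e[OF assms(2)] e[OF assms(3)]
    by (simp only: funpow_add[OF assms] plus_fun_apply sum.distrib scale_right_distrib nat_0_le int_nat_eq) (simp split: if_splits)
qed

lemma expo_scale:
  assumes "U \<in> Ser (-1)" "Z \<in> Ser K"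
  shows "expo (sbr U) (\<lambda>k. s a (Z k)) = (\<lambda>k. s a (expo (sbr U) Z k))"
proof
  fix k
  note e = expo_eq[OF assms(1), where N = "nat (K - k)" and k = k]
  have "expo (sbr U) (\<lambda>k. s a (Z k)) k = (\<Sum>n\<le>nat (K - k). s (1 / fact n) ((sbr U ^^ n) (\<lambda>k. s a (Z k)) k))"
    by (rule e[OF Ser_scale[OF assms(2)]]) simp
  then show "expo (sbr U) (\<lambda>k. s a (Z k)) k = s a (expo (sbr U) Z k)"
    using e[OF assms(2)] by (simp add: funpow_scale[OF assms] scale_sum_right mult.commute)
qed

lemma sbr_zero_right: "U \<in> Ser L \<Longrightarrow> sbr U 0 = 0"
  using sbr_scale_right[of U L "\<lambda>_. 0" 0 0] by (simp add: zero_fun_def Ser_def)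

lemma expo_fixed:
  assumes "U \<in> Ser (-1)" "Z \<in> Ser K" "sbr U Z = 0"
  shows "expo (sbr U) Z = Z"
proof
  fix k
  have z: "(sbr U ^^ Suc n) Z = 0" for n
    by (induction n) (simp_all only: funpow.simps o_apply id_apply assms(3) sbr_zero_right[OF assms(1)])
  have "expo (sbr U) Z k = (\<Sum>n\<le>Suc (nat (K - k)). s (1 / fact n) ((sbr U ^^ n) Z k))"
    by (rule expo_eq[OF assms(1,2)]) simp
  also have "\<dots> = Z k" unfolding sum.atMost_Suc_shift z zero_fun_def by simp
  finally show "expo (sbr U) Z k = Z k" .
qed

text \<open>The number of terms relevant to \<open>expo\<close> grows as the degree decreases. Here
  the cutoff is the same in all degrees, so the sum can be pulled out of brackets and powers; in
  degrees at least \<open>K - N\<close> it agrees with \<open>expo\<close>.\<close>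

definition pexpo :: "nat \<Rightarrow> (int \<Rightarrow> 'a) \<Rightarrow> (int \<Rightarrow> 'a) \<Rightarrow> int \<Rightarrow> 'a" where
  "pexpo N U Z = (\<lambda>k. \<Sum>n\<le>N. s (1 / fact n) ((sbr U ^^ n) Z k))"

lemma pexpo_Ser: "U \<in> Ser (-1) \<Longrightarrow> Z \<in> Ser K \<Longrightarrow> pexpo N U Z \<in> Ser K"
  unfolding pexpo_def using funpow_Ser
  by (intro SerI) (auto intro!: C_sum C_scale sum.neutral dest: SerD simp: SerD(1)[OF funpow_Ser] funpow_zero)

lemma expo_pexpo: "U \<in> Ser (-1) \<Longrightarrow> Z \<in> Ser K \<Longrightarrow> K - k \<le> int N \<Longrightarrow> expo (sbr U) Z k = pexpo N U Z k"
  unfolding pexpo_def by (rule expo_eq)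

lemma sbr_sum_left:
  assumes "\<And>i. i \<in> S \<Longrightarrow> F i \<in> Ser K" "W \<in> Ser L"
  shows "sbr (\<lambda>k. \<Sum>i\<in>S. s (a i) (F i k)) W n = (\<Sum>i\<in>S. s (a i) (sbr (F i) W n))"
proof -
  let ?A = "{n - L..K}"
  have F: "(\<lambda>k. \<Sum>i\<in>S. s (a i) (F i k)) \<in> Ser K"
    by (intro SerI) (auto intro!: C_sum C_scale sum.neutral simp: SerD[OF assms(1)])
  have "b (\<Sum>i\<in>S. s (a i) (F i k)) (W m) = (\<Sum>i\<in>S. s (a i) (b (F i k) (W m)))" for k m
  proof -
    have "b (\<Sum>i\<in>S. s (a i) (F i k)) (W m) = (\<Sum>i\<in>S. b (s (a i) (F i k)) (W m))"
      using assms by (intro b_sum_left[where k = k]) (auto intro: C_scale dest: SerD)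
    also have "\<dots> = (\<Sum>i\<in>S. s (a i) (b (F i k) (W m)))"
      using assms by (intro sum.cong refl b_scale_left[where k = k and m = m]) (auto dest: SerD)
    finally show ?thesis .
  qed
  then have "sbr (\<lambda>k. \<Sum>i\<in>S. s (a i) (F i k)) W n = (\<Sum>k\<in>?A. \<Sum>i\<in>S. s (a i) (b (F i k) (W (n - k))))"
    using sbr_eq[OF F assms(2), of ?A n] by simp
  also have "\<dots> = (\<Sum>i\<in>S. \<Sum>k\<in>?A. s (a i) (b (F i k) (W (n - k))))" by (rule sum.swap)
  also have "\<dots> = (\<Sum>i\<in>S. s (a i) (sbr (F i) W n))"
    using sbr_eq[OF assms(1) assms(2), of _ ?A n] by (intro sum.cong) (auto simp: scale_sum_right)
  finally show ?thesis .
qed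

lemma sbr_sum_right:
  assumes "\<And>i. i \<in> S \<Longrightarrow> F i \<in> Ser L" "W \<in> Ser K"
  shows "sbr W (\<lambda>k. \<Sum>i\<in>S. s (a i) (F i k)) n = (\<Sum>i\<in>S. s (a i) (sbr W (F i) n))"
proof -
  let ?A = "{n - L..K}"
  have F: "(\<lambda>k. \<Sum>i\<in>S. s (a i) (F i k)) \<in> Ser L"
    by (intro SerI) (auto intro!: C_sum C_scale sum.neutral simp: SerD[OF assms(1)])
  have "b (W m) (\<Sum>i\<in>S. s (a i) (F i k)) = (\<Sum>i\<in>S. s (a i) (b (W m) (F i k)))" for k m
  proof -
    have "b (W m) (\<Sum>i\<in>S. s (a i) (F i k)) = (\<Sum>i\<in>S. b (W m) (s (a i) (F i k)))"
      using assms by (intro b_sum_right[where k = m and m = k]) (auto intro: C_scale dest: SerD)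
    also have "\<dots> = (\<Sum>i\<in>S. s (a i) (b (W m) (F i k)))"
      using assms by (intro sum.cong refl b_scale_right[where k = m and m = k]) (auto dest: SerD)
    finally show ?thesis .
  qed
  then have "sbr W (\<lambda>k. \<Sum>i\<in>S. s (a i) (F i k)) n = (\<Sum>k\<in>?A. \<Sum>i\<in>S. s (a i) (b (W k) (F i (n - k))))"
    using sbr_eq[OF assms(2) F, of ?A n] by simp
  also have "\<dots> = (\<Sum>i\<in>S. \<Sum>k\<in>?A. s (a i) (b (W k) (F i (n - k))))" by (rule sum.swap)
  also have "\<dots> = (\<Sum>i\<in>S. s (a i) (sbr W (F i) n))"
    using sbr_eq[OF assms(2) assms(1), of _ ?A n] by (intro sum.cong) (auto simp: scale_sum_right)
  finally show ?thesis .
qed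

lemma funpow_sbr:
  assumes U: "U \<in> Ser (-1)" and Z: "Z \<in> Ser K" and W: "W \<in> Ser L"
  shows "(sbr U ^^ n) (sbr Z W) k =
    (\<Sum>i\<le>n. s (of_nat (n choose i)) (sbr ((sbr U ^^ i) Z) ((sbr U ^^ (n - i)) W) k))"
proof (induction n arbitrary: k)
  case 0 then show ?case by simp
next
  case (Suc n)
  let ?Z = "\<lambda>i. (sbr U ^^ i) Z" and ?W = "\<lambda>i. (sbr U ^^ i) W"
  have Zi: "?Z i \<in> Ser K" for i using funpow_Ser[OF U Z, of i] Ser_mono by fastforce
  have Wi: "?W i \<in> Ser L" for i using funpow_Ser[OF U W, of i] Ser_mono by fastforce
  have e: "(sbr U ^^ n) (sbr Z W) = (\<lambda>k. \<Sum>i\<in>{..n}. s (of_nat (n choose i)) (sbr (?Z i) (?W (n - i)) k))"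
    using Suc by blast
  have "(sbr U ^^ Suc n) (sbr Z W) k = sbr U ((sbr U ^^ n) (sbr Z W)) k" by simp
  also have "\<dots> = (\<Sum>i\<le>n. s (of_nat (n choose i)) (sbr U (sbr (?Z i) (?W (n - i))) k))"
    unfolding e by (rule sbr_sum_right[OF sbr_Ser[OF Zi Wi] U])
  also have "\<dots> = (\<Sum>i\<le>n. s (of_nat (n choose i)) (sbr (?Z (Suc i)) (?W (n - i)) k)) +
      (\<Sum>i\<le>n. s (of_nat (n choose i)) (sbr (?Z i) (?W (Suc n - i)) k))"
    by (simp add: sbr_leibniz[OF U Zi Wi] scale_right_distrib sum.distrib Suc_diff_le)
  also have "(\<Sum>i\<le>n. s (of_nat (n choose i)) (sbr (?Z i) (?W (Suc n - i)) k)) =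
      (\<Sum>i\<le>Suc n. s (of_nat (n choose i)) (sbr (?Z i) (?W (Suc n - i)) k))" by simp
  also have "\<dots> = sbr (?Z 0) (?W (Suc n)) k +
      (\<Sum>i\<le>n. s (of_nat (n choose Suc i)) (sbr (?Z (Suc i)) (?W (n - i)) k))"
    unfolding sum.atMost_Suc_shift by simp
  also have "(\<Sum>i\<le>n. s (of_nat (n choose i)) (sbr (?Z (Suc i)) (?W (n - i)) k)) +
      (sbr (?Z 0) (?W (Suc n)) k + (\<Sum>i\<le>n. s (of_nat (n choose Suc i)) (sbr (?Z (Suc i)) (?W (n - i)) k))) =
      sbr (?Z 0) (?W (Suc n)) k + (\<Sum>i\<le>n. s (of_nat (Suc n choose Suc i)) (sbr (?Z (Suc i)) (?W (n - i)) k))"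
    by (simp add: scale_left_distrib sum.distrib)
  also have "\<dots> = (\<Sum>i\<le>Suc n. s (of_nat (Suc n choose i)) (sbr (?Z i) (?W (Suc n - i)) k))"
    unfolding sum.atMost_Suc_shift by simp
  finally show ?case .
qed

lemma sum_square_triangle:
  fixes F :: "nat \<Rightarrow> nat \<Rightarrow> 'a"
  assumes "\<And>i j. N < i + j \<Longrightarrow> F i j = 0"
  shows "(\<Sum>i\<le>N. \<Sum>j\<le>N. F i j) = (\<Sum>n\<le>N. \<Sum>i\<le>n. F i (n - i))"
proof -
  have "(\<Sum>n\<le>N. \<Sum>i\<le>n. F i (n - i)) = (\<Sum>(i, j)\<in>{(i, j). i + j \<le> N}. F i j)"
    by (rule sum.triangle_reindex_eq[symmetric])
  also have "\<dots> = (\<Sum>(i, j)\<in>{..N} \<times> {..N}. F i j)"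
    by (rule sum.mono_neutral_left) (auto intro: assms)
  finally show ?thesis by (simp add: sum.cartesian_product)
qed

text \<open>The Leibniz formula gives a triangular sum, the product of two truncated exponentials a
  square one. They agree because a bracket with more than \<open>N\<close> factors of ad
  \<open>U\<close> altogether starts below degree \<open>k\<close>.\<close>

lemma expo_sbr:
  assumes U: "U \<in> Ser (-1)" and Z: "Z \<in> Ser K" and W: "W \<in> Ser L"
  shows "expo (sbr U) (sbr Z W) = sbr (expo (sbr U) Z) (expo (sbr U) W)"
proof
  fix k
  define N where "N = nat (K + L - k)"
  let ?Z = "\<lambda>i. (sbr U ^^ i) Z" and ?W = "\<lambda>i. (sbr U ^^ i) W"
  have Zi: "?Z i \<in> Ser K" for i using funpow_Ser[OF U Z, of i] Ser_mono by fastforce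
  have Wi: "?W i \<in> Ser L" for i using funpow_Ser[OF U W, of i] Ser_mono by fastforce
  define F where "F i j = s (1 / (fact i * fact j)) (sbr (?Z i) (?W j) k)" for i j
  have F0: "F i j = 0" if "N < i + j" for i j
  proof -
    have "sbr (?Z i) (?W j) \<in> Ser ((K - int i) + (L - int j))"
      by (rule sbr_Ser[OF funpow_Ser[OF U Z] funpow_Ser[OF U W]])
    moreover have "(K - int i) + (L - int j) < k" using that unfolding N_def by linarith
    ultimately show ?thesis unfolding F_def using SerD(2) by fastforce
  qed
  have "expo (sbr U) (sbr Z W) k = (\<Sum>n\<le>N. s (1 / fact n) ((sbr U ^^ n) (sbr Z W) k))"
    by (rule expo_eq[OF U sbr_Ser[OF Z W]]) (simp add: N_def)
  also have "\<dots> = (\<Sum>n\<le>N. \<Sum>i\<le>n. F i (n - i))"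
    unfolding funpow_sbr[OF U Z W] F_def scale_sum_right
    by (intro sum.cong refl) (simp add: binomial_fact)
  also have "\<dots> = (\<Sum>i\<le>N. \<Sum>j\<le>N. F i j)" using sum_square_triangle[of N F] F0 by simp
  also have "\<dots> = sbr (pexpo N U Z) (pexpo N U W) k"
    unfolding pexpo_def sbr_sum_left[of "{..N}" ?Z K _ L, OF Zi pexpo_Ser[OF U W, of N, unfolded pexpo_def]]
      sbr_sum_right[of "{..N}" ?W L _ K, OF Wi Zi] F_def
    by (simp add: scale_sum_right mult.commute)
  also have "\<dots> = sbr (expo (sbr U) Z) (expo (sbr U) W) k"
  proof -
    have "sbr (pexpo N U Z) (pexpo N U W) k = (\<Sum>m\<in>{k - L..K}. b (pexpo N U Z m) (pexpo N U W (k - m)))"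
      by (rule sbr_eq[OF pexpo_Ser[OF U Z] pexpo_Ser[OF U W]]) auto
    also have "\<dots> = (\<Sum>m\<in>{k - L..K}. b (expo (sbr U) Z m) (expo (sbr U) W (k - m)))"
      by (intro sum.cong refl arg_cong2[where f = b] expo_pexpo[OF U Z, symmetric]
          expo_pexpo[OF U W, symmetric]) (auto simp: N_def)
    also have "\<dots> = sbr (expo (sbr U) Z) (expo (sbr U) W) k"
      by (rule sbr_eq[OF expo_Ser[OF U Z] expo_Ser[OF U W], symmetric]) auto
    finally show ?thesis .
  qed
  finally show "expo (sbr U) (sbr Z W) k = sbr (expo (sbr U) Z) (expo (sbr U) W) k" .
qed

text \<open>A negative \<open>U\<close> carries information downwards only, so components in degrees
  at least \<open>k\<close> depend on nothing below \<open>k\<close>. This permits replacing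
  \<open>expo\<close> by \<open>pexpo\<close> under further powers.\<close>

lemma funpow_agree:
  assumes U: "U \<in> Ser (-1)" and Z: "Z \<in> Ser K" and W: "W \<in> Ser K" and "\<And>m. k \<le> m \<Longrightarrow> Z m = W m"
  shows "k \<le> m \<Longrightarrow> (sbr U ^^ n) Z m = (sbr U ^^ n) W m"
proof (induction n arbitrary: m)
  case 0 then show ?case using assms(4) by simp
next
  case (Suc n)
  have A: "{m - (K - int n)..- 1} \<subseteq> {m - K..-1}" by auto
  have "(sbr U ^^ Suc n) Z m = (\<Sum>i\<in>{m - K..-1}. b (U i) ((sbr U ^^ n) Z (m - i)))"
    using sbr_eq[OF U funpow_Ser[OF U Z, of n] _ A] by simp
  also have "\<dots> = (\<Sum>i\<in>{m - K..-1}. b (U i) ((sbr U ^^ n) W (m - i)))"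
    using Suc.IH Suc.prems by (intro sum.cong) auto
  also have "\<dots> = (sbr U ^^ Suc n) W m"
    using sbr_eq[OF U funpow_Ser[OF U W, of n] _ A] by simp
  finally show ?case .
qed

lemma funpow_uminus:
  assumes U: "U \<in> Ser (-1)" and Z: "Z \<in> Ser K"
  shows "((\<lambda>Z. - sbr U Z) ^^ n) Z = (\<lambda>k. s ((-1) ^ n) ((sbr U ^^ n) Z k))"
    "(sbr (- U) ^^ n) Z = (\<lambda>k. s ((-1) ^ n) ((sbr U ^^ n) Z k))"
proof -
  have m: "sbr (- U) W = - sbr U W" if "W \<in> Ser L" for W L
    using sbr_scale_left[OF U that, of "-1"] by (simp add: fun_Compl_def)
  show 1: "((\<lambda>Z. - sbr U Z) ^^ n) Z = (\<lambda>k. s ((-1) ^ n) ((sbr U ^^ n) Z k))"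
  proof (induction n)
    case (Suc n)
    then show ?case using sbr_scale_right[OF U funpow_Ser[OF U Z, of n], of "(-1) ^ n"]
      by (simp add: fun_Compl_def)
  qed simp
  show "(sbr (- U) ^^ n) Z = (\<lambda>k. s ((-1) ^ n) ((sbr U ^^ n) Z k))"
  proof (induction n)
    case (Suc n)
    then show ?case using sbr_scale_right[OF U funpow_Ser[OF U Z, of n], of "(-1) ^ n"]
        m[OF Ser_scale[OF funpow_Ser[OF U Z, of n]], of "(-1) ^ n"]
      by (simp add: fun_Compl_def)
  qed simp
qed

lemma expo_uminus: "U \<in> Ser (-1) \<Longrightarrow> Z \<in> Ser K \<Longrightarrow> expo (\<lambda>Z. - sbr U Z) Z = expo (sbr (- U)) Z"
  unfolding expo_def by (simp add: funpow_uminus)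

lemma expo_inverse:
  assumes U: "U \<in> Ser (-1)" and Z: "Z \<in> Ser K"
  shows "expo (sbr (- U)) (expo (sbr U) Z) = Z"
proof
  fix k
  define N where "N = nat (K - k)"
  let ?Z = "\<lambda>i. (sbr U ^^ i) Z"
  have Zi: "?Z i \<in> Ser K" for i using funpow_Ser[OF U Z, of i] Ser_mono by fastforce
  define F where "F i j = s ((-1) ^ i / (fact i * fact j)) (?Z (i + j) k)" for i j
  have pw: "(sbr U ^^ i) (pexpo M U Z) = (\<lambda>k. \<Sum>j\<in>{..M}. s (1 / fact j) (?Z (i + j) k))" for i M
  proof (induction i)
    case 0 then show ?case by (simp add: pexpo_def)
  next
    case (Suc i)
    have "(sbr U ^^ Suc i) (pexpo M U Z) = sbr U (\<lambda>k. \<Sum>j\<in>{..M}. s (1 / fact j) (?Z (i + j) k))"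
      using Suc by simp
    then show ?case using sbr_sum_right[of "{..M}" "\<lambda>j. ?Z (i + j)" K, OF Zi U] by auto
  qed
  have "expo (sbr (- U)) (expo (sbr U) Z) k =
      (\<Sum>i\<le>N. s (1 / fact i) ((sbr (- U) ^^ i) (expo (sbr U) Z) k))"
    by (rule expo_eq[OF Ser_minus[OF U] expo_Ser[OF U Z]]) (simp add: N_def)
  also have "\<dots> = (\<Sum>i\<le>N. s ((-1) ^ i / fact i) ((sbr U ^^ i) (expo (sbr U) Z) k))"
    unfolding funpow_uminus(2)[OF U expo_Ser[OF U Z]] by simp
  also have "\<dots> = (\<Sum>i\<le>N. s ((-1) ^ i / fact i) ((sbr U ^^ i) (pexpo N U Z) k))"
  proof (intro sum.cong refl arg_cong[of _ _ "s _"] funpow_agree[OF U expo_Ser[OF U Z] pexpo_Ser[OF U Z]])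
    fix m assume "k \<le> m"
    then show "expo (sbr U) Z m = pexpo N U Z m" by (intro expo_pexpo[OF U Z]) (simp add: N_def)
  qed auto
  also have "\<dots> = (\<Sum>i\<le>N. \<Sum>j\<le>N. F i j)"
    unfolding pw F_def by (simp add: scale_sum_right)
  also have "\<dots> = (\<Sum>n\<le>N. \<Sum>i\<le>n. F i (n - i))"
  proof (rule sum_square_triangle)
    fix i j assume "N < i + j"
    then show "F i j = 0" unfolding F_def using funpow_zero[OF U Z, of k "i + j"] by (simp add: N_def)
  qed
  \<comment> \<open>Collecting by total power leaves the alternating sums of binomial coefficients,
    which vanish except for \<open>n = 0\<close>.\<close>
  also have "\<dots> = (\<Sum>n\<le>N. s (1 / fact n * (\<Sum>i\<le>n. (-1) ^ i * of_nat (n choose i))) (?Z n k))"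
    unfolding F_def sum_distrib_left scale_sum_left
    by (intro sum.cong refl) (auto simp: binomial_fact)
  also have "\<dots> = (\<Sum>n\<le>N. if n = 0 then Z k else 0)"
    by (intro sum.cong refl) (auto simp: choose_alternating_sum)
  also have "\<dots> = Z k" by simp
  finally show "expo (sbr (- U)) (expo (sbr U) Z) k = Z k" .
qed

text \<open>A change of \<open>U\<close> in degree \<open>- n\<close> uses up \<open>n\<close>
  degrees once, and each of the \<open>m\<close> further factors lowers the degree by at least one
  more.\<close>

lemma funpow_update:
  assumes U: "U \<in> Ser (-1)" and U': "U' \<in> Ser (-1)" and Z: "Z \<in> Ser K"
    and eq: "\<And>k. - int n < k \<Longrightarrow> U k = U' k"
  shows "K - int n - int m < k \<Longrightarrow> (sbr U ^^ Suc m) Z k = (sbr U' ^^ Suc m) Z k"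
proof (induction m arbitrary: k)
  case 0
  have "sbr U Z k = (\<Sum>i\<in>{k - K..-1}. b (U i) (Z (k - i)))" by (rule sbr_eq[OF U Z]) auto
  also have "\<dots> = (\<Sum>i\<in>{k - K..-1}. b (U' i) (Z (k - i)))"
    using 0 eq by (intro sum.cong) auto
  also have "\<dots> = sbr U' Z k" by (rule sbr_eq[OF U' Z, symmetric]) auto
  finally show ?case by simp
next
  case (Suc m)
  let ?A = "{k - (K - int (Suc m))..-1}"
  have "sbr U ((sbr U ^^ Suc m) Z) k = (\<Sum>i\<in>?A. b (U i) ((sbr U ^^ Suc m) Z (k - i)))"
    by (rule sbr_eq[OF U funpow_Ser[OF U Z]]) auto
  also have "\<dots> = (\<Sum>i\<in>?A. b (U' i) ((sbr U' ^^ Suc m) Z (k - i)))"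
  proof (rule sum.cong[OF refl])
    fix i assume "i \<in> ?A"
    then have "U i = U' i" "(sbr U ^^ Suc m) Z (k - i) = (sbr U' ^^ Suc m) Z (k - i)"
      using Suc.prems by (auto intro!: eq Suc.IH simp del: funpow.simps)
    then show "b (U i) ((sbr U ^^ Suc m) Z (k - i)) = b (U' i) ((sbr U' ^^ Suc m) Z (k - i))" by simp
  qed
  also have "\<dots> = sbr U' ((sbr U' ^^ Suc m) Z) k"
    by (rule sbr_eq[OF U' funpow_Ser[OF U' Z], symmetric]) auto
  finally show ?case by (simp only: funpow.simps o_apply)
qed

text \<open>The linearization behind every construction by degrees: a change of \<open>U\<close> in
  degree \<open>- n\<close> is first felt in degree \<open>K - n\<close>, and there only through the
  linear term of the exponential. Hence each new component is subject to a linear equation.\<close>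

lemma expo_update:
  assumes U: "U \<in> Ser (-1)" and U': "U' \<in> Ser (-1)" and Z: "Z \<in> Ser K" and n: "1 \<le> n"
    and eq: "\<And>k. - int n < k \<Longrightarrow> U k = U' k"
  shows "K - int n < k \<Longrightarrow> expo (sbr U) Z k = expo (sbr U') Z k"
    "expo (sbr U) Z (K - int n) - expo (sbr U') Z (K - int n) = b (U (- int n) - U' (- int n)) (Z K)"
proof -
  let ?t = "\<lambda>U j k. s (1 / fact j) ((sbr U ^^ j) Z k)"
  have e: "expo (sbr U) Z k = ?t U 0 k + ?t U 1 k + (\<Sum>j\<in>{2..nat (K - k) + 1}. ?t U j k)"
    if "U \<in> Ser (-1)" for U k
  proof -
    have "expo (sbr U) Z k = (\<Sum>j\<le>nat (K - k) + 1. ?t U j k)" by (rule expo_eq[OF that Z]) simp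
    also have "{..nat (K - k) + 1} = {0, 1} \<union> {2..nat (K - k) + 1}" by auto
    finally show ?thesis by (simp add: sum.union_disjoint add.assoc)
  qed
  have t: "?t U j k = ?t U' j k" if "2 \<le> j" "K - int n \<le> k" for j k
  proof -
    obtain m where j: "j = Suc m" "1 \<le> m" using \<open>2 \<le> j\<close> by (cases j) auto
    show ?thesis unfolding j(1) using funpow_update[OF U U' Z eq, where m = m and k = k] j(2) that(2) by simp
  qed
  show "expo (sbr U) Z k = expo (sbr U') Z k" if "K - int n < k"
    unfolding e[OF U] e[OF U'] using t[of _ k] funpow_update[OF U U' Z eq, where m = 0 and k = k] that by simp
  let ?k = "K - int n"
  have "{?k - K..-1} = insert (- int n) {- int n + 1..-1}" using n by auto
  then have s: "sbr V Z ?k = b (V (- int n)) (Z K) + (\<Sum>i\<in>{- int n + 1..-1}. b (V i) (Z (?k - i)))"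
    if "V \<in> Ser (-1)" for V
    using sbr_eq[OF that Z, of "{?k - K..-1}" ?k] by simp
  have "expo (sbr U) Z ?k - expo (sbr U') Z ?k = sbr U Z ?k - sbr U' Z ?k"
    unfolding e[OF U] e[OF U'] using t[of _ ?k] by simp
  also have "\<dots> = b (U (- int n)) (Z K) - b (U' (- int n)) (Z K)"
    unfolding s[OF U] s[OF U'] using eq by simp
  also have "\<dots> = b (U (- int n) - U' (- int n)) (Z K)"
    by (rule b_diff_left[symmetric, OF SerD(1)[OF U] SerD(1)[OF U'] SerD(1)[OF Z]])
  finally show "expo (sbr U) Z ?k - expo (sbr U') Z ?k = b (U (- int n) - U' (- int n)) (Z K)" .
qed

section \<open>Constructing a negative series degree by degree\<close>

primrec rec_prefix :: "(nat \<Rightarrow> (int \<Rightarrow> 'a) \<Rightarrow> 'a) \<Rightarrow> nat \<Rightarrow> int \<Rightarrow> 'a" where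
  "rec_prefix F 0 = (\<lambda>_. 0)"
| "rec_prefix F (Suc n) = (rec_prefix F n)(- int (Suc n) := F (Suc n) (rec_prefix F n))"

text \<open>The prefix with index \<open>n\<close> knows the components in degrees
  \<open>- n\<close> to \<open>-1\<close>, and later steps do not alter them.\<close>

definition rec_ser :: "(nat \<Rightarrow> (int \<Rightarrow> 'a) \<Rightarrow> 'a) \<Rightarrow> int \<Rightarrow> 'a" where
  "rec_ser F k = rec_prefix F (nat (- k)) k"

lemma rec_prefix_outside: "k < - int n \<or> 0 \<le> k \<Longrightarrow> rec_prefix F n k = 0"
  by (induction n) auto

lemma rec_prefix_inside: "- int n \<le> k \<Longrightarrow> rec_prefix F n k = rec_ser F k"
proof (induction n)
  case 0 then show ?case unfolding rec_ser_def by simp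
next
  case (Suc n)
  show ?case
  proof (cases "k = - int (Suc n)")
    case True then show ?thesis unfolding rec_ser_def by (simp add: nat_add_distrib)
  next
    case False then show ?thesis using Suc by simp
  qed
qed

lemma rec_ser_step: "rec_ser F (- int (Suc n)) = F (Suc n) (rec_prefix F n)"
  using rec_prefix_inside[of "Suc n" "- int (Suc n)" F] by simp

lemma rec_ser_nonneg: "0 \<le> k \<Longrightarrow> rec_ser F k = 0"
  unfolding rec_ser_def using rec_prefix_outside by blast

lemma rec_prefix_Ser:
  assumes "\<And>n V. V \<in> Ser (-1) \<Longrightarrow> F (Suc n) V \<in> C (- int (Suc n))"
  shows "rec_prefix F n \<in> Ser (-1)"
proof (induction n)
  case 0 then show ?case by (simp add: Ser_def)
next
  case (Suc n)
  show ?case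
    by (rule SerI) (use assms[OF Suc, of n] SerD[OF Suc] in auto)
qed

lemma rec_ser_Ser:
  assumes "\<And>n V. V \<in> Ser (-1) \<Longrightarrow> F (Suc n) V \<in> C (- int (Suc n))"
  shows "rec_ser F \<in> Ser (-1)"
  using SerD(1)[OF rec_prefix_Ser[OF assms]] rec_ser_nonneg unfolding rec_ser_def
  by (intro SerI) (auto simp: rec_ser_def rec_prefix_outside)

section \<open>Unipotent automorphisms are exponentials\<close>

definition unipotent :: "((int \<Rightarrow> 'a) \<Rightarrow> int \<Rightarrow> 'a) \<Rightarrow> bool" where
  "unipotent \<sigma> \<longleftrightarrow> (\<forall>K. \<forall>Z\<in>Ser K. \<sigma> Z \<in> Ser K \<and> \<sigma> Z K = Z K) \<and>
     (\<forall>K. \<forall>Z\<in>Ser K. \<forall>W\<in>Ser K. \<sigma> (Z + W) = \<sigma> Z + \<sigma> W) \<and>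
     (\<forall>K. \<forall>Z\<in>Ser K. \<forall>a. \<sigma> (\<lambda>k. s a (Z k)) = (\<lambda>k. s a (\<sigma> Z k))) \<and>
     (\<forall>K L. \<forall>Z\<in>Ser K. \<forall>W\<in>Ser L. \<sigma> (sbr Z W) = sbr (\<sigma> Z) (\<sigma> W))"

lemma unipotentD:
  assumes "unipotent \<sigma>" "Z \<in> Ser K"
  shows "\<sigma> Z \<in> Ser K" "\<sigma> Z K = Z K" "W \<in> Ser K \<Longrightarrow> \<sigma> (Z + W) = \<sigma> Z + \<sigma> W"
    "\<sigma> (\<lambda>k. s a (Z k)) = (\<lambda>k. s a (\<sigma> Z k))" "W \<in> Ser L \<Longrightarrow> \<sigma> (sbr Z W) = sbr (\<sigma> Z) (\<sigma> W)"
  using assms unfolding unipotent_def by metis+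

lemma unipotent_expo: "U \<in> Ser (-1) \<Longrightarrow> unipotent (expo (sbr U))"
  unfolding unipotent_def using expo_Ser expo_lead expo_add expo_scale expo_sbr by blast

lemma unipotent_compose:
  assumes "unipotent \<sigma>" "unipotent \<tau>" shows "unipotent (\<lambda>Z. \<sigma> (\<tau> Z))"
  unfolding unipotent_def
proof (intro conjI allI ballI)
  fix K Z assume Z: "Z \<in> Ser K"
  note t = unipotentD[OF assms(2) Z] and st = unipotentD[OF assms(1) unipotentD(1)[OF assms(2) Z]]
  show "\<sigma> (\<tau> Z) \<in> Ser K" "\<sigma> (\<tau> Z) K = Z K" "\<sigma> (\<tau> (\<lambda>k. s a (Z k))) = (\<lambda>k. s a (\<sigma> (\<tau> Z) k))" for a
    using t st by simp_all
  show "\<sigma> (\<tau> (Z + W)) = \<sigma> (\<tau> Z) + \<sigma> (\<tau> W)" if "W \<in> Ser K" for W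
    using t(3)[OF that] st(3)[OF unipotentD(1)[OF assms(2) that]] by simp
  show "\<sigma> (\<tau> (sbr Z W)) = sbr (\<sigma> (\<tau> Z)) (\<sigma> (\<tau> W))" if "W \<in> Ser L" for W L
    using t(5)[OF that] st(5)[OF unipotentD(1)[OF assms(2) that]] by simp
qed

end

locale graded_lie_derivation = graded_lie +
  fixes D :: 'a
  assumes D_C: "D \<in> C 0" and b_D: "x \<in> C k \<Longrightarrow> b D x = s (of_int k) x"
    and b_D_right: "x \<in> C k \<Longrightarrow> b x D = s (- of_int k) x"
begin

definition Dser :: "int \<Rightarrow> 'a" where "Dser = (\<lambda>k. if k = 0 then D else 0)"

lemma Dser_Ser: "Dser \<in> Ser 0" unfolding Dser_def Ser_def using D_C by auto

lemma sbr_Dser: "Z \<in> Ser K \<Longrightarrow> sbr Dser Z = (\<lambda>k. s (of_int k) (Z k))"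
proof
  fix k assume Z: "Z \<in> Ser K"
  have z: "b (Dser i) (Z (k - i)) = (if i = 0 then s (of_int k) (Z k) else 0)" for i
    using b_zero_left[OF SerD(1)[OF Z]] b_D[OF SerD(1)[OF Z]] unfolding Dser_def by simp
  show "sbr Dser Z k = s (of_int k) (Z k)" unfolding sbr_Sum_any z by simp
qed

text \<open>The series \<open>Y\<close>, the bracket of \<open>Dser\<close> with \<open>Z\<close>
  minus \<open>K\<close> times \<open>Z\<close>, has lost its top component, so the induction
  applies to it. Comparing components of \<open>Y\<close> and its image, the factor
  \<open>k - K\<close> can be cancelled below the top degree.\<close>

lemma unipotent_fixing_derivation:
  assumes u: "unipotent \<tau>" and D: "\<tau> Dser = Dser" and "Z \<in> Ser K"
  shows "\<tau> Z = Z"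
proof -
  have claim: "K - int n < k \<Longrightarrow> Z \<in> Ser K \<Longrightarrow> \<tau> Z k = Z k" for n K k Z
  proof (induction n arbitrary: K Z)
    case 0
    then show ?case using SerD(2)[OF unipotentD(1)[OF u 0(2)]] SerD(2)[OF 0(2)] by simp
  next
    case (Suc n)
    show ?case
    proof (cases "k = K")
      case True then show ?thesis using unipotentD(2)[OF u Suc.prems(2)] by simp
    next
      case False
      define Y where "Y = sbr Dser Z + (\<lambda>k. s (- of_int K) (Z k))"
      have DZ: "sbr Dser Z \<in> Ser K" using sbr_Ser[OF Dser_Ser Suc.prems(2)] by simp
      have Yk: "Y = (\<lambda>k. s (of_int (k - K)) (Z k))"
        unfolding Y_def sbr_Dser[OF Suc.prems(2)] by (auto simp: scale_left_diff_distrib)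
      have "Y \<in> Ser (K - 1)"
      proof (rule SerI)
        show "Y j \<in> C j" for j unfolding Yk using C_scale[OF SerD(1)[OF Suc.prems(2)]] .
        show "Y j = 0" if "K - 1 < j" for j
          unfolding Yk using SerD(2)[OF Suc.prems(2), of j] that by (cases "j = K") auto
      qed
      then have a: "\<tau> Y k = Y k" using Suc.IH[of "K - 1" Y] Suc.prems(1) by simp
      have "\<tau> Y = sbr Dser (\<tau> Z) + (\<lambda>k. s (- of_int K) (\<tau> Z k))"
        unfolding Y_def unipotentD(3)[OF u DZ Ser_scale[OF Suc.prems(2)]] unipotentD(5)[OF u Dser_Ser Suc.prems(2)]
          unipotentD(4)[OF u Suc.prems(2)] D ..
      then have c: "\<tau> Y k = s (of_int (k - K)) (\<tau> Z k)"
        unfolding sbr_Dser[OF unipotentD(1)[OF u Suc.prems(2)]] by (simp add: scale_left_diff_distrib)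
      have "s (of_int (k - K)) (\<tau> Z k) = s (of_int (k - K)) (Z k)"
        using c[symmetric] a by (simp only: Yk)
      moreover have "complex_of_int (k - K) \<noteq> 0" using False by simp
      ultimately show ?thesis by (rule scale_left_imp_eq[rotated])
    qed
  qed
  show ?thesis
  proof
    fix k show "\<tau> Z k = Z k" using claim[of K "nat (K - k) + 1" k Z] assms(3) by simp
  qed
qed

text \<open>
  This replaces the Baker--Campbell--Hausdorff formula: since the degree derivation is inner, a
  unipotent automorphism is determined by its value on \<open>D\<close>, and every value is attained by an
  exponential.
\<close>

lemma unipotent_eq_expo:
  assumes u: "unipotent \<sigma>"
  shows "\<exists>U\<in>Ser (-1). \<forall>K. \<forall>Z\<in>Ser K. expo (sbr U) Z = \<sigma> Z"
proof -
  define S where "S = \<sigma> Dser"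
  have S: "S \<in> Ser 0" "S 0 = D" using unipotentD(1,2)[OF u Dser_Ser] unfolding S_def Dser_def by auto
  \<comment> \<open>By \<open>expo_update\<close> the new component is bracketed with
    \<open>D\<close>, and for an element of degree \<open>- n\<close> this bracket is multiplication
    by \<open>n\<close>. Dividing the remaining error by \<open>n\<close> therefore removes
    it.\<close>
  define F where "F n V = s (1 / of_nat n) (S (- int n) - expo (sbr V) Dser (- int n))" for n V
  have FC: "F (Suc n) V \<in> C (- int (Suc n))" if "V \<in> Ser (-1)" for n V
    unfolding F_def by (intro C_scale C_diff SerD(1)[OF S(1)] SerD(1)[OF expo_Ser[OF that Dser_Ser]])
  define U where "U = rec_ser F"
  have U: "U \<in> Ser (-1)" unfolding U_def by (rule rec_ser_Ser[OF FC])
  have "expo (sbr U) Dser = S"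
  proof
    fix k :: int
    consider "k > 0" | "k = 0" | n where "k = - int (Suc n)"
      by (metis neg_int_cases not_less_iff_gr_or_eq gr0_implies_Suc)
    then show "expo (sbr U) Dser k = S k"
    proof cases
      case 1 then show ?thesis using SerD(2)[OF expo_Ser[OF U Dser_Ser]] SerD(2)[OF S(1)] by simp
    next
      case 2 then show ?thesis using expo_lead[OF U Dser_Ser] S(2) by (simp add: Dser_def)
    next
      case 3
      let ?V = "rec_prefix F n"
      have V: "?V \<in> Ser (-1)" by (rule rec_prefix_Ser[OF FC])
      have "expo (sbr U) Dser (0 - int (Suc n)) - expo (sbr ?V) Dser (0 - int (Suc n)) =
          b (U (- int (Suc n)) - ?V (- int (Suc n))) (Dser 0)"
      proof (rule expo_update(2)[OF U V Dser_Ser])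
        fix k assume "- int (Suc n) < k"
        then show "U k = ?V k" unfolding U_def using rec_prefix_inside[of n k F] by simp
      qed simp
      also have "U (- int (Suc n)) - ?V (- int (Suc n)) = F (Suc n) ?V"
        unfolding U_def rec_ser_step by (simp add: rec_prefix_outside)
      also have "b (F (Suc n) ?V) (Dser 0) = s (of_nat (Suc n)) (F (Suc n) ?V)"
        using b_D_right[OF FC[OF V]] unfolding Dser_def by simp
      also have "\<dots> = S (- int (Suc n)) - expo (sbr ?V) Dser (- int (Suc n))"
        unfolding F_def by (simp del: of_nat_Suc)
      finally show ?thesis using 3 by simp
    qed
  qed
  define \<tau> where "\<tau> Z = expo (sbr (- U)) (\<sigma> Z)" for Z
  have "unipotent \<tau>" unfolding \<tau>_def by (rule unipotent_compose[OF unipotent_expo[OF Ser_minus[OF U]] u])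
  moreover have "\<tau> Dser = Dser" unfolding \<tau>_def S_def[symmetric] \<open>expo (sbr U) Dser = S\<close>[symmetric]
    by (rule expo_inverse[OF U Dser_Ser])
  ultimately have \<tau>: "\<tau> Z = Z" if "Z \<in> Ser K" for Z K using unipotent_fixing_derivation that by blast
  have "expo (sbr U) Z = \<sigma> Z" if "Z \<in> Ser K" for Z K
  proof -
    have "expo (sbr (- (- U))) (expo (sbr (- U)) (\<sigma> Z)) = \<sigma> Z"
      by (rule expo_inverse[OF Ser_minus[OF U] unipotentD(1)[OF u that]])
    then show ?thesis using \<tau>[OF that] unfolding \<tau>_def by simp
  qed
  then show ?thesis using U by blast
qed

end

section \<open>Smooth curves\<close>

text \<open>If the derivatives of the generators stay in the generated algebra, the algebra is
  closed under differentiation. Smoothness of sums, products and reciprocals follows without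
  formulas for higher derivatives.\<close>

inductive_set fun_algebra :: "(real \<Rightarrow> complex) set \<Rightarrow> (real \<Rightarrow> complex) set" for B where
  base: "u \<in> B \<Longrightarrow> u \<in> fun_algebra B"
| const: "(\<lambda>_. z) \<in> fun_algebra B"
| add: "u \<in> fun_algebra B \<Longrightarrow> v \<in> fun_algebra B \<Longrightarrow> (\<lambda>x. u x + v x) \<in> fun_algebra B"
| mult: "u \<in> fun_algebra B \<Longrightarrow> v \<in> fun_algebra B \<Longrightarrow> (\<lambda>x. u x * v x) \<in> fun_algebra B"

lemma fun_algebra_smooth:
  assumes B: "\<And>g. g \<in> B \<Longrightarrow> \<exists>g'\<in>fun_algebra B. \<forall>x\<in>D. (g has_vector_derivative g' x) (at x)"
    and u: "u \<in> fun_algebra B"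
  shows "smooth_scalar D u"
proof -
  have d: "\<exists>v'\<in>fun_algebra B. \<forall>x\<in>D. (v has_vector_derivative v' x) (at x)" if "v \<in> fun_algebra B" for v
    using that
  proof induction
    case (base u) then show ?case using B by blast
  next
    case (const z) then show ?case
      by (intro bexI[of _ "\<lambda>_. 0"]) (auto intro: fun_algebra.const)
  next
    case (add u v)
    then obtain u' v' where uv: "u' \<in> fun_algebra B" "\<forall>x\<in>D. (u has_vector_derivative u' x) (at x)"
      "v' \<in> fun_algebra B" "\<forall>x\<in>D. (v has_vector_derivative v' x) (at x)" by blast
    then show ?case by (intro bexI[of _ "\<lambda>x. u' x + v' x"])
        (auto intro: fun_algebra.add has_vector_derivative_add)
  next
    case (mult u v)
    then obtain u' v' where uv: "u' \<in> fun_algebra B" "\<forall>x\<in>D. (u has_vector_derivative u' x) (at x)"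
      "v' \<in> fun_algebra B" "\<forall>x\<in>D. (v has_vector_derivative v' x) (at x)" by blast
    then show ?case using mult.hyps by (intro bexI[of _ "\<lambda>x. u x * v' x + u' x * v x"])
        (auto intro: fun_algebra.add fun_algebra.mult has_vector_derivative_mult)
  qed
  define der where "der v = (SOME v'. v' \<in> fun_algebra B \<and> (\<forall>x\<in>D. (v has_vector_derivative v' x) (at x)))" for v
  have der: "der v \<in> fun_algebra B" "\<forall>x\<in>D. (v has_vector_derivative der v x) (at x)"
    if "v \<in> fun_algebra B" for v
    using someI_ex[of "\<lambda>v'. v' \<in> fun_algebra B \<and> (\<forall>x\<in>D. (v has_vector_derivative v' x) (at x))"] d[OF that]
    unfolding der_def by blast+
  have "(der ^^ n) u \<in> fun_algebra B" for n by (induction n) (auto simp: u der)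
  then show ?thesis unfolding smooth_scalar_def
    by (intro exI[of _ "\<lambda>n. (der ^^ n) u"]) (auto simp: der)
qed

lemma smooth_scalar_cong: "smooth_scalar D u \<Longrightarrow> (\<And>x. x \<in> D \<Longrightarrow> u x = v x) \<Longrightarrow> smooth_scalar D v"
proof -
  assume "smooth_scalar D u" and e: "\<And>x. x \<in> D \<Longrightarrow> u x = v x"
  then obtain F where F: "\<forall>x\<in>D. F (0::nat) x = u x" "\<forall>n. \<forall>x\<in>D. (F n has_vector_derivative F (Suc n) x) (at x)"
    unfolding smooth_scalar_def by blast
  show "smooth_scalar D v" unfolding smooth_scalar_def
    by (rule exI[of _ F]) (use F e in auto)
qed

lemma smooth_scalar_subset: "smooth_scalar D u \<Longrightarrow> E \<subseteq> D \<Longrightarrow> smooth_scalar E u"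
proof -
  assume "smooth_scalar D u" and E: "E \<subseteq> D"
  then obtain F where F: "\<forall>x\<in>D. F (0::nat) x = u x" "\<forall>n. \<forall>x\<in>D. (F n has_vector_derivative F (Suc n) x) (at x)"
    unfolding smooth_scalar_def by blast
  show "smooth_scalar E u" unfolding smooth_scalar_def
    by (rule exI[of _ F]) (use F E in auto)
qed

lemma smooth_scalar_const [simp]: "smooth_scalar D (\<lambda>_. z)"
  by (rule fun_algebra_smooth[of "{}"]) (auto intro: fun_algebra.const)

lemma smooth_scalar_of_real [simp]: "smooth_scalar D complex_of_real"
proof (rule fun_algebra_smooth[of "{complex_of_real}"])
  have "(complex_of_real has_vector_derivative 1) (at x)" for x
    using has_vector_derivative_of_real[OF DERIV_ident] by simp
  then show "\<exists>g'\<in>fun_algebra {complex_of_real}. \<forall>x\<in>D. (g has_vector_derivative g' x) (at x)"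
    if "g \<in> {complex_of_real}" for g
    using that by (intro bexI[of _ "\<lambda>_. 1"]) (auto intro: fun_algebra.const)
qed (auto intro: fun_algebra.base)

lemma smooth_scalar_binop:
  assumes "smooth_scalar D u" "smooth_scalar D v"
  shows smooth_scalar_add: "smooth_scalar D (\<lambda>x. u x + v x)"
    and smooth_scalar_mult: "smooth_scalar D (\<lambda>x. u x * v x)"
proof -
  obtain F H where F: "\<forall>x\<in>D. F (0::nat) x = u x" "\<forall>n. \<forall>x\<in>D. (F n has_vector_derivative F (Suc n) x) (at x)"
    and H: "\<forall>x\<in>D. H (0::nat) x = v x" "\<forall>n. \<forall>x\<in>D. (H n has_vector_derivative H (Suc n) x) (at x)"
    using assms unfolding smooth_scalar_def by blast
  define B where "B = range F \<union> range H"
  have B: "F n \<in> fun_algebra B" "H n \<in> fun_algebra B" for n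
    unfolding B_def by (auto intro: fun_algebra.base)
  have d: "\<exists>g'\<in>fun_algebra B. \<forall>x\<in>D. (g has_vector_derivative g' x) (at x)" if "g \<in> B" for g
    using that F(2) H(2) B unfolding B_def by blast
  show "smooth_scalar D (\<lambda>x. u x + v x)"
    by (rule smooth_scalar_cong[OF fun_algebra_smooth[OF d fun_algebra.add[OF B(1)[of 0] B(2)[of 0]]]])
      (use F(1) H(1) in auto)
  show "smooth_scalar D (\<lambda>x. u x * v x)"
    by (rule smooth_scalar_cong[OF fun_algebra_smooth[OF d fun_algebra.mult[OF B(1)[of 0] B(2)[of 0]]]])
      (use F(1) H(1) in auto)
qed

lemma smooth_scalar_inverse:
  assumes D: "open D" and u: "smooth_scalar D u" and nz: "\<And>x. x \<in> D \<Longrightarrow> u x \<noteq> 0"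
  shows "smooth_scalar D (\<lambda>x. 1 / u x)"
proof -
  obtain F where F: "\<forall>x\<in>D. F (0::nat) x = u x" "\<forall>n. \<forall>x\<in>D. (F n has_vector_derivative F (Suc n) x) (at x)"
    using u unfolding smooth_scalar_def by blast
  \<comment> \<open>The reciprocal is added as one more generator; its derivative is minus its
    square times \<open>F 1\<close>, again in the algebra.\<close>
  define v where "v x = inverse (F 0 x)" for x
  define B where "B = insert v (range F)"
  have B: "F n \<in> fun_algebra B" "v \<in> fun_algebra B" for n
    unfolding B_def by (auto intro: fun_algebra.base)
  have v: "(v has_vector_derivative (- 1) * (v x * (v x * F 1 x))) (at x)" if x: "x \<in> D" for x
  proof -
    have "((inverse \<circ> F 0) has_vector_derivative (F 1 x * (- (inverse (F 0 x) ^ Suc (Suc 0))))) (at x)"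
    proof (rule field_vector_diff_chain_at)
      show "(F 0 has_vector_derivative F 1 x) (at x)" using F(2) x by fastforce
      show "(inverse has_field_derivative - (inverse (F 0 x) ^ Suc (Suc 0))) (at (F 0 x))"
        by (rule DERIV_inverse) (use F(1) nz[OF x] x in simp)
    qed
    then show ?thesis unfolding v_def o_def by (simp add: algebra_simps)
  qed
  have d: "\<exists>g'\<in>fun_algebra B. \<forall>x\<in>D. (g has_vector_derivative g' x) (at x)" if gB: "g \<in> B" for g
  proof (cases "g = v")
    case True
    have "(\<lambda>x. (- 1) * (v x * (v x * F 1 x))) \<in> fun_algebra B"
      by (intro fun_algebra.mult fun_algebra.const B)
    then show ?thesis unfolding True by (rule bexI[rotated]) (use v in blast)
  next
    case False
    then obtain n where n: "g = F n" using gB unfolding B_def by blast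
    show ?thesis unfolding n by (rule bexI[OF _ B(1)[of "Suc n"]]) (use F(2) in blast)
  qed
  show ?thesis
    by (rule smooth_scalar_cong[OF fun_algebra_smooth[OF d B(2)]])
      (use F(1) in \<open>auto simp: v_def inverse_eq_divide\<close>)
qed

lemma smooth_scalar_deriv:
  assumes D: "open D" and u: "smooth_scalar D u"
  shows "smooth_scalar D (\<lambda>x. vector_derivative u (at x))"
    "x \<in> D \<Longrightarrow> (u has_vector_derivative vector_derivative u (at x)) (at x)"
proof -
  obtain F where F: "\<forall>x\<in>D. F (0::nat) x = u x" "\<forall>n. \<forall>x\<in>D. (F n has_vector_derivative F (Suc n) x) (at x)"
    using u unfolding smooth_scalar_def by blast
  have d: "(u has_vector_derivative F 1 x) (at x)" if "x \<in> D" for x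
    by (rule has_vector_derivative_transform_within_open[OF _ D that, of "F 0"]) (use F that in auto)
  then have e: "vector_derivative u (at x) = F 1 x" if "x \<in> D" for x
    using vector_derivative_at that by blast
  show "smooth_scalar D (\<lambda>x. vector_derivative u (at x))" unfolding smooth_scalar_def
    by (intro exI[of _ "\<lambda>n. F (Suc n)"]) (use F e in auto)
  show "x \<in> D \<Longrightarrow> (u has_vector_derivative vector_derivative u (at x)) (at x)" using d e by simp
qed

context drinfeld_sokolov_data
begin

section \<open>Smooth curves in the algebra and their derivatives\<close>

lemma smooth_curve_outside: "smooth_curve G D P \<Longrightarrow> x \<notin> D \<Longrightarrow> P x = 0"
  unfolding smooth_curve_def by blast

lemma smooth_curve_term:
  assumes "smooth_scalar D u" shows "smooth_curve G D (restr D (\<lambda>x. sc (u x) v))"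
  unfolding smooth_curve_def restr_def
  by (auto intro!: exI[of _ "{v}"] exI[of _ "\<lambda>_. u"] simp: assms)

lemma smooth_curve_zero [simp]: "smooth_curve G D (\<lambda>_. 0)"
  unfolding smooth_curve_def by (auto intro!: exI[of _ "{}"])

lemma smooth_curve_add:
  assumes "smooth_curve G D P" "smooth_curve G D R" shows "smooth_curve G D (\<lambda>x. P x + R x)"
proof -
  obtain S u where S: "finite S" "\<forall>v\<in>S. smooth_scalar D (u v)" "\<forall>x\<in>D. P x = (\<Sum>v\<in>S. sc (u v x) v)"
    using assms(1) unfolding smooth_curve_def by blast
  obtain T w where T: "finite T" "\<forall>v\<in>T. smooth_scalar D (w v)" "\<forall>x\<in>D. R x = (\<Sum>v\<in>T. sc (w v x) v)"
    using assms(2) unfolding smooth_curve_def by blast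
  define z where "z v = (\<lambda>x. (if v \<in> S then u v x else 0) + (if v \<in> T then w v x else 0))" for v
  have "smooth_scalar D (z v)" if "v \<in> S \<union> T" for v
    unfolding z_def using S(2) T(2)
    by (cases "v \<in> S"; cases "v \<in> T") (auto intro: smooth_scalar_add)
  moreover have "P x + R x = (\<Sum>v\<in>S \<union> T. sc (z v x) v)" if "x \<in> D" for x
  proof -
    have "P x = (\<Sum>v\<in>S \<union> T. sc (if v \<in> S then u v x else 0) v)"
      using S that by (auto intro!: sum.mono_neutral_cong_left simp: T(1))
    moreover have "R x = (\<Sum>v\<in>S \<union> T. sc (if v \<in> T then w v x else 0) v)"
      using T that by (auto intro!: sum.mono_neutral_cong_left simp: S(1))
    ultimately show ?thesis unfolding z_def by (simp add: vs.scale_left_distrib sum.distrib)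
  qed
  moreover have "P x + R x = 0" if "x \<notin> D" for x
    using smooth_curve_outside[OF assms(1) that] smooth_curve_outside[OF assms(2) that] by simp
  ultimately show ?thesis unfolding smooth_curve_def using S(1) T(1) by blast
qed

lemma smooth_curve_sum:
  "(\<And>i. i \<in> I \<Longrightarrow> smooth_curve G D (P i)) \<Longrightarrow> smooth_curve G D (\<lambda>x. \<Sum>i\<in>I. P i x)"
  by (induction I rule: infinite_finite_induct) (auto intro: smooth_curve_add)

text \<open>The finitely many vectors of an expansion are added one at a time, so facts linear in
  the curve reduce to a scalar function times a fixed vector.\<close>

lemma smooth_curve_induct [consumes 1, case_names zero step]:
  assumes P: "smooth_curve G D P"
    and zero: "Q (\<lambda>_. 0)"
    and step: "\<And>u v R. smooth_scalar D u \<Longrightarrow> smooth_curve G D R \<Longrightarrow> Q R \<Longrightarrow>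
      Q (\<lambda>x. restr D (\<lambda>x. sc (u x) v) x + R x)"
  shows "Q P"
proof -
  obtain S u where S: "finite S" "\<forall>v\<in>S. smooth_scalar D (u v)" "\<forall>x\<in>D. P x = (\<Sum>v\<in>S. sc (u v x) v)"
    using P unfolding smooth_curve_def by blast
  have "Q (restr D (\<lambda>x. \<Sum>v\<in>T. sc (u v x) v)) \<and> smooth_curve G D (restr D (\<lambda>x. \<Sum>v\<in>T. sc (u v x) v))"
    if "T \<subseteq> S" for T
    using finite_subset[OF that S(1)] that
  proof (induction T rule: finite_induct)
    case empty
    have "restr D (\<lambda>x. \<Sum>v\<in>{}. sc (u v x) v) = (\<lambda>_. 0)" unfolding restr_def by auto
    then show ?case using zero by simp
  next
    case (insert v T)
    have e: "restr D (\<lambda>x. \<Sum>v\<in>insert v T. sc (u v x) v) =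
        (\<lambda>x. restr D (\<lambda>x. sc (u v x) v) x + restr D (\<lambda>x. \<Sum>v\<in>T. sc (u v x) v) x)"
      using insert.hyps unfolding restr_def by auto
    have v: "smooth_scalar D (u v)" using S(2) insert.prems by blast
    show ?case unfolding e using insert step[OF v] smooth_curve_add[OF smooth_curve_term[OF v]] by auto
  qed
  moreover have "restr D (\<lambda>x. \<Sum>v\<in>S. sc (u v x) v) = P"
    using S(3) smooth_curve_outside[OF P] unfolding restr_def by auto
  ultimately show ?thesis by auto
qed

lemma smooth_curve_linear:
  assumes P: "smooth_curve G D P" and f: "Vector_Spaces.linear sc sc f"
  shows "smooth_curve G D (\<lambda>x. f (P x))"
proof -
  interpret f: Vector_Spaces.linear sc sc f by fact
  from P show ?thesis
  proof (induction rule: smooth_curve_induct)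
    case zero then show ?case by simp
  next
    case (step u v R)
    have "f (restr D (\<lambda>x. sc (u x) v) x) = restr D (\<lambda>x. sc (u x) (f v)) x" for x
      unfolding restr_def by (auto simp: f.scale)
    then show ?case unfolding f.add
      using smooth_curve_add[OF smooth_curve_term[OF step(1), of "f v"] step(3)] by simp
  qed
qed

lemma smooth_curve_functional:
  assumes P: "smooth_curve G D P" and f: "Vector_Spaces.linear sc (*) f"
  shows "smooth_scalar D (\<lambda>x. f (P x))"
proof -
  interpret f: Vector_Spaces.linear sc "(*)" f by fact
  from P show ?thesis
  proof (induction rule: smooth_curve_induct)
    case zero then show ?case by simp
  next
    case (step u v R)
    have "smooth_scalar D (\<lambda>x. u x * f v)" using step by (intro smooth_scalar_mult) auto
    then have "smooth_scalar D (\<lambda>x. f (restr D (\<lambda>x. sc (u x) v) x))"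
      by (rule smooth_scalar_cong) (auto simp: restr_def f.scale)
    then show ?case unfolding f.add using step by (intro smooth_scalar_add)
  qed
qed

lemma smooth_curve_scalar:
  assumes P: "smooth_curve G D P" and f: "smooth_scalar D f"
  shows "smooth_curve G D (\<lambda>x. sc (f x) (P x))"
  using P
proof (induction rule: smooth_curve_induct)
  case zero then show ?case by simp
next
  case (step u v R)
  have "smooth_curve G D (restr D (\<lambda>x. sc (f x * u x) v))"
    using smooth_curve_term smooth_scalar_mult[OF f step(1)] by simp
  moreover have "sc (f x) (restr D (\<lambda>x. sc (u x) v) x) = restr D (\<lambda>x. sc (f x * u x) v) x" for x
    unfolding restr_def by auto
  ultimately show ?case unfolding vs.scale_right_distrib using smooth_curve_add[OF _ step(3)] by simp
qed

lemma smooth_curve_br: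
  assumes P: "smooth_curve G D P" and R: "smooth_curve G D R"
  shows "smooth_curve G D (\<lambda>x. br (P x) (R x))"
  using P
proof (induction rule: smooth_curve_induct)
  case zero then show ?case by simp
next
  case (step u v T)
  have "smooth_curve G D (\<lambda>x. sc (u x) (br v (R x)))"
    by (rule smooth_curve_scalar[OF smooth_curve_linear[OF R linear_br_right] step(1)])
  moreover have "br (restr D (\<lambda>x. sc (u x) v) x) (R x) = sc (u x) (br v (R x))" for x
    unfolding restr_def using smooth_curve_outside[OF R] by (auto simp: br_scale_left)
  ultimately show ?case unfolding br_add_left using smooth_curve_add[OF _ step(3)] by simp
qed

lemma smooth_curve_subset:
  assumes "smooth_curve G D P" "E \<subseteq> D" shows "smooth_curve G E (restr E P)"
proof -
  obtain S u where S: "finite S" "\<forall>v\<in>S. smooth_scalar D (u v)" "\<forall>x\<in>D. P x = (\<Sum>v\<in>S. sc (u v x) v)"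
    using assms(1) unfolding smooth_curve_def by blast
  show ?thesis unfolding smooth_curve_def restr_def
    by (intro conjI allI impI exI[of _ S] exI[of _ u]) (use S assms(2) smooth_scalar_subset in auto)
qed

lemma smooth_curve_const: "smooth_curve G D (restr D (\<lambda>_. v))"
  using smooth_curve_term[of D "\<lambda>_. 1" v] by simp

definition has_cd :: "(real \<Rightarrow> 'g) \<Rightarrow> 'g \<Rightarrow> real \<Rightarrow> bool" where
  "has_cd P Y x \<longleftrightarrow> (\<forall>w. Vector_Spaces.linear sc (*) w \<longrightarrow> ((\<lambda>t. w (P t)) has_vector_derivative w Y) (at x))"

lemma curve_deriv_eq:
  assumes "has_cd P Y x" "x \<in> D" shows "curve_deriv G D P x = Y"
proof -
  have "(THE Y. has_cd P Y x) = Y"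
  proof (rule the_equality[of "\<lambda>Y. has_cd P Y x"])
    fix Z assume "has_cd P Z x"
    then show "Z = Y" using assms(1) unfolding has_cd_def
      by (intro vs.functionals_separate) (blast intro: vector_derivative_unique_at)
  qed fact
  then show ?thesis unfolding curve_deriv_def restr_def has_cd_def using assms(2) by simp
qed

lemma curve_deriv_outside: "x \<notin> D \<Longrightarrow> curve_deriv G D P x = 0"
  unfolding curve_deriv_def restr_def by simp

lemma has_cd_zero: "has_cd (\<lambda>_. 0) 0 x"
  unfolding has_cd_def
proof (intro allI impI)
  fix w assume "Vector_Spaces.linear sc (*) w"
  then interpret w: Vector_Spaces.linear sc "(*)" w .
  show "((\<lambda>t. w 0) has_vector_derivative w 0) (at x)" by simp
qed

lemma has_cd_add: "has_cd P Y x \<Longrightarrow> has_cd R Z x \<Longrightarrow> has_cd (\<lambda>t. P t + R t) (Y + Z) x"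
  unfolding has_cd_def
proof (intro allI impI)
  fix w assume w: "Vector_Spaces.linear sc (*) w"
  then interpret w: Vector_Spaces.linear sc "(*)" w .
  assume "\<forall>w. Vector_Spaces.linear sc (*) w \<longrightarrow> ((\<lambda>t. w (P t)) has_vector_derivative w Y) (at x)"
    "\<forall>w. Vector_Spaces.linear sc (*) w \<longrightarrow> ((\<lambda>t. w (R t)) has_vector_derivative w Z) (at x)"
  then show "((\<lambda>t. w (P t + R t)) has_vector_derivative w (Y + Z)) (at x)"
    unfolding w.add using w by (intro has_vector_derivative_add) auto
qed

lemma has_cd_scalar:
  assumes u: "(u has_vector_derivative u') (at x)" and P: "has_cd P Y x"
  shows "has_cd (\<lambda>t. sc (u t) (P t)) (sc (u x) Y + sc u' (P x)) x"
  unfolding has_cd_def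
proof (intro allI impI)
  fix w assume w: "Vector_Spaces.linear sc (*) w"
  then interpret w: Vector_Spaces.linear sc "(*)" w .
  have wP: "((\<lambda>t. w (P t)) has_vector_derivative w Y) (at x)" using P w unfolding has_cd_def by blast
  show "((\<lambda>t. w (sc (u t) (P t))) has_vector_derivative w (sc (u x) Y + sc u' (P x))) (at x)"
    unfolding w.add w.scale by (rule has_vector_derivative_mult[OF u wP])
qed

lemma has_cd_linear:
  assumes f: "Vector_Spaces.linear sc sc f" and P: "has_cd P Y x"
  shows "has_cd (\<lambda>t. f (P t)) (f Y) x"
  unfolding has_cd_def
proof (intro allI impI)
  fix w assume w: "Vector_Spaces.linear sc (*) w"
  have "Vector_Spaces.linear sc (*) (w \<circ> f)" using Vector_Spaces.linear_compose[OF f w] .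
  then show "((\<lambda>t. w (f (P t))) has_vector_derivative w (f Y)) (at x)"
    using P unfolding has_cd_def o_def by blast
qed

lemma has_cd_cong:
  assumes D: "open D" "x \<in> D" and "\<And>t. t \<in> D \<Longrightarrow> P t = R t" and P: "has_cd P Y x"
  shows "has_cd R Y x"
  unfolding has_cd_def
proof (intro allI impI)
  fix w assume "Vector_Spaces.linear sc (*) w"
  then have "((\<lambda>t. w (P t)) has_vector_derivative w Y) (at x)" using P unfolding has_cd_def by blast
  then show "((\<lambda>t. w (R t)) has_vector_derivative w Y) (at x)"
    by (rule has_vector_derivative_transform_within_open[OF _ D]) (simp add: assms(3))
qed

lemma smooth_curve_has_cd:
  assumes D: "open D" and P: "smooth_curve G D P"
  shows "smooth_curve G D (curve_deriv G D P)" "x \<in> D \<Longrightarrow> has_cd P (curve_deriv G D P x) x"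
proof -
  have "\<exists>P'. smooth_curve G D P' \<and> (\<forall>x\<in>D. has_cd P (P' x) x)"
    using P
  proof (induction rule: smooth_curve_induct)
    case zero then show ?case using has_cd_zero by (intro exI[of _ "\<lambda>_. 0"]) auto
  next
    case (step u v R)
    then obtain R' where R': "smooth_curve G D R'" "\<forall>x\<in>D. has_cd R (R' x) x" by blast
    define u' where "u' x = vector_derivative u (at x)" for x
    have u': "smooth_scalar D u'" "x \<in> D \<Longrightarrow> (u has_vector_derivative u' x) (at x)" for x
      using smooth_scalar_deriv[OF D step(1)] unfolding u'_def by auto
    have "has_cd (restr D (\<lambda>x. sc (u x) v)) (restr D (\<lambda>x. sc (u' x) v) x) x" if x: "x \<in> D" for x
    proof (rule has_cd_cong[OF D x])
      have "has_cd (\<lambda>_. v) 0 x" unfolding has_cd_def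
      proof (intro allI impI)
        fix w assume "Vector_Spaces.linear sc (*) w"
        then interpret w: Vector_Spaces.linear sc "(*)" w .
        show "((\<lambda>t. w v) has_vector_derivative w 0) (at x)" by simp
      qed
      then show "has_cd (\<lambda>x. sc (u x) v) (restr D (\<lambda>x. sc (u' x) v) x) x"
        using has_cd_scalar[OF u'(2)[OF x]] x by (fastforce simp: restr_def)
    qed (simp add: restr_def)
    then have "has_cd (\<lambda>x. restr D (\<lambda>x. sc (u x) v) x + R x) (restr D (\<lambda>x. sc (u' x) v) x + R' x) x"
      if "x \<in> D" for x using has_cd_add R'(2) that by auto
    then show ?case using smooth_curve_add[OF smooth_curve_term[OF u'(1)] R'(1)] by blast
  qed
  then obtain P' where P': "smooth_curve G D P'" "\<forall>x\<in>D. has_cd P (P' x) x" by blast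
  have "curve_deriv G D P x = P' x" for x
    using P' curve_deriv_eq curve_deriv_outside smooth_curve_outside by (cases "x \<in> D") auto
  then have "curve_deriv G D P = P'" by auto
  then show "smooth_curve G D (curve_deriv G D P)" "x \<in> D \<Longrightarrow> has_cd P (curve_deriv G D P x) x"
    using P' by auto
qed

end

locale ds_open = drinfeld_sokolov_data G for G :: "'g::ab_group_add affine_data" +
  fixes D :: "real set"
  assumes D: "open D"
begin

abbreviation "cd \<equiv> curve_deriv G D"
abbreviation "smc \<equiv> smooth_curve G D"

lemma cd_eqI:
  assumes "\<And>x. x \<in> D \<Longrightarrow> has_cd P (Y x) x" "\<And>x. x \<notin> D \<Longrightarrow> Y x = 0" shows "cd P = Y"
  using curve_deriv_eq assms curve_deriv_outside by (metis ext)

lemma cd_smooth: "smc P \<Longrightarrow> smc (cd P)" and cd_has: "smc P \<Longrightarrow> x \<in> D \<Longrightarrow> has_cd P (cd P x) x"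
  using smooth_curve_has_cd[OF D] by blast+

lemma cd_add: "smc P \<Longrightarrow> smc R \<Longrightarrow> cd (\<lambda>x. P x + R x) = (\<lambda>x. cd P x + cd R x)"
  by (rule cd_eqI) (auto intro: has_cd_add cd_has simp: curve_deriv_outside)

lemma cd_linear: "smc P \<Longrightarrow> Vector_Spaces.linear sc sc f \<Longrightarrow> cd (\<lambda>x. f (P x)) = (\<lambda>x. f (cd P x))"
proof -
  assume P: "smc P" and f: "Vector_Spaces.linear sc sc f"
  then interpret f: Vector_Spaces.linear sc sc f by simp
  show ?thesis by (rule cd_eqI) (auto intro: has_cd_linear f cd_has P simp: curve_deriv_outside)
qed

lemma linear_sc: "Vector_Spaces.linear sc sc (sc a)"
  unfolding Vector_Spaces.linear_iff by (auto simp: vector_space_sc vs.scale_right_distrib mult.commute)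

lemma cd_scale: "smc P \<Longrightarrow> cd (\<lambda>x. sc a (P x)) = (\<lambda>x. sc a (cd P x))"
  using cd_linear linear_sc by blast

lemma cd_minus: "smc P \<Longrightarrow> cd (\<lambda>x. - P x) = (\<lambda>x. - cd P x)"
  using cd_scale[of P "-1"] by simp

lemma smc_scale: "smc P \<Longrightarrow> smc (\<lambda>x. sc a (P x))"
  using smooth_curve_linear linear_sc by blast

lemma smc_minus: "smc P \<Longrightarrow> smc (\<lambda>x. - P x)"
  using smc_scale[of P "-1"] by simp

lemma smc_diff: "smc P \<Longrightarrow> smc R \<Longrightarrow> smc (\<lambda>x. P x - R x)"
  using smooth_curve_add[of D P "\<lambda>x. - R x"] smc_minus by simp

lemma cd_diff: "smc P \<Longrightarrow> smc R \<Longrightarrow> cd (\<lambda>x. P x - R x) = (\<lambda>x. cd P x - cd R x)"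
  using cd_add[of P "\<lambda>x. - R x"] smc_minus cd_minus by simp

lemma cd_scalar:
  assumes P: "smc P" and u: "smooth_scalar D u"
  shows "cd (\<lambda>x. sc (u x) (P x)) = (\<lambda>x. sc (u x) (cd P x) + sc (vector_derivative u (at x)) (P x))"
  by (rule cd_eqI)
    (auto intro!: has_cd_scalar smooth_scalar_deriv(2)[OF D u] cd_has[OF P]
      simp: curve_deriv_outside smooth_curve_outside[OF P])

lemma cd_const: "cd (restr D (\<lambda>_. v)) = (\<lambda>_. 0)"
proof (rule cd_eqI)
  fix x assume x: "x \<in> D"
  show "has_cd (restr D (\<lambda>_. v)) 0 x"
  proof (rule has_cd_cong[OF D x])
    show "has_cd (\<lambda>_. v) 0 x" unfolding has_cd_def
    proof (intro allI impI)
      fix w assume "Vector_Spaces.linear sc (*) w"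
      then interpret w: Vector_Spaces.linear sc "(*)" w .
      show "((\<lambda>t. w v) has_vector_derivative w 0) (at x)" by simp
    qed
  qed (simp add: restr_def)
qed simp

lemma cd_sum:
  "(\<And>i. i \<in> I \<Longrightarrow> smc (P i)) \<Longrightarrow> cd (\<lambda>x. \<Sum>i\<in>I. P i x) = (\<lambda>x. \<Sum>i\<in>I. cd (P i) x)"
proof (induction I rule: infinite_finite_induct)
  case (insert i I)
  then show ?case using cd_add[of "P i" "\<lambda>x. \<Sum>i\<in>I. P i x"] smooth_curve_sum[of I D P] by auto
qed (auto intro!: cd_eqI has_cd_zero)

lemma cd_br:
  assumes P: "smc P" and R: "smc R"
  shows "cd (\<lambda>x. br (P x) (R x)) = (\<lambda>x. br (cd P x) (R x) + br (P x) (cd R x))"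
  using P
proof (induction rule: smooth_curve_induct)
  case zero
  have "cd (\<lambda>_. 0) = (\<lambda>_. 0)" by (rule cd_eqI) (auto intro: has_cd_zero)
  then show ?case by simp
next
  case (step u v T)
  let ?t = "restr D (\<lambda>x. sc (u x) v)"
  have t: "smc ?t" by (rule smooth_curve_term[OF step(1)])
  have vR: "smc (\<lambda>x. br v (R x))" by (rule smooth_curve_linear[OF R linear_br_right])
  have ct: "?t = (\<lambda>x. sc (u x) (restr D (\<lambda>_. v) x))" unfolding restr_def by auto
  have cdt: "cd ?t = (\<lambda>x. sc (vector_derivative u (at x)) (restr D (\<lambda>_. v) x))"
    unfolding ct cd_scalar[OF smooth_curve_const step(1)] cd_const by simp
  have "(\<lambda>x. br (?t x) (R x)) = (\<lambda>x. sc (u x) (br v (R x)))"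
    unfolding restr_def using smooth_curve_outside[OF R] by (auto simp: br_scale_left)
  then have "cd (\<lambda>x. br (?t x) (R x)) = (\<lambda>x. sc (u x) (br v (cd R x)) + sc (vector_derivative u (at x)) (br v (R x)))"
    using cd_scalar[OF vR step(1)] cd_linear[OF R linear_br_right] by simp
  also have "\<dots> = (\<lambda>x. br (cd ?t x) (R x) + br (?t x) (cd R x))"
  proof
    fix x
    show "sc (u x) (br v (cd R x)) + sc (vector_derivative u (at x)) (br v (R x)) = br (cd ?t x) (R x) + br (?t x) (cd R x)"
      using fun_cong[OF cdt, of x] smooth_curve_outside[OF R, of x] curve_deriv_outside[of x D R]
      by (cases "x \<in> D") (simp_all add: restr_def br_scale_left add.commute)
  qed
  finally have 1: "cd (\<lambda>x. br (?t x) (R x)) = (\<lambda>x. br (cd ?t x) (R x) + br (?t x) (cd R x))" .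
  show ?case
    unfolding cd_add[OF t step(2)] br_add_left
      cd_add[OF smooth_curve_br[OF t R] smooth_curve_br[OF step(2) R]] 1 step(3)
    by (simp add: algebra_simps)
qed

lemma cd_Eig: "smc P \<Longrightarrow> (\<And>x. P x \<in> Eig k) \<Longrightarrow> cd P x \<in> Eig k"
proof -
  assume P: "smc P" "\<And>x. P x \<in> Eig k"
  have "(\<lambda>x. br dd (cd P x)) = cd (\<lambda>x. br dd (P x))" using cd_linear[OF P(1) linear_br_right] by simp
  also have "\<dots> = cd (\<lambda>x. sc (of_int k) (P x))" using P(2) unfolding Eig_def by simp
  also have "\<dots> = (\<lambda>x. sc (of_int k) (cd P x))" by (rule cd_scale[OF P(1)])
  finally have "br dd (cd P x) = sc (of_int k) (cd P x)" by (rule fun_cong)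
  then show ?thesis unfolding Eig_def by simp
qed

section \<open>The graded Lie algebra of operators\<close>

definition CC :: "int \<Rightarrow> 'g dop set" where
  "CC k = {(a, P). smc P \<and> (\<forall>x. P x \<in> Eig k) \<and> (k \<noteq> 0 \<longrightarrow> a = 0)}"

lemma CC_iff: "Z \<in> CC k \<longleftrightarrow> smc (snd Z) \<and> (\<forall>x. snd Z x \<in> Eig k) \<and> (k \<noteq> 0 \<longrightarrow> fst Z = 0)"
  unfolding CC_def by (auto simp: case_prod_beta)

lemma vector_space_op_scale: "vector_space (op_scale G)"
  by unfold_locales (auto simp: op_scale_def plus_fun_def vs.scale_right_distrib vs.scale_left_distrib algebra_simps)

lemma op_brk_pair:
  "op_brk G D Z W = (0, \<lambda>x. sc (fst Z) (cd (snd W) x) - sc (fst W) (cd (snd Z) x) + br (snd Z x) (snd W x))"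
  unfolding op_brk_def by (simp add: case_prod_beta)

lemma op_scale_pair: "op_scale G a Z = (a * fst Z, \<lambda>x. sc a (snd Z x))"
  unfolding op_scale_def by (simp add: case_prod_beta)

lemma smc_op_brk:
  assumes "smc P" "smc R" shows "smc (\<lambda>x. sc a (cd R x) - sc b (cd P x) + br (P x) (R x))"
  by (intro smooth_curve_add smc_diff smc_scale cd_smooth smooth_curve_br assms)

lemma cd_op_brk:
  assumes "smc P" "smc R"
  shows "cd (\<lambda>x. sc a (cd R x) - sc b (cd P x) + br (P x) (R x)) =
    (\<lambda>x. sc a (cd (cd R) x) - sc b (cd (cd P) x) + (br (cd P x) (R x) + br (P x) (cd R x)))"
  by (simp only: cd_add[OF smc_diff[OF smc_scale[OF cd_smooth[OF assms(2)]] smc_scale[OF cd_smooth[OF assms(1)]]]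
      smooth_curve_br[OF assms]] cd_diff[OF smc_scale[OF cd_smooth[OF assms(2)]] smc_scale[OF cd_smooth[OF assms(1)]]]
      cd_scale[OF cd_smooth[OF assms(2)]] cd_scale[OF cd_smooth[OF assms(1)]] cd_br[OF assms])

lemma graded_lie_dop: "graded_lie (op_scale G) (op_brk G D) CC"
proof -
  interpret op: vector_space "op_scale G" by (rule vector_space_op_scale)
  show ?thesis
  proof
    show "op.subspace (CC k)" for k
      unfolding op.subspace_def
      by (auto simp: CC_iff op_scale_pair plus_fun_def zero_fun_def smooth_curve_add smc_scale
          vs.subspace_0[OF subspace_Eig] vs.subspace_add[OF subspace_Eig] vs.subspace_scale[OF subspace_Eig])
    fix k m x y assume "x \<in> CC k" "y \<in> CC m"
    then have x: "smc (snd x)" "\<And>t. snd x t \<in> Eig k" "k \<noteq> 0 \<longrightarrow> fst x = 0"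
      and y: "smc (snd y)" "\<And>t. snd y t \<in> Eig m" "m \<noteq> 0 \<longrightarrow> fst y = 0" unfolding CC_iff by auto
    have "sc (fst x) (cd (snd y) t) \<in> Eig (k + m)" for t
      using vs.subspace_scale[OF subspace_Eig cd_Eig[OF y(1,2)]] x(3) vs.subspace_0[OF subspace_Eig] by (cases "k = 0") auto
    moreover have "sc (fst y) (cd (snd x) t) \<in> Eig (k + m)" for t
      using vs.subspace_scale[OF subspace_Eig cd_Eig[OF x(1,2)]] y(3) vs.subspace_0[OF subspace_Eig] by (cases "m = 0") auto
    ultimately show "op_brk G D x y \<in> CC (k + m)"
      unfolding CC_iff op_brk_pair using smc_op_brk[OF x(1) y(1)] Eig_br[OF x(2) y(2)]
      by (auto intro!: vs.subspace_add[OF subspace_Eig] vs.subspace_diff[OF subspace_Eig])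
  next
    fix k m x x' y assume "x \<in> CC k" "x' \<in> CC k" "y \<in> CC m"
    then have "smc (snd x)" "smc (snd x')" "smc (snd y)" unfolding CC_iff by auto
    then show "op_brk G D (x + x') y = op_brk G D x y + op_brk G D x' y"
      unfolding op_brk_pair by (auto simp: plus_fun_def cd_add br_add_left vs.scale_left_distrib vs.scale_right_distrib)
  next
    fix k m x y y' assume "x \<in> CC k" "y \<in> CC m" "y' \<in> CC m"
    then have "smc (snd x)" "smc (snd y')" "smc (snd y)" unfolding CC_iff by auto
    then show "op_brk G D x (y + y') = op_brk G D x y + op_brk G D x y'"
      unfolding op_brk_pair by (auto simp: plus_fun_def cd_add br_add_right vs.scale_left_distrib vs.scale_right_distrib)
  next
    fix k m x y a assume "x \<in> CC k" "y \<in> CC m"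
    then have "smc (snd x)" "smc (snd y)" unfolding CC_iff by auto
    then show "op_brk G D (op_scale G a x) y = op_scale G a (op_brk G D x y)"
      "op_brk G D x (op_scale G a y) = op_scale G a (op_brk G D x y)"
      unfolding op_brk_pair op_scale_pair
      by (auto simp: cd_scale br_scale_left br_scale_right vs.scale_right_distrib vs.scale_right_diff_distrib mult.commute)
  next
    fix i j k x y z assume "x \<in> CC i" "y \<in> CC j" "z \<in> CC k"
    then have s: "smc (snd x)" "smc (snd y)" "smc (snd z)" unfolding CC_iff by auto
    show "op_brk G D x (op_brk G D y z) = op_brk G D (op_brk G D x y) z + op_brk G D y (op_brk G D x z)"
    proof (rule prod_eqI)
      show "snd (op_brk G D x (op_brk G D y z)) = snd (op_brk G D (op_brk G D x y) z + op_brk G D y (op_brk G D x z))"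
      proof
        fix t
        have a: "br (cd (snd x) t) (snd y t) = - br (snd y t) (cd (snd x) t)" by (rule br_anti)
        have j: "br (snd x t) (br (snd y t) (snd z t)) = br (br (snd x t) (snd y t)) (snd z t) + br (snd y t) (br (snd x t) (snd z t))"
          by (rule jacobi)
        show "snd (op_brk G D x (op_brk G D y z)) t = snd (op_brk G D (op_brk G D x y) z + op_brk G D y (op_brk G D x z)) t"
          unfolding op_brk_pair snd_conv fst_conv snd_add plus_fun_def
            cd_op_brk[OF s(2,3)] cd_op_brk[OF s(1,2)] cd_op_brk[OF s(1,3)]
          by (simp add: br_add_left br_add_right br_diff_left br_diff_right br_scale_left br_scale_right a j
              vs.scale_right_distrib vs.scale_right_diff_distrib algebra_simps)
      qed
    qed (simp add: op_brk_pair)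
  qed
qed

text \<open>The constant curve \<open>dd\<close> has derivative zero, so it commutes with the
  partial derivative, and its bracket multiplies each component by its degree. For this reason the
  carriers \<open>CC\<close> are built from \<open>Eig\<close>, whose degree 0 contains
  \<open>dd\<close>, and not from \<open>gdeg\<close>.\<close>

lemma graded_lie_derivation_dop:
  "graded_lie_derivation (op_scale G) (op_brk G D) CC (0, restr D (\<lambda>_. dd))"
proof -
  interpret graded_lie "op_scale G" "op_brk G D" CC by (rule graded_lie_dop)
  have e: "op_brk G D (0, restr D (\<lambda>_. dd)) x = op_scale G (of_int k) x" if "x \<in> CC k" for x k
    using that smooth_curve_outside[of D "snd x"] unfolding op_brk_pair op_scale_pair fst_conv snd_conv cd_const CC_iff
    by (auto simp: restr_def Eig_def)
  have f: "op_brk G D x (0, restr D (\<lambda>_. dd)) = op_scale G (- of_int k) x" if "x \<in> CC k" for x k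
  proof -
    have "br (snd x t) (restr D (\<lambda>_. dd) t) = - br (restr D (\<lambda>_. dd) t) (snd x t)" for t by (rule br_anti)
    then show ?thesis using that smooth_curve_outside[of D "snd x"] unfolding op_brk_pair op_scale_pair fst_conv snd_conv cd_const CC_iff
      by (auto simp: restr_def Eig_def)
  qed
  show ?thesis
  proof
    show "(0, restr D (\<lambda>_. dd)) \<in> CC 0" unfolding CC_iff
      using smooth_curve_const Eig_gens(4) vs.subspace_0[OF subspace_Eig] by (auto simp: restr_def)
  qed (use e f in auto)
qed

sublocale dop: graded_lie_derivation "op_scale G" "op_brk G D" CC "(0, restr D (\<lambda>_. dd))"
  by (rule graded_lie_derivation_dop)

lemma ser_brk_eq: "ser_brk G D = dop.sbr"
  unfolding ser_brk_def dop.sbr_def ..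

lemma exp_ser_eq: "exp_ser G = dop.expo"
  unfolding exp_ser_def dop.expo_def ..

end

section \<open>The dressing element\<close>

context graded_lie
begin

lemma sbr_zero_left: "Z \<in> Ser K \<Longrightarrow> sbr (\<lambda>_. 0) Z = 0"
  using sbr_scale_left[of "\<lambda>_. 0" 0 Z K 0] by (simp add: zero_fun_def Ser_def)

lemma zero_Ser: "(\<lambda>_. 0) \<in> Ser K" by (simp add: Ser_def)

lemma expo_zero: "Z \<in> Ser K \<Longrightarrow> expo (sbr (\<lambda>_. 0)) Z = Z"
  by (rule expo_fixed[OF zero_Ser _ sbr_zero_left])

lemma expo_second:
  assumes "U \<in> Ser (-1)" "Z \<in> Ser K"
  shows "expo (sbr U) Z (K - 1) = Z (K - 1) + b (U (-1)) (Z K)"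
proof -
  have "expo (sbr U) Z (K - int 1) - expo (sbr (\<lambda>_. 0)) Z (K - int 1) = b (U (- int 1) - 0) (Z K)"
    by (rule expo_update(2)[OF assms(1) zero_Ser assms(2)]) (use SerD(2)[OF assms(1)] in auto)
  then show ?thesis unfolding expo_zero[OF assms(2)] by (simp add: algebra_simps)
qed

end

context ds_open
begin

lemma restr_const_Eig: "v \<in> Eig k \<Longrightarrow> restr D (\<lambda>_. v) x \<in> Eig k"
  unfolding restr_def using vs.subspace_0[OF subspace_Eig] by simp

section \<open>Dressing as a statement about series\<close>

definition Lser :: "(real \<Rightarrow> 'g) \<Rightarrow> 'g dser" where
  "Lser Q = homog 0 (1, Q) + homog 1 (0, restr D (\<lambda>_. Lam1 G))"

definition Pser :: "int \<times> nat \<Rightarrow> 'g dser" where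
  "Pser p = homog (fst p) (0, restr D (\<lambda>_. Lam G p))"

lemma Lser_apply: "Lser Q k = (if k = 0 then (1, Q) else if k = 1 then (0, restr D (\<lambda>_. Lam1 G)) else 0)"
  unfolding Lser_def homog_def by simp

lemma Pser_apply: "Pser p k = (if k = fst p then (0, restr D (\<lambda>_. Lam G p)) else 0)"
  unfolding Pser_def homog_def by simp

lemma Lser_Ser: "smc Q \<Longrightarrow> (\<And>x. Q x \<in> Eig 0) \<Longrightarrow> Lser Q \<in> dop.Ser 1"
proof (rule dop.SerI)
  assume "smc Q" "\<And>x. Q x \<in> Eig 0"
  then have "(1, Q) \<in> CC 0" "(0, restr D (\<lambda>_. Lam1 G)) \<in> CC 1"
    by (simp_all add: CC_iff smooth_curve_const restr_const_Eig Lam1_Eig)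
  then show "Lser Q k \<in> CC k" for k by (simp add: Lser_apply)
qed (simp add: Lser_apply)

lemma Pser_Ser: "p \<in> exponents G \<Longrightarrow> Pser p \<in> dop.Ser (fst p)"
proof (rule dop.SerI)
  assume "p \<in> exponents G"
  then have "(0, restr D (\<lambda>_. Lam G p)) \<in> CC (fst p)"
    by (simp add: CC_iff smooth_curve_const restr_const_Eig Lam_Eig)
  then show "Pser p k \<in> CC k" for k by (simp add: Pser_apply)
qed (simp add: Pser_apply)

lemma SerD_curve:
  assumes "Z \<in> dop.Ser K"
  shows "smc (snd (Z k))" "snd (Z k) x \<in> Eig k" "k \<noteq> 0 \<Longrightarrow> fst (Z k) = 0" "x \<notin> D \<Longrightarrow> snd (Z k) x = 0"
  using dop.SerD(1)[OF assms, of k] smooth_curve_outside unfolding CC_iff by blast+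

text \<open>In negative degrees \<open>gdeg\<close> and \<open>Eig\<close> coincide, so passing to
  the larger algebra with \<open>dd\<close> admits no new dressing elements.\<close>

lemma neg_curves_Ser: "U \<in> neg_curves G D UNIV \<longleftrightarrow> curve_ser U \<in> dop.Ser (-1)"
proof
  assume U: "U \<in> neg_curves G D UNIV"
  have "smc (U k)" "k < 0 \<Longrightarrow> U k x \<in> gdeg G k" "0 \<le> k \<Longrightarrow> U k = 0" for k x
    using U unfolding neg_curves_def by (auto split: if_splits)
  then show "curve_ser U \<in> dop.Ser (-1)"
    by (intro dop.SerI)
      (auto simp: curve_ser_def CC_iff zero_prod_def zero_fun_def gdeg_eq,
        metis gdeg_Eig linorder_not_less vs.subspace_0[OF subspace_Eig] zero_fun_apply)
next
  assume U: "curve_ser U \<in> dop.Ser (-1)"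
  have "smc (U k)" "U k x \<in> Eig k" for k x using SerD_curve[OF U, of k] by (auto simp: curve_ser_def)
  moreover have "U k = 0" if "0 \<le> k" for k
    using dop.SerD(2)[OF U, of k] that by (simp add: curve_ser_def zero_prod_def)
  ultimately show "U \<in> neg_curves G D UNIV" unfolding neg_curves_def by (auto simp: gdeg_eq)
qed

lemma curve_ser_snd: "V \<in> dop.Ser (-1) \<Longrightarrow> curve_ser (\<lambda>k. snd (V k)) = V"
proof
  fix k assume V: "V \<in> dop.Ser (-1)"
  show "curve_ser (\<lambda>k. snd (V k)) k = V k"
  proof (cases "k = 0")
    case True then show ?thesis using dop.SerD(2)[OF V, of 0] by (simp add: curve_ser_def zero_prod_def)
  next
    case False then show ?thesis using SerD_curve(3)[OF V False] by (simp add: curve_ser_def prod_eq_iff)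
  qed
qed

lemma B_curve_facts: "B_curve G D Q \<Longrightarrow> smc Q" "B_curve G D Q \<Longrightarrow> Q x \<in> Hspan"
  "B_curve G D Q \<Longrightarrow> fm dd (Q x) = 0" "B_curve G D Q \<Longrightarrow> Q x \<in> Eig 0"
proof -
  assume Q: "B_curve G D Q"
  show "smc Q" using Q unfolding B_curve_def by blast
  have "Q x \<in> Hspan \<and> fm dd (Q x) = 0"
    using Q smooth_curve_outside[OF \<open>smc Q\<close>, of x] vs.subspace_0[OF subspace_Hspan]
    unfolding B_curve_def Bspace_iff by (cases "x \<in> D") auto
  then show "Q x \<in> Hspan" "fm dd (Q x) = 0" "Q x \<in> Eig 0" using Hspan_Eig by auto
qed

lemma B_curve_Lser: "B_curve G D Q \<Longrightarrow> Lser Q \<in> dop.Ser 1"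
  using Lser_Ser B_curve_facts by blast

definition dressed :: "(int \<Rightarrow> 'g dop) \<Rightarrow> int \<times> nat \<Rightarrow> 'g dser" where
  "dressed V p = dop.expo (dop.sbr V) (Pser p)"

definition is_dressing :: "(real \<Rightarrow> 'g) \<Rightarrow> 'g dser \<Rightarrow> bool" where
  "is_dressing Q V \<longleftrightarrow> V \<in> dop.Ser (-1) \<and>
     (\<exists>H\<in>dop.Ser (-1). (\<forall>k x. snd (H k) x \<in> heis G) \<and> dop.expo (dop.sbr (- V)) (Lser Q) = Lser (\<lambda>_. 0) + H) \<and>
     (\<forall>p\<in>pos_exponents G. \<forall>x\<in>D. fm dd (snd (dressed V p 0) x) = 0)"

lemma neg_curves_heis:
  "H \<in> neg_curves G D (heis G) \<longleftrightarrow> H \<in> neg_curves G D UNIV \<and> (\<forall>k x. H k x \<in> heis G)"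
proof -
  have "0 \<in> heis G" by (rule vs.subspace_0[OF subspace_heis])
  then show ?thesis unfolding neg_curves_def by (auto split: if_splits) (metis linorder_not_less zero_fun_apply)+
qed

lemma dressing_iff:
  assumes "B_curve G D Q"
  shows "dressing G D Q U \<longleftrightarrow> is_dressing Q (curve_ser U)"
proof -
  have e: "homog 0 (1, Q) + homog 1 (0, restr D (\<lambda>_. Lam1 G)) = Lser Q"
    "homog 0 (1, 0) + homog 1 (0, restr D (\<lambda>_. Lam1 G)) = Lser (\<lambda>_. 0)"
    unfolding Lser_def zero_fun_def by simp_all
  have h: "(\<exists>H\<in>neg_curves G D (heis G). Z = Y + curve_ser H) \<longleftrightarrow>
     (\<exists>H\<in>dop.Ser (-1). (\<forall>k x. snd (H k) x \<in> heis G) \<and> Z = Y + H)" for Z Y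
  proof
    assume "\<exists>H\<in>neg_curves G D (heis G). Z = Y + curve_ser H"
    then obtain H where H: "H \<in> neg_curves G D (heis G)" "Z = Y + curve_ser H" by blast
    then show "\<exists>H\<in>dop.Ser (-1). (\<forall>k x. snd (H k) x \<in> heis G) \<and> Z = Y + H"
      by (intro bexI[of _ "curve_ser H"]) (auto simp: neg_curves_heis neg_curves_Ser curve_ser_def)
  next
    assume "\<exists>H\<in>dop.Ser (-1). (\<forall>k x. snd (H k) x \<in> heis G) \<and> Z = Y + H"
    then obtain H where H: "H \<in> dop.Ser (-1)" "\<forall>k x. snd (H k) x \<in> heis G" "Z = Y + H" by blast
    then show "\<exists>H\<in>neg_curves G D (heis G). Z = Y + curve_ser H"
      by (intro bexI[of _ "\<lambda>k. snd (H k)"]) (auto simp: neg_curves_heis neg_curves_Ser curve_ser_snd)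
  qed
  show ?thesis
  proof (cases "curve_ser U \<in> dop.Ser (-1)")
    case True
    then show ?thesis
      unfolding dressing_def is_dressing_def e h exp_ser_eq ser_brk_eq neg_curves_Ser dressed_def Pser_def
        dop.expo_uminus[OF True B_curve_Lser[OF assms]] by blast
  next
    case False
    then show ?thesis unfolding dressing_def is_dressing_def neg_curves_Ser by blast
  qed
qed

lemma snd_op_brk_L: "snd (op_brk G D (0, P) (0, restr D (\<lambda>_. v))) x = (if x \<in> D then br (P x) v else 0)"
  unfolding op_brk_pair by (simp add: restr_def)

lemma pos_exponentsD: "p \<in> pos_exponents G \<Longrightarrow> p \<in> exponents G" "p \<in> pos_exponents G \<Longrightarrow> 0 < fst p"
  unfolding pos_exponents_def by auto

lemma form_dd_br: "X \<in> Eig k \<Longrightarrow> fm dd (br X Y) = of_int k * fm X Y"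
  using form_inv[of dd X Y] unfolding Eig_def by (simp add: form_scale_left)

text \<open>Let \<open>- m\<close> be the first degree where two solutions may differ, and
  \<open>W\<close> the difference there. Its bracket with Lambda_1 lies in the Heisenberg part and
  in the complementary image, so it vanishes and \<open>W\<close> is in the Heisenberg subalgebra.
  The normalization against the exponents equal to \<open>m\<close> then annihilates all its
  coefficients.\<close>

lemma dressing_unique:
  assumes Q: "B_curve G D Q" and U: "is_dressing Q U" and V: "is_dressing Q V"
  shows "U = V"
proof -
  have U1: "U \<in> dop.Ser (-1)" and V1: "V \<in> dop.Ser (-1)" using U V unfolding is_dressing_def by blast+
  obtain H where H: "H \<in> dop.Ser (-1)" "\<forall>k x. snd (H k) x \<in> heis G" "dop.expo (dop.sbr (- U)) (Lser Q) = Lser (\<lambda>_. 0) + H"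
    using U unfolding is_dressing_def by blast
  obtain I where I: "I \<in> dop.Ser (-1)" "\<forall>k x. snd (I k) x \<in> heis G" "dop.expo (dop.sbr (- V)) (Lser Q) = Lser (\<lambda>_. 0) + I"
    using V unfolding is_dressing_def by blast
  have claim: "\<forall>k. - int (Suc n) < k \<longrightarrow> U k = V k" for n
  proof (induction n)
    case 0
    then show ?case using dop.SerD(2)[OF U1] dop.SerD(2)[OF V1] by auto
  next
    case (Suc n)
    define m where "m = Suc n"
    have agree: "U k = V k" if "- int m < k" for k using Suc that unfolding m_def by blast
    define W where "W x = snd (U (- int m)) x - snd (V (- int m)) x" for x
    have fz: "fst (U (- int m)) = 0" "fst (V (- int m)) = 0"
      using SerD_curve(3)[OF U1] SerD_curve(3)[OF V1] unfolding m_def by auto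
    have We: "W x \<in> Eig (- int m)" for x unfolding W_def
      by (intro vs.subspace_diff[OF subspace_Eig] SerD_curve(2)[OF U1] SerD_curve(2)[OF V1])
    have d: "U (- int m) - V (- int m) = (0, W)" unfolding W_def using fz
      by (simp add: prod_eq_iff fun_eq_iff)
    have d': "(- U) (- int m) - (- V) (- int m) = (0, \<lambda>x. - W x)" unfolding W_def using fz
      by (simp add: prod_eq_iff fun_eq_iff)
    have W0: "W x = 0" if x: "x \<in> D" for x
    proof -
      have "dop.expo (dop.sbr (- U)) (Lser Q) (1 - int m) - dop.expo (dop.sbr (- V)) (Lser Q) (1 - int m) =
          op_brk G D ((- U) (- int m) - (- V) (- int m)) (Lser Q 1)"
        by (rule dop.expo_update(2)[OF dop.Ser_minus[OF U1] dop.Ser_minus[OF V1] B_curve_Lser[OF Q]])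
          (use agree in \<open>auto simp: m_def\<close>)
      then have "snd (H (1 - int m) - I (1 - int m)) x = - br (W x) (Lam1 G)"
        unfolding H(3) I(3) d' using x by (simp add: Lser_apply snd_op_brk_L br_minus_left)
      then have LW: "br (Lam1 G) (W x) = snd (H (1 - int m)) x - snd (I (1 - int m)) x"
        using br_anti[of "Lam1 G" "W x"] by simp
      have "br (Lam1 G) (W x) = 0"
      \<comment> \<open>For \<open>m = 1\<close> the bracket has degree 0, where neither
        \<open>H\<close> nor \<open>I\<close> has a component.\<close>
      proof (cases "m = 1")
        case True
        then show ?thesis using LW dop.SerD(2)[OF H(1)] dop.SerD(2)[OF I(1)] by simp
      next
        case False
        then have neg: "1 - int m < 0" unfolding m_def by simp
        have "br (Lam1 G) (W x) \<in> heis G" unfolding LW using H(2) I(2) by (intro vs.subspace_diff[OF subspace_heis]) auto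
        moreover have e: "br (Lam1 G) (W x) \<in> Eig (1 - int m)" using Eig_br[OF Lam1_Eig We] by simp
        ultimately have "hproj (1 - int m) (br (Lam1 G) (W x)) = br (Lam1 G) (W x)" using hproj_id neg by simp
        moreover have "hproj (1 - int m) (br (Lam1 G) (W x)) = 0"
        proof -
          interpret h: Vector_Spaces.linear sc sc "hproj (1 - int m)" by (rule linear_hproj)
          have "hproj (1 - int m) (br LS (W x)) = 0" using hproj_image_LS[OF neg] We by simp
          then show ?thesis unfolding br_Lam1 h.scale by simp
        qed
        ultimately show ?thesis by simp
      qed
      then have "br LS (W x) = 0" using nu_nz unfolding br_Lam1 by simp
      then have Wh: "W x \<in> heis G" using heisI[OF We] unfolding m_def by simp
      have "fm (W x) (Lam G (int m, a)) = 0" if a: "a < emult G (int m)" for a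
      proof -
        have p: "(int m, a) \<in> pos_exponents G" using a unfolding pos_exponents_def by (simp add: exponents_pair m_def)
        have e: "dressed U (int m, a) (int m - int m) - dressed V (int m, a) (int m - int m) =
            op_brk G D (U (- int m) - V (- int m)) (Pser (int m, a) (int m))"
          unfolding dressed_def
          by (rule dop.expo_update(2)[OF U1 V1]) (use agree Pser_Ser[OF pos_exponentsD(1)[OF p]] in \<open>auto simp: m_def\<close>)
        have "snd (dressed U (int m, a) 0) x - snd (dressed V (int m, a) 0) x =
            snd (dressed U (int m, a) (int m - int m) - dressed V (int m, a) (int m - int m)) x"
          by simp
        also have "\<dots> = br (W x) (Lam G (int m, a))"
          unfolding e d using x by (simp add: Pser_apply snd_op_brk_L)
        finally have "br (W x) (Lam G (int m, a)) = snd (dressed U (int m, a) 0) x - snd (dressed V (int m, a) 0) x" ..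
        moreover have "fm dd (snd (dressed U (int m, a) 0) x) = 0" "fm dd (snd (dressed V (int m, a) 0) x) = 0"
          using U V p x unfolding is_dressing_def by blast+
        ultimately have "fm dd (br (W x) (Lam G (int m, a))) = 0" by (simp add: form_diff_right)
        then show ?thesis unfolding form_dd_br[OF We] m_def by (simp del: of_nat_Suc)
      qed
      then have "hproj (- int m) (W x) = 0" unfolding hproj_def by (simp add: emult_minus)
      then show "W x = 0" using hproj_id[OF Wh We] unfolding m_def by simp
    qed
    have "W x = 0" for x
      using W0 SerD_curve(4)[OF U1, of x] SerD_curve(4)[OF V1, of x] unfolding W_def by (cases "x \<in> D") auto
    then have "W = (\<lambda>_. 0)" by auto
    then have "U (- int m) - V (- int m) = 0" using d by (simp add: zero_prod_def zero_fun_def)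
    then have Um: "U (- int m) = V (- int m)" by simp
    then have "U k = V k" if "- int (Suc m) < k" for k
      using agree[of k] Um that by (cases "k = - int m") auto
    then show ?case unfolding m_def by blast
  qed
  have "U k = V k" for k using claim[of "nat (- k)"] by auto
  then show ?thesis by auto
qed

text \<open>The term with \<open>solve\<close> moves the component of degree \<open>1 - n\<close>
  into the Heisenberg part. The added vectors of degree \<open>- n\<close> commute with Lambda_1 for
  n > 1, so they are free to enforce the normalization: the required pairing with
  \<open>Lam G (int n, a)\<close> is the old defect divided by \<open>n\<close>, and h converts
  pairings into coefficients. For \<open>n = 1\<close> the sum is empty, because the bracket with
  Lambda_1 would put a multiple of c into degree 0.\<close>

definition dress_step :: "(real \<Rightarrow> 'g) \<Rightarrow> nat \<Rightarrow> 'g dser \<Rightarrow> 'g dop" where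
  "dress_step Q n V = (0, \<lambda>x. - solve (1 - int n) (snd (dop.expo (dop.sbr (- V)) (Lser Q) (1 - int n)) x) +
     (\<Sum>a<(if n = 1 then 0 else emult G (int n)).
       sc ((fm dd (snd (dressed V (int n, a) 0) x) / of_nat n +
            fm (solve (1 - int n) (snd (dop.expo (dop.sbr (- V)) (Lser Q) (1 - int n)) x)) (Lam G (int n, a))) / cox_c)
         (Lam G (- int n, a))))"

lemma smooth_form_right: "smc P \<Longrightarrow> smooth_scalar D (\<lambda>x. fm X (P x))"
  by (rule smooth_curve_functional[OF _ linear_form])

lemma smooth_form_left: "smc P \<Longrightarrow> smooth_scalar D (\<lambda>x. fm (P x) X)"
  using smooth_form_right[of P X] by (simp add: form_sym[of X])

lemma smc_term0: "smooth_scalar D u \<Longrightarrow> (\<And>x. x \<notin> D \<Longrightarrow> u x = 0) \<Longrightarrow> smc (\<lambda>x. sc (u x) v)"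
proof -
  assume u: "smooth_scalar D u" "\<And>x. x \<notin> D \<Longrightarrow> u x = 0"
  then have "(\<lambda>x. sc (u x) v) = restr D (\<lambda>x. sc (u x) v)" unfolding restr_def by auto
  then show ?thesis using smooth_curve_term[OF u(1), of v] by simp
qed

lemma dressed_Ser: "V \<in> dop.Ser (-1) \<Longrightarrow> p \<in> exponents G \<Longrightarrow> dressed V p \<in> dop.Ser (fst p)"
  unfolding dressed_def by (rule dop.expo_Ser[OF _ Pser_Ser])

lemma dress_step_CC:
  assumes Q: "B_curve G D Q" and V: "V \<in> dop.Ser (-1)"
  shows "dress_step Q (Suc n) V \<in> CC (- int (Suc n))"
proof -
  define m where "m = Suc n"
  let ?E = "dop.expo (dop.sbr (- V)) (Lser Q)"
  have E: "?E \<in> dop.Ser 1" by (rule dop.expo_Ser[OF dop.Ser_minus[OF V] B_curve_Lser[OF Q]])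
  note Es = SerD_curve[OF E, of "1 - int m"]
  interpret sl: Vector_Spaces.linear sc sc "solve (1 - int m)" by (rule linear_solve)
  have S: "smc (\<lambda>x. solve (1 - int m) (snd (?E (1 - int m)) x))"
    by (rule smooth_curve_linear[OF Es(1) linear_solve])
  have t: "smc (\<lambda>x. sc ((fm dd (snd (dressed V (int m, a) 0) x) / of_nat m +
            fm (solve (1 - int m) (snd (?E (1 - int m)) x)) (Lam G (int m, a))) / cox_c) (Lam G (- int m, a)))"
    if "a < emult G (int m)" for a
  proof (rule smc_term0)
    have p: "(int m, a) \<in> exponents G" using that by (simp add: exponents_pair)
    note R = SerD_curve[OF dressed_Ser[OF V p], of 0]
    have "smooth_scalar D (\<lambda>x. (1 / of_nat m / cox_c) * fm dd (snd (dressed V (int m, a) 0) x) +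
        (1 / cox_c) * fm (solve (1 - int m) (snd (?E (1 - int m)) x)) (Lam G (int m, a)))"
      by (intro smooth_scalar_add smooth_scalar_mult smooth_scalar_const smooth_form_right[OF R(1)] smooth_form_left[OF S])
    then show "smooth_scalar D (\<lambda>x. (fm dd (snd (dressed V (int m, a) 0) x) / of_nat m +
            fm (solve (1 - int m) (snd (?E (1 - int m)) x)) (Lam G (int m, a))) / cox_c)"
      by (simp add: add_divide_distrib divide_divide_eq_left mult.commute)
    fix x assume "x \<notin> D"
    then show "(fm dd (snd (dressed V (int m, a) 0) x) / of_nat m +
            fm (solve (1 - int m) (snd (?E (1 - int m)) x)) (Lam G (int m, a))) / cox_c = 0"
      using SerD_curve(4)[OF E] SerD_curve(4)[OF dressed_Ser[OF V p]] by (simp add: sl.zero)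
  qed
  have "smc (snd (dress_step Q m V))" unfolding dress_step_def snd_conv
    by (intro smooth_curve_add smc_minus S smooth_curve_sum t) (auto split: if_splits)
  moreover have "snd (dress_step Q m V) x \<in> Eig (- int m)" for x
    unfolding dress_step_def snd_conv
  proof (intro vs.subspace_add[OF subspace_Eig] vs.subspace_neg[OF subspace_Eig]
      vs.subspace_sum[OF subspace_Eig] vs.subspace_scale[OF subspace_Eig])
    show "solve (1 - int m) (snd (?E (1 - int m)) x) \<in> Eig (- int m)" using solve_Eig[of "1 - int m"] by simp
    fix a assume "a \<in> {..<(if m = 1 then 0 else emult G (int m))}"
    then have "(- int m, a) \<in> exponents G" by (auto simp: exponents_pair emult_minus split: if_splits)
    then show "Lam G (- int m, a) \<in> Eig (- int m)" using Lam_Eig by fastforce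
  qed
  moreover have "fst (dress_step Q m V) = 0" unfolding dress_step_def by simp
  ultimately show ?thesis unfolding CC_iff m_def by simp
qed

definition dress_ser :: "(real \<Rightarrow> 'g) \<Rightarrow> 'g dser" where
  "dress_ser Q = dop.rec_ser (dress_step Q)"

lemma dress_ser_Ser: "B_curve G D Q \<Longrightarrow> dress_ser Q \<in> dop.Ser (-1)"
  unfolding dress_ser_def by (rule dop.rec_ser_Ser) (rule dress_step_CC)

lemma dress_ser_dressing:
  assumes Q: "B_curve G D Q" shows "is_dressing Q (dress_ser Q)"
proof -
  define U where "U = dress_ser Q"
  have U: "U \<in> dop.Ser (-1)" unfolding U_def by (rule dress_ser_Ser[OF Q])
  define V where "V n = dop.rec_prefix (dress_step Q) n" for n
  have V: "V n \<in> dop.Ser (-1)" for n unfolding V_def by (rule dop.rec_prefix_Ser) (rule dress_step_CC[OF Q])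
  have V0: "V 0 = (\<lambda>_. 0)" unfolding V_def by simp
  define W where "W n = snd (dress_step Q (Suc n) (V n))" for n
  have step: "U (- int (Suc n)) - V n (- int (Suc n)) = (0, W n)" for n
    unfolding U_def dress_ser_def dop.rec_ser_step V_def W_def by (simp add: dop.rec_prefix_outside dress_step_def)
  have agree: "U k = V n k" if "- int (Suc n) < k" for k n
    unfolding U_def dress_ser_def V_def using dop.rec_prefix_inside[of n k] that by simp
  let ?E = "\<lambda>V. dop.expo (dop.sbr (- V)) (Lser Q)"
  have E: "?E V \<in> dop.Ser 1" if "V \<in> dop.Ser (-1)" for V
    by (rule dop.expo_Ser[OF dop.Ser_minus[OF that] B_curve_Lser[OF Q]])
  have W_Eig: "W n x \<in> Eig (- int (Suc n))" for n x
    using dress_step_CC[OF Q V, of n n] unfolding W_def CC_iff by blast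
  have EU: "snd (?E U (- int n)) x = snd (?E (V n) (- int n)) x + br (Lam1 G) (W n x)"
    and EUf: "fst (?E U (- int n)) = fst (?E (V n) (- int n))" if x: "x \<in> D" for n x
  proof -
    have d': "(- U) (- int (Suc n)) - (- V n) (- int (Suc n)) = (0, \<lambda>x. - W n x)"
      using arg_cong[OF step[of n], of uminus] by (simp add: fun_Compl_def)
    have e: "?E U (1 - int (Suc n)) - ?E (V n) (1 - int (Suc n)) =
        op_brk G D ((- U) (- int (Suc n)) - (- V n) (- int (Suc n))) (Lser Q 1)"
      by (rule dop.expo_update(2)[OF dop.Ser_minus[OF U] dop.Ser_minus[OF V] B_curve_Lser[OF Q]])
        (use agree in auto)
    have "snd (?E U (- int n)) x - snd (?E (V n) (- int n)) x = snd (?E U (1 - int (Suc n)) - ?E (V n) (1 - int (Suc n))) x" by simp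
    also have "\<dots> = - br (W n x) (Lam1 G)"
      unfolding e d' using x by (simp add: Lser_apply snd_op_brk_L br_minus_left)
    finally show "snd (?E U (- int n)) x = snd (?E (V n) (- int n)) x + br (Lam1 G) (W n x)"
      using br_anti[of "Lam1 G" "W n x"] by (simp add: algebra_simps)
    have "fst (?E U (1 - int (Suc n)) - ?E (V n) (1 - int (Suc n))) = 0" unfolding e op_brk_pair by simp
    then show "fst (?E U (- int n)) = fst (?E (V n) (- int n))" by simp
  qed
  have E0: "?E (V 0) = Lser Q"
    unfolding V0 using dop.expo_zero[OF B_curve_Lser[OF Q]] by (simp add: fun_Compl_def)
  have W0: "W 0 x = - solve 0 (Q x)" for x
    unfolding W_def dress_step_def snd_conv One_nat_def[symmetric] E0 by (simp add: Lser_apply)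
  have brW0: "br (Lam1 G) (W 0 x) = - Q x" for x
    unfolding W0 br_minus_right using br_solve[of 0 "Q x"] B_curve_facts(2)[OF Q] by (simp add: hproj_def)
  have WS: "W (Suc n) x = - solve (- int (Suc n)) (snd (?E (V (Suc n)) (- int (Suc n))) x) +
     (\<Sum>a<emult G (int (Suc (Suc n))).
       sc ((fm dd (snd (dressed (V (Suc n)) (int (Suc (Suc n)), a) 0) x) / of_nat (Suc (Suc n)) +
            fm (solve (- int (Suc n)) (snd (?E (V (Suc n)) (- int (Suc n))) x)) (Lam G (int (Suc (Suc n)), a))) / cox_c)
         (Lam G (- int (Suc (Suc n)), a)))" for n x
    unfolding W_def dress_step_def snd_conv by (simp add: algebra_simps del: of_nat_Suc) (simp add: algebra_simps)
  have EUS: "snd (?E U (- int (Suc n))) x \<in> heis G" if x: "x \<in> D" for n x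
  proof -
    let ?e = "snd (?E (V (Suc n)) (- int (Suc n))) x"
    have e: "?e \<in> Eig (- int (Suc n))" by (rule SerD_curve(2)[OF E[OF V]])
    have z: "br (Lam1 G) (Lam G (- int (Suc (Suc n)), a)) = 0" if "a < emult G (int (Suc (Suc n)))" for a
    proof -
      have p: "(- int (Suc (Suc n)), a) \<in> exponents G" using that by (simp add: exponents_pair emult_minus del: of_nat_Suc)
      show ?thesis using br_Lam1_zero[OF Lam_heis[OF p] Lam_Eig[OF p]] by simp
    qed
    have "br (Lam1 G) (W (Suc n) x) = - (?e - hproj (- int (Suc n)) ?e)"
      unfolding WS br_add_right br_minus_right br_sum_right br_scale_right
      using br_solve[of "- int (Suc n)" ?e] e z by (simp del: of_nat_Suc)
    then have "snd (?E U (- int (Suc n))) x = hproj (- int (Suc n)) ?e" using EU[OF x, of "Suc n"] by simp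
    then show ?thesis using hproj_heis by simp
  qed
  define H where "H = (\<lambda>k. if k < 0 then ?E U k else 0)"
  have H: "H \<in> dop.Ser (-1)" unfolding H_def
    by (rule dop.SerI) (auto intro: dop.SerD(1)[OF E[OF U]])
  have "snd (H k) x \<in> heis G" for k x
  proof (cases "k < 0 \<and> x \<in> D")
    case True
    then obtain n where "k = - int (Suc n)" by (metis neg_int_cases gr0_implies_Suc)
    then show ?thesis using EUS True unfolding H_def by auto
  next
    case False
    then have "snd (H k) x = 0" using SerD_curve(4)[OF H] dop.SerD(2)[OF H, of k] by (cases "k < 0") auto
    then show ?thesis using vs.subspace_0[OF subspace_heis] by simp
  qed
  moreover have "?E U = Lser (\<lambda>_. 0) + H"
  proof
    fix k :: int
    consider "k > 1" | "k = 1" | "k = 0" | "k < 0" by linarith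
    then show "?E U k = (Lser (\<lambda>_. 0) + H) k"
    proof cases
      case 1 then show ?thesis using dop.SerD(2)[OF E[OF U]] by (simp add: H_def Lser_apply)
    next
      case 2 then show ?thesis using dop.expo_lead[OF dop.Ser_minus[OF U] B_curve_Lser[OF Q]]
        by (simp add: H_def Lser_apply)
    next
      case 3
      have s: "snd (?E U 0) x = 0" for x
      proof (cases "x \<in> D")
        case True then show ?thesis using EU[OF True, of 0] E0 brW0 by (simp add: Lser_apply)
      next
        case False then show ?thesis using SerD_curve(4)[OF E[OF U]] by simp
      qed
      have f: "fst (?E U 0) = 1"
      proof -
        have "dop.expo (dop.sbr (- U)) (Lser Q) (1 - 1) = Lser Q (1 - 1) + op_brk G D ((- U) (-1)) (Lser Q 1)"
          by (rule dop.expo_second[OF dop.Ser_minus[OF U] B_curve_Lser[OF Q]])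
        then show ?thesis by (simp add: Lser_apply op_brk_pair)
      qed
      have "?E U 0 = (1, \<lambda>_. 0)" using s f by (simp add: prod_eq_iff fun_eq_iff)
      then show ?thesis using 3 by (simp add: H_def Lser_apply)
    next
      case 4 then show ?thesis by (simp add: H_def Lser_apply)
    qed
  qed
  moreover have "fm dd (snd (dressed U p 0) x) = 0" if p: "p \<in> pos_exponents G" and x: "x \<in> D" for p x
  proof -
    obtain n a where pe: "p = (int (Suc n), a)"
      using pos_exponentsD(2)[OF p] by (metis gr0_implies_Suc pos_int_cases prod.collapse)
    have pE: "p \<in> exponents G" using pos_exponentsD(1)[OF p] .
    have a: "a < emult G (int (Suc n))" using pE unfolding pe by (simp add: exponents_pair)
    have e: "dressed U p (int (Suc n) - int (Suc n)) - dressed (V n) p (int (Suc n) - int (Suc n)) =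
        op_brk G D (U (- int (Suc n)) - V n (- int (Suc n))) (Pser p (int (Suc n)))"
      unfolding dressed_def
      by (rule dop.expo_update(2)[OF U V]) (use agree Pser_Ser[OF pE] pe in auto)
    have "snd (dressed U p 0) x - snd (dressed (V n) p 0) x =
        snd (dressed U p (int (Suc n) - int (Suc n)) - dressed (V n) p (int (Suc n) - int (Suc n))) x" by simp
    also have "\<dots> = br (W n x) (Lam G p)"
      unfolding e step using x pe by (simp add: Pser_apply snd_op_brk_L)
    finally have f1: "fm dd (snd (dressed U p 0) x) = fm dd (snd (dressed (V n) p 0) x) + fm dd (br (W n x) (Lam G p))"
      by (metis add.commute diff_add_cancel form_add_right)
    have f2: "fm dd (br (W n x) (Lam G p)) = - of_nat (Suc n) * fm (W n x) (Lam G p)"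
      using form_dd_br[OF W_Eig, of n x "Lam G p"] by simp
    show ?thesis
    proof (cases n)
      case 0
      \<comment> \<open>For the exponent 1 the normalization holds automatically: the degree 0
        component of the dressed Lambda_1 is \<open>Q\<close>, which is orthogonal to
        \<open>dd\<close>.\<close>
      then have p1: "p = (1, 0)" using a pe emult_1 by simp
      have "dressed (V 0) p = Pser p" unfolding dressed_def V0 by (rule dop.expo_zero[OF Pser_Ser[OF pE]])
      then have "fm dd (snd (dressed (V 0) p 0) x) = 0" by (simp add: Pser_apply p1)
      moreover have "br (W 0 x) (Lam1 G) = Q x" using brW0[of x] br_anti[of "W 0 x" "Lam1 G"] by simp
      then have "fm dd (br (W 0 x) (Lam G p)) = 0" using B_curve_facts(3)[OF Q] p1 by simp
      ultimately show ?thesis using f1 0 by simp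
    next
      case (Suc m)
      let ?r = "snd (dressed (V (Suc m)) p 0) x" and ?s = "solve (- int (Suc m)) (snd (?E (V (Suc m)) (- int (Suc m))) x)"
      have L: "fm (Lam G (- int (Suc (Suc m)), a')) (Lam G p) = (if a' = a then cox_c else 0)"
        if "a' < emult G (int (Suc (Suc m)))" for a'
        using form_Lam[of "(- int (Suc (Suc m)), a')" p] pE pe that Suc
        by (simp add: exponents_pair emult_minus del: of_nat_Suc)
      have "fm (W n x) (Lam G p) = - fm ?s (Lam G p) + (\<Sum>a'<emult G (int (Suc (Suc m))).
         if a' = a then fm dd (snd (dressed (V (Suc m)) (int (Suc (Suc m)), a) 0) x) / of_nat (Suc (Suc m)) +
            fm ?s (Lam G (int (Suc (Suc m)), a)) else 0)"
        unfolding Suc WS form_add_left form_minus_left form_sum_left form_scale_left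
        by (intro arg_cong2[of _ _ _ _ "(+)"] refl sum.cong) (use L cox_nz in \<open>auto simp del: of_nat_Suc\<close>)
      also have "\<dots> = fm dd ?r / of_nat (Suc (Suc m))"
        using a Suc pe by (simp del: of_nat_Suc)
      finally have "fm (W n x) (Lam G p) = fm dd ?r / of_nat (Suc n)" using Suc by simp
      then show ?thesis using f1 f2 Suc by (simp del: of_nat_Suc)
    qed
  qed
  ultimately show ?thesis unfolding is_dressing_def U_def[symmetric] using U H by blast
qed

lemma dress_eq: "B_curve G D Q \<Longrightarrow> dress G D Q = (\<lambda>k. snd (dress_ser Q k))"
proof -
  assume Q: "B_curve G D Q"
  have c: "curve_ser (\<lambda>k. snd (dress_ser Q k)) = dress_ser Q" by (rule curve_ser_snd[OF dress_ser_Ser[OF Q]])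
  show ?thesis unfolding dress_def
  proof (rule the_equality)
    show "dressing G D Q (\<lambda>k. snd (dress_ser Q k))" unfolding dressing_iff[OF Q] c by (rule dress_ser_dressing[OF Q])
    fix U assume "dressing G D Q U"
    then have "curve_ser U = dress_ser Q"
      unfolding dressing_iff[OF Q] using dressing_unique[OF Q] dress_ser_dressing[OF Q] by blast
    then show "U = (\<lambda>k. snd (dress_ser Q k))" by (metis curve_ser_def snd_conv ext)
  qed
qed

lemma curve_ser_dress: "B_curve G D Q \<Longrightarrow> curve_ser (dress G D Q) = dress_ser Q"
  using dress_eq curve_ser_snd[OF dress_ser_Ser] by simp

section \<open>Components of the Lax equation\<close>

definition derived_ops :: "'g dop set" where
  "derived_ops = {Z. fst Z = 0 \<and> (\<forall>x. snd Z x \<in> derived_algebra G)}"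

lemma derived_ops_sum: "(\<And>i. i \<in> S \<Longrightarrow> F i \<in> derived_ops) \<Longrightarrow> sum F S \<in> derived_ops"
proof (induction S rule: infinite_finite_induct)
  case (insert i S)
  then show ?case unfolding derived_ops_def by (auto intro: vs.subspace_add[OF subspace_derived])
qed (auto simp: derived_ops_def vs.subspace_0[OF subspace_derived])

lemma derived_ops_scale: "Z \<in> derived_ops \<Longrightarrow> op_scale G a Z \<in> derived_ops"
  unfolding derived_ops_def op_scale_pair by (auto intro: vs.subspace_scale[OF subspace_derived])

text \<open>Every term is a bracket of curves or starts from a Heisenberg vector. In degree 0 this
  excludes \<open>dd\<close>, which will place the degree 0 component of \<open>M\<close> in
  \<open>Hspan\<close>.\<close>

lemma dressed_derived:
  assumes V: "V \<in> dop.Ser (-1)" and p: "p \<in> exponents G"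
  shows "dressed V p k \<in> derived_ops"
proof -
  have fV: "fst (V i) = 0" for i
    using SerD_curve(3)[OF V] dop.SerD(2)[OF V] by (cases "i < 0") auto
  have "(dop.sbr V ^^ n) (Pser p) k \<in> derived_ops" for n k
  proof (induction n arbitrary: k)
    case 0
    then show ?case using Lam_heis[OF p] heis_derived vs.subspace_0[OF subspace_derived]
      by (auto simp: derived_ops_def Pser_apply restr_def)
  next
    case (Suc n)
    let ?W = "(dop.sbr V ^^ n) (Pser p)"
    have "op_brk G D (V i) (?W (k - i)) \<in> derived_ops" for i
      using Suc[of "k - i"] fV[of i] unfolding derived_ops_def op_brk_pair by (auto simp: br_derived)
    then have "dop.sbr V ?W k \<in> derived_ops" unfolding dop.sbr_def[of V ?W] by (intro derived_ops_sum)
    then show ?case by simp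
  qed
  then show ?thesis unfolding dressed_def dop.expo_def by (intro derived_ops_sum derived_ops_scale)
qed

lemma sbr_Pser:
  assumes Z: "Z \<in> dop.Ser K" and p: "p \<in> exponents G"
  shows "dop.sbr Z (Pser p) k = op_brk G D (Z (k - fst p)) (0, restr D (\<lambda>_. Lam G p))"
proof -
  have "op_brk G D (Z i) (Pser p (k - i)) =
      (if i = k - fst p then op_brk G D (Z i) (0, restr D (\<lambda>_. Lam G p)) else 0)" for i
    using dop.b_zero_right[OF dop.SerD(1)[OF Z]] by (auto simp: Pser_apply)
  then show ?thesis unfolding dop.sbr_Sum_any by simp
qed

lemma sbr_Lser:
  assumes Q: "B_curve G D Q" and W: "W \<in> dop.Ser K"
  shows "dop.sbr (Lser Q) W k = op_brk G D (1, Q) (W k) + op_brk G D (0, restr D (\<lambda>_. Lam1 G)) (W (k - 1))"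
proof -
  have "dop.sbr (Lser Q) W k = (\<Sum>i\<in>{0, 1}. op_brk G D (Lser Q i) (W (k - i)))"
    unfolding dop.sbr_Sum_any
    by (rule Sum_any.expand_superset) (use dop.b_zero_left[OF dop.SerD(1)[OF W]] in \<open>auto simp: Lser_apply split: if_splits\<close>)
  then show ?thesis by (simp add: Lser_apply)
qed

text \<open>Pulled back by the dressing, the bracket of the operator with the dressed Lambda_p
  becomes the bracket of a Heisenberg-valued operator with Lambda_p. That is a multiple of c, so it
  sits in degree 0 and is fixed by the exponential; all other degrees give exact equations.\<close>

lemma dressed_lax:
  assumes Q: "B_curve G D Q" and V: "is_dressing Q V" and p: "p \<in> pos_exponents G" and k: "k \<noteq> 0" and x: "x \<in> D"
  shows "cd (snd (dressed V p k)) x + br (Q x) (snd (dressed V p k) x) +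
    br (Lam1 G) (snd (dressed V p (k - 1)) x) = 0"
proof -
  have V1: "V \<in> dop.Ser (-1)" using V unfolding is_dressing_def by blast
  have pE: "p \<in> exponents G" "0 < fst p" using pos_exponentsD[OF p] by auto
  obtain H where H: "H \<in> dop.Ser (-1)" "\<forall>k x. snd (H k) x \<in> heis G"
    "dop.expo (dop.sbr (- V)) (Lser Q) = Lser (\<lambda>_. 0) + H"
    using V unfolding is_dressing_def by blast
  define Z where "Z = Lser (\<lambda>_. 0) + H"
  have Z: "Z \<in> dop.Ser 1" unfolding Z_def H(3)[symmetric]
    by (rule dop.expo_Ser[OF dop.Ser_minus[OF V1] B_curve_Lser[OF Q]])
  have EZ: "dop.expo (dop.sbr V) Z = Lser Q"
    unfolding Z_def H(3)[symmetric] using dop.expo_inverse[OF dop.Ser_minus[OF V1] B_curve_Lser[OF Q]] by simp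
  define Y where "Y = dop.sbr Z (Pser p)"
  have Y: "Y \<in> dop.Ser (1 + fst p)" unfolding Y_def by (rule dop.sbr_Ser[OF Z Pser_Ser[OF pE(1)]])
  have Yk: "Y k = op_brk G D (Z (k - fst p)) (0, restr D (\<lambda>_. Lam G p))" for k
    unfolding Y_def by (rule sbr_Pser[OF Z pE(1)])
  have Ycc: "snd (Y k) x \<in> vs.span {cc}" for k x
  proof -
    have "snd (Y k) x = br (snd (Z (k - fst p)) x) (restr D (\<lambda>_. Lam G p) x)"
      unfolding Yk op_brk_pair snd_conv cd_const by simp
    moreover have "snd (Z j) x \<in> heis G" for j
      using H(2) Lam1_heis vs.subspace_0[OF subspace_heis] vs.subspace_add[OF subspace_heis]
      unfolding Z_def by (simp add: Lser_apply restr_def)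
    moreover have "restr D (\<lambda>_. Lam G p) x \<in> heis G"
      using Lam_heis[OF pE(1)] vs.subspace_0[OF subspace_heis] by (simp add: restr_def)
    ultimately show ?thesis using heis_br by simp
  qed
  have Y0: "Y j = 0" if "j \<noteq> 0" for j
    using span_cc_Eig[OF Ycc SerD_curve(2)[OF Y]] SerD_curve(3)[OF Y that] that
    by (simp add: prod_eq_iff fun_eq_iff)
  have "fst (Y 0) = 0" unfolding Yk op_brk_pair by simp
  have "dop.sbr V Y = 0"
  proof
    fix j
    have "op_brk G D (V i) (Y (j - i)) = 0" for i
    proof (cases "j = i")
      case True
      have fV: "fst (V i) = 0" using SerD_curve(3)[OF V1] dop.SerD(2)[OF V1] by (cases "i < 0") auto
      have "br (snd (V i) t) (snd (Y 0) t) = 0" for t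
        using Ycc[of 0 t] by (auto simp: span_cc br_scale_right)
      then show ?thesis unfolding op_brk_pair using True fV \<open>fst (Y 0) = 0\<close>
        by (simp add: zero_prod_def zero_fun_def)
    next
      case False
      then show ?thesis using Y0[of "j - i"] dop.b_zero_right[OF dop.SerD(1)[OF V1]] by simp
    qed
    then show "dop.sbr V Y j = 0 j" unfolding dop.sbr_def by simp
  qed
  then have "dop.expo (dop.sbr V) Y = Y" by (rule dop.expo_fixed[OF V1 Y])
  moreover have "dop.expo (dop.sbr V) Y = dop.sbr (Lser Q) (dressed V p)"
    unfolding Y_def dop.expo_sbr[OF V1 Z Pser_Ser[OF pE(1)]] EZ dressed_def ..
  ultimately have "dop.sbr (Lser Q) (dressed V p) k = 0" using Y0[OF k] by simp
  then have s: "snd (op_brk G D (1, Q) (dressed V p k) + op_brk G D (0, restr D (\<lambda>_. Lam1 G)) (dressed V p (k - 1))) x = 0"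
    unfolding sbr_Lser[OF Q dressed_Ser[OF V1 pE(1)]] by simp
  have f: "fst (dressed V p j) = 0" for j using dressed_derived[OF V1 pE(1), of j] unfolding derived_ops_def by simp
  show ?thesis using s f[of k] f[of "k - 1"] x unfolding op_brk_pair by (simp add: restr_def)
qed

definition Rc :: "(real \<Rightarrow> 'g) \<Rightarrow> int \<times> nat \<Rightarrow> int \<Rightarrow> real \<Rightarrow> 'g" where
  "Rc Q p k = snd (dressed (dress_ser Q) p k)"

lemma snd_sum_apply: "snd (sum F S) x = (\<Sum>i\<in>S. snd (F i) x)"
  by (induction S rule: infinite_finite_induct) auto

lemma nonneg_part_eq:
  assumes "Z \<in> dop.Ser K" "K \<le> N" shows "snd (nonneg_part Z) x = (\<Sum>k\<in>{0..N}. snd (Z k) x)"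
proof -
  have "nonneg_part Z = (\<Sum>k\<in>{0..N}. Z k)" unfolding nonneg_part_def
  proof (rule sum.mono_neutral_left)
    show "{k. 0 \<le> k \<and> Z k \<noteq> 0} \<subseteq> {0..N}"
    proof
      fix k assume "k \<in> {k. 0 \<le> k \<and> Z k \<noteq> 0}"
      then show "k \<in> {0..N}" using dop.SerD(2)[OF assms(1), of k] assms(2) by (cases "k \<le> K") auto
    qed
  qed auto
  then show ?thesis by (simp add: snd_sum_apply)
qed

lemma dressed_Lam_eq:
  assumes Q: "B_curve G D Q" and p: "p \<in> pos_exponents G" and N: "fst p \<le> N"
  shows "dressed_Lam G D Q p x = (\<Sum>k\<in>{0..N}. Rc Q p k x)"
proof -
  have "dressed (dress_ser Q) p = exp_ser G (ser_brk G D (curve_ser (dress G D Q))) (homog (fst p) (0, restr D (\<lambda>_. Lam G p)))"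
    unfolding dressed_def Pser_def exp_ser_eq ser_brk_eq curve_ser_dress[OF Q] ..
  then show ?thesis unfolding dressed_Lam_def Rc_def
    using nonneg_part_eq[OF dressed_Ser[OF dress_ser_Ser[OF Q] pos_exponentsD(1)[OF p]] N] by simp
qed

lemma Rc_facts:
  assumes Q: "B_curve G D Q" and p: "p \<in> pos_exponents G"
  shows "smc (Rc Q p k)" "Rc Q p k x \<in> Eig k" "Rc Q p k x \<in> derived_algebra G" "fst p < k \<Longrightarrow> Rc Q p k x = 0"
    "fm dd (Rc Q p 0 x) = 0"
    "k \<noteq> 0 \<Longrightarrow> x \<in> D \<Longrightarrow> cd (Rc Q p k) x + br (Q x) (Rc Q p k x) + br (Lam1 G) (Rc Q p (k - 1) x) = 0"
proof -
  note S = dressed_Ser[OF dress_ser_Ser[OF Q] pos_exponentsD(1)[OF p]]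
  show "smc (Rc Q p k)" "Rc Q p k x \<in> Eig k" unfolding Rc_def by (rule SerD_curve[OF S])+
  show "Rc Q p k x \<in> derived_algebra G"
    using dressed_derived[OF dress_ser_Ser[OF Q] pos_exponentsD(1)[OF p], of k] unfolding Rc_def derived_ops_def by blast
  show "fst p < k \<Longrightarrow> Rc Q p k x = 0" unfolding Rc_def using dop.SerD(2)[OF S] by simp
  show "fm dd (Rc Q p 0 x) = 0"
    using dress_ser_dressing[OF Q] p SerD_curve(4)[OF S, of x 0] unfolding is_dressing_def Rc_def by (cases "x \<in> D") auto
  show "k \<noteq> 0 \<Longrightarrow> x \<in> D \<Longrightarrow> cd (Rc Q p k) x + br (Q x) (Rc Q p k x) + br (Lam1 G) (Rc Q p (k - 1) x) = 0"
    unfolding Rc_def by (rule dressed_lax[OF Q dress_ser_dressing[OF Q] p])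
qed

text \<open>The degree 0 part of the dressing equation says that \<open>Q\<close> is the bracket of
  the degree -1 component of U with Lambda_1, and this bracket is also the degree 0 part of the
  dressed Lambda_1.\<close>

lemma Rc_one:
  assumes Q: "B_curve G D Q" and x: "x \<in> D"
  shows "Rc Q (1, 0) 1 x = Lam1 G" "Rc Q (1, 0) 0 x = Q x"
proof -
  define U where "U = dress_ser Q"
  have U: "U \<in> dop.Ser (-1)" unfolding U_def by (rule dress_ser_Ser[OF Q])
  note P1 = Pser_Ser[OF one_exponent(1), simplified]
  show "Rc Q (1, 0) 1 x = Lam1 G"
    unfolding Rc_def dressed_def U_def[symmetric] dop.expo_lead[OF U P1] using x by (simp add: Pser_apply restr_def)
  have 1: "snd (dressed U (1, 0) 0) x = br (snd (U (-1)) x) (Lam1 G)"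
    using dop.expo_second[OF U P1] SerD_curve(3)[OF U, of "-1"] x unfolding dressed_def
    by (simp add: Pser_apply op_brk_pair restr_def)
  have "is_dressing Q U" unfolding U_def by (rule dress_ser_dressing[OF Q])
  then obtain H where H: "H \<in> dop.Ser (-1)" "dop.expo (dop.sbr (- U)) (Lser Q) = Lser (\<lambda>_. 0) + H"
    unfolding is_dressing_def by blast
  have "snd (dop.expo (dop.sbr (- U)) (Lser Q) 0) x = 0"
    unfolding H(2) using dop.SerD(2)[OF H(1)] by (simp add: Lser_apply)
  moreover have "snd (dop.expo (dop.sbr (- U)) (Lser Q) (1 - 1)) x = Q x - br (snd (U (-1)) x) (Lam1 G)"
    unfolding dop.expo_second[OF dop.Ser_minus[OF U] B_curve_Lser[OF Q]]
    using SerD_curve(3)[OF U, of "-1"] x by (simp add: Lser_apply op_brk_pair restr_def br_minus_left)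
  ultimately show "Rc Q (1, 0) 0 x = Q x" unfolding Rc_def U_def[symmetric] 1 by simp
qed

end

context drinfeld_sokolov_data
begin

text \<open>The symmetry of the rescaled Cartan matrix converts the weight of a Cartan element on
  the \<open>i\<close>-th root vectors into a pairing with \<open>hh i\<close>, which is how theta_i
  is defined.\<close>

lemma br_Hspan_weight:
  assumes Q: "Q \<in> Hspan" and i: "i \<le> ll"
  shows "br Q (ff i) = sc (- (fm (hh i) Q / rat i)) (ff i)" "br Q (ee i) = sc (fm (hh i) Q / rat i) (ee i)"
proof -
  obtain q where q: "Q = (\<Sum>j\<le>ll. sc (q j) (hh j))" using Q Hspan_iff by blast
  have "fm (hh i) Q = (\<Sum>j\<le>ll. q j * aa j i) * rat i"
    unfolding q form_sum_right form_scale_right sum_distrib_right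
    by (rule sum.cong) (use i aa_sym in \<open>auto simp: form_hh mult.assoc\<close>)
  then have w: "fm (hh i) Q / rat i = (\<Sum>j\<le>ll. q j * aa j i)" using rat_nz[OF i] by simp
  show "br Q (ff i) = sc (- (fm (hh i) Q / rat i)) (ff i)"
    unfolding w unfolding q br_sum_left br_scale_left sum_negf[symmetric] vs.scale_sum_left
    by (rule sum.cong) (use i in \<open>auto simp: br_hf\<close>)
  show "br Q (ee i) = sc (fm (hh i) Q / rat i) (ee i)"
    unfolding w unfolding q br_sum_left br_scale_left vs.scale_sum_left
    by (rule sum.cong) (use i in \<open>auto simp: br_he\<close>)
qed

lemma br_Hspan_Hspan: "X \<in> Hspan \<Longrightarrow> Y \<in> Hspan \<Longrightarrow> br X Y = 0"
  unfolding Hspan_iff by (auto simp: br_sum_left br_sum_right br_scale_left br_scale_right br_hh intro!: sum.neutral)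

lemma br_ff_Lam1: "i \<le> ll \<Longrightarrow> br (ff i) (Lam1 G) = - sc (nu G) (hh i)"
  using br_ff_sum_ee[of i "\<lambda>_. 1"] unfolding Lam1_eq LS_sum by (simp add: br_scale_right)

lemma form_ff_Lam1: "i \<le> ll \<Longrightarrow> fm (ff i) (Lam1 G) = nu G * rat i"
proof -
  assume i: "i \<le> ll"
  have "fm (ff i) LS = (\<Sum>j\<le>ll. if i = j then rat j else 0)"
    unfolding Lam_sum_def form_sum_right by (rule sum.cong) (use i in \<open>auto simp: form_ff_ee\<close>)
  then show ?thesis unfolding Lam1_eq form_scale_right using i by simp
qed

lemma theta_eq: "i \<le> ll \<Longrightarrow> theta G Q i x = fm (hh i) (Q x) / rat i"
  unfolding theta_def label_ratio_def by simp

lemma sum_lab_theta: "Q x \<in> Hspan \<Longrightarrow> (\<Sum>i\<le>ll. of_nat (lab G i) * theta G Q i x) = 0"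
proof -
  assume Q: "Q x \<in> Hspan"
  have "of_nat (lab G i) * theta G Q i x = of_nat (dlab G i) * fm (hh i) (Q x)" if "i \<le> ll" for i
    unfolding theta_def using lab_pos[OF that] by simp
  then have "(\<Sum>i\<le>ll. of_nat (lab G i) * theta G Q i x) = fm cc (Q x)"
    unfolding central_def form_sum_left form_scale_left by (intro sum.cong) auto
  then show ?thesis using form_Hspan_cc[OF Q] form_sym by simp
qed

lemma derived_Eig0: "X \<in> derived_algebra G \<Longrightarrow> X \<in> Eig 0 \<Longrightarrow> X \<in> Hspan"
  using gdeg0 unfolding gdeg_def Eig_def by auto

end

section \<open>The function M and the reduced equation by components\<close>

locale ds_red = ds_open G D for G :: "'g::ab_group_add affine_data" and D +
  fixes b :: "int \<times> nat \<Rightarrow> complex"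
  assumes fin: "finite {p \<in> pos_exponents G. b p \<noteq> 0}"
begin

definition PS where "PS = {p. p \<in> pos_exponents G \<and> (b p \<noteq> 0 \<or> p = (1, 0))}"

lemma PS: "finite PS" "p \<in> PS \<Longrightarrow> p \<in> pos_exponents G" "(1, 0) \<in> PS"
proof -
  have "PS \<subseteq> insert (1, 0) {p \<in> pos_exponents G. b p \<noteq> 0}" unfolding PS_def by auto
  then show "finite PS" using fin finite_subset by blast
qed (use one_exponent(2) in \<open>auto simp: PS_def\<close>)

abbreviation "rh \<equiv> complex_of_nat (twist G) * complex_of_nat (cox G)"

lemma rh_nz: "rh \<noteq> 0" using twist_pos cox_pos by simp

definition coef :: "int \<times> nat \<Rightarrow> real \<Rightarrow> complex" where
  "coef p x = b p - (if p = (1, 0) then 1 else 0) / rh * complex_of_real x"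

lemma smooth_coef: "smooth_scalar D (coef p)"
proof -
  have "smooth_scalar D (\<lambda>x. b p + - ((if p = (1, 0) then 1 else 0) / rh) * complex_of_real x)"
    by (intro smooth_scalar_add smooth_scalar_mult) auto
  then show ?thesis unfolding coef_def by simp
qed

lemma deriv_coef: "vector_derivative (coef p) (at x) = (if p = (1, 0) then - 1 / rh else 0)"
proof (rule vector_derivative_at)
  have "(complex_of_real has_vector_derivative 1) (at x)"
    using has_vector_derivative_of_real[OF DERIV_ident] by simp
  then have "((\<lambda>x. (if p = (1, 0) then 1 else 0) / rh * complex_of_real x) has_vector_derivative
      (if p = (1, 0) then 1 else 0) / rh * 1) (at x)" by (rule has_vector_derivative_mult_right)
  then have "((\<lambda>x. b p - (if p = (1, 0) then 1 else 0) / rh * complex_of_real x) has_vector_derivative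
      0 - (if p = (1, 0) then 1 else 0) / rh * 1) (at x)"
    by (intro has_vector_derivative_diff has_vector_derivative_const)
  then show "(coef p has_vector_derivative (if p = (1, 0) then - 1 / rh else 0)) (at x)"
    unfolding coef_def by (auto split: if_splits)
qed

definition Mc :: "(real \<Rightarrow> 'g) \<Rightarrow> int \<Rightarrow> real \<Rightarrow> 'g" where
  "Mc Q k x = sc rh (\<Sum>p\<in>PS. sc (coef p x) (Rc Q p k x))"

text \<open>A bound for the degrees occurring in \<open>M\<close>: exponents in \<open>PS\<close>
  are positive, so their sum dominates each of them. As the exponent 1 is always present, degrees 0
  and 1 lie in the range.\<close>

definition NN :: int where "NN = (\<Sum>p\<in>PS. fst p)"

lemma NN: "p \<in> PS \<Longrightarrow> fst p \<le> NN" "1 \<le> NN"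
proof -
  show a: "p \<in> PS \<Longrightarrow> fst p \<le> NN" for p unfolding NN_def
    by (rule member_le_sum) (use PS(1) pos_exponentsD(2)[OF PS(2)] in \<open>auto simp: less_imp_le\<close>)
  show "1 \<le> NN" using a[OF PS(3)] by simp
qed

lemma Mfun_eq:
  assumes Q: "B_curve G D Q" shows "Mfun G b D Q x = (\<Sum>k\<in>{0..NN}. Mc Q k x)"
proof -
  have "Mfun G b D Q x = sc rh (\<Sum>p\<in>PS. sc (coef p x) (dressed_Lam G D Q p x))"
    unfolding Mfun_def Let_def PS_def coef_def ..
  also have "\<dots> = sc rh (\<Sum>p\<in>PS. \<Sum>k\<in>{0..NN}. sc (coef p x) (Rc Q p k x))"
    by (intro arg_cong[of _ _ "sc rh"] sum.cong refl)
      (simp add: dressed_Lam_eq[OF Q PS(2) NN(1)] vs.scale_sum_right)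
  also have "\<dots> = (\<Sum>k\<in>{0..NN}. Mc Q k x)"
    unfolding Mc_def vs.scale_sum_right by (rule sum.swap)
  finally show ?thesis .
qed

lemma Mc_facts:
  assumes Q: "B_curve G D Q"
  shows "smc (Mc Q k)" "Mc Q k x \<in> Eig k" "Mc Q k x \<in> derived_algebra G" "NN < k \<Longrightarrow> Mc Q k x = 0"
    "fm dd (Mc Q 0 x) = 0" "Mc Q 0 x \<in> Hspan" "x \<notin> D \<Longrightarrow> Mc Q k x = 0"
    "k \<noteq> 0 \<Longrightarrow> x \<in> D \<Longrightarrow>
      cd (Mc Q k) x + br (Q x) (Mc Q k x) + br (Lam1 G) (Mc Q (k - 1) x) = - Rc Q (1, 0) k x"
proof -
  note R = Rc_facts[OF Q PS(2)]
  have t: "smc (\<lambda>x. sc (coef p x) (Rc Q p k x))" if "p \<in> PS" for p k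
    by (rule smooth_curve_scalar[OF R(1)[OF that] smooth_coef])
  show s: "smc (Mc Q k)" for k unfolding Mc_def by (intro smc_scale smooth_curve_sum t)
  show e: "Mc Q k x \<in> Eig k" "Mc Q k x \<in> derived_algebra G" for k x unfolding Mc_def
    by (intro vs.subspace_scale vs.subspace_sum subspace_Eig subspace_derived R; assumption)+
  show "NN < k \<Longrightarrow> Mc Q k x = 0" unfolding Mc_def using NN(1) R(4) by (force intro!: sum.neutral)
  show "fm dd (Mc Q 0 x) = 0" unfolding Mc_def by (simp add: form_scale_right form_sum_right R(5))
  show "Mc Q 0 x \<in> Hspan" using derived_Eig0[OF e(2) e(1)] .
  show "x \<notin> D \<Longrightarrow> Mc Q k x = 0" by (rule smooth_curve_outside[OF s])
  have cdM: "cd (Mc Q k) x = sc rh (\<Sum>p\<in>PS. sc (coef p x) (cd (Rc Q p k) x)) - Rc Q (1, 0) k x" for k x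
  proof -
    have "cd (Mc Q k) = (\<lambda>x. sc rh (cd (\<lambda>x. \<Sum>p\<in>PS. sc (coef p x) (Rc Q p k x)) x))"
      unfolding Mc_def by (rule cd_scale[OF smooth_curve_sum[OF t]])
    also have "\<dots> = (\<lambda>x. sc rh (\<Sum>p\<in>PS. sc (coef p x) (cd (Rc Q p k) x) + sc (vector_derivative (coef p) (at x)) (Rc Q p k x)))"
      using cd_sum[of PS "\<lambda>p x. sc (coef p x) (Rc Q p k x)", OF t] by (simp add: cd_scalar[OF R(1) smooth_coef])
    \<comment> \<open>Only the coefficient of the exponent 1 depends on \<open>x\<close>; its
      derivative \<open>- 1 / rh\<close> against the outer factor \<open>rh\<close> yields the
      single inhomogeneous term.\<close>
    also have "\<dots> = (\<lambda>x. sc rh (\<Sum>p\<in>PS. sc (coef p x) (cd (Rc Q p k) x)) + sc rh (\<Sum>p\<in>PS. if (1, 0) = p then sc (- 1 / rh) (Rc Q p k x) else 0))"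
      unfolding sum.distrib vs.scale_right_distrib deriv_coef
      by (intro ext arg_cong2[of _ _ _ _ "(+)"] arg_cong[of _ _ "sc rh"] refl sum.cong) auto
    also have "\<dots> = (\<lambda>x. sc rh (\<Sum>p\<in>PS. sc (coef p x) (cd (Rc Q p k) x)) - Rc Q (1, 0) k x)"
      using PS rh_nz by simp
    finally show ?thesis by (rule fun_cong)
  qed
  assume k: "k \<noteq> 0" and x: "x \<in> D"
  have "sc rh (\<Sum>p\<in>PS. sc (coef p x) (cd (Rc Q p k) x)) + br (Q x) (Mc Q k x) + br (Lam1 G) (Mc Q (k - 1) x) =
      sc rh (\<Sum>p\<in>PS. sc (coef p x) (cd (Rc Q p k) x + br (Q x) (Rc Q p k x) + br (Lam1 G) (Rc Q p (k - 1) x)))"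
    unfolding Mc_def by (simp add: br_scale_right br_sum_right vs.scale_right_distrib sum.distrib)
  also have "\<dots> = 0" using R(6)[OF _ k x] by simp
  finally show "cd (Mc Q k) x + br (Q x) (Mc Q k x) + br (Lam1 G) (Mc Q (k - 1) x) = - Rc Q (1, 0) k x"
    unfolding cdM by (simp add: algebra_simps)
qed

lemma smc_Mfun: "B_curve G D Q \<Longrightarrow> smc (Mfun G b D Q)"
proof -
  assume Q: "B_curve G D Q"
  have "Mfun G b D Q = (\<lambda>x. \<Sum>k\<in>{0..NN}. Mc Q k x)" using Mfun_eq[OF Q] by auto
  then show ?thesis using smooth_curve_sum[of "{0..NN}" D "Mc Q"] Mc_facts(1)[OF Q] by simp
qed

lemma form_Mfun:
  assumes Q: "B_curve G D Q" and X: "X \<in> Eig (- m)" and m: "0 \<le> m" "m \<le> NN"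
  shows "fm X (Mfun G b D Q x) = fm X (Mc Q m x)"
proof -
  have "fm X (Mfun G b D Q x) = (\<Sum>k\<in>{0..NN}. if k = m then fm X (Mc Q k x) else 0)"
    unfolding Mfun_eq[OF Q] form_sum_right
    by (rule sum.cong) (use form_Eig[OF X Mc_facts(2)[OF Q]] in auto)
  then show ?thesis using m by simp
qed

lemma chi_Mc: "B_curve G D Q \<Longrightarrow> i \<le> ll \<Longrightarrow> chi G (Mfun G b D Q) i x = rat i - fm (hh i) (Mc Q 0 x)"
  unfolding chi_def using form_Mfun[of Q "hh i" 0] Eig_gens(3)[of i] NN(2) by simp

lemma phi_Mc: "B_curve G D Q \<Longrightarrow> i \<le> ll \<Longrightarrow> phi G (Mfun G b D Q) i x = 1 / nu G * fm (ff i) (Mc Q 1 x)"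
  unfolding phi_def using form_Mfun[of Q "ff i" 1] Eig_gens(2)[of i] NN(2) by simp

lemma sum_dlab_chi:
  assumes Q: "B_curve G D Q"
  shows "(\<Sum>i\<le>ll. of_nat (dlab G i) * chi G (Mfun G b D Q) i x) = cox_c"
proof -
  have "(\<Sum>i\<le>ll. of_nat (dlab G i) * chi G (Mfun G b D Q) i x) =
      (\<Sum>i\<le>ll. of_nat (lab G i)) - (\<Sum>i\<le>ll. of_nat (dlab G i) * fm (hh i) (Mc Q 0 x))"
    unfolding sum_subtractf[symmetric]
    by (rule sum.cong) (use dlab_pos in \<open>auto simp: chi_Mc[OF Q] right_diff_distrib label_ratio_def\<close>)
  also have "(\<Sum>i\<le>ll. of_nat (dlab G i) * fm (hh i) (Mc Q 0 x)) = fm cc (Mc Q 0 x)"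
    unfolding central_def by (simp add: form_sum_left form_scale_left)
  also have "\<dots> = 0" using form_Hspan_cc[OF Mc_facts(6)[OF Q]] form_sym by simp
  finally show ?thesis unfolding cox_def by simp
qed

text \<open>For degrees at least 1 the equations of \<open>Mc_facts\<close> add up to
  \<open>- Lam1 G\<close>, from degree 1, and this cancels the \<open>Lam1 G\<close> produced by the
  bracket with \<open>- dd\<close>. In degree 0 the Cartan elements \<open>Q\<close> and
  \<open>Mc Q 0\<close> commute, so only the derivative is left.\<close>

lemma red_bracket:
  assumes Q: "B_curve G D Q"
  shows "op_brk G D (lax_L G D Q) (lax_M G D (Mfun G b D Q)) = (0, cd (Mc Q 0))"
proof -
  let ?M = "Mfun G b D Q"
  have M: "smc ?M" by (rule smc_Mfun[OF Q])
  have r: "restr D (\<lambda>x. - dd + ?M x) = (\<lambda>x. ?M x - restr D (\<lambda>_. dd) x)"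
    using smooth_curve_outside[OF M] unfolding restr_def by auto
  have cdr: "cd (restr D (\<lambda>x. - dd + ?M x)) = cd ?M"
    unfolding r cd_diff[OF M smooth_curve_const] cd_const by simp
  have e: "cd ?M x + br (restr D (\<lambda>x. Lam1 G + Q x) x) (restr D (\<lambda>x. - dd + ?M x) x) = cd (Mc Q 0) x" for x
  proof (cases "x \<in> D")
    case False
    then show ?thesis by (simp add: restr_def curve_deriv_outside)
  next
    case x: True
    have Mx: "?M x = (\<Sum>k\<in>{0..NN}. Mc Q k x)" by (rule Mfun_eq[OF Q])
    have cdM: "cd ?M x = (\<Sum>k\<in>{0..NN}. cd (Mc Q k) x)"
    proof -
      have "?M = (\<lambda>x. \<Sum>k\<in>{0..NN}. Mc Q k x)" using Mfun_eq[OF Q] by auto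
      then show ?thesis using cd_sum[of "{0..NN}" "Mc Q"] Mc_facts(1)[OF Q] by simp
    qed
    have I: "{0..NN} = insert 0 {1..NN}" using NN(2) by auto
    have d: "br (Lam1 G + Q x) dd = - Lam1 G"
      using br_anti[of "Lam1 G" dd] br_anti[of "Q x" dd] Lam1_Eig B_curve_facts(4)[OF Q, of x]
      by (simp add: br_add_left Eig_def)
    \<comment> \<open>Lambda_1 raises the degree, so its contribution is reindexed; the range must
      then reach \<open>NN + 1\<close>, where the component of \<open>M\<close> itself
      vanishes.\<close>
    have sh: "(\<Sum>k\<in>{0..NN}. br (Lam1 G) (Mc Q k x)) = (\<Sum>k\<in>{1..NN + 1}. br (Lam1 G) (Mc Q (k - 1) x))"
      by (rule sum.reindex_bij_witness[where i = "\<lambda>k. k - 1" and j = "\<lambda>k. k + 1"]) auto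
    have ext: "(\<Sum>k\<in>{1..NN + 1}. F k) = (\<Sum>k\<in>{1..NN}. F k) + F (NN + 1)" for F :: "int \<Rightarrow> 'g"
    proof -
      have "{1..NN + 1} = insert (NN + 1) {1..NN}" using NN(2) by auto
      then show ?thesis by (simp add: add.commute)
    qed
    have z: "cd (Mc Q (NN + 1)) x = 0" "Mc Q (NN + 1) x = 0"
    proof -
      show "Mc Q (NN + 1) x = 0" using Mc_facts(4)[OF Q] by simp
      have "Mc Q (NN + 1) = (\<lambda>_. 0)" using Mc_facts(4)[OF Q] by auto
      moreover have "cd (\<lambda>_. 0) = (\<lambda>_. 0)" by (rule cd_eqI) (auto intro: has_cd_zero)
      ultimately show "cd (Mc Q (NN + 1)) x = 0" by simp
    qed
    have e1: "br (Lam1 G + Q x) (- dd + ?M x) =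
        Lam1 G + ((\<Sum>k\<in>{0..NN}. br (Lam1 G) (Mc Q k x)) + (\<Sum>k\<in>{0..NN}. br (Q x) (Mc Q k x)))"
    proof -
      have "br (Lam1 G + Q x) (- dd + ?M x) = - br (Lam1 G + Q x) dd + br (Lam1 G + Q x) (?M x)"
        by (simp only: br_add_right br_minus_right)
      then show ?thesis unfolding d unfolding Mx br_add_left br_sum_right sum.distrib by simp
    qed
    have e2: "(\<Sum>k\<in>{1..NN + 1}. cd (Mc Q k) x + br (Q x) (Mc Q k x) + br (Lam1 G) (Mc Q (k - 1) x)) =
        (\<Sum>k\<in>{1..NN}. cd (Mc Q k) x) + (\<Sum>k\<in>{1..NN}. br (Q x) (Mc Q k x)) + (\<Sum>k\<in>{0..NN}. br (Lam1 G) (Mc Q k x))"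
      unfolding sum.distrib sh ext[of "\<lambda>k. cd (Mc Q k) x"] ext[of "\<lambda>k. br (Q x) (Mc Q k x)"] z by simp
    have e3: "(\<Sum>k\<in>{0..NN}. F k) = F 0 + (\<Sum>k\<in>{1..NN}. F k)" for F :: "int \<Rightarrow> 'g"
      unfolding I by simp
    have "cd ?M x + br (Lam1 G + Q x) (- dd + ?M x) =
        cd (Mc Q 0) x + br (Q x) (Mc Q 0 x) + Lam1 G +
        (\<Sum>k\<in>{1..NN + 1}. cd (Mc Q k) x + br (Q x) (Mc Q k x) + br (Lam1 G) (Mc Q (k - 1) x))"
      unfolding e1 e2 cdM e3[of "\<lambda>k. cd (Mc Q k) x"] e3[of "\<lambda>k. br (Q x) (Mc Q k x)"]
      by (simp add: add_ac)
    also have "(\<Sum>k\<in>{1..NN + 1}. cd (Mc Q k) x + br (Q x) (Mc Q k x) + br (Lam1 G) (Mc Q (k - 1) x)) =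
        (\<Sum>k\<in>{1..NN + 1}. if k = 1 then - Lam1 G else 0)"
    proof (rule sum.cong[OF refl])
      fix k assume k: "k \<in> {1..NN + 1}"
      have "Rc Q (1, 0) k x = (if k = 1 then Lam1 G else 0)"
        using k Rc_one(1)[OF Q x] Rc_facts(4)[OF Q one_exponent(2), of k x] by auto
      then show "cd (Mc Q k) x + br (Q x) (Mc Q k x) + br (Lam1 G) (Mc Q (k - 1) x) = (if k = 1 then - Lam1 G else 0)"
        using Mc_facts(8)[OF Q _ x, of k] k by simp
    qed
    also have "\<dots> = - Lam1 G" using NN(2) by simp
    also have "br (Q x) (Mc Q 0 x) = 0" by (rule br_Hspan_Hspan[OF B_curve_facts(2)[OF Q] Mc_facts(6)[OF Q]])
    finally show ?thesis using x by (simp add: restr_def)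
  qed
  show ?thesis unfolding op_brk_pair lax_L_def lax_M_def fst_conv snd_conv cdr using e by simp
qed

lemma red_solution_iff:
  "red_solution G b D Q M \<longleftrightarrow> B_curve G D Q \<and> M = Mfun G b D Q \<and> (\<forall>x\<in>D. cd (Mc Q 0) x = 0)"
proof -
  have "(0, cd (Mc Q 0)) = (0 :: 'g dop) \<longleftrightarrow> (\<forall>x\<in>D. cd (Mc Q 0) x = 0)"
    using curve_deriv_outside by (auto simp: zero_prod_def fun_eq_iff)
  then show ?thesis unfolding red_solution_def using red_bracket by auto
qed

lemma functional_derivative:
  assumes "smc P" "x \<in> D"
  shows "((\<lambda>t. fm X (P t)) has_vector_derivative fm X (cd P x)) (at x)"
  using cd_has[OF assms] linear_form[of X] unfolding has_cd_def by blast

lemma chi_derivative: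
  assumes Q: "B_curve G D Q" and i: "i \<le> ll" and x: "x \<in> D"
  shows "(chi G (Mfun G b D Q) i has_vector_derivative - fm (hh i) (cd (Mc Q 0) x)) (at x)"
proof -
  have "((\<lambda>t. rat i - fm (hh i) (Mc Q 0 t)) has_vector_derivative 0 - fm (hh i) (cd (Mc Q 0) x)) (at x)"
    by (intro has_vector_derivative_diff has_vector_derivative_const functional_derivative Mc_facts(1)[OF Q] x)
  moreover have "chi G (Mfun G b D Q) i = (\<lambda>t. rat i - fm (hh i) (Mc Q 0 t))" using chi_Mc[OF Q i] by auto
  ultimately show ?thesis by simp
qed

text \<open>Invariance moves \<open>Q\<close> and Lambda_1 onto \<open>ff i\<close> in the degree 1
  equation. There \<open>Q\<close> acts through theta_i, and the bracket of \<open>ff i\<close> with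
  Lambda_1 is -nu times \<open>hh i\<close>, which brings in the degree 0 component of
  \<open>M\<close> and hence chi_i.\<close>

lemma phi_derivative:
  assumes Q: "B_curve G D Q" and i: "i \<le> ll" and x: "x \<in> D"
  shows "(phi G (Mfun G b D Q) i has_vector_derivative
    - (theta G Q i x * phi G (Mfun G b D Q) i x + chi G (Mfun G b D Q) i x)) (at x)"
proof -
  have l: "fm (ff i) (cd (Mc Q 1) x) + fm (ff i) (br (Q x) (Mc Q 1 x)) + fm (ff i) (br (Lam1 G) (Mc Q 0 x)) = - nu G * rat i"
  proof -
    have "cd (Mc Q 1) x + br (Q x) (Mc Q 1 x) + br (Lam1 G) (Mc Q (1 - 1) x) = - Lam1 G"
      using Mc_facts(8)[OF Q _ x, of 1] Rc_one(1)[OF Q x] by simp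
    then have "fm (ff i) (cd (Mc Q 1) x + br (Q x) (Mc Q 1 x) + br (Lam1 G) (Mc Q 0 x)) = fm (ff i) (- Lam1 G)" by simp
    then show ?thesis by (simp add: form_add_right form_minus_right form_ff_Lam1[OF i])
  qed
  have "br (ff i) (Q x) = sc (theta G Q i x) (ff i)"
    using br_anti[of "ff i" "Q x"] br_Hspan_weight(1)[OF B_curve_facts(2)[OF Q] i, of x]
    by (simp add: theta_eq[OF i])
  then have 1: "fm (ff i) (br (Q x) (Mc Q 1 x)) = theta G Q i x * fm (ff i) (Mc Q 1 x)"
    using form_inv[of "ff i" "Q x" "Mc Q 1 x"] by (simp add: form_scale_left)
  have 2: "fm (ff i) (br (Lam1 G) (Mc Q 0 x)) = - nu G * fm (hh i) (Mc Q 0 x)"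
    using form_inv[of "ff i" "Lam1 G" "Mc Q 0 x"] br_ff_Lam1[OF i] by (simp add: form_minus_left form_scale_left)
  have "fm (ff i) (cd (Mc Q 1) x) = - nu G * (theta G Q i x * phi G (Mfun G b D Q) i x + chi G (Mfun G b D Q) i x)"
  proof -
    have "fm (ff i) (cd (Mc Q 1) x) = - nu G * rat i - theta G Q i x * fm (ff i) (Mc Q 1 x) + nu G * fm (hh i) (Mc Q 0 x)"
      using l unfolding 1 2 by (simp add: algebra_simps eq_diff_eq)
    then show ?thesis unfolding phi_Mc[OF Q i] chi_Mc[OF Q i] using nu_nz by (simp add: algebra_simps)
  qed
  then have e: "1 / nu G * fm (ff i) (cd (Mc Q 1) x) = - (theta G Q i x * phi G (Mfun G b D Q) i x + chi G (Mfun G b D Q) i x)"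
    using nu_nz by simp
  have "((\<lambda>t. 1 / nu G * fm (ff i) (Mc Q 1 t)) has_vector_derivative 1 / nu G * fm (ff i) (cd (Mc Q 1) x)) (at x)"
    by (intro has_vector_derivative_mult_right functional_derivative Mc_facts(1)[OF Q] x)
  moreover have "phi G (Mfun G b D Q) i = (\<lambda>t. 1 / nu G * fm (ff i) (Mc Q 1 t))" using phi_Mc[OF Q i] by auto
  ultimately show ?thesis unfolding e by simp
qed

text \<open>Identically vanishing pairings with \<open>cc\<close> and \<open>dd\<close> pass to the
  derivative. The first puts it in \<open>Hspan\<close>, orthogonality to the coroots leaves a
  multiple of \<open>cc\<close>, and the second excludes that multiple.\<close>

lemma cd_Mc0_zero:
  assumes Q: "B_curve G D Q" and x: "x \<in> D" and z: "\<And>i. i \<le> ll \<Longrightarrow> fm (hh i) (cd (Mc Q 0) x) = 0"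
  shows "cd (Mc Q 0) x = 0"
proof -
  let ?Y = "cd (Mc Q 0) x"
  have E: "?Y \<in> Eig 0" by (rule cd_Eig[OF Mc_facts(1,2)[OF Q]])
  have f0: "fm X ?Y = 0" if "\<And>t. fm X (Mc Q 0 t) = 0" for X
    using functional_derivative[OF Mc_facts(1)[OF Q] x, of X 0] unfolding that
    by (rule vector_derivative_unique_at[OF _ has_vector_derivative_const])
  have c: "fm cc ?Y = 0"
    by (rule f0) (simp only: form_sym[of cc] form_Hspan_cc[OF Mc_facts(6)[OF Q]])
  have d: "fm dd ?Y = 0" by (rule f0) (rule Mc_facts(5)[OF Q])
  obtain Y y where Y: "Y \<in> Hspan" "?Y = Y + sc y dd" using span_hset_split E Eig0 by blast
  have "y * cox_c = 0" using c form_Hspan_cc[OF Y(1)] unfolding Y(2)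
    by (simp add: form_add_right form_scale_right form_sym[of cc Y] form_sym[of cc dd] form_dd_cc)
  then have YY: "?Y = Y" using Y(2) cox_nz by simp
  have "fm Y (hh j) = 0" if "j \<le> ll" for j using z[OF that] unfolding YY by (simp only: form_sym[of Y])
  then obtain t where t: "?Y = sc t cc" using Hspan_radical[OF Y(1)] YY by auto
  then have "t * cox_c = 0" using d by (simp add: form_scale_right form_dd_cc)
  then show ?thesis using t cox_nz by simp
qed

end

section \<open>Differential polynomials\<close>

lemma vector_derivative_cong_open:
  assumes "open S" "x \<in> S" "\<And>t. t \<in> S \<Longrightarrow> f t = g t"
  shows "vector_derivative f (at x) = vector_derivative g (at x)"
proof -
  have "(f has_vector_derivative d) (at x) \<longleftrightarrow> (g has_vector_derivative d) (at x)" for d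
    using has_vector_derivative_transform_within_open[OF _ assms(1,2), of f d g]
      has_vector_derivative_transform_within_open[OF _ assms(1,2), of g d f] assms(3) by metis
  then show ?thesis unfolding vector_derivative_def by simp
qed

lemma diff_poly_sum:
  "(\<And>i. i \<in> S \<Longrightarrow> diff_poly l (P i)) \<Longrightarrow> diff_poly l (\<lambda>x u. \<Sum>i\<in>S. P i x u)"
proof (induction S rule: infinite_finite_induct)
  case (insert i S)
  then show ?case using diff_poly.intros(4)[of l "P i" "\<lambda>x u. \<Sum>i\<in>S. P i x u"] by simp
qed (simp_all add: diff_poly.intros(1))

context drinfeld_sokolov_data
begin

section \<open>Differential polynomials uniform in the domain and in Q\<close>

definition valid :: "real set \<Rightarrow> (real \<Rightarrow> 'g) \<Rightarrow> bool" where
  "valid D Q \<longleftrightarrow> open D \<and> B_curve G D Q"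

lemma valid_ds_open: "valid D Q \<Longrightarrow> ds_open G D"
  unfolding valid_def by (intro ds_open.intro ds_open_axioms.intro drinfeld_sokolov_data_axioms) blast

lemma smooth_theta: "valid D Q \<Longrightarrow> smooth_scalar D (theta G Q i)"
proof -
  assume "valid D Q"
  then have "smooth_curve G D Q" unfolding valid_def B_curve_def by blast
  then have "smooth_scalar D (\<lambda>x. of_nat (dlab G i) / of_nat (lab G i) * form G (coroot G i) (Q x))"
    by (intro smooth_scalar_mult smooth_scalar_const smooth_curve_functional linear_form)
  then show ?thesis unfolding theta_def .
qed

lemma theta_jet_derivative:
  assumes V: "valid D Q" and x: "x \<in> D"
  shows "((\<lambda>t. theta_jet G Q t i m) has_vector_derivative theta_jet G Q x i (Suc m)) (at x)"
proof -
  have D: "open D" using V unfolding valid_def by blast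
  have "smooth_scalar D (((\<lambda>u t. vector_derivative u (at t)) ^^ m) (theta G Q i))"
    by (induction m) (auto simp: smooth_theta[OF V] intro: smooth_scalar_deriv(1)[OF D])
  then show ?thesis unfolding theta_jet_def using smooth_scalar_deriv(2)[OF D _ x] by simp
qed

text \<open>Differentiation shifts jet variables by one; the resulting polynomial depends on
  \<open>P\<close> alone, not on the domain or on \<open>Q\<close>.\<close>

lemma diff_poly_derivative:
  assumes "diff_poly ll P"
  shows "\<exists>P'. diff_poly ll P' \<and> (\<forall>D Q x. valid D Q \<longrightarrow> x \<in> D \<longrightarrow>
    ((\<lambda>t. P t (theta_jet G Q t)) has_vector_derivative P' x (theta_jet G Q x)) (at x))"
  using assms
proof induction
  case (1 z)
  then show ?case by (intro exI[of _ "\<lambda>x u. 0"]) (auto intro: diff_poly.intros(1))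
next
  case 2
  have "(complex_of_real has_vector_derivative 1) (at x)" for x
    using has_vector_derivative_of_real[OF DERIV_ident] by simp
  then show ?case by (intro exI[of _ "\<lambda>x u. 1"]) (auto intro: diff_poly.intros(1))
next
  case (3 i m)
  then show ?case using theta_jet_derivative
    by (intro exI[of _ "\<lambda>x u. u i (Suc m)"]) (auto intro: diff_poly.intros(3))
next
  case (4 P R)
  then obtain P' R' where "diff_poly ll P'" "diff_poly ll R'"
    "\<forall>D Q x. valid D Q \<longrightarrow> x \<in> D \<longrightarrow> ((\<lambda>t. P t (theta_jet G Q t)) has_vector_derivative P' x (theta_jet G Q x)) (at x)"
    "\<forall>D Q x. valid D Q \<longrightarrow> x \<in> D \<longrightarrow> ((\<lambda>t. R t (theta_jet G Q t)) has_vector_derivative R' x (theta_jet G Q x)) (at x)"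
    by blast
  then show ?case
    by (intro exI[of _ "\<lambda>x u. P' x u + R' x u"]) (auto intro: diff_poly.intros(4) has_vector_derivative_add)
next
  case (5 P R)
  then obtain P' R' where "diff_poly ll P'" "diff_poly ll R'"
    "\<forall>D Q x. valid D Q \<longrightarrow> x \<in> D \<longrightarrow> ((\<lambda>t. P t (theta_jet G Q t)) has_vector_derivative P' x (theta_jet G Q x)) (at x)"
    "\<forall>D Q x. valid D Q \<longrightarrow> x \<in> D \<longrightarrow> ((\<lambda>t. R t (theta_jet G Q t)) has_vector_derivative R' x (theta_jet G Q x)) (at x)"
    by blast
  then show ?case using 5
    by (intro exI[of _ "\<lambda>x u. P x u * R' x u + P' x u * R x u"])
      (auto intro: diff_poly.intros(4,5) has_vector_derivative_mult)
qed

text \<open>The polynomial is chosen before the open set and \<open>Q\<close>, and in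
  \<open>DPv\<close> so is the finite set of vectors. This uniformity is what makes restriction to a
  smaller open set possible in \<open>DPv_local\<close>.\<close>

definition DPs :: "(real set \<Rightarrow> (real \<Rightarrow> 'g) \<Rightarrow> real \<Rightarrow> complex) \<Rightarrow> bool" where
  "DPs f \<longleftrightarrow> (\<exists>P. diff_poly ll P \<and> (\<forall>D Q x. valid D Q \<longrightarrow> x \<in> D \<longrightarrow> f D Q x = P x (theta_jet G Q x)))"

definition DPv :: "(real set \<Rightarrow> (real \<Rightarrow> 'g) \<Rightarrow> real \<Rightarrow> 'g) \<Rightarrow> bool" where
  "DPv F \<longleftrightarrow> (\<exists>S P. finite S \<and> (\<forall>v\<in>S. diff_poly ll (P v)) \<and>
     (\<forall>D Q x. valid D Q \<longrightarrow> x \<in> D \<longrightarrow> F D Q x = (\<Sum>v\<in>S. sc (P v x (theta_jet G Q x)) v)))"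

lemma DPv_cong:
  assumes "DPv F" "\<And>D Q x. valid D Q \<Longrightarrow> x \<in> D \<Longrightarrow> H D Q x = F D Q x" shows "DPv H"
proof -
  obtain S P where "finite S" "\<forall>v\<in>S. diff_poly ll (P v)"
    "\<forall>D Q x. valid D Q \<longrightarrow> x \<in> D \<longrightarrow> F D Q x = (\<Sum>v\<in>S. sc (P v x (theta_jet G Q x)) v)"
    using assms(1) unfolding DPv_def by blast
  then show ?thesis unfolding DPv_def using assms(2) by (intro exI[of _ S] exI[of _ P]) simp
qed

lemma DPs_cong:
  assumes "DPs F" "\<And>D Q x. valid D Q \<Longrightarrow> x \<in> D \<Longrightarrow> H D Q x = F D Q x" shows "DPs H"
proof -
  obtain P where "diff_poly ll P" "\<forall>D Q x. valid D Q \<longrightarrow> x \<in> D \<longrightarrow> F D Q x = P x (theta_jet G Q x)"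
    using assms(1) unfolding DPs_def by blast
  then show ?thesis unfolding DPs_def using assms(2) by (intro exI[of _ P]) simp
qed

lemma DPv_term: "diff_poly ll P \<Longrightarrow> DPv (\<lambda>D Q x. sc (P x (theta_jet G Q x)) v)"
  unfolding DPv_def by (intro exI[of _ "{v}"] exI[of _ "\<lambda>_. P"]) simp

lemma DPv_zero: "DPv (\<lambda>D Q x. 0)"
  unfolding DPv_def by (intro exI[of _ "{}"]) simp

lemma DPv_add:
  assumes "DPv F" "DPv H" shows "DPv (\<lambda>D Q x. F D Q x + H D Q x)"
proof -
  obtain S P where S: "finite S" "\<forall>v\<in>S. diff_poly ll (P v)"
    "\<forall>D Q x. valid D Q \<longrightarrow> x \<in> D \<longrightarrow> F D Q x = (\<Sum>v\<in>S. sc (P v x (theta_jet G Q x)) v)"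
    using assms(1) unfolding DPv_def by blast
  obtain T R where T: "finite T" "\<forall>v\<in>T. diff_poly ll (R v)"
    "\<forall>D Q x. valid D Q \<longrightarrow> x \<in> D \<longrightarrow> H D Q x = (\<Sum>v\<in>T. sc (R v x (theta_jet G Q x)) v)"
    using assms(2) unfolding DPv_def by blast
  define A where "A v = (if v \<in> S then P v else (\<lambda>x u. 0))" for v
  define B where "B v = (if v \<in> T then R v else (\<lambda>x u. 0))" for v
  have "diff_poly ll (A v)" "diff_poly ll (B v)" for v
    unfolding A_def B_def using S(2) T(2) diff_poly.intros(1) by auto
  then have "diff_poly ll (\<lambda>x u. A v x u + B v x u)" for v by (rule diff_poly.intros(4))
  moreover have "F D Q x + H D Q x = (\<Sum>v\<in>S \<union> T. sc (A v x (theta_jet G Q x) + B v x (theta_jet G Q x)) v)"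
    if "valid D Q" "x \<in> D" for D Q x
  proof -
    have "F D Q x = (\<Sum>v\<in>S \<union> T. sc (A v x (theta_jet G Q x)) v)"
      unfolding A_def using S that by (auto intro!: sum.mono_neutral_cong_left simp: T(1))
    moreover have "H D Q x = (\<Sum>v\<in>S \<union> T. sc (B v x (theta_jet G Q x)) v)"
      unfolding B_def using T that by (auto intro!: sum.mono_neutral_cong_left simp: S(1))
    ultimately show ?thesis by (simp add: vs.scale_left_distrib sum.distrib)
  qed
  ultimately show ?thesis unfolding DPv_def using S(1) T(1)
    by (intro exI[of _ "S \<union> T"] exI[of _ "\<lambda>v x u. A v x u + B v x u"]) simp
qed

lemma DPv_sum: "(\<And>i. i \<in> I \<Longrightarrow> DPv (F i)) \<Longrightarrow> DPv (\<lambda>D Q x. \<Sum>i\<in>I. F i D Q x)"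
proof (induction I rule: infinite_finite_induct)
  case (insert i I)
  then show ?case using DPv_add[of "F i" "\<lambda>D Q x. \<Sum>i\<in>I. F i D Q x"] by simp
qed (simp_all add: DPv_zero)

lemma DPv_scalar:
  assumes "DPs f" "DPv F" shows "DPv (\<lambda>D Q x. sc (f D Q x) (F D Q x))"
proof -
  obtain S P where S: "finite S" "\<forall>v\<in>S. diff_poly ll (P v)"
    "\<forall>D Q x. valid D Q \<longrightarrow> x \<in> D \<longrightarrow> F D Q x = (\<Sum>v\<in>S. sc (P v x (theta_jet G Q x)) v)"
    using assms(2) unfolding DPv_def by blast
  obtain R where R: "diff_poly ll R" "\<forall>D Q x. valid D Q \<longrightarrow> x \<in> D \<longrightarrow> f D Q x = R x (theta_jet G Q x)"
    using assms(1) unfolding DPs_def by blast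
  show ?thesis unfolding DPv_def
    by (intro exI[of _ S] exI[of _ "\<lambda>v x u. R x u * P v x u"])
      (use S R in \<open>auto intro: diff_poly.intros(5) simp: vs.scale_sum_right\<close>)
qed

lemma DPs_const: "DPs (\<lambda>D Q x. z)"
  unfolding DPs_def by (intro exI[of _ "\<lambda>x u. z"]) (simp add: diff_poly.intros(1))

lemma DPs_of_real: "DPs (\<lambda>D Q x. complex_of_real x)"
  unfolding DPs_def by (intro exI[of _ "\<lambda>x u. complex_of_real x"]) (simp add: diff_poly.intros(2))

lemma DPs_add: "DPs f \<Longrightarrow> DPs g \<Longrightarrow> DPs (\<lambda>D Q x. f D Q x + g D Q x)"
proof -
  assume "DPs f" "DPs g"
  then obtain P R where "diff_poly ll P" "\<forall>D Q x. valid D Q \<longrightarrow> x \<in> D \<longrightarrow> f D Q x = P x (theta_jet G Q x)"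
    "diff_poly ll R" "\<forall>D Q x. valid D Q \<longrightarrow> x \<in> D \<longrightarrow> g D Q x = R x (theta_jet G Q x)"
    unfolding DPs_def by blast
  then show ?thesis unfolding DPs_def
    by (intro exI[of _ "\<lambda>x u. P x u + R x u"]) (simp add: diff_poly.intros(4))
qed

lemma DPs_mult: "DPs f \<Longrightarrow> DPs g \<Longrightarrow> DPs (\<lambda>D Q x. f D Q x * g D Q x)"
proof -
  assume "DPs f" "DPs g"
  then obtain P R where "diff_poly ll P" "\<forall>D Q x. valid D Q \<longrightarrow> x \<in> D \<longrightarrow> f D Q x = P x (theta_jet G Q x)"
    "diff_poly ll R" "\<forall>D Q x. valid D Q \<longrightarrow> x \<in> D \<longrightarrow> g D Q x = R x (theta_jet G Q x)"
    unfolding DPs_def by blast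
  then show ?thesis unfolding DPs_def
    by (intro exI[of _ "\<lambda>x u. P x u * R x u"]) (simp add: diff_poly.intros(5))
qed

lemma DPs_functional:
  assumes "DPv F" "Vector_Spaces.linear sc (*) w" shows "DPs (\<lambda>D Q x. w (F D Q x))"
proof -
  interpret w: Vector_Spaces.linear sc "(*)" w by fact
  obtain S P where S: "finite S" "\<forall>v\<in>S. diff_poly ll (P v)"
    "\<forall>D Q x. valid D Q \<longrightarrow> x \<in> D \<longrightarrow> F D Q x = (\<Sum>v\<in>S. sc (P v x (theta_jet G Q x)) v)"
    using assms(1) unfolding DPv_def by blast
  have "diff_poly ll (\<lambda>x u. \<Sum>v\<in>S. P v x u * w v)"
    using S(2) by (intro diff_poly_sum diff_poly.intros(5) diff_poly.intros(1)) auto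
  then show ?thesis unfolding DPs_def using S(3)
    by (intro exI[of _ "\<lambda>x u. \<Sum>v\<in>S. P v x u * w v"]) (simp add: w.sum w.scale)
qed

lemma DPv_linear:
  assumes "DPv F" "Vector_Spaces.linear sc sc f" shows "DPv (\<lambda>D Q x. f (F D Q x))"
proof -
  interpret f: Vector_Spaces.linear sc sc f by fact
  obtain S P where S: "finite S" "\<forall>v\<in>S. diff_poly ll (P v)"
    "\<forall>D Q x. valid D Q \<longrightarrow> x \<in> D \<longrightarrow> F D Q x = (\<Sum>v\<in>S. sc (P v x (theta_jet G Q x)) v)"
    using assms(1) unfolding DPv_def by blast
  have "DPv (\<lambda>D Q x. \<Sum>v\<in>S. sc (P v x (theta_jet G Q x)) (f v))"
    using S(2) by (intro DPv_sum DPv_term) auto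
  then show ?thesis by (rule DPv_cong) (simp add: S(3) f.sum f.scale)
qed

lemma DPv_br:
  assumes "DPv F" "DPv H" shows "DPv (\<lambda>D Q x. br (F D Q x) (H D Q x))"
proof -
  obtain S P where S: "finite S" "\<forall>v\<in>S. diff_poly ll (P v)"
    "\<forall>D Q x. valid D Q \<longrightarrow> x \<in> D \<longrightarrow> F D Q x = (\<Sum>v\<in>S. sc (P v x (theta_jet G Q x)) v)"
    using assms(1) unfolding DPv_def by blast
  have "DPs (\<lambda>D Q x. P v x (theta_jet G Q x))" if "v \<in> S" for v
    unfolding DPs_def using S(2) that by blast
  then have "DPv (\<lambda>D Q x. \<Sum>v\<in>S. sc (P v x (theta_jet G Q x)) (br v (H D Q x)))"
    using assms(2) by (intro DPv_sum DPv_scalar DPv_linear[OF _ linear_br_right]) auto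
  then show ?thesis by (rule DPv_cong) (simp add: S(3) br_sum_left br_scale_left)
qed

lemma DPv_deriv:
  assumes "DPv F" shows "DPv (\<lambda>D Q. curve_deriv G D (F D Q))"
proof -
  obtain S P where S: "finite S" "\<forall>v\<in>S. diff_poly ll (P v)"
    "\<forall>D Q x. valid D Q \<longrightarrow> x \<in> D \<longrightarrow> F D Q x = (\<Sum>v\<in>S. sc (P v x (theta_jet G Q x)) v)"
    using assms(1) unfolding DPv_def by blast
  have "\<forall>v\<in>S. \<exists>P'. diff_poly ll P' \<and> (\<forall>D Q x. valid D Q \<longrightarrow> x \<in> D \<longrightarrow>
      ((\<lambda>t. P v t (theta_jet G Q t)) has_vector_derivative P' x (theta_jet G Q x)) (at x))"
    using diff_poly_derivative S(2) by blast
  then obtain P' where P': "\<forall>v\<in>S. diff_poly ll (P' v) \<and> (\<forall>D Q x. valid D Q \<longrightarrow> x \<in> D \<longrightarrow>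
      ((\<lambda>t. P v t (theta_jet G Q t)) has_vector_derivative P' v x (theta_jet G Q x)) (at x))"
    by (rule bchoice[THEN exE])
  have "curve_deriv G D (F D Q) x = (\<Sum>v\<in>S. sc (P' v x (theta_jet G Q x)) v)"
    if V: "valid D Q" and x: "x \<in> D" for D Q x
  proof (rule curve_deriv_eq[OF _ x])
    have D: "open D" using V unfolding valid_def by blast
    show "has_cd (F D Q) (\<Sum>v\<in>S. sc (P' v x (theta_jet G Q x)) v) x"
    proof (rule has_cd_cong[OF D x])
      show "(\<Sum>v\<in>S. sc (P v t (theta_jet G Q t)) v) = F D Q t" if "t \<in> D" for t using S(3) V that by simp
      show "has_cd (\<lambda>t. \<Sum>v\<in>S. sc (P v t (theta_jet G Q t)) v) (\<Sum>v\<in>S. sc (P' v x (theta_jet G Q x)) v) x"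
        unfolding has_cd_def
      proof (intro allI impI)
        fix w assume "Vector_Spaces.linear sc (*) w"
        then interpret w: Vector_Spaces.linear sc "(*)" w .
        show "((\<lambda>t. w (\<Sum>v\<in>S. sc (P v t (theta_jet G Q t)) v)) has_vector_derivative
            w (\<Sum>v\<in>S. sc (P' v x (theta_jet G Q x)) v)) (at x)"
          unfolding w.sum w.scale
          by (intro has_vector_derivative_sum has_vector_derivative_mult_left) (use P' V x in blast)
      qed
    qed
  qed
  moreover have "DPv (\<lambda>D Q x. \<Sum>v\<in>S. sc (P' v x (theta_jet G Q x)) v)"
    using P' by (intro DPv_sum DPv_term) auto
  ultimately show ?thesis by (rule DPv_cong[rotated])
qed

lemma DPv_const: "DPv (\<lambda>D Q. restr D (\<lambda>_. v))"
  by (rule DPv_cong[OF DPv_term[OF diff_poly.intros(1)[of ll 1], of v]]) (simp add: restr_def)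

section \<open>The functions theta_1, ..., theta_l as coordinates\<close>

lemma hh_independent:
  assumes "(\<Sum>i\<le>ll. sc (x i) (hh i)) = 0" "i \<le> ll" shows "x i = 0"
proof -
  have "(\<Sum>i\<le>ll. x i * aa i j) = 0" if j: "j \<le> ll" for j
  proof -
    have "fm (\<Sum>i\<le>ll. sc (x i) (hh i)) (hh j) = (\<Sum>i\<le>ll. x i * aa i j) * rat j"
      unfolding form_sum_left sum_distrib_right
      by (rule sum.cong) (use j in \<open>auto simp: form_scale_left form_hh\<close>)
    then show ?thesis unfolding assms(1) using rat_nz[OF j] by simp
  qed
  then obtain t where t: "\<forall>i\<le>ll. x i = t * of_nat (dlab G i)" using kernel_dlab by blast
  then have "(\<Sum>i\<le>ll. sc (x i) (hh i)) = sc t cc" unfolding central_def vs.scale_sum_right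
    by (intro sum.cong) auto
  then have "sc t cc = 0" using assms(1) by (simp only:)
  then have "fm dd (sc t cc) = 0" by (simp only: form_zero_right)
  then have "t * cox_c = 0" by (simp only: form_scale_right form_dd_cc)
  then show ?thesis using t assms(2) cox_nz by simp
qed

lemma subspace_Bspace: "vs.subspace (Bspace G)"
  unfolding vs.subspace_def
  using vs.subspace_0[OF subspace_Hspan] vs.subspace_add[OF subspace_Hspan] vs.subspace_scale[OF subspace_Hspan]
  by (simp add: Bspace_iff form_add_right form_scale_right)

text \<open>The central element is orthogonal to \<open>Hspan\<close> and has a positive coefficient
  at \<open>hh 0\<close>, so the pairings with the other coroots determine the one with
  \<open>hh 0\<close>. What remains is a multiple of \<open>cc\<close>, and orthogonality to
  \<open>dd\<close> makes it zero.\<close>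

lemma Bspace_separated:
  assumes X: "X \<in> Bspace G" and z: "\<And>j. j \<in> {1..ll} \<Longrightarrow> fm (hh j) X = 0" shows "X = 0"
proof -
  have H: "X \<in> Hspan" "fm dd X = 0" using X unfolding Bspace_iff by auto
  have "(\<Sum>i\<le>ll. of_nat (dlab G i) * fm (hh i) X) = fm cc X"
    unfolding central_def by (simp add: form_sum_left form_scale_left)
  also have "\<dots> = 0" using form_Hspan_cc[OF H(1)] form_sym by simp
  finally have "of_nat (dlab G 0) * fm (hh 0) X + (\<Sum>i\<in>{1..ll}. of_nat (dlab G i) * fm (hh i) X) = 0"
    by (simp add: atMost_atLeast0 sum.atLeast_Suc_atMost)
  then have "fm (hh 0) X = 0" using z dlab_pos[of 0] by simp
  then have "fm X (hh j) = 0" if "j \<le> ll" for j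
    using z[of j] that by (cases "j = 0") (auto simp: form_sym[of X])
  then obtain t where t: "X = sc t cc" using Hspan_radical[OF H(1)] by blast
  then have "t * cox_c = 0" using H(2) form_scale_right form_dd_cc by simp
  then show ?thesis using t cox_nz by simp
qed

text \<open>Otherwise \<open>hh i\<close> would agree on the space with a combination of the other
  coroots of positive index. The difference \<open>Y\<close> would be orthogonal to all coroots,
  hence a multiple of \<open>cc\<close>; its coefficient 0 at index 0 makes that multiple zero,
  against the coefficient 1 at \<open>i\<close>.\<close>

lemma Bspace_dual:
  assumes i: "i \<in> {1..ll}"
  shows "\<exists>X\<in>Bspace G. \<forall>j\<in>{1..ll}. fm (hh j) X / rat j = (if j = i then 1 else 0)"
proof -
  have "\<exists>v\<in>Bspace G. (\<forall>j\<in>{1..ll} - {i}. fm (hh j) v = 0) \<and> fm (hh i) v \<noteq> 0"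
  proof (rule ccontr)
    assume "\<not> ?thesis"
    then have "\<exists>c. \<forall>v\<in>Bspace G. fm (hh i) v = (\<Sum>j\<in>{1..ll} - {i}. c j * fm (hh j) v)"
      by (intro vs.functional_in_span subspace_Bspace linear_form) auto
    then obtain c where c: "\<forall>v\<in>Bspace G. fm (hh i) v = (\<Sum>j\<in>{1..ll} - {i}. c j * fm (hh j) v)" by blast
    define y where "y j = (if j = i then 1 else if j = 0 then 0 else - c j)" for j
    define Y where "Y = (\<Sum>j\<le>ll. sc (y j) (hh j))"
    have YH: "Y \<in> Hspan" unfolding Y_def Hspan_iff by blast
    have I: "(\<Sum>j\<le>ll. F j) = F 0 + (F i + sum F ({1..ll} - {i}))" for F :: "nat \<Rightarrow> complex"
      using sum.remove[OF _ i, of F] by (simp add: atMost_atLeast0 sum.atLeast_Suc_atMost)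
    have YB: "fm Y v = 0" if "v \<in> Bspace G" for v
    proof -
      have "fm Y v = (\<Sum>j\<le>ll. y j * fm (hh j) v)" unfolding Y_def by (simp add: form_sum_left form_scale_left)
      also have "\<dots> = fm (hh i) v + (\<Sum>j\<in>{1..ll} - {i}. - (c j * fm (hh j) v))"
        unfolding I using i by (auto simp: y_def intro!: sum.cong arg_cong2[of _ _ _ _ "(+)"])
      also have "\<dots> = 0" using c that by (simp add: sum_negf)
      finally show ?thesis .
    qed
    have "fm Y (hh m) = 0" if m: "m \<le> ll" for m
    proof -
      \<comment> \<open>The subtracted multiple of \<open>cc\<close> makes \<open>v\<close>
        orthogonal to \<open>dd\<close>, and \<open>Y\<close> cannot see it since
        \<open>Hspan\<close> is orthogonal to \<open>cc\<close>.\<close>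
      define v where "v = hh m - sc (rat m / cox_c) cc"
      have "v \<in> Bspace G" unfolding v_def Bspace_iff
        using vs.subspace_diff[OF subspace_Hspan Hspan_hh[OF m] vs.subspace_scale[OF subspace_Hspan cc_Hspan]] cox_nz
        by (simp add: form_diff_right form_scale_right form_dd_cc form_dh[OF m])
      then have "fm Y v = 0" by (rule YB)
      then show ?thesis unfolding v_def by (simp add: form_diff_right form_scale_right form_Hspan_cc[OF YH])
    qed
    then obtain t where t: "Y = sc t cc" using Hspan_radical[OF YH] by blast
    then have "(\<Sum>j\<le>ll. sc (y j - t * of_nat (dlab G j)) (hh j)) = 0"
      unfolding Y_def central_def vs.scale_sum_right by (simp add: vs.scale_left_diff_distrib sum_subtractf)
    then have e: "y j = t * of_nat (dlab G j)" if "j \<le> ll" for j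
      using hh_independent[of "\<lambda>j. y j - t * of_nat (dlab G j)" j] that by simp
    have "t = 0" using e[of 0] dlab_pos[of 0] i by (auto simp: y_def)
    then show False using e[of i] i by (simp add: y_def)
  qed
  then obtain v where v: "v \<in> Bspace G" "\<forall>j\<in>{1..ll} - {i}. fm (hh j) v = 0" "fm (hh i) v \<noteq> 0" by blast
  show ?thesis
    by (intro bexI[of _ "sc (rat i / fm (hh i) v) v"])
      (use v rat_nz i vs.subspace_scale[OF subspace_Bspace] in \<open>auto simp: form_scale_right\<close>)
qed

lemma Bspace_coordinates:
  "bij_betw (\<lambda>X. \<lambda>i\<in>{1..ll}. of_nat (dlab G i) / of_nat (lab G i) * fm (hh i) X) (Bspace G) ({1..ll} \<rightarrow>\<^sub>E UNIV)"
proof -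
  have r: "of_nat (dlab G i) / of_nat (lab G i) * z = z / rat i" for i z
    unfolding label_ratio_def by simp
  obtain X where X: "\<And>i. i \<in> {1..ll} \<Longrightarrow> X i \<in> Bspace G \<and> (\<forall>j\<in>{1..ll}. fm (hh j) (X i) / rat j = (if j = i then 1 else 0))"
    using bchoice[of "{1..ll}"] Bspace_dual by metis
  show ?thesis unfolding r bij_betw_def
  proof
    show "inj_on (\<lambda>X. \<lambda>i\<in>{1..ll}. fm (hh i) X / rat i) (Bspace G)"
    proof (rule inj_onI)
      fix Y Z assume a: "Y \<in> Bspace G" "Z \<in> Bspace G" "(\<lambda>i\<in>{1..ll}. fm (hh i) Y / rat i) = (\<lambda>i\<in>{1..ll}. fm (hh i) Z / rat i)"
      have "fm (hh j) (Y - Z) = 0" if j: "j \<in> {1..ll}" for j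
        using fun_cong[OF a(3), of j] j rat_nz[of j] by (simp add: form_diff_right)
      then have "Y - Z = 0" using Bspace_separated vs.subspace_diff[OF subspace_Bspace a(1,2)] by blast
      then show "Y = Z" by simp
    qed
    show "(\<lambda>X. \<lambda>i\<in>{1..ll}. fm (hh i) X / rat i) ` Bspace G = {1..ll} \<rightarrow>\<^sub>E UNIV"
    proof
      show "{1..ll} \<rightarrow>\<^sub>E UNIV \<subseteq> (\<lambda>X. \<lambda>i\<in>{1..ll}. fm (hh i) X / rat i) ` Bspace G"
      proof
        fix g :: "nat \<Rightarrow> complex" assume g: "g \<in> {1..ll} \<rightarrow>\<^sub>E UNIV"
        define Y where "Y = (\<Sum>i\<in>{1..ll}. sc (g i) (X i))"
        have "Y \<in> Bspace G" unfolding Y_def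
          using X by (intro vs.subspace_sum[OF subspace_Bspace] vs.subspace_scale[OF subspace_Bspace]) blast
        moreover have "fm (hh j) Y / rat j = g j" if j: "j \<in> {1..ll}" for j
        proof -
          have "fm (hh j) Y / rat j = (\<Sum>i\<in>{1..ll}. g i * (fm (hh j) (X i) / rat j))"
            unfolding Y_def by (simp add: form_sum_right form_scale_right sum_divide_distrib)
          also have "\<dots> = (\<Sum>i\<in>{1..ll}. if j = i then g i else 0)"
            by (rule sum.cong) (use X j in auto)
          finally show ?thesis using j by simp
        qed
        then have "(\<lambda>i\<in>{1..ll}. fm (hh i) Y / rat i) = g"
          using g by (auto simp: restrict_def PiE_def extensional_def fun_eq_iff)
        ultimately show "g \<in> (\<lambda>X. \<lambda>i\<in>{1..ll}. fm (hh i) X / rat i) ` Bspace G" by blast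
      qed
    qed auto
  qed
qed

lemma DPv_Q: "DPv (\<lambda>D Q. Q)"
proof -
  obtain X where X: "\<And>i. i \<in> {1..ll} \<Longrightarrow> X i \<in> Bspace G \<and> (\<forall>j\<in>{1..ll}. fm (hh j) (X i) / rat j = (if j = i then 1 else 0))"
    using bchoice[of "{1..ll}"] Bspace_dual by metis
  have "DPv (\<lambda>D Q x. \<Sum>i\<in>{1..ll}. sc (theta_jet G Q x i 0) (X i))"
    by (intro DPv_sum DPv_term[of "\<lambda>x u. u _ 0"] diff_poly.intros(3))
  then show ?thesis
  proof (rule DPv_cong)
    fix D Q x assume V: "valid D Q" and x: "x \<in> D"
    then have Q: "Q x \<in> Bspace G" unfolding valid_def B_curve_def by blast
    define Z where "Z = Q x - (\<Sum>i\<in>{1..ll}. sc (theta_jet G Q x i 0) (X i))"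
    have "Z \<in> Bspace G" unfolding Z_def using X
      by (intro vs.subspace_diff[OF subspace_Bspace] Q vs.subspace_sum[OF subspace_Bspace] vs.subspace_scale[OF subspace_Bspace]) blast
    moreover have "fm (hh j) Z = 0" if j: "j \<in> {1..ll}" for j
    proof -
      have "fm (hh j) (X i) = (if j = i then rat i else 0)" if "i \<in> {1..ll}" for i
        using X[OF that] j rat_nz[of j] by (auto simp: divide_eq_eq split: if_splits)
      then have "(\<Sum>i\<in>{1..ll}. theta_jet G Q x i 0 * fm (hh j) (X i)) = (\<Sum>i\<in>{1..ll}. if j = i then theta G Q i x * rat i else 0)"
        by (intro sum.cong) (auto simp: theta_jet_def)
      then show ?thesis unfolding Z_def form_diff_right form_sum_right form_scale_right
        using j rat_nz[of j] theta_eq[of j Q x] by simp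
    qed
    ultimately have "Z = 0" by (rule Bspace_separated)
    then show "Q x = (\<Sum>i\<in>{1..ll}. sc (theta_jet G Q x i 0) (X i))" unfolding Z_def by simp
  qed
qed

text \<open>Jets are local, and one polynomial computes both sides. Applied to \<open>Mfun\<close>
  this says that building \<open>M\<close> from the restricted \<open>Q\<close> gives the
  restriction of \<open>M\<close>.\<close>

lemma DPv_local:
  assumes F: "DPv F" and V: "valid D Q" and E: "open E" "E \<subseteq> D" and x: "x \<in> E"
  shows "valid E (restr E Q)" "F E (restr E Q) x = F D Q x"
proof -
  show VE: "valid E (restr E Q)"
    using V E smooth_curve_subset[of D Q E] unfolding valid_def B_curve_def by (auto simp: restr_def)
  have "((\<lambda>u t. vector_derivative u (at t)) ^^ m) (theta G (restr E Q) i) t =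
      ((\<lambda>u t. vector_derivative u (at t)) ^^ m) (theta G Q i) t" if "t \<in> E" for i m t
    using that
  proof (induction m arbitrary: t)
    case 0 then show ?case by (simp add: theta_def restr_def)
  next
    case (Suc m)
    show ?case using vector_derivative_cong_open[OF E(1) Suc.prems Suc.IH] by simp
  qed
  then have "theta_jet G (restr E Q) x = theta_jet G Q x" unfolding theta_jet_def using x by auto
  then show "F E (restr E Q) x = F D Q x"
    using F V VE x E(2) unfolding DPv_def by force
qed

section \<open>The dressing element depends on Q by differential polynomials\<close>

abbreviation "SER D K \<equiv> graded_lie.Ser (ds_open.CC G D) K"

text \<open>The coefficient of the partial derivative multiplies derivatives inside brackets; it is
  required to be a constant common to all domains and all \<open>Q\<close>, so that brackets stay in
  the class.\<close>

definition DPser :: "(real set \<Rightarrow> (real \<Rightarrow> 'g) \<Rightarrow> 'g dser) \<Rightarrow> bool" where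
  "DPser Z \<longleftrightarrow> (\<forall>k. (\<exists>a. \<forall>D Q. valid D Q \<longrightarrow> fst (Z D Q k) = a) \<and> DPv (\<lambda>D Q. snd (Z D Q k)))"

lemma DPserD: "DPser Z \<Longrightarrow> \<exists>a. \<forall>D Q. valid D Q \<longrightarrow> fst (Z D Q k) = a" "DPser Z \<Longrightarrow> DPv (\<lambda>D Q. snd (Z D Q k))"
  unfolding DPser_def by blast+

lemma DPv_scale: "DPv F \<Longrightarrow> DPv (\<lambda>D Q x. sc a (F D Q x))"
  by (rule DPv_scalar[OF DPs_const])

lemma DPv_minus: "DPv F \<Longrightarrow> DPv (\<lambda>D Q x. - F D Q x)"
  using DPv_scale[of F "-1"] by simp

lemma DPser_sbr:
  assumes V: "DPser V" and Z: "DPser Z"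
    and S: "\<And>D Q. valid D Q \<Longrightarrow> V D Q \<in> SER D (-1)" "\<And>D Q. valid D Q \<Longrightarrow> Z D Q \<in> SER D K"
  shows "DPser (\<lambda>D Q. ser_brk G D (V D Q) (Z D Q))"
  unfolding DPser_def
proof
  fix k
  have e: "ser_brk G D (V D Q) (Z D Q) k = (\<Sum>i\<in>{k - K..-1}. op_brk G D (V D Q i) (Z D Q (k - i)))"
    if v: "valid D Q" for D Q
  proof -
    interpret o: ds_open G D by (rule valid_ds_open[OF v])
    show ?thesis unfolding o.ser_brk_eq by (rule o.dop.sbr_eq[OF S(1)[OF v] S(2)[OF v]]) auto
  qed
  have f: "fst (ser_brk G D (V D Q) (Z D Q) k) = 0" if v: "valid D Q" for D Q
  proof -
    interpret o: ds_open G D by (rule valid_ds_open[OF v])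
    show ?thesis unfolding e[OF v] o.op_brk_pair by (simp add: fst_sum)
  qed
  obtain a where a: "\<And>i D Q. valid D Q \<Longrightarrow> fst (V D Q i) = a i" using DPserD(1)[OF V] by metis
  obtain b where b: "\<And>i D Q. valid D Q \<Longrightarrow> fst (Z D Q i) = b i" using DPserD(1)[OF Z] by metis
  have "DPv (\<lambda>D Q x. \<Sum>i\<in>{k - K..-1}. sc (a i) (curve_deriv G D (snd (Z D Q (k - i))) x) +
      - sc (b (k - i)) (curve_deriv G D (snd (V D Q i)) x) + br (snd (V D Q i) x) (snd (Z D Q (k - i)) x))"
    by (intro DPv_sum DPv_add DPv_minus DPv_scale DPv_br DPv_deriv DPserD(2)[OF V] DPserD(2)[OF Z])
  then have "DPv (\<lambda>D Q. snd (ser_brk G D (V D Q) (Z D Q) k))"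
  proof (rule DPv_cong)
    fix D Q x assume v: "valid D Q"
    interpret o: ds_open G D by (rule valid_ds_open[OF v])
    show "snd (ser_brk G D (V D Q) (Z D Q) k) x = (\<Sum>i\<in>{k - K..-1}. sc (a i) (curve_deriv G D (snd (Z D Q (k - i))) x) +
      - sc (b (k - i)) (curve_deriv G D (snd (V D Q i)) x) + br (snd (V D Q i) x) (snd (Z D Q (k - i)) x))"
      unfolding e[OF v] o.snd_sum_apply unfolding o.op_brk_pair by (simp add: a[OF v] b[OF v])
  qed
  then show "(\<exists>a. \<forall>D Q. valid D Q \<longrightarrow> fst (ser_brk G D (V D Q) (Z D Q) k) = a) \<and>
      DPv (\<lambda>D Q. snd (ser_brk G D (V D Q) (Z D Q) k))" using f by blast
qed

lemma DPser_expo: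
  assumes V: "DPser V" and Z: "DPser Z"
    and S: "\<And>D Q. valid D Q \<Longrightarrow> V D Q \<in> SER D (-1)" "\<And>D Q. valid D Q \<Longrightarrow> Z D Q \<in> SER D K"
  shows "DPser (\<lambda>D Q. exp_ser G (ser_brk G D (V D Q)) (Z D Q))"
  unfolding DPser_def
proof
  fix k
  have p: "DPser (\<lambda>D Q. (ser_brk G D (V D Q) ^^ n) (Z D Q)) \<and>
      (\<forall>D Q. valid D Q \<longrightarrow> (ser_brk G D (V D Q) ^^ n) (Z D Q) \<in> SER D (K - int n))" for n
  proof (induction n)
    case 0 then show ?case using Z S(2) by simp
  next
    case (Suc n)
    have "(ser_brk G D (V D Q) ^^ Suc n) (Z D Q) \<in> SER D (K - int (Suc n))" if v: "valid D Q" for D Q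
    proof -
      interpret o: ds_open G D by (rule valid_ds_open[OF v])
      show ?thesis unfolding o.ser_brk_eq by (rule o.dop.funpow_Ser[OF S(1)[OF v] S(2)[OF v]])
    qed
    moreover have "DPser (\<lambda>D Q. ser_brk G D (V D Q) ((ser_brk G D (V D Q) ^^ n) (Z D Q)))"
      using Suc by (intro DPser_sbr[OF V _ S(1)]) auto
    ultimately show ?case by simp
  qed
  define N where "N = nat (K - k)"
  have e: "exp_ser G (ser_brk G D (V D Q)) (Z D Q) k =
      (\<Sum>n\<le>N. op_scale G (1 / fact n) ((ser_brk G D (V D Q) ^^ n) (Z D Q) k))" if v: "valid D Q" for D Q
  proof -
    interpret o: ds_open G D by (rule valid_ds_open[OF v])
    show ?thesis unfolding o.ser_brk_eq o.exp_ser_eq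
      by (rule o.dop.expo_eq[OF S(1)[OF v] S(2)[OF v]]) (simp add: N_def)
  qed
  have "\<exists>a. \<forall>n. \<forall>D Q. valid D Q \<longrightarrow> fst ((ser_brk G D (V D Q) ^^ n) (Z D Q) k) = a n"
    by (rule choice) (use DPserD(1)[OF p[THEN conjunct1]] in blast)
  then obtain a where a: "\<And>n D Q. valid D Q \<Longrightarrow> fst ((ser_brk G D (V D Q) ^^ n) (Z D Q) k) = a n" by blast
  have "fst (exp_ser G (ser_brk G D (V D Q)) (Z D Q) k) = (\<Sum>n\<le>N. 1 / fact n * a n)" if v: "valid D Q" for D Q
  proof -
    interpret o: ds_open G D by (rule valid_ds_open[OF v])
    show ?thesis unfolding e[OF v] o.op_scale_pair by (simp add: fst_sum a[OF v])
  qed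
  moreover have "DPv (\<lambda>D Q x. \<Sum>n\<le>N. sc (1 / fact n) (snd ((ser_brk G D (V D Q) ^^ n) (Z D Q) k) x))"
    by (intro DPv_sum DPv_scale DPserD(2)[OF p[THEN conjunct1]])
  then have "DPv (\<lambda>D Q. snd (exp_ser G (ser_brk G D (V D Q)) (Z D Q) k))"
  proof (rule DPv_cong)
    fix D Q x assume v: "valid D Q"
    interpret o: ds_open G D by (rule valid_ds_open[OF v])
    show "snd (exp_ser G (ser_brk G D (V D Q)) (Z D Q) k) x =
        (\<Sum>n\<le>N. sc (1 / fact n) (snd ((ser_brk G D (V D Q) ^^ n) (Z D Q) k) x))"
      unfolding e[OF v] o.snd_sum_apply unfolding o.op_scale_pair by simp
  qed
  ultimately show "(\<exists>a. \<forall>D Q. valid D Q \<longrightarrow> fst (exp_ser G (ser_brk G D (V D Q)) (Z D Q) k) = a) \<and>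
      DPv (\<lambda>D Q. snd (exp_ser G (ser_brk G D (V D Q)) (Z D Q) k))" by blast
qed

lemma DPser_uminus: "DPser V \<Longrightarrow> DPser (\<lambda>D Q. - V D Q)"
  unfolding DPser_def
proof
  fix k assume a: "\<forall>k. (\<exists>a. \<forall>D Q. valid D Q \<longrightarrow> fst (V D Q k) = a) \<and> DPv (\<lambda>D Q. snd (V D Q k))"
  then obtain a where "\<forall>D Q. valid D Q \<longrightarrow> fst (V D Q k) = a" by blast
  then have "\<forall>D Q. valid D Q \<longrightarrow> fst ((- V D Q) k) = - a" by simp
  moreover have "DPv (\<lambda>D Q. snd ((- V D Q) k))"
    by (rule DPv_cong[OF DPv_minus[of "\<lambda>D Q. snd (V D Q k)"]]) (use a in auto)
  ultimately show "(\<exists>a. \<forall>D Q. valid D Q \<longrightarrow> fst ((- V D Q) k) = a) \<and> DPv (\<lambda>D Q. snd ((- V D Q) k))" by blast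
qed

lemma DPser_Lser: "DPser (\<lambda>D Q. ds_open.Lser G D Q)"
  unfolding DPser_def
proof
  fix k
  have v: "ds_open.Lser G D Q k = (if k = 0 then (1, Q) else if k = 1 then (0, restr D (\<lambda>_. Lam1 G)) else 0)"
    if "valid D Q" for D Q
    using ds_open.Lser_apply[OF valid_ds_open[OF that]] by blast
  have "DPv (\<lambda>D Q. snd (if k = 0 then (1, Q) else if k = 1 then (0, restr D (\<lambda>_. Lam1 G)) else (0 :: 'g dop)))"
    by (cases "k = 0"; cases "k = 1") (simp_all add: DPv_Q DPv_const DPv_zero zero_fun_def)
  then have "DPv (\<lambda>D Q. snd (ds_open.Lser G D Q k))" by (rule DPv_cong) (simp add: v)
  moreover have "fst (ds_open.Lser G D Q k) = (if k = 0 then 1 else 0)" if "valid D Q" for D Q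
    unfolding v[OF that] by simp
  ultimately show "(\<exists>a. \<forall>D Q. valid D Q \<longrightarrow> fst (ds_open.Lser G D Q k) = a) \<and> DPv (\<lambda>D Q. snd (ds_open.Lser G D Q k))"
    by blast
qed

lemma DPser_Pser: "DPser (\<lambda>D Q. ds_open.Pser G D p)"
  unfolding DPser_def
proof
  fix k
  have v: "ds_open.Pser G D p k = (if k = fst p then (0, restr D (\<lambda>_. Lam G p)) else 0)" if "valid D Q" for D Q
    using ds_open.Pser_apply[OF valid_ds_open[OF that]] by blast
  have "DPv (\<lambda>D Q. snd (if k = fst p then (0, restr D (\<lambda>_. Lam G p)) else (0 :: 'g dop)))"
    by (cases "k = fst p") (simp_all add: DPv_const DPv_zero zero_fun_def)
  then have "DPv (\<lambda>D Q. snd (ds_open.Pser G D p k))" by (rule DPv_cong) (simp add: v)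
  moreover have "fst (ds_open.Pser G D p k) = 0" if "valid D Q" for D Q
    unfolding v[OF that] by simp
  ultimately show "(\<exists>a. \<forall>D Q. valid D Q \<longrightarrow> fst (ds_open.Pser G D p k) = a) \<and> DPv (\<lambda>D (Q::real \<Rightarrow> 'g). snd (ds_open.Pser G D p k))"
    by blast
qed

lemma DPser_dressed:
  assumes V: "DPser V" and S: "\<And>D Q. valid D Q \<Longrightarrow> V D Q \<in> SER D (-1)" and p: "p \<in> exponents G"
  shows "DPser (\<lambda>D Q. ds_open.dressed G D (V D Q) p)"
proof -
  have "DPser (\<lambda>D Q. exp_ser G (ser_brk G D (V D Q)) (ds_open.Pser G D p))"
    by (rule DPser_expo[OF V DPser_Pser S]) (use ds_open.Pser_Ser valid_ds_open p in blast)+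
  moreover have "exp_ser G (ser_brk G D (V D Q)) (ds_open.Pser G D p) = ds_open.dressed G D (V D Q) p"
    if v: "valid D Q" for D Q
  proof -
    interpret o: ds_open G D by (rule valid_ds_open[OF v])
    show ?thesis unfolding o.dressed_def o.ser_brk_eq o.exp_ser_eq ..
  qed
  ultimately show ?thesis unfolding DPser_def
    by (metis (mono_tags, lifting) DPv_cong)
qed

lemma DPv_dress_step:
  assumes V: "DPser V" and S: "\<And>D Q. valid D Q \<Longrightarrow> V D Q \<in> SER D (-1)"
  shows "DPv (\<lambda>D Q. snd (ds_open.dress_step G D Q n (V D Q)))"
proof -
  define E where "E D Q = exp_ser G (ser_brk G D (- V D Q)) (ds_open.Lser G D Q)" for D Q
  have E: "DPser E" unfolding E_def
  proof (rule DPser_expo[OF DPser_uminus[OF V] DPser_Lser])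
    fix D Q assume v: "valid D Q"
    interpret o: ds_open G D by (rule valid_ds_open[OF v])
    show "- V D Q \<in> SER D (-1)" by (rule o.dop.Ser_minus[OF S[OF v]])
    show "ds_open.Lser G D Q \<in> SER D 1" using v o.B_curve_Lser unfolding valid_def by blast
  qed
  let ?S = "\<lambda>D Q x. solve (1 - int n) (snd (E D Q (1 - int n)) x)"
  have Sd: "DPv ?S" by (rule DPv_linear[OF DPserD(2)[OF E] linear_solve])
  have R: "DPv (\<lambda>D Q. snd (ds_open.dressed G D (V D Q) (int n, a) 0))" if "a < emult G (int n)" for a
    by (rule DPserD(2)[OF DPser_dressed[OF V S]]) (use that in \<open>simp_all add: exponents_pair\<close>)
  have lin: "Vector_Spaces.linear sc (*) (\<lambda>X. fm X Y)" for Y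
    using linear_form[of Y] by (simp add: form_sym[of _ Y])
  have t: "DPs (\<lambda>D Q x. (1 / of_nat n / cox_c) * fm dd (snd (ds_open.dressed G D (V D Q) (int n, a) 0) x) +
      (1 / cox_c) * fm (?S D Q x) (Lam G (int n, a)))" if "a < emult G (int n)" for a
    by (intro DPs_add DPs_mult DPs_const DPs_functional[OF R[OF that] linear_form] DPs_functional[OF Sd lin])
  have "DPv (\<lambda>D Q x. - ?S D Q x + (\<Sum>a<(if n = 1 then 0 else emult G (int n)).
      sc ((1 / of_nat n / cox_c) * fm dd (snd (ds_open.dressed G D (V D Q) (int n, a) 0) x) +
      (1 / cox_c) * fm (?S D Q x) (Lam G (int n, a))) (restr D (\<lambda>_. Lam G (- int n, a)) x)))"
    by (intro DPv_add DPv_minus Sd DPv_sum DPv_scalar t DPv_const) (auto split: if_splits)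
  then show ?thesis
  proof (rule DPv_cong)
    fix D Q x assume v: "valid D Q" and x: "x \<in> D"
    interpret o: ds_open G D by (rule valid_ds_open[OF v])
    show "snd (ds_open.dress_step G D Q n (V D Q)) x = - ?S D Q x + (\<Sum>a<(if n = 1 then 0 else emult G (int n)).
      sc ((1 / of_nat n / cox_c) * fm dd (snd (ds_open.dressed G D (V D Q) (int n, a) 0) x) +
      (1 / cox_c) * fm (?S D Q x) (Lam G (int n, a))) (restr D (\<lambda>_. Lam G (- int n, a)) x))"
      unfolding o.dress_step_def E_def o.exp_ser_eq o.ser_brk_eq snd_conv using x
      by (simp add: restr_def add_divide_distrib mult.commute)
  qed
qed

lemma DPser_rec_prefix: "DPser (\<lambda>D Q. graded_lie.rec_prefix (ds_open.dress_step G D Q) n)"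
proof (induction n)
  case 0
  have "graded_lie.rec_prefix (ds_open.dress_step G D Q) 0 k = 0" if v: "valid D Q" for D Q k
  proof -
    interpret o: ds_open G D by (rule valid_ds_open[OF v])
    show ?thesis by simp
  qed
  then show ?case unfolding DPser_def using DPv_cong[OF DPv_zero] by simp
next
  case (Suc n)
  have S: "graded_lie.rec_prefix (ds_open.dress_step G D Q) n \<in> SER D (-1)" if v: "valid D Q" for D Q
  proof -
    interpret o: ds_open G D by (rule valid_ds_open[OF v])
    have Q: "B_curve G D Q" using v unfolding valid_def by blast
    show ?thesis by (rule o.dop.rec_prefix_Ser) (rule o.dress_step_CC[OF Q])
  qed
  have e: "graded_lie.rec_prefix (ds_open.dress_step G D Q) (Suc n) k =
     (if k = - int (Suc n) then ds_open.dress_step G D Q (Suc n) (graded_lie.rec_prefix (ds_open.dress_step G D Q) n)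
      else graded_lie.rec_prefix (ds_open.dress_step G D Q) n k)" if v: "valid D Q" for D Q k
  proof -
    interpret o: ds_open G D by (rule valid_ds_open[OF v])
    show ?thesis by simp
  qed
  have f: "fst (ds_open.dress_step G D Q (Suc n) W) = 0" if v: "valid D Q" for D Q W
  proof -
    interpret o: ds_open G D by (rule valid_ds_open[OF v])
    show ?thesis unfolding o.dress_step_def by simp
  qed
  show ?case unfolding DPser_def
  proof
    fix k
    show "(\<exists>a. \<forall>D Q. valid D Q \<longrightarrow> fst (graded_lie.rec_prefix (ds_open.dress_step G D Q) (Suc n) k) = a) \<and>
      DPv (\<lambda>D Q. snd (graded_lie.rec_prefix (ds_open.dress_step G D Q) (Suc n) k))"
    proof (cases "k = - int (Suc n)")
      case True
      then show ?thesis using f e by (auto intro!: DPv_cong[OF DPv_dress_step[OF Suc S]])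
    next
      case False
      obtain a where "\<forall>D Q. valid D Q \<longrightarrow> fst (graded_lie.rec_prefix (ds_open.dress_step G D Q) n k) = a"
        using DPserD(1)[OF Suc] by blast
      then show ?thesis using False e by (auto intro!: DPv_cong[OF DPserD(2)[OF Suc]])
    qed
  qed
qed

lemma DPser_dress_ser: "DPser (\<lambda>D Q. ds_open.dress_ser G D Q)"
  unfolding DPser_def
proof
  fix k
  have e: "ds_open.dress_ser G D Q k = graded_lie.rec_prefix (ds_open.dress_step G D Q) (nat (- k)) k"
    if v: "valid D Q" for D Q
  proof -
    interpret o: ds_open G D by (rule valid_ds_open[OF v])
    show ?thesis unfolding o.dress_ser_def o.dop.rec_ser_def ..
  qed
  obtain a where "\<forall>D Q. valid D Q \<longrightarrow> fst (graded_lie.rec_prefix (ds_open.dress_step G D Q) (nat (- k)) k) = a"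
    using DPserD(1)[OF DPser_rec_prefix] by blast
  then show "(\<exists>a. \<forall>D Q. valid D Q \<longrightarrow> fst (ds_open.dress_ser G D Q k) = a) \<and> DPv (\<lambda>D Q. snd (ds_open.dress_ser G D Q k))"
    using e by (auto intro!: DPv_cong[OF DPserD(2)[OF DPser_rec_prefix]])
qed

lemma DPv_dressed_Lam: "p \<in> pos_exponents G \<Longrightarrow> DPv (\<lambda>D Q. dressed_Lam G D Q p)"
proof -
  assume p: "p \<in> pos_exponents G"
  then have pE: "p \<in> exponents G" unfolding pos_exponents_def by blast
  have S: "ds_open.dress_ser G D Q \<in> SER D (-1)" if v: "valid D Q" for D Q
  proof -
    interpret o: ds_open G D by (rule valid_ds_open[OF v])
    show ?thesis using o.dress_ser_Ser v unfolding valid_def by blast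
  qed
  have "DPv (\<lambda>D Q x. \<Sum>k\<in>{0..fst p}. snd (ds_open.dressed G D (ds_open.dress_ser G D Q) p k) x)"
    by (intro DPv_sum DPserD(2)[OF DPser_dressed[OF DPser_dress_ser S pE]])
  then show ?thesis
  proof (rule DPv_cong)
    fix D Q x assume v: "valid D Q"
    interpret o: ds_open G D by (rule valid_ds_open[OF v])
    have "B_curve G D Q" using v unfolding valid_def by blast
    then show "dressed_Lam G D Q p x = (\<Sum>k\<in>{0..fst p}. snd (ds_open.dressed G D (ds_open.dress_ser G D Q) p k) x)"
      using o.dressed_Lam_eq[OF _ p order_refl] unfolding o.Rc_def by blast
  qed
qed

lemma DPv_Mfun: "DPv (\<lambda>D Q. Mfun G b D Q)"
proof -
  let ?rh = "complex_of_nat (twist G) * complex_of_nat (cox G)"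
  have c: "DPs (\<lambda>D Q x. b p + - ((if p = (1, 0) then 1 else 0) / ?rh) * complex_of_real x)" for p
    by (intro DPs_add DPs_mult DPs_const DPs_of_real)
  have "DPv (\<lambda>D Q x. sc ?rh (\<Sum>p | p \<in> pos_exponents G \<and> (b p \<noteq> 0 \<or> p = (1, 0)).
      sc (b p + - ((if p = (1, 0) then 1 else 0) / ?rh) * complex_of_real x) (dressed_Lam G D Q p x)))"
    by (intro DPv_scale DPv_sum DPv_scalar c DPv_dressed_Lam) auto
  then show ?thesis by (rule DPv_cong) (simp add: Mfun_def Let_def)
qed

end

section \<open>Baecklund transformations\<close>

lemma exp_nil_eq:
  fixes s :: "complex \<Rightarrow> 'c::ab_group_add \<Rightarrow> 'c"
  assumes s: "vector_space s" and z: "\<And>n. N < n \<Longrightarrow> (T ^^ n) y = 0"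
  shows "exp_nil s T y = (\<Sum>n\<le>N. s (1 / fact n) ((T ^^ n) y))"
proof -
  interpret s: vector_space s by fact
  show ?thesis unfolding exp_nil_def
  proof (rule sum.mono_neutral_cong_left)
    show "{n. (T ^^ n) y \<noteq> 0} \<subseteq> {..N}"
      using z by (auto simp: not_less[symmetric])
  qed auto
qed

context graded_lie
begin

text \<open>The exponential of ad W is only needed where a double bracket vanishes: the Heisenberg
  subalgebra is commutative up to the center.\<close>

lemma expo_two:
  assumes U: "U \<in> Ser (-1)" and Z: "Z \<in> Ser K" and z: "sbr U (sbr U Z) = 0"
  shows "expo (sbr U) Z = Z + sbr U Z"
proof
  fix k
  have zz: "(sbr U ^^ Suc (Suc n)) Z = 0" for n
    by (induction n) (simp_all only: funpow.simps o_apply id_apply z sbr_zero_right[OF U])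
  have "expo (sbr U) Z k = (\<Sum>n\<le>Suc (Suc (nat (K - k))). s (1 / fact n) ((sbr U ^^ n) Z k))"
    by (rule expo_eq[OF U Z]) simp
  also have "\<dots> = Z k + sbr U Z k"
    unfolding sum.atMost_Suc_shift zz zero_fun_def by simp
  finally show "expo (sbr U) Z k = (Z + sbr U Z) k" by simp
qed

end

context drinfeld_sokolov_data
begin

section \<open>Powers of ad \<open>ff j\<close> on the components of M\<close>

lemma linear_funpow_br: "Vector_Spaces.linear sc sc (br X ^^ n)"
proof (induction n)
  case 0
  show ?case unfolding Vector_Spaces.linear_iff by (simp add: vector_space_sc)
next
  case (Suc n)
  show ?case unfolding funpow.simps using Vector_Spaces.linear_compose[OF Suc linear_br_right] .
qed

lemma funpow_br_add: "(br X ^^ n) (Y + Z) = (br X ^^ n) Y + (br X ^^ n) Z"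
  and funpow_br_scale: "(br X ^^ n) (sc a Y) = sc a ((br X ^^ n) Y)"
  using linear_funpow_br[where X = X and n = n] by (auto simp: Vector_Spaces.linear_iff)

lemma funpow_br_zero: "(br X ^^ n) 0 = 0" using funpow_br_scale[where a = 0 and Y = 0] by simp

lemma funpow_br_sum: "(br X ^^ n) (sum F S) = (\<Sum>i\<in>S. (br X ^^ n) (F i))"
  by (induction S rule: infinite_finite_induct) (auto simp: funpow_br_add funpow_br_zero)

lemma funpow_br_mono: "(br X ^^ m) Y = 0 \<Longrightarrow> m \<le> n \<Longrightarrow> (br X ^^ n) Y = 0"
proof -
  assume a: "(br X ^^ m) Y = 0" "m \<le> n"
  obtain d where "n = d + m" using a(2) by (metis le_add_diff_inverse2)
  then have "(br X ^^ n) Y = (br X ^^ d) ((br X ^^ m) Y)" by (simp add: funpow_add)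
  then show ?thesis using a funpow_br_zero by simp
qed

lemma form_funpow_br: "fm Y ((br X ^^ n) Z) = (-1) ^ n * fm ((br X ^^ n) Y) Z"
proof (induction n arbitrary: Z)
  case (Suc n)
  have "fm Y ((br X ^^ Suc n) Z) = fm Y ((br X ^^ n) (br X Z))" by (simp add: funpow_swap1)
  also have "\<dots> = (-1) ^ n * fm ((br X ^^ n) Y) (br X Z)" by (rule Suc)
  also have "fm ((br X ^^ n) Y) (br X Z) = - fm (br X ((br X ^^ n) Y)) Z" by (simp add: form_ad)
  finally show ?case by simp
qed simp

lemma funpow_br_Eig: "X \<in> Eig k \<Longrightarrow> Y \<in> Eig m \<Longrightarrow> (br X ^^ n) Y \<in> Eig (m + int n * k)"
proof (induction n)
  case (Suc n)
  then show ?case using Eig_br[of X k "(br X ^^ n) Y" "m + int n * k"] by (simp add: algebra_simps)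
qed simp

text \<open>Modulo \<open>nilrad j\<close>, whose degree 1 part is killed by ad \<open>ff j\<close>,
  the vector is a multiple of \<open>ee j\<close>. The powers therefore follow the sl2 string from
  \<open>ee j\<close> to \<open>hh j\<close> to \<open>ff j\<close>.\<close>

lemma funpow_ff_Eig1:
  assumes X: "X \<in> Eig 1" and j: "j \<le> ll"
  shows "br (ff j) X = sc (- (fm (ff j) X / rat j)) (hh j)"
    "br (ff j) (br (ff j) X) = sc (- 2 * (fm (ff j) X / rat j)) (ff j)"
    "3 \<le> n \<Longrightarrow> (br (ff j) ^^ n) X = 0"
proof -
  let ?m = "fm (ff j) X / rat j"
  define Y where "Y = X - sc ?m (ee j)"
  have Y: "Y \<in> nilrad j" unfolding Y_def by (rule Eig1_nilrad[OF X j])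
  have YE: "Y \<in> Eig 1" unfolding Y_def
    by (intro vs.subspace_diff[OF subspace_Eig] X vs.subspace_scale[OF subspace_Eig] Eig_gens j)
  have "br (ff j) Y = 0" using nilrad_nilpotent[OF Y YE j, of 1] by simp
  then show 1: "br (ff j) X = sc (- ?m) (hh j)"
    unfolding Y_def by (simp add: br_diff_right br_scale_right br_fe[OF j j] eq_neg_iff_add_eq_0)
  have fh: "br (ff j) (hh j) = sc 2 (ff j)"
    using br_anti[of "ff j" "hh j"] br_hf[OF j j] aa_diag[OF j] by simp
  show 2: "br (ff j) (br (ff j) X) = sc (- 2 * ?m) (ff j)"
    unfolding 1 br_scale_right fh by simp
  have "(br (ff j) ^^ 3) X = 0" using 2 by (simp add: eval_nat_numeral br_scale_right br_minus_right)
  then show "3 \<le> n \<Longrightarrow> (br (ff j) ^^ n) X = 0" by (rule funpow_br_mono)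
qed

lemma funpow_ff_Eig_ge2:
  assumes "X \<in> Eig k" "2 \<le> k" "j \<le> ll" "k \<le> int n"
  shows "(br (ff j) ^^ n) X = 0"
  by (rule nilrad_nilpotent[OF Eig_nilrad[OF assms(1,2)] assms(1,3,4)])

lemma br_ff_Hspan: "X \<in> Hspan \<Longrightarrow> j \<le> ll \<Longrightarrow> br (ff j) X = sc (fm (hh j) X / rat j) (ff j)"
  using br_anti[of "ff j" X] br_Hspan_weight(1)[of X j] by simp

end

text \<open>Here phi_j has no zeros on the whole of \<open>D\<close>; the general case is reduced to
  this one by restriction to the regular set.\<close>

locale ds_backlund = ds_red G D b for G :: "'g::ab_group_add affine_data" and D b +
  fixes Q :: "real \<Rightarrow> 'g" and j :: nat
  assumes Q: "B_curve G D Q" and j: "j \<le> ll"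
    and red: "x \<in> D \<Longrightarrow> cd (Mc Q 0) x = 0"
    and nz: "x \<in> D \<Longrightarrow> phi G (Mfun G b D Q) j x \<noteq> 0"
begin

abbreviation "MM \<equiv> Mfun G b D Q"
abbreviation "ch \<equiv> chi G MM j"
abbreviation "ph \<equiv> phi G MM j"
abbreviation "th \<equiv> theta G Q j"
abbreviation "xx \<equiv> xi G MM j"

section \<open>The function xi_j and the transformed Q\<close>

lemma smooth_ch: "smooth_scalar D ch" and smooth_ph: "smooth_scalar D ph" and smooth_xx: "smooth_scalar D xx"
proof -
  have "smooth_scalar D (\<lambda>x. rat j + (-1) * fm (hh j) (Mc Q 0 x))"
    by (intro smooth_scalar_add smooth_scalar_mult smooth_scalar_const smooth_form_right Mc_facts(1)[OF Q])
  then show c: "smooth_scalar D ch" by (rule smooth_scalar_cong) (simp add: chi_Mc[OF Q j])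
  have "smooth_scalar D (\<lambda>x. 1 / nu G * fm (ff j) (Mc Q 1 x))"
    by (intro smooth_scalar_mult smooth_scalar_const smooth_form_right Mc_facts(1)[OF Q])
  then show p: "smooth_scalar D ph" by (rule smooth_scalar_cong) (simp add: phi_Mc[OF Q j])
  have "smooth_scalar D (\<lambda>x. (1 / nu G) * (ch x * (1 / ph x)))"
    by (intro smooth_scalar_mult smooth_scalar_const c smooth_scalar_inverse[OF D p] nz)
  then show "smooth_scalar D xx" by (rule smooth_scalar_cong) (simp add: xi_def)
qed

lemma ch_derivative: "x \<in> D \<Longrightarrow> (ch has_vector_derivative 0) (at x)"
  using chi_derivative[OF Q j] red by fastforce

lemma xx_ph: "x \<in> D \<Longrightarrow> xx x * (nu G * ph x) = ch x"
  unfolding xi_def using nz nu_nz by simp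

text \<open>Differentiate nu xi phi_j = chi_j, whose right-hand side is constant, and insert the ODE
  for phi_j: the result is a Riccati equation for xi.\<close>

lemma xx_derivative:
  assumes x: "x \<in> D"
  shows "vector_derivative xx (at x) = xx x * th x + nu G * (xx x)\<^sup>2"
proof -
  let ?d = "vector_derivative xx (at x)"
  have d: "(xx has_vector_derivative ?d) (at x)" by (rule smooth_scalar_deriv(2)[OF D smooth_xx x])
  have "((\<lambda>t. xx t * (nu G * ph t)) has_vector_derivative
      xx x * (nu G * - (th x * ph x + ch x)) + ?d * (nu G * ph x)) (at x)"
    by (intro has_vector_derivative_mult d has_vector_derivative_mult_right phi_derivative[OF Q j x])
  then have "(ch has_vector_derivative xx x * (nu G * - (th x * ph x + ch x)) + ?d * (nu G * ph x)) (at x)"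
    by (rule has_vector_derivative_transform_within_open[OF _ D x]) (rule xx_ph)
  then have "xx x * (nu G * - (th x * ph x + ch x)) + ?d * (nu G * ph x) = 0"
    using ch_derivative[OF x] vector_derivative_unique_at by blast
  then have "?d * (nu G * ph x) = (xx x * th x + nu G * (xx x)\<^sup>2) * (nu G * ph x)"
    unfolding xx_ph[OF x, symmetric] by (simp add: algebra_simps power2_eq_square)
  then show ?thesis using nz[OF x] nu_nz by simp
qed

definition Fm :: "real \<Rightarrow> 'g" where "Fm = restr D (\<lambda>x. sc (- xx x) (ff j))"

lemma Fm_apply: "x \<in> D \<Longrightarrow> Fm x = sc (- xx x) (ff j)" unfolding Fm_def restr_def by simp

lemma smc_Fm: "smc Fm"
proof -
  have "smooth_scalar D (\<lambda>x. (-1) * xx x)" by (intro smooth_scalar_mult smooth_scalar_const smooth_xx)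
  then show ?thesis unfolding Fm_def by (intro smooth_curve_term) simp
qed

lemma cd_Fm: "x \<in> D \<Longrightarrow> cd Fm x = sc (- (xx x * th x + nu G * (xx x)\<^sup>2)) (ff j)"
proof -
  assume x: "x \<in> D"
  have e: "Fm = (\<lambda>x. - sc (xx x) (restr D (\<lambda>_. ff j) x))" unfolding Fm_def restr_def by auto
  have s: "smc (\<lambda>x. sc (xx x) (restr D (\<lambda>_. ff j) x))"
    by (rule smooth_curve_scalar[OF smooth_curve_const smooth_xx])
  show ?thesis unfolding e cd_minus[OF s] cd_scalar[OF smooth_curve_const smooth_xx] cd_const xx_derivative[OF x]
    using x by (simp add: restr_def del: minus_add_distrib)
qed

lemma Fm_CC: "(0, Fm) \<in> CC (-1)"
  unfolding CC_iff using smc_Fm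
  by (auto simp: Fm_def restr_def intro: Eig_gens(2)[OF j] vs.subspace_neg[OF subspace_Eig]
      vs.subspace_scale[OF subspace_Eig] vs.subspace_0[OF subspace_Eig])

definition NF :: "'g dser" where "NF = homog (-1) (0, Fm)"

lemma NF_Ser: "NF \<in> dop.Ser (-1)"
  by (rule dop.SerI) (auto simp: NF_def homog_def Fm_CC)

lemma sbr_NF:
  assumes "Z \<in> dop.Ser K" shows "dop.sbr NF Z k = op_brk G D (0, Fm) (Z (k + 1))"
proof -
  have "op_brk G D (NF i) (Z (k - i)) = (if i = -1 then op_brk G D (0, Fm) (Z (k - i)) else 0)" for i
    using dop.b_zero_left[OF dop.SerD(1)[OF assms]] by (auto simp: NF_def homog_def)
  then show ?thesis unfolding dop.sbr_Sum_any by simp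
qed

lemma op_brk_Fm: "op_brk G D (0, Fm) (0, P) = (0, \<lambda>x. br (Fm x) (P x))"
  unfolding op_brk_pair by simp

lemma sbr_NF_funpow:
  assumes Z: "Z \<in> dop.Ser K" "\<And>k. fst (Z k) = 0"
  shows "fst ((dop.sbr NF ^^ n) Z k) = 0 \<and>
    (\<forall>x\<in>D. snd ((dop.sbr NF ^^ n) Z k) x = sc ((- xx x) ^ n) ((br (ff j) ^^ n) (snd (Z (k + int n)) x)))"
proof (induction n arbitrary: k)
  case 0 then show ?case using Z(2) by simp
next
  case (Suc n)
  have e: "(dop.sbr NF ^^ Suc n) Z k = op_brk G D (0, Fm) ((dop.sbr NF ^^ n) Z (k + 1))"
    using sbr_NF[OF dop.funpow_Ser[OF NF_Ser Z(1)]] by simp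
  have f: "fst ((dop.sbr NF ^^ n) Z (k + 1)) = 0" using Suc[of "k + 1"] by simp
  have "(dop.sbr NF ^^ n) Z (k + 1) = (0, snd ((dop.sbr NF ^^ n) Z (k + 1)))" using f by (simp add: prod_eq_iff)
  then have e': "(dop.sbr NF ^^ Suc n) Z k = (0, \<lambda>x. br (Fm x) (snd ((dop.sbr NF ^^ n) Z (k + 1)) x))"
    unfolding e using op_brk_Fm by metis
  show ?case unfolding e' using Suc[of "k + 1"]
    by (auto simp: Fm_apply br_minus_left br_scale_left br_scale_right algebra_simps)
qed

text \<open>Conjugation alone adds nu xi \<open>hh j\<close>. As (d | h_j) is \<open>rat j\<close>
  and (d | c) = h, the multiple of \<open>cc\<close> is the one that restores orthogonality to
  \<open>dd\<close>.\<close>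

definition Qt :: "real \<Rightarrow> 'g" where
  "Qt = restr D (\<lambda>x. Q x + sc (nu G * xx x) (hh j) - sc (nu G * rat j / cox_c * xx x) cc)"

lemma Qt_apply: "x \<in> D \<Longrightarrow> Qt x = Q x + sc (nu G * xx x) (hh j) - sc (nu G * rat j / cox_c * xx x) cc"
  unfolding Qt_def restr_def by simp

lemma B_curve_Qt: "B_curve G D Qt"
  unfolding B_curve_def
proof
  have e: "Qt = (\<lambda>x. Q x + restr D (\<lambda>x. sc (nu G * xx x) (hh j)) x - restr D (\<lambda>x. sc (nu G * rat j / cox_c * xx x) cc) x)"
    unfolding Qt_def restr_def using smooth_curve_outside[OF B_curve_facts(1)[OF Q]] by auto
  show "smc Qt" unfolding e
    by (intro smc_diff smooth_curve_add B_curve_facts(1)[OF Q] smooth_curve_term smooth_scalar_mult smooth_scalar_const smooth_xx)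
  show "\<forall>x\<in>D. Qt x \<in> Bspace G"
  proof
    fix x assume x: "x \<in> D"
    have "Qt x \<in> Hspan" unfolding Qt_apply[OF x]
      by (intro vs.subspace_diff[OF subspace_Hspan] vs.subspace_add[OF subspace_Hspan] vs.subspace_scale[OF subspace_Hspan]
          B_curve_facts(2)[OF Q] Hspan_hh j cc_Hspan)
    moreover have "fm dd (Qt x) = 0" unfolding Qt_apply[OF x]
      using B_curve_facts(3)[OF Q, of x] cox_nz
      by (simp add: form_diff_right form_add_right form_scale_right form_dh[OF j] form_dd_cc)
    ultimately show "Qt x \<in> Bspace G" unfolding Bspace_iff by blast
  qed
qed

definition UQ :: "'g dser" where "UQ = dress_ser Q"

lemma UQ: "UQ \<in> dop.Ser (-1)" "is_dressing Q UQ"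
  unfolding UQ_def by (rule dress_ser_Ser[OF Q], rule dress_ser_dressing[OF Q])

definition Ep :: "int \<times> nat \<Rightarrow> 'g dser" where "Ep p = dop.expo (dop.sbr NF) (dressed UQ p)"

lemma dressed_fst: "p \<in> exponents G \<Longrightarrow> fst (dressed UQ p k) = 0"
  using dressed_derived[OF UQ(1)] unfolding derived_ops_def by blast

lemma Ep_Ser: "p \<in> exponents G \<Longrightarrow> Ep p \<in> dop.Ser (fst p)"
  unfolding Ep_def by (rule dop.expo_Ser[OF NF_Ser dressed_Ser[OF UQ(1)]])

lemma Ep_apply:
  assumes p: "p \<in> exponents G" and N: "fst p - k \<le> int N"
  shows "fst (Ep p k) = 0"
    "x \<in> D \<Longrightarrow> snd (Ep p k) x = (\<Sum>n\<le>N. sc ((- xx x) ^ n / fact n) ((br (ff j) ^^ n) (Rc Q p (k + int n) x)))"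
proof -
  note S = dressed_Ser[OF UQ(1) p]
  have e: "Ep p k = (\<Sum>n\<le>N. op_scale G (1 / fact n) ((dop.sbr NF ^^ n) (dressed UQ p) k))"
    unfolding Ep_def by (rule dop.expo_eq[OF NF_Ser S N])
  note T = sbr_NF_funpow[OF S dressed_fst[OF p]]
  show "fst (Ep p k) = 0" unfolding e op_scale_pair using T by (simp add: fst_sum)
  assume x: "x \<in> D"
  show "snd (Ep p k) x = (\<Sum>n\<le>N. sc ((- xx x) ^ n / fact n) ((br (ff j) ^^ n) (Rc Q p (k + int n) x)))"
    unfolding e snd_sum_apply op_scale_pair snd_conv
    by (rule sum.cong) (use T[THEN conjunct2, rule_format, OF x] in \<open>simp_all add: Rc_def UQ_def\<close>)
qed

text \<open>
  Adding \<open>ad\<close> of \<open>\<Sum>\<^sub>p w\<^sub>p \<Lambda>\<^sub>-\<^sub>p\<close> changes the dressed \<open>\<Lambda>\<^sub>p\<close> by \<open>- p w\<^sub>p c\<close>; since \<open>(d | c) = h\<close>, the following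
  coefficients restore the normalization.
\<close>

definition ww :: "int \<times> nat \<Rightarrow> real \<Rightarrow> complex" where
  "ww p x = fm dd (snd (Ep p 0) x) / (of_int (fst p) * cox_c)"

lemma smooth_ww: "p \<in> exponents G \<Longrightarrow> smooth_scalar D (ww p)" and ww_outside: "p \<in> exponents G \<Longrightarrow> x \<notin> D \<Longrightarrow> ww p x = 0"
proof -
  assume p: "p \<in> exponents G"
  have "smooth_scalar D (\<lambda>x. (1 / (of_int (fst p) * cox_c)) * fm dd (snd (Ep p 0) x))"
    by (intro smooth_scalar_mult smooth_scalar_const smooth_form_right SerD_curve(1)[OF Ep_Ser[OF p]])
  then show "smooth_scalar D (ww p)" unfolding ww_def by simp
  show "x \<notin> D \<Longrightarrow> ww p x = 0" unfolding ww_def using SerD_curve(4)[OF Ep_Ser[OF p]] by simp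
qed

text \<open>The degree 0 component of the conjugated dressed Lambda_1 is \<open>Q\<close> plus nu xi
  \<open>hh j\<close>, so this coefficient equals the one of \<open>cc\<close> in \<open>Qt\<close>.
  That coincidence cancels the central terms in \<open>dressing_Qt\<close>.\<close>

lemma ww_one: "x \<in> D \<Longrightarrow> ww (1, 0) x = nu G * rat j / cox_c * xx x"
proof -
  assume x: "x \<in> D"
  have "snd (Ep (1, 0) 0) x = (\<Sum>n\<le>1. sc ((- xx x) ^ n / fact n) ((br (ff j) ^^ n) (Rc Q (1, 0) (0 + int n) x)))"
    by (rule Ep_apply(2)[OF one_exponent(1) _ x]) simp
  also have "\<dots> = Q x + sc (xx x * nu G) (hh j)"
    using Rc_one[OF Q x] br_ff_Lam1[OF j] by simp
  finally have "fm dd (snd (Ep (1, 0) 0) x) = xx x * nu G * rat j"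
    using B_curve_facts(3)[OF Q, of x] by (simp add: form_add_right form_scale_right form_dh[OF j])
  then show ?thesis unfolding ww_def by simp
qed

definition Ws :: "'g dser" where
  "Ws k = (0, \<lambda>x. if k < 0 then \<Sum>a<emult G (- k). sc (ww (- k, a) x) (Lam G (k, a)) else 0)"

lemma Ws_smc: "smc (snd (Ws k))"
proof (cases "k < 0")
  case True
  have "smc (\<lambda>x. sc (ww (- k, a) x) (Lam G (k, a)))" if "a < emult G (- k)" for a
    by (rule smc_term0) (use that smooth_ww ww_outside in \<open>auto simp: exponents_pair\<close>)
  then show ?thesis unfolding Ws_def using True by (auto intro!: smooth_curve_sum)
qed (simp add: Ws_def)

lemma Lam_neg: "a < emult G (- k) \<Longrightarrow> Lam G (k, a) \<in> heis G \<inter> Eig k"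
  using Lam_heis[of "(k, a)"] Lam_Eig[of "(k, a)"] by (simp add: exponents_pair emult_minus)

lemma Ws_heis: "snd (Ws k) x \<in> heis G \<inter> Eig k"
proof (cases "k < 0")
  case True
  then show ?thesis unfolding Ws_def using Lam_neg
    by (auto intro!: vs.subspace_sum[OF subspace_heis] vs.subspace_sum[OF subspace_Eig]
        vs.subspace_scale[OF subspace_heis] vs.subspace_scale[OF subspace_Eig])
qed (simp add: Ws_def vs.subspace_0[OF subspace_heis] vs.subspace_0[OF subspace_Eig])

lemma Ws_Ser: "Ws \<in> dop.Ser (-1)"
proof (rule dop.SerI)
  show "Ws k \<in> CC k" for k unfolding CC_iff using Ws_smc Ws_heis by (simp add: Ws_def)
  show "Ws k = 0" if "-1 < k" for k using that by (simp add: Ws_def zero_prod_def zero_fun_def)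
qed

text \<open>The Heisenberg vectors are constant in \<open>x\<close>, so only coefficients get
  differentiated. The derivative that ad W produces from the partial derivative can thus be absorbed
  into the Heisenberg-valued part.\<close>

lemma cd_Ws_heis: "cd (snd (Ws k)) x \<in> heis G"
proof (cases "k < 0")
  case True
  have s: "smc (\<lambda>x. sc (ww (- k, a) x) (restr D (\<lambda>_. Lam G (k, a)) x))" if "a < emult G (- k)" for a
    by (intro smooth_curve_scalar smooth_curve_const smooth_ww) (use that in \<open>simp add: exponents_pair\<close>)
  have e: "snd (Ws k) = (\<lambda>x. \<Sum>a<emult G (- k). sc (ww (- k, a) x) (restr D (\<lambda>_. Lam G (k, a)) x))"
    unfolding Ws_def using True ww_outside by (auto simp: restr_def exponents_pair intro!: sum.cong)
  have "cd (snd (Ws k)) = (\<lambda>x. \<Sum>a<emult G (- k). cd (\<lambda>x. sc (ww (- k, a) x) (restr D (\<lambda>_. Lam G (k, a)) x)) x)"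
    unfolding e by (rule cd_sum) (use s in simp)
  also have "\<dots> = (\<lambda>x. \<Sum>a<emult G (- k). sc (vector_derivative (ww (- k, a)) (at x)) (restr D (\<lambda>_. Lam G (k, a)) x))"
    by (intro ext sum.cong refl) (simp add: cd_scalar[OF smooth_curve_const smooth_ww] cd_const exponents_pair)
  finally show ?thesis using Lam_neg vs.subspace_0[OF subspace_heis]
    by (auto intro!: vs.subspace_sum[OF subspace_heis] vs.subspace_scale[OF subspace_heis] simp: restr_def)
next
  case False
  have "cd (\<lambda>_. 0) = (\<lambda>_. 0)" by (rule cd_eqI) (auto intro: has_cd_zero)
  then show ?thesis using False vs.subspace_0[OF subspace_heis] by (simp add: Ws_def)
qed

lemma heis_br_zero: "X \<in> heis G \<inter> Eig k \<Longrightarrow> Y \<in> heis G \<inter> Eig m \<Longrightarrow> k + m \<noteq> 0 \<Longrightarrow> br X Y = 0"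
  using span_cc_Eig[OF heis_br Eig_br] by blast

text \<open>Central curves of degree 0. Negative series commute with them, so they pass unchanged
  through every exponential below.\<close>

definition cser :: "(real \<Rightarrow> complex) \<Rightarrow> 'g dser" where
  "cser u = homog 0 (0, restr D (\<lambda>x. sc (u x) cc))"

lemma cser_Ser: "smooth_scalar D u \<Longrightarrow> 0 \<le> K \<Longrightarrow> cser u \<in> dop.Ser K"
proof (rule dop.SerI)
  assume u: "smooth_scalar D u" and K: "0 \<le> K"
  have "(0, restr D (\<lambda>x. sc (u x) cc)) \<in> CC 0"
    unfolding CC_iff using smooth_curve_term[OF u] vs.subspace_scale[OF subspace_Eig cc_Eig] vs.subspace_0[OF subspace_Eig]
    by (auto simp: restr_def)
  then show "cser u k \<in> CC k" for k by (simp add: cser_def homog_def)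
  show "cser u k = 0" if "K < k" for k using that K by (simp add: cser_def homog_def)
qed

lemma sbr_cser:
  assumes V: "V \<in> dop.Ser (-1)" and u: "smooth_scalar D u" shows "dop.sbr V (cser u) = 0"
proof
  fix k
  have fV: "fst (V i) = 0" for i using SerD_curve(3)[OF V] dop.SerD(2)[OF V] by (cases "i < 0") auto
  have "op_brk G D (V i) (cser u (k - i)) = 0" for i
  proof (cases "k = i")
    case True
    then show ?thesis unfolding op_brk_pair by (auto simp: fV cser_def homog_def zero_prod_def zero_fun_def restr_def br_scale_right)
  next
    case False
    then show ?thesis using dop.b_zero_right[OF dop.SerD(1)[OF V]] by (simp add: cser_def homog_def)
  qed
  then show "dop.sbr V (cser u) k = 0 k" unfolding dop.sbr_def by simp
qed

lemma expo_cser: "V \<in> dop.Ser (-1) \<Longrightarrow> smooth_scalar D u \<Longrightarrow> dop.expo (dop.sbr V) (cser u) = cser u"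
  by (rule dop.expo_fixed[OF _ cser_Ser[OF _ order_refl] sbr_cser])

lemma br_Ws_Lam:
  assumes p: "p \<in> exponents G" "0 < fst p"
  shows "br (snd (Ws (- fst p)) x) (Lam G p) = sc (- of_int (fst p) * ww p x) cc"
proof -
  have "br (Lam G (- fst p, a)) (Lam G p) = (if a = snd p then sc (- of_int (fst p)) cc else 0)" if "a < emult G (fst p)" for a
    using br_Lam[of "(- fst p, a)" p] p that by (auto simp: exponents_pair emult_minus)
  then have "(\<Sum>a<emult G (fst p). sc (ww (fst p, a) x) (br (Lam G (- fst p, a)) (Lam G p))) =
      (\<Sum>a<emult G (fst p). if a = snd p then sc (ww p x * - of_int (fst p)) cc else 0)"
    by (intro sum.cong) auto
  moreover have "snd p < emult G (fst p)" using p(1) exponents_pair[of "fst p" "snd p"] by simp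
  ultimately show ?thesis unfolding Ws_def using p(2) by (simp add: br_sum_left br_scale_left mult.commute)
qed

lemma sbr_Ws_Pser:
  assumes p: "p \<in> exponents G" "0 < fst p"
  shows "dop.sbr Ws (Pser p) = cser (\<lambda>x. - of_int (fst p) * ww p x)"
proof
  fix k
  have e: "dop.sbr Ws (Pser p) k = op_brk G D (Ws (k - fst p)) (0, restr D (\<lambda>_. Lam G p))"
    by (rule sbr_Pser[OF Ws_Ser p(1)])
  show "dop.sbr Ws (Pser p) k = cser (\<lambda>x. - of_int (fst p) * ww p x) k"
  proof (cases "k = 0")
    case True
    then show ?thesis unfolding e op_brk_pair using br_Ws_Lam[OF p]
      by (auto simp: cser_def homog_def restr_def Ws_def)
  next
    case False
    have "br (snd (Ws (k - fst p)) x) (Lam G p) = 0" for x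
      using heis_br_zero[OF Ws_heis, of "Lam G p" "fst p" "k - fst p" x] Lam_heis[OF p(1)] Lam_Eig[OF p(1)] False by simp
    then show ?thesis unfolding e op_brk_pair using False
      by (auto simp: cser_def homog_def restr_def Ws_def zero_prod_def zero_fun_def)
  qed
qed

lemma smooth_neg_ww: "p \<in> exponents G \<Longrightarrow> smooth_scalar D (\<lambda>x. - of_int (fst p) * ww p x)"
  by (intro smooth_scalar_mult smooth_scalar_const smooth_ww)

lemma expo_Ws_Pser:
  assumes p: "p \<in> exponents G" "0 < fst p"
  shows "dop.expo (dop.sbr Ws) (Pser p) = Pser p + cser (\<lambda>x. - of_int (fst p) * ww p x)"
  using dop.expo_two[OF Ws_Ser Pser_Ser[OF p(1)]] sbr_cser[OF Ws_Ser smooth_neg_ww[OF p(1)]]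
  unfolding sbr_Ws_Pser[OF p] by simp

section \<open>The dressing element of the transformed Q\<close>

definition sigma :: "'g dser \<Rightarrow> 'g dser" where
  "sigma Z = dop.expo (dop.sbr NF) (dop.expo (dop.sbr UQ) (dop.expo (dop.sbr Ws) Z))"

lemma sigma_Pser:
  assumes p: "p \<in> exponents G" "0 < fst p"
  shows "sigma (Pser p) = Ep p + cser (\<lambda>x. - of_int (fst p) * ww p x)"
proof -
  note u = smooth_neg_ww[OF p(1)]
  have c: "cser (\<lambda>x. - of_int (fst p) * ww p x) \<in> dop.Ser (fst p)" by (rule cser_Ser[OF u]) (use p in simp)
  show ?thesis unfolding sigma_def expo_Ws_Pser[OF p] dop.expo_add[OF UQ(1) Pser_Ser[OF p(1)] c] expo_cser[OF UQ(1) u]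
      dressed_def[of UQ p, symmetric] dop.expo_add[OF NF_Ser dressed_Ser[OF UQ(1) p(1)] c] expo_cser[OF NF_Ser u] Ep_def ..
qed

text \<open>In degree -1 the Riccati equation turns the first bracket into nu xi^2
  \<open>ff j\<close>, and half of the double bracket is its negative. So no negative degree
  survives and the result has again the shape of a Lax operator, up to a central term.\<close>

lemma expo_NF_Lser: "dop.expo (dop.sbr NF) (Lser Q) = Lser Qt + cser (\<lambda>x. nu G * rat j / cox_c * xx x)"
proof
  fix k
  note L = B_curve_Lser[OF Q]
  let ?T = "dop.sbr NF"
  have TL: "?T (Lser Q) k = op_brk G D (0, Fm) (Lser Q (k + 1))" for k by (rule sbr_NF[OF L])
  have TTL: "?T (?T (Lser Q)) k = op_brk G D (0, Fm) (?T (Lser Q) (k + 1))" for k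
    by (rule sbr_NF[OF dop.sbr_Ser[OF NF_Ser L]])
  have TTTL: "?T (?T (?T (Lser Q))) k = op_brk G D (0, Fm) (?T (?T (Lser Q)) (k + 1))" for k
    by (rule sbr_NF[OF dop.sbr_Ser[OF NF_Ser dop.sbr_Ser[OF NF_Ser L]]])
  have z: "op_brk G D (0, Fm) 0 = 0" using dop.b_zero_right[OF Fm_CC] .
  have T0: "?T (Lser Q) 0 = (0, restr D (\<lambda>x. sc (nu G * xx x) (hh j)))"
  proof -
    have "br (Fm x) (restr D (\<lambda>_. Lam1 G) x) = restr D (\<lambda>x. sc (nu G * xx x) (hh j)) x" for x
      by (simp add: Fm_def restr_def br_minus_left br_scale_left br_ff_Lam1[OF j] mult.commute)
    then show ?thesis unfolding TL by (simp add: Lser_apply op_brk_Fm)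
  qed
  have T1: "?T (Lser Q) (-1) = (0, restr D (\<lambda>x. sc (nu G * (xx x)\<^sup>2) (ff j)))"
  proof -
    have "- cd Fm x + br (Fm x) (Q x) = restr D (\<lambda>x. sc (nu G * (xx x)\<^sup>2) (ff j)) x" for x
    proof (cases "x \<in> D")
      case True
      have "br (ff j) (Q x) = sc (th x) (ff j)"
        using br_ff_Hspan[OF B_curve_facts(2)[OF Q] j] by (simp add: theta_eq[OF j])
      then show ?thesis using True
        by (simp add: cd_Fm Fm_apply br_minus_left br_scale_left restr_def vs.scale_left_distrib del: minus_add_distrib)
    next
      case False then show ?thesis by (simp add: curve_deriv_outside Fm_def restr_def)
    qed
    then show ?thesis unfolding TL by (simp add: Lser_apply op_brk_pair)
  qed
  have Tz: "?T (Lser Q) k = 0" if "k \<noteq> 0" "k \<noteq> -1" for k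
  proof -
    have "k + 1 \<noteq> 0" "k + 1 \<noteq> 1" using that by auto
    then show ?thesis unfolding TL by (simp add: Lser_apply z)
  qed
  have fh: "br (ff j) (hh j) = sc 2 (ff j)"
    using br_anti[of "ff j" "hh j"] br_hf[OF j j] aa_diag[OF j] by simp
  have TT1: "?T (?T (Lser Q)) (-1) = (0, restr D (\<lambda>x. sc (- 2 * nu G * (xx x)\<^sup>2) (ff j)))"
  proof -
    have "br (Fm x) (restr D (\<lambda>x. sc (nu G * xx x) (hh j)) x) = restr D (\<lambda>x. sc (- 2 * nu G * (xx x)\<^sup>2) (ff j)) x" for x
      by (simp add: Fm_def restr_def br_minus_left br_scale_left br_scale_right fh power2_eq_square mult_ac)
    then show ?thesis unfolding TTL by (simp add: T0 op_brk_Fm)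
  qed
  have TTz: "?T (?T (Lser Q)) k = 0" if "k \<noteq> -1" for k
  proof (cases "k = -2")
    case True
    have "br (Fm x) (restr D (\<lambda>x. sc (nu G * (xx x)\<^sup>2) (ff j)) x) = 0" for x
      by (simp add: Fm_def restr_def br_minus_left br_scale_left br_scale_right br_minus_right)
    then show ?thesis unfolding TTL using True by (simp add: T1 op_brk_Fm zero_prod_def zero_fun_def)
  next
    case False
    then have "k + 1 \<noteq> 0" "k + 1 \<noteq> -1" using that by auto
    then show ?thesis unfolding TTL by (simp add: Tz z)
  qed
  have "?T (?T (?T (Lser Q))) = 0"
  proof
    fix k
    have "br (Fm x) (restr D (\<lambda>x. sc (- 2 * nu G * (xx x)\<^sup>2) (ff j)) x) = 0" for x
      by (simp add: Fm_def restr_def br_minus_left br_scale_left br_scale_right br_minus_right)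
    then have a1: "op_brk G D (0, Fm) (?T (?T (Lser Q)) (-1)) = 0"
      unfolding TT1 op_brk_Fm by (simp add: zero_prod_def zero_fun_def)
    have a2: "op_brk G D (0, Fm) (?T (?T (Lser Q)) (k + 1)) = 0" if "k + 1 \<noteq> -1"
      unfolding TTz[OF that] by (rule z)
    have "op_brk G D (0, Fm) (?T (?T (Lser Q)) (k + 1)) = 0"
    proof (cases "k + 1 = -1")
      case True
      show ?thesis unfolding True by (rule a1)
    qed (rule a2)
    then show "?T (?T (?T (Lser Q))) k = 0 k"
      unfolding TTTL zero_fun_apply .
  qed
  then have TTT: "(?T ^^ Suc (Suc (Suc n))) (Lser Q) = 0" for n
    by (induction n) (simp_all only: funpow.simps o_apply id_apply dop.sbr_zero_right[OF NF_Ser])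
  have "dop.expo ?T (Lser Q) k = (\<Sum>n\<le>Suc (Suc (Suc (nat (1 - k)))). op_scale G (1 / fact n) ((?T ^^ n) (Lser Q) k))"
    by (rule dop.expo_eq[OF NF_Ser L]) simp
  also have "\<dots> = Lser Q k + (?T (Lser Q) k + op_scale G (1 / 2) (?T (?T (Lser Q)) k))"
  proof -
    interpret op: vector_space "op_scale G" by (rule vector_space_op_scale)
    show ?thesis unfolding sum.atMost_Suc_shift TTT zero_fun_def by (simp add: numeral_2_eq_2)
  qed
  also have "\<dots> = (Lser Qt + cser (\<lambda>x. nu G * rat j / cox_c * xx x)) k"
  proof -
    interpret op: vector_space "op_scale G" by (rule vector_space_op_scale)
    consider "k = 0" | "k = -1" | "k \<noteq> 0" "k \<noteq> -1" by blast
    then show ?thesis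
    proof cases
      case 1
      have "Q x + restr D (\<lambda>x. sc (nu G * xx x) (hh j)) x = Qt x + restr D (\<lambda>x. sc (nu G * rat j / cox_c * xx x) cc) x" for x
        using smooth_curve_outside[OF B_curve_facts(1)[OF Q]] by (simp add: Qt_def restr_def)
      then show ?thesis using 1 T0 TTz[of 0] by (simp add: Lser_apply cser_def homog_def fun_eq_iff)
    next
      case 2
      then show ?thesis unfolding 2 T1 TT1 op_scale_pair
        by (simp add: Lser_apply cser_def homog_def zero_prod_def zero_fun_def fun_eq_iff restr_def
            flip: vs.scale_left_distrib)
    next
      case 3
      then show ?thesis using Tz[of k] TTz[of k] by (simp add: Lser_apply cser_def homog_def)
    qed
  qed
  finally show "dop.expo ?T (Lser Q) k = (Lser Qt + cser (\<lambda>x. nu G * rat j / cox_c * xx x)) k" .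
qed

text \<open>By \<open>unipotent_eq_expo\<close> the composite \<open>sigma\<close> is the
  exponential of some \<open>V\<close>. Pulling the operator of \<open>Qt\<close> back through
  \<open>sigma\<close> gives a Heisenberg-valued tail, and the coefficients \<open>ww\<close> were
  chosen so that the dressed Lambda_p are orthogonal to \<open>dd\<close>; hence \<open>V\<close>
  satisfies the conditions defining a dressing element.\<close>

lemma dressing_Qt: "\<exists>V. is_dressing Qt V \<and> (\<forall>p\<in>exponents G. 0 < fst p \<longrightarrow>
    dressed V p = Ep p + cser (\<lambda>x. - of_int (fst p) * ww p x))"
proof -
  have "dop.unipotent sigma"
    using dop.unipotent_compose[OF dop.unipotent_expo[OF NF_Ser]
        dop.unipotent_compose[OF dop.unipotent_expo[OF UQ(1)] dop.unipotent_expo[OF Ws_Ser]]]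
    unfolding sigma_def[abs_def] .
  then obtain V where V: "V \<in> dop.Ser (-1)" "\<And>K Z. Z \<in> dop.Ser K \<Longrightarrow> dop.expo (dop.sbr V) Z = sigma Z"
    using dop.unipotent_eq_expo by blast
  have dV: "dressed V p = Ep p + cser (\<lambda>x. - of_int (fst p) * ww p x)" if "p \<in> exponents G" "0 < fst p" for p
    unfolding dressed_def V(2)[OF Pser_Ser[OF that(1)]] by (rule sigma_Pser[OF that])
  obtain H where H: "H \<in> dop.Ser (-1)" "\<forall>k x. snd (H k) x \<in> heis G"
    "dop.expo (dop.sbr (- UQ)) (Lser Q) = Lser (\<lambda>_. 0) + H"
    using UQ(2) unfolding is_dressing_def by blast
  have EU: "dop.expo (dop.sbr UQ) (Lser (\<lambda>_. 0) + H) = Lser Q"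
    unfolding H(3)[symmetric] using dop.expo_inverse[OF dop.Ser_minus[OF UQ(1)] B_curve_Lser[OF Q]] by simp
  define W' where "W' k = (0 :: complex, cd (snd (Ws k)))" for k
  have W'S: "W' \<in> dop.Ser (-1)"
  proof (rule dop.SerI)
    show "W' k \<in> CC k" for k unfolding W'_def CC_iff
      using cd_smooth[OF Ws_smc] cd_Eig[OF Ws_smc] Ws_heis by auto
    have "cd (\<lambda>_. 0) = (\<lambda>_. 0)" by (rule cd_eqI) (auto intro: has_cd_zero)
    then show "W' k = 0" if "-1 < k" for k
      using that by (simp add: W'_def Ws_def zero_prod_def zero_fun_def)
  qed
  have W'h: "snd (W' k) x \<in> heis G" for k x unfolding W'_def using cd_Ws_heis by simp
  \<comment> \<open>The exponential of ad W subtracts \<open>W'\<close> when acting on the partial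
    derivative, so the tail of the new operator must contain it in advance.\<close>
  define H' where "H' = H + W'"
  have H'S: "H' \<in> dop.Ser (-1)" unfolding H'_def by (rule dop.Ser_add[OF H(1) W'S])
  have H'h: "snd (H' k) x \<in> heis G" for k x
    unfolding H'_def using H(2) W'h vs.subspace_add[OF subspace_heis] by simp
  have L0: "Lser (\<lambda>_. 0) \<in> dop.Ser 1" by (rule Lser_Ser) (simp_all add: vs.subspace_0[OF subspace_Eig])
  let ?u = "\<lambda>x. - of_int (fst (1 :: int, 0 :: nat)) * ww (1, 0) x"
  have u: "smooth_scalar D ?u" by (rule smooth_neg_ww[OF one_exponent(1)])
  have neg_zero: "dop.sbr Ws Z = 0" if Z: "Z \<in> dop.Ser (-1)" "\<And>k x. snd (Z k) x \<in> heis G" for Z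
  proof
    fix k
    have "op_brk G D (Ws i) (Z (k - i)) = 0" for i
    proof (cases "i < 0 \<and> k - i < 0")
      case True
      have "br (snd (Ws i) x) (snd (Z (k - i)) x) = 0" for x
        using heis_br_zero[OF Ws_heis, of "snd (Z (k - i)) x" "k - i" i x] Z(2) SerD_curve(2)[OF Z(1)] True by simp
      moreover have "fst (Z (k - i)) = 0" "fst (Ws i) = 0" using SerD_curve(3)[OF Z(1)] True by (auto simp: Ws_def)
      ultimately show ?thesis unfolding op_brk_pair by (simp add: zero_prod_def zero_fun_def)
    next
      case False
      then show ?thesis using dop.sbr_terms(2,3)[OF Ws_Ser Z(1)] by force
    qed
    then show "dop.sbr Ws Z k = 0 k" unfolding dop.sbr_def by simp
  qed
  have WL: "dop.sbr Ws (Lser (\<lambda>_. 0)) = - W' + cser ?u"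
  proof
    fix k
    have t: "op_brk G D (Ws i) (Lser (\<lambda>_. 0) (k - i)) =
        (if i = k then op_brk G D (Ws k) (1, \<lambda>_. 0) else 0) +
        (if i = k - 1 then op_brk G D (Ws (k - 1)) (0, restr D (\<lambda>_. Lam1 G)) else 0)" for i
      using dop.b_zero_right[OF dop.SerD(1)[OF Ws_Ser]] by (auto simp: Lser_apply)
    have 1: "op_brk G D (Ws k) (1, \<lambda>_. 0) = - W' k"
      unfolding op_brk_pair W'_def by (simp add: Ws_def fun_eq_iff prod_eq_iff)
    have 2: "op_brk G D (Ws (k - 1)) (0, restr D (\<lambda>_. Lam1 G)) = cser ?u k"
      using sbr_Pser[OF Ws_Ser one_exponent(1), of k] sbr_Ws_Pser[OF one_exponent(1)] by simp
    have "dop.sbr Ws (Lser (\<lambda>_. 0)) k = (\<Sum>i\<in>{k, k - 1}. op_brk G D (Ws i) (Lser (\<lambda>_. 0) (k - i)))"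
      unfolding dop.sbr_Sum_any by (rule Sum_any.expand_superset) (auto simp: t split: if_splits)
    also have "\<dots> = - W' k + cser ?u k" unfolding t 1 2 by simp
    finally show "dop.sbr Ws (Lser (\<lambda>_. 0)) k = (- W' + cser ?u) k" by simp
  qed
  have WLH: "dop.sbr Ws (Lser (\<lambda>_. 0) + H') = - W' + cser ?u"
    unfolding dop.sbr_add_right[OF Ws_Ser L0 dop.Ser_mono[OF H'S]] WL using neg_zero[OF H'S H'h]
    by (simp add: dop.sbr_add_right[OF Ws_Ser L0 dop.Ser_mono[OF H'S]] WL)
  have mW'S: "- W' \<in> dop.Ser 0" using dop.Ser_mono[OF dop.Ser_minus[OF W'S]] by simp
  have "dop.sbr Ws (- W') = 0"
    by (rule neg_zero[OF dop.Ser_minus[OF W'S]]) (simp add: W'h vs.subspace_neg[OF subspace_heis])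
  then have "dop.sbr Ws (dop.sbr Ws (Lser (\<lambda>_. 0) + H')) = 0"
    unfolding WLH dop.sbr_add_right[OF Ws_Ser mW'S cser_Ser[OF u order_refl]] sbr_cser[OF Ws_Ser u] by simp
  then have "dop.expo (dop.sbr Ws) (Lser (\<lambda>_. 0) + H') = (Lser (\<lambda>_. 0) + H') + (- W' + cser ?u)"
    using dop.expo_two[OF Ws_Ser dop.Ser_add[OF L0 dop.Ser_mono[OF H'S]]] unfolding WLH by simp
  also have "\<dots> = (Lser (\<lambda>_. 0) + H) + cser ?u"
    unfolding H'_def by (simp add: fun_eq_iff algebra_simps)
  finally have EW: "dop.expo (dop.sbr Ws) (Lser (\<lambda>_. 0) + H') = (Lser (\<lambda>_. 0) + H) + cser ?u" .
  have LH: "Lser (\<lambda>_. 0) + H \<in> dop.Ser 1" using dop.Ser_add[OF L0 dop.Ser_mono[OF H(1)]] by simp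
  have c1: "cser ?u \<in> dop.Ser 1" by (rule cser_Ser[OF u]) simp
  \<comment> \<open>One central term comes from conjugating the operator of \<open>Q\<close>, the
    other from the bracket of W with Lambda_1; \<open>ww_one\<close> makes them opposite.\<close>
  have cs: "cser (\<lambda>x. nu G * rat j / cox_c * xx x) + cser ?u = 0"
    unfolding cser_def homog_def using ww_one
    by (auto simp: fun_eq_iff restr_def zero_prod_def)
  have "sigma (Lser (\<lambda>_. 0) + H') = Lser Qt"
    unfolding sigma_def EW dop.expo_add[OF UQ(1) LH c1] EU expo_cser[OF UQ(1) u]
      dop.expo_add[OF NF_Ser B_curve_Lser[OF Q] c1] expo_cser[OF NF_Ser u] expo_NF_Lser
    using cs by (simp add: add.assoc)
  then have EV: "dop.expo (dop.sbr V) (Lser (\<lambda>_. 0) + H') = Lser Qt"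
    using V(2)[OF dop.Ser_add[OF L0 dop.Ser_mono[OF H'S]]] by simp
  have "dop.expo (dop.sbr (- V)) (Lser Qt) = Lser (\<lambda>_. 0) + H'"
    unfolding EV[symmetric] by (rule dop.expo_inverse[OF V(1) dop.Ser_add[OF L0 dop.Ser_mono[OF H'S]]]) simp
  moreover have "fm dd (snd (dressed V p 0) x) = 0" if p: "p \<in> pos_exponents G" and x: "x \<in> D" for p x
  proof -
    have "snd (dressed V p 0) x = snd (Ep p 0) x + sc (- of_int (fst p) * ww p x) cc"
      unfolding dV[OF pos_exponentsD[OF p]] using x by (simp add: cser_def homog_def restr_def)
    then show ?thesis using pos_exponentsD(2)[OF p] cox_nz
      by (simp add: form_add_right form_scale_right form_minus_right form_diff_right form_dd_cc ww_def)
  qed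
  ultimately have "is_dressing Qt V" unfolding is_dressing_def using V(1) H'S H'h by blast
  then show ?thesis using dV by blast
qed

lemma Rc_Qt:
  assumes p: "p \<in> pos_exponents G" and N: "fst p \<le> int N" and k: "0 \<le> k" and x: "x \<in> D"
  shows "Rc Qt p k x = (\<Sum>n\<le>N. sc ((- xx x) ^ n / fact n) ((br (ff j) ^^ n) (Rc Q p (k + int n) x))) -
    (if k = 0 then sc (of_int (fst p) * ww p x) cc else 0)"
proof -
  obtain V where V: "is_dressing Qt V" "\<forall>p\<in>exponents G. 0 < fst p \<longrightarrow>
    dressed V p = Ep p + cser (\<lambda>x. - of_int (fst p) * ww p x)" using dressing_Qt by blast
  have "dress_ser Qt = V" by (rule dressing_unique[OF B_curve_Qt dress_ser_dressing[OF B_curve_Qt] V(1)])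
  then have "Rc Qt p k x = snd (Ep p k + cser (\<lambda>x. - of_int (fst p) * ww p x) k) x"
    unfolding Rc_def using V(2) pos_exponentsD[OF p] by simp
  moreover have "snd (Ep p k) x = (\<Sum>n\<le>N. sc ((- xx x) ^ n / fact n) ((br (ff j) ^^ n) (Rc Q p (k + int n) x)))"
    by (rule Ep_apply(2)[OF pos_exponentsD(1)[OF p] _ x]) (use N k in simp)
  ultimately show ?thesis using x by (simp add: cser_def homog_def restr_def)
qed

section \<open>The transformed M by components\<close>

definition NM :: nat where "NM = nat NN"

lemma int_NM: "int NM = NN" unfolding NM_def using NN(2) by simp

text \<open>For nonnegative \<open>k\<close> this is the degree \<open>k\<close> part of the
  exponential of -xi ad \<open>ff j\<close> applied to \<open>M\<close>; components of
  \<open>M\<close> reach it only from degree \<open>k\<close> or above.\<close>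

definition Am :: "int \<Rightarrow> real \<Rightarrow> 'g" where
  "Am k x = (\<Sum>n\<le>NM. sc ((- xx x) ^ n / fact n) ((br (ff j) ^^ n) (Mc Q (k + int n) x)))"

text \<open>The central corrections of all exponents are collected in one unspecified scalar
  \<open>g\<close>; its value is more easily found from the pairing with \<open>dd\<close> than from
  the sum over \<open>p\<close>.\<close>

lemma Mc_Qt:
  assumes x: "x \<in> D"
  shows "\<exists>g. \<forall>k\<ge>0. Mc Qt k x = Am k x - (if k = 0 then sc g cc else 0)"
proof -
  have "Mc Qt k x = Am k x - (if k = 0 then sc (rh * (\<Sum>p\<in>PS. coef p x * (of_int (fst p) * ww p x))) cc else 0)"
    if k: "0 \<le> k" for k
  proof -
    have "Mc Qt k x = sc rh (\<Sum>p\<in>PS. sc (coef p x) ((\<Sum>n\<le>NM. sc ((- xx x) ^ n / fact n) ((br (ff j) ^^ n) (Rc Q p (k + int n) x))) -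
      (if k = 0 then sc (of_int (fst p) * ww p x) cc else 0)))"
      unfolding Mc_def
      by (intro arg_cong[of _ _ "sc rh"] sum.cong refl) (use Rc_Qt[OF PS(2) _ k x] NN(1) in \<open>simp add: int_NM\<close>)
    also have "\<dots> = sc rh (\<Sum>p\<in>PS. \<Sum>n\<le>NM. sc (coef p x) (sc ((- xx x) ^ n / fact n) ((br (ff j) ^^ n) (Rc Q p (k + int n) x)))) -
      (if k = 0 then sc (rh * (\<Sum>p\<in>PS. coef p x * (of_int (fst p) * ww p x))) cc else 0)"
      by (simp add: vs.scale_right_diff_distrib sum_subtractf vs.scale_sum_right vs.scale_sum_left sum_distrib_left mult.assoc)
    also have "sc rh (\<Sum>p\<in>PS. \<Sum>n\<le>NM. sc (coef p x) (sc ((- xx x) ^ n / fact n) ((br (ff j) ^^ n) (Rc Q p (k + int n) x)))) =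
       sc rh (\<Sum>n\<le>NM. \<Sum>p\<in>PS. sc (coef p x) (sc ((- xx x) ^ n / fact n) ((br (ff j) ^^ n) (Rc Q p (k + int n) x))))"
      by (subst sum.swap) simp
    also have "\<dots> = Am k x" unfolding Am_def Mc_def
      by (simp add: funpow_br_scale funpow_br_sum vs.scale_sum_right mult_ac)
    finally show ?thesis .
  qed
  then show ?thesis by blast
qed

lemma ch_rat: "x \<in> D \<Longrightarrow> xx x * (fm (ff j) (Mc Q 1 x) / rat j) = ch x / rat j"
  using xx_ph[of x] phi_Mc[OF Q j, of x] nu_nz by (simp add: field_simps)

text \<open>A component of degree n at least 2 is killed by n applications of ad
  \<open>ff j\<close>, so it never arrives in degree 0. Only degrees 0 and 1 contribute, the latter
  through nu xi phi_j = chi_j.\<close>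

lemma Am_zero:
  assumes x: "x \<in> D" shows "Am 0 x = Mc Q 0 x + sc (ch x / rat j) (hh j)"
proof -
  have z: "(br (ff j) ^^ n) (Mc Q (0 + int n) x) = 0" if "2 \<le> n" for n
    by (rule funpow_ff_Eig_ge2[OF Mc_facts(2)[OF Q] _ j]) (use that in auto)
  have NM1: "1 \<le> NM" using int_NM NN(2) by linarith
  have "Am 0 x = (\<Sum>n\<in>{0, 1}. sc ((- xx x) ^ n / fact n) ((br (ff j) ^^ n) (Mc Q (0 + int n) x)))"
    unfolding Am_def by (rule sum.mono_neutral_right) (use z NM1 in \<open>auto simp: numeral_2_eq_2 not_less_eq_eq\<close>)
  also have "\<dots> = Mc Q 0 x + sc (xx x * (fm (ff j) (Mc Q 1 x) / rat j)) (hh j)"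
    using funpow_ff_Eig1(1)[OF Mc_facts(2)[OF Q] j, of x] by simp
  finally show ?thesis unfolding ch_rat[OF x] .
qed

lemma Mc_Qt_eq:
  assumes x: "x \<in> D"
  shows "0 \<le> k \<Longrightarrow> Mc Qt k x = Am k x - (if k = 0 then sc (ch x / cox_c) cc else 0)"
proof -
  obtain g where g: "\<forall>k\<ge>0. Mc Qt k x = Am k x - (if k = 0 then sc g cc else 0)" using Mc_Qt[OF x] by blast
  \<comment> \<open>The transformed \<open>M\<close> is also orthogonal to \<open>dd\<close> in
    degree 0. With (d | h_j) equal to \<open>rat j\<close> and (d | c) = h, this forces
    \<open>g\<close> to be chi_j / h.\<close>
  have "fm dd (Mc Qt 0 x) = 0" by (rule Mc_facts(5)[OF B_curve_Qt])
  then have "ch x - g * cox_c = 0"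
    using g Mc_facts(5)[OF Q, of x] rat_nz[OF j]
    by (simp add: Am_zero[OF x] form_diff_right form_add_right form_scale_right form_dh[OF j] form_dd_cc)
  then have "g = ch x / cox_c" using cox_nz by (simp add: field_simps)
  then show "0 \<le> k \<Longrightarrow> Mc Qt k x = Am k x - (if k = 0 then sc (ch x / cox_c) cc else 0)" using g by simp
qed

lemma Mc_Qt_0: "x \<in> D \<Longrightarrow> Mc Qt 0 x = Mc Q 0 x + sc (ch x / rat j) (hh j) - sc (ch x / cox_c) cc"
  using Mc_Qt_eq[of x 0] Am_zero by simp

text \<open>The degree 0 component changes by fixed vectors with coefficient chi_j, and chi_j is
  constant, so its derivative remains zero.\<close>

lemma red_Qt: "red_solution G b D Qt (Mfun G b D Qt)"
  unfolding red_solution_iff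
proof (intro conjI ballI refl B_curve_Qt)
  fix x assume x: "x \<in> D"
  have "cd (Mc Qt 0) x = cd (\<lambda>x. Mc Q 0 x + sc (ch x) (restr D (\<lambda>_. sc (1 / rat j) (hh j)) x) + sc (ch x) (restr D (\<lambda>_. sc (- 1 / cox_c) cc) x)) x"
  proof (rule arg_cong[of _ _ "\<lambda>P. cd P x"], rule ext)
    fix t
    show "Mc Qt 0 t = Mc Q 0 t + sc (ch t) (restr D (\<lambda>_. sc (1 / rat j) (hh j)) t) + sc (ch t) (restr D (\<lambda>_. sc (- 1 / cox_c) cc) t)"
      using Mc_Qt_0[of t] Mc_facts(7)[OF B_curve_Qt, of t 0] Mc_facts(7)[OF Q, of t 0]
      by (cases "t \<in> D") (auto simp: restr_def)
  qed
  also have "\<dots> = 0"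
  proof -
    have s: "smc (\<lambda>x. sc (ch x) (restr D (\<lambda>_. v) x))" for v
      by (rule smooth_curve_scalar[OF smooth_curve_const smooth_ch])
    have "vector_derivative ch (at x) = 0" using ch_derivative[OF x] by (rule vector_derivative_at)
    then show ?thesis
      by (simp only: cd_add[OF smooth_curve_add[OF Mc_facts(1)[OF Q] s] s] cd_add[OF Mc_facts(1)[OF Q] s]
          cd_scalar[OF smooth_curve_const smooth_ch] cd_const red[OF x]) simp
  qed
  finally show "cd (Mc Qt 0) x = 0" .
qed

section \<open>The conjugation formulas defining the transformation\<close>

lemma gauge_step: "- op_brk G D (0, restr D (\<lambda>x. sc (xx x) (ff j))) Z = op_brk G D (0, Fm) Z"
proof -
  have s: "smc (restr D (\<lambda>x. sc (xx x) (ff j)))" by (rule smooth_curve_term[OF smooth_xx])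
  have e: "Fm = (\<lambda>x. - restr D (\<lambda>x. sc (xx x) (ff j)) x)" unfolding Fm_def restr_def by auto
  show ?thesis unfolding op_brk_pair fst_conv snd_conv e cd_minus[OF s]
    by (simp add: fun_eq_iff prod_eq_iff br_minus_left)
qed

lemma gauge_eq: "gauge G D MM j Z = exp_nil (op_scale G) (op_brk G D (0, Fm)) Z"
  unfolding gauge_def gauge_step ..

lemma gauge_lax_L: "gauge G D MM j (lax_L G D Q) = (1, restr D (\<lambda>x. Lam1 G + Q x + sc (nu G * xx x) (hh j)))"
proof -
  interpret op: vector_space "op_scale G" by (rule vector_space_op_scale)
  let ?T = "op_brk G D (0, Fm)"
  have fh: "br (ff j) (hh j) = sc 2 (ff j)"
    using br_anti[of "ff j" "hh j"] br_hf[OF j j] aa_diag[OF j] by simp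
  have T1: "?T (lax_L G D Q) = (0, restr D (\<lambda>x. sc (nu G * xx x) (hh j) + sc (nu G * (xx x)\<^sup>2) (ff j)))"
  proof -
    have "- cd Fm x + br (Fm x) (restr D (\<lambda>x. Lam1 G + Q x) x) =
        restr D (\<lambda>x. sc (nu G * xx x) (hh j) + sc (nu G * (xx x)\<^sup>2) (ff j)) x" for x
    proof (cases "x \<in> D")
      case True
      have "br (ff j) (Q x) = sc (th x) (ff j)"
        using br_ff_Hspan[OF B_curve_facts(2)[OF Q] j] by (simp add: theta_eq[OF j])
      then show ?thesis using True
        by (simp add: cd_Fm Fm_apply br_minus_left br_scale_left br_add_right br_ff_Lam1[OF j] restr_def
            vs.scale_left_distrib mult.commute del: minus_add_distrib)
    next
      case False then show ?thesis by (simp add: curve_deriv_outside Fm_def restr_def)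
    qed
    then show ?thesis unfolding lax_L_def op_brk_pair by simp
  qed
  have T2: "?T (?T (lax_L G D Q)) = (0, restr D (\<lambda>x. sc (- 2 * nu G * (xx x)\<^sup>2) (ff j)))"
  proof -
    have "br (Fm x) (restr D (\<lambda>x. sc (nu G * xx x) (hh j) + sc (nu G * (xx x)\<^sup>2) (ff j)) x) =
        restr D (\<lambda>x. sc (- 2 * nu G * (xx x)\<^sup>2) (ff j)) x" for x
      by (simp add: Fm_def restr_def br_minus_left br_scale_left br_scale_right br_add_right fh power2_eq_square mult_ac)
    then show ?thesis unfolding T1 op_brk_Fm by simp
  qed
  have T3: "?T (?T (?T (lax_L G D Q))) = 0"
  proof -
    have "br (Fm x) (restr D (\<lambda>x. sc (- 2 * nu G * (xx x)\<^sup>2) (ff j)) x) = 0" for x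
      by (simp add: Fm_def restr_def br_minus_left br_scale_left br_scale_right br_minus_right)
    then show ?thesis unfolding T2 op_brk_Fm by (simp add: zero_prod_def zero_fun_def)
  qed
  have "(?T ^^ n) (lax_L G D Q) = 0" if n: "2 < n" for n
  proof -
    have "(?T ^^ Suc (Suc (Suc m))) (lax_L G D Q) = 0" for m
      by (induction m) (simp_all only: funpow.simps o_apply id_apply T3 dop.b_zero_right[OF Fm_CC])
    moreover obtain m where "n = Suc (Suc (Suc m))" using n by (metis Suc_diff_Suc add_2_eq_Suc less_imp_Suc_add)
    ultimately show ?thesis by simp
  qed
  then have "gauge G D MM j (lax_L G D Q) = (\<Sum>n\<le>2. op_scale G (1 / fact n) ((?T ^^ n) (lax_L G D Q)))"
    unfolding gauge_eq by (intro exp_nil_eq vector_space_op_scale) auto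
  also have "\<dots> = lax_L G D Q + ?T (lax_L G D Q) + op_scale G (1 / 2) (?T (?T (lax_L G D Q)))"
    by (simp add: numeral_2_eq_2)
  \<comment> \<open>The term nu xi^2 \<open>ff j\<close> of the first bracket cancels half of the
    double bracket.\<close>
  also have "\<dots> = (1, restr D (\<lambda>x. Lam1 G + Q x + sc (nu G * xx x) (hh j)))"
    unfolding T2 unfolding T1 unfolding lax_L_def op_scale_pair
    by (auto simp: fun_eq_iff restr_def)
  finally show ?thesis .
qed

text \<open>A component of degree m at least 2 dies after m steps, so after at most
  \<open>NM\<close>; three steps suffice for degrees 0 and 1 and for \<open>dd\<close>.\<close>

definition nil_bound :: nat where "nil_bound = NM + 3"

lemma funpow_dd: "2 \<le> n \<Longrightarrow> (br (ff j) ^^ n) dd = 0"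
proof (rule funpow_br_mono)
  have "br (ff j) dd = ff j" using br_anti[of "ff j" dd] br_df[OF j] by simp
  then show "(br (ff j) ^^ 2) dd = 0" by (simp add: numeral_2_eq_2)
qed

lemma funpow_Mc:
  assumes "m = 0 \<and> 2 \<le> n \<or> m = 1 \<and> 3 \<le> n \<or> 2 \<le> m \<and> m \<le> int n"
  shows "(br (ff j) ^^ n) (Mc Q m x) = 0"
  using assms
proof (elim disjE conjE)
  assume m: "m = 0" and n: "2 \<le> n"
  show ?thesis
  proof (rule funpow_br_mono[OF _ n])
    show "(br (ff j) ^^ 2) (Mc Q m x) = 0"
      unfolding m using br_ff_Hspan[OF Mc_facts(6)[OF Q] j, of x] by (simp add: numeral_2_eq_2 br_scale_right)
  qed
next
  assume m: "m = 1" and n: "3 \<le> n"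
  show ?thesis unfolding m by (rule funpow_ff_Eig1(3)[OF Mc_facts(2)[OF Q] j n])
next
  assume m: "2 \<le> m" "m \<le> int n"
  show ?thesis by (rule funpow_ff_Eig_ge2[OF Mc_facts(2)[OF Q] m(1) j m(2)])
qed

lemma funpow_lax_M:
  assumes n: "nil_bound \<le> n" shows "(br (ff j) ^^ n) (- dd + MM x) = 0"
proof -
  have "(br (ff j) ^^ n) (- dd) = 0" using funpow_dd[of n] n funpow_br_scale[of n "ff j" "-1" dd]
    by (simp add: nil_bound_def)
  moreover have "(br (ff j) ^^ n) (MM x) = 0"
    unfolding Mfun_eq[OF Q] funpow_br_sum
  proof (rule sum.neutral, rule ballI)
    fix k assume "k \<in> {0..NN}"
    then show "(br (ff j) ^^ n) (Mc Q k x) = 0"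
      using n int_NM by (intro funpow_Mc) (auto simp: nil_bound_def)
  qed
  ultimately show ?thesis by (simp only: funpow_br_add add_0_left)
qed

lemma gauge_lax_M:
  assumes N: "nil_bound \<le> N"
  shows "gauge G D MM j (lax_M G D MM) =
    (0, restr D (\<lambda>x. \<Sum>n\<le>N. sc ((- xx x) ^ n / fact n) ((br (ff j) ^^ n) (- dd + MM x))))"
proof -
  interpret op: vector_space "op_scale G" by (rule vector_space_op_scale)
  let ?T = "op_brk G D (0, Fm)"
  have T: "(?T ^^ n) (lax_M G D MM) = (0, restr D (\<lambda>x. sc ((- xx x) ^ n) ((br (ff j) ^^ n) (- dd + MM x))))" for n
  proof (induction n)
    case 0 then show ?case by (simp add: lax_M_def)
  next
    case (Suc n)
    show ?case unfolding funpow.simps o_apply Suc op_brk_Fm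
      by (auto simp: restr_def Fm_def br_minus_left br_scale_left br_scale_right)
  qed
  have "gauge G D MM j (lax_M G D MM) = (\<Sum>n\<le>N. op_scale G (1 / fact n) ((?T ^^ n) (lax_M G D MM)))"
    unfolding gauge_eq
  proof (rule exp_nil_eq[OF vector_space_op_scale])
    fix n assume "N < n"
    then show "(?T ^^ n) (lax_M G D MM) = 0"
      unfolding T using funpow_lax_M[of n] N by (simp add: restr_def zero_prod_def zero_fun_def)
  qed
  then show ?thesis unfolding T op_scale_pair
    by (auto simp: prod_eq_iff fst_sum snd_sum_apply fun_eq_iff restr_def)
qed

text \<open>Conjugation respects the truncation to degrees at least 0. What could fall below is of
  degree -1: xi \<open>ff j\<close> from \<open>- dd\<close>, one bracket on the degree 0 component
  and half a double bracket on the degree 1 component. They sum to zero by the definition of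
  xi.\<close>

lemma gauge_sum:
  assumes x: "x \<in> D" and N: "nil_bound \<le> N"
  shows "(\<Sum>n\<le>N. sc ((- xx x) ^ n / fact n) ((br (ff j) ^^ n) (- dd + MM x))) =
    - dd + (\<Sum>k\<in>{0..NN}. Am k x)"
proof -
  define t where "t n m = sc ((- xx x) ^ n / fact n) ((br (ff j) ^^ n) (Mc Q m x))" for n m
  have t0: "t n m = 0" if "m = 0 \<and> 2 \<le> n \<or> m = 1 \<and> 3 \<le> n \<or> 2 \<le> m \<and> m \<le> int n \<or> NN < m" for n m
    unfolding t_def using that funpow_Mc[of m n x] Mc_facts(4)[OF Q, of m x] by (auto simp: funpow_br_zero)
  \<comment> \<open>The part of row \<open>n\<close> that drops below degree 0; by \<open>t0\<close>
    nothing else survives there.\<close>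
  define \<delta> where "\<delta> n = (if n = 1 then t 1 0 else if n = 2 then t 2 1 else 0)" for n :: nat
  have row: "(\<Sum>m\<in>{0..NN}. t n m) = (\<Sum>k\<in>{0..NN}. t n (k + int n)) + \<delta> n" for n
  proof -
    have "(\<Sum>m\<in>{0..NN}. t n m) = (\<Sum>m\<in>{0..NN} \<inter> {m. int n \<le> m}. t n m) + (\<Sum>m\<in>{0..NN} \<inter> - {m. int n \<le> m}. t n m)"
      by (rule sum.Int_Diff[of "{0..NN}" _ "{m. int n \<le> m}", unfolded Diff_eq]) simp
    also have "(\<Sum>m\<in>{0..NN} \<inter> {m. int n \<le> m}. t n m) = (\<Sum>k\<in>{0..NN} \<inter> {k. k + int n \<le> NN}. t n (k + int n))"
      by (rule sum.reindex_bij_witness[where i = "\<lambda>k. k + int n" and j = "\<lambda>m. m - int n"]) auto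
    also have "\<dots> = (\<Sum>k\<in>{0..NN}. t n (k + int n))"
      by (rule sum.mono_neutral_left) (auto intro: t0)
    also have "(\<Sum>m\<in>{0..NN} \<inter> - {m. int n \<le> m}. t n m) = \<delta> n"
    proof -
      consider "n = 0" | "n = 1" | "n = 2" | "3 \<le> n" by linarith
      then show ?thesis
      proof cases
        case 1 then show ?thesis by (auto simp: \<delta>_def intro!: sum.neutral)
      next
        case 2
        have "{0..NN} \<inter> - {m. int n \<le> m} = {0}" using 2 NN(2) by auto
        then show ?thesis using 2 by (simp add: \<delta>_def)
      next
        case 3
        have "{0..NN} \<inter> - {m. int n \<le> m} = {0, 1}" using 3 NN(2) by auto
        then show ?thesis using 3 t0[of 0 2] by (simp add: \<delta>_def)
      next
        case 4
        then show ?thesis by (auto simp: \<delta>_def intro!: sum.neutral t0)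
      qed
    qed
    finally show ?thesis .
  qed
  have "(\<Sum>n\<le>N. sc ((- xx x) ^ n / fact n) ((br (ff j) ^^ n) (- dd + MM x))) =
      (\<Sum>n\<le>N. sc ((- xx x) ^ n / fact n) ((br (ff j) ^^ n) (- dd))) + (\<Sum>n\<le>N. \<Sum>m\<in>{0..NN}. t n m)"
  proof -
    have "(br (ff j) ^^ n) (- dd + MM x) = (br (ff j) ^^ n) (- dd) + (\<Sum>m\<in>{0..NN}. (br (ff j) ^^ n) (Mc Q m x))" for n
      by (simp only: funpow_br_add Mfun_eq[OF Q] funpow_br_sum)
    then show ?thesis unfolding t_def by (simp only: vs.scale_right_distrib vs.scale_sum_right sum.distrib)
  qed
  also have "(\<Sum>n\<le>N. sc ((- xx x) ^ n / fact n) ((br (ff j) ^^ n) (- dd))) = - dd + sc (xx x) (ff j)"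
  proof -
    have m: "(br (ff j) ^^ n) (- dd) = - (br (ff j) ^^ n) dd" for n
      using funpow_br_scale[of n "ff j" "-1" dd] by simp
    have "br (ff j) dd = ff j" using br_anti[of "ff j" dd] br_df[OF j] by simp
    moreover have "(\<Sum>n\<le>N. sc ((- xx x) ^ n / fact n) ((br (ff j) ^^ n) (- dd))) =
        (\<Sum>n\<in>{0, 1}. sc ((- xx x) ^ n / fact n) ((br (ff j) ^^ n) (- dd)))"
      by (rule sum.mono_neutral_right) (use N funpow_dd in \<open>auto simp: nil_bound_def m not_less_eq_eq numeral_2_eq_2\<close>)
    ultimately show ?thesis by (simp add: m)
  qed
  also have "(\<Sum>n\<le>N. \<Sum>m\<in>{0..NN}. t n m) = (\<Sum>k\<in>{0..NN}. \<Sum>n\<le>N. t n (k + int n)) + (\<Sum>n\<le>N. \<delta> n)"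
    unfolding row sum.distrib by (subst sum.swap) simp
  also have "(\<Sum>k\<in>{0..NN}. \<Sum>n\<le>N. t n (k + int n)) = (\<Sum>k\<in>{0..NN}. Am k x)"
  proof (rule sum.cong[OF refl])
    fix k assume k: "k \<in> {0..NN}"
    show "(\<Sum>n\<le>N. t n (k + int n)) = Am k x" unfolding Am_def t_def[symmetric]
      by (rule sum.mono_neutral_right) (use N k int_NM in \<open>auto simp: nil_bound_def intro!: t0\<close>)
  qed
  also have "(\<Sum>n\<le>N. \<delta> n) = t 1 0 + t 2 1"
  proof -
    have "(\<Sum>n\<le>N. \<delta> n) = (\<Sum>n\<in>{1, 2}. \<delta> n)"
      by (rule sum.mono_neutral_right) (use N in \<open>auto simp: nil_bound_def \<delta>_def\<close>)
    then show ?thesis by (simp add: \<delta>_def)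
  qed
  also have "t 1 0 + t 2 1 = - sc (xx x) (ff j)"
  proof -
    let ?m = "fm (ff j) (Mc Q 1 x) / rat j" and ?a = "fm (hh j) (Mc Q 0 x) / rat j"
    have "ch x / rat j = 1 - ?a" using rat_nz[OF j] by (simp add: chi_Mc[OF Q j] diff_divide_distrib)
    \<comment> \<open>The defining relation nu xi phi_j = chi_j divided by \<open>rat j\<close>. It
      replaces the quadratic term in xi by terms linear in xi, which then cancel.\<close>
    then have xm: "xx x * ?m = 1 - ?a" using ch_rat[OF x] by simp
    have "t 1 0 = sc (- xx x * ?a) (ff j)"
      unfolding t_def using br_ff_Hspan[OF Mc_facts(6)[OF Q] j, of x] by simp
    moreover have "t 2 1 = sc (- xx x * (xx x * ?m)) (ff j)"
      unfolding t_def using funpow_ff_Eig1(2)[OF Mc_facts(2)[OF Q] j, of x] by (simp add: numeral_2_eq_2)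
    ultimately have "t 1 0 + t 2 1 = sc (- xx x * ?a + - xx x * (xx x * ?m)) (ff j)"
      by (simp only: vs.scale_left_distrib)
    also have "- xx x * ?a + - xx x * (xx x * ?m) = - xx x" unfolding xm by (simp add: algebra_simps)
    finally show ?thesis by simp
  qed
  finally show ?thesis by (simp add: algebra_simps)
qed

lemma Mfun_Qt:
  assumes x: "x \<in> D"
  shows "Mfun G b D Qt x = (\<Sum>k\<in>{0..NN}. Am k x) - sc (ch x / cox_c) cc"
proof -
  have "Mfun G b D Qt x = (\<Sum>k\<in>{0..NN}. Am k x - (if k = 0 then sc (ch x / cox_c) cc else 0))"
    unfolding Mfun_eq[OF B_curve_Qt] using Mc_Qt_eq[OF x] by (intro sum.cong) auto
  then show ?thesis using NN(2) by (simp add: sum_subtractf)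
qed

text \<open>\<open>backlund_on\<close> stands for the definition of the transformation once its
  regular set has been identified with \<open>D\<close>.\<close>

lemma backlund_iff:
  "backlund_on \<longleftrightarrow> Qt' = Qt \<and> Mt = Mfun G b D Qt"
  if "backlund_on \<longleftrightarrow> (\<forall>x. x \<notin> D \<longrightarrow> Qt' x = 0 \<and> Mt x = 0) \<and>
     lax_L G D Qt' = gauge G D MM j (lax_L G D Q) -
       (0, restr D (\<lambda>x. sc (nu G * of_nat (lab G j) / (of_nat (cox G) * of_nat (dlab G j)) * xx x) cc)) \<and>
     lax_M G D Mt = gauge G D MM j (lax_M G D MM) - (0, restr D (\<lambda>x. sc (ch x / of_nat (cox G)) cc))"
proof -
  have c: "nu G * of_nat (lab G j) / (of_nat (cox G) * of_nat (dlab G j)) = nu G * rat j / cox_c"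
    unfolding label_ratio_def by simp
  have L: "lax_L G D Qt' = gauge G D MM j (lax_L G D Q) -
       (0, restr D (\<lambda>x. sc (nu G * of_nat (lab G j) / (of_nat (cox G) * of_nat (dlab G j)) * xx x) cc)) \<longleftrightarrow>
      (\<forall>x\<in>D. Qt' x = Qt x)"
    unfolding gauge_lax_L c unfolding lax_L_def by (auto simp: fun_eq_iff restr_def Qt_def algebra_simps)
  have M: "lax_M G D Mt = gauge G D MM j (lax_M G D MM) - (0, restr D (\<lambda>x. sc (ch x / of_nat (cox G)) cc)) \<longleftrightarrow>
      (\<forall>x\<in>D. Mt x = Mfun G b D Qt x)"
  proof -
    have "gauge G D MM j (lax_M G D MM) = (0, restr D (\<lambda>x. - dd + (\<Sum>k\<in>{0..NN}. Am k x)))"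
      unfolding gauge_lax_M[OF order_refl]
    proof (rule arg_cong[of _ _ "Pair 0"], rule ext)
      fix x
      show "restr D (\<lambda>x. \<Sum>n\<le>nil_bound. sc ((- xx x) ^ n / fact n) ((br (ff j) ^^ n) (- dd + MM x))) x =
          restr D (\<lambda>x. - dd + (\<Sum>k\<in>{0..NN}. Am k x)) x"
        unfolding restr_def using gauge_sum[OF _ order_refl, of x] by (cases "x \<in> D") (simp_all only: if_True if_False)
    qed
    then show ?thesis
      unfolding lax_M_def by (auto simp: fun_eq_iff restr_def Mfun_Qt algebra_simps)
  qed
  have o: "Qt x = 0" "Mfun G b D Qt x = 0" if "x \<notin> D" for x
    using that smooth_curve_outside[OF smc_Mfun[OF B_curve_Qt]] by (auto simp: Qt_def restr_def)
  have "(Qt' = Qt \<and> Mt = Mfun G b D Qt) \<longleftrightarrow> (\<forall>x. Qt' x = Qt x \<and> Mt x = Mfun G b D Qt x)"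
    by blast
  also have "\<dots> \<longleftrightarrow> (\<forall>x. x \<notin> D \<longrightarrow> Qt' x = 0 \<and> Mt x = 0) \<and>
      (\<forall>x\<in>D. Qt' x = Qt x) \<and> (\<forall>x\<in>D. Mt x = Mfun G b D Qt x)"
    using o by metis
  finally show ?thesis using that L M by argo
qed

section \<open>Explicit action on chi, theta and phi\<close>

lemma chi_Qt:
  assumes x: "x \<in> D" and i: "i \<le> ll"
  shows "chi G (Mfun G b D Qt) i x = chi G MM i x - aa i j * ch x"
  using rat_nz[OF j] form_Hspan_cc[OF Hspan_hh[OF i]]
  by (simp add: chi_Mc[OF B_curve_Qt i] chi_Mc[OF Q i] Mc_Qt_0[OF x] form_diff_right form_add_right form_scale_right
      form_hh[OF i j] del: of_int_mult)

lemma theta_Qt: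
  assumes x: "x \<in> D" and i: "i \<le> ll"
  shows "theta G Qt i x = theta G Q i x + aa j i * (ch x / ph x)"
proof -
  have "aa i j * rat j / rat i = aa j i" using aa_sym[OF i j] rat_nz[OF i] by simp
  moreover have "nu G * xx x = ch x / ph x" unfolding xi_def using nu_nz by simp
  moreover have "theta G Qt i x = theta G Q i x + nu G * xx x * (aa i j * rat j / rat i)"
    unfolding theta_eq[OF i] Qt_apply[OF x] using form_Hspan_cc[OF Hspan_hh[OF i]]
    by (simp add: form_diff_right form_add_right form_scale_right form_hh[OF i j] add_divide_distrib)
  ultimately show ?thesis by simp
qed

text \<open>Invariance moves the powers of ad \<open>ff j\<close> from \<open>M\<close> onto
  \<open>ff i\<close> with alternating signs, so -xi becomes xi; \<open>dd\<close> is orthogonal to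
  the resulting negative degrees, and so \<open>gauge_sum\<close> for -d + M can be used.\<close>

lemma phi_Qt:
  assumes x: "x \<in> D" and i: "i \<le> ll"
  shows "phi G (Mfun G b D Qt) i x =
    1 / nu G * fm (exp_nil sc (\<lambda>Y. sc (xx x) (br (ff j) Y)) (ff i)) (MM x)"
proof -
  obtain N0 where N0: "(br (ff j) ^^ N0) (ff i) = 0" using ff_nilpotent_ff[OF i j] by blast
  define N where "N = nil_bound + N0"
  have T: "((\<lambda>Y. sc (xx x) (br (ff j) Y)) ^^ n) (ff i) = sc (xx x ^ n) ((br (ff j) ^^ n) (ff i))" for n
    by (induction n) (simp_all add: br_scale_right mult.commute)
  have "exp_nil sc (\<lambda>Y. sc (xx x) (br (ff j) Y)) (ff i) = (\<Sum>n\<le>N. sc (1 / fact n) (sc (xx x ^ n) ((br (ff j) ^^ n) (ff i))))"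
    unfolding T[symmetric]
  proof (rule exp_nil_eq[OF vector_space_sc])
    fix n assume "N < n"
    then show "((\<lambda>Y. sc (xx x) (br (ff j) Y)) ^^ n) (ff i) = 0"
      unfolding T using funpow_br_mono[OF N0, of n] by (simp add: N_def)
  qed
  then have "fm (exp_nil sc (\<lambda>Y. sc (xx x) (br (ff j) Y)) (ff i)) (MM x) =
      (\<Sum>n\<le>N. (xx x ^ n / fact n) * fm ((br (ff j) ^^ n) (ff i)) (MM x))"
    by (simp add: form_sum_left form_scale_left)
  also have "\<dots> = (\<Sum>n\<le>N. ((- xx x) ^ n / fact n) * fm (ff i) ((br (ff j) ^^ n) (- dd + MM x)))"
  proof (rule sum.cong[OF refl])
    fix n
    have "(br (ff j) ^^ n) (ff i) \<in> Eig (-1 + int n * -1)" by (rule funpow_br_Eig) (use Eig_gens i j in auto)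
    then have "fm ((br (ff j) ^^ n) (ff i)) dd = 0" by (rule form_Eig[OF _ Eig_gens(4)]) simp
    then have "fm (ff i) ((br (ff j) ^^ n) (- dd + MM x)) = (-1) ^ n * fm ((br (ff j) ^^ n) (ff i)) (MM x)"
      unfolding form_funpow_br by (simp add: form_add_right form_minus_right form_diff_right)
    moreover have "(- xx x) ^ n * (-1) ^ n = xx x ^ n" by (simp add: power_mult_distrib[symmetric])
    ultimately show "xx x ^ n / fact n * fm ((br (ff j) ^^ n) (ff i)) (MM x) =
        (- xx x) ^ n / fact n * fm (ff i) ((br (ff j) ^^ n) (- dd + MM x))"
      by (metis (no_types, opaque_lifting) mult.assoc times_divide_eq_left)
  qed
  also have "\<dots> = fm (ff i) (\<Sum>n\<le>N. sc ((- xx x) ^ n / fact n) ((br (ff j) ^^ n) (- dd + MM x)))"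
    by (simp add: form_sum_right form_scale_right)
  also have "\<dots> = fm (ff i) (- dd + (\<Sum>k\<in>{0..NN}. Am k x))"
    by (subst gauge_sum[OF x]) (simp_all add: N_def)
  also have "\<dots> = fm (ff i) (Mfun G b D Qt x)"
    unfolding Mfun_Qt[OF x] using form_Eig[OF Eig_gens(2)[OF i] Eig_gens(4)] form_Eig[OF Eig_gens(2)[OF i] cc_Eig]
    by (simp add: form_add_right form_diff_right form_minus_right form_scale_right)
  finally show ?thesis unfolding phi_def by simp
qed

end

section \<open>Constancy of chi, the ODE system and restriction to regular sets\<close>

context drinfeld_sokolov_data
begin

lemma ds_red_intro: "open D \<Longrightarrow> finite {p \<in> pos_exponents G. b p \<noteq> 0} \<Longrightarrow> ds_red G D b"
  by (intro ds_red.intro ds_open.intro ds_open_axioms.intro ds_red_axioms.intro drinfeld_sokolov_data_axioms)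

lemma chi_phi_diff_poly:
  "\<exists>P R. diff_poly ll P \<and> diff_poly ll R \<and> (\<forall>D Q. open D \<and> B_curve G D Q \<longrightarrow> (\<forall>x\<in>D.
     chi G (Mfun G b D Q) i x = P x (theta_jet G Q x) \<and> phi G (Mfun G b D Q) i x = R x (theta_jet G Q x)))"
proof -
  have "DPs (\<lambda>D Q x. rat i + (-1) * fm (hh i) (Mfun G b D Q x))"
    by (intro DPs_add DPs_mult DPs_const DPs_functional[OF DPv_Mfun linear_form])
  then have c: "DPs (\<lambda>D Q x. chi G (Mfun G b D Q) i x)" by (rule DPs_cong) (simp add: chi_def)
  have "DPs (\<lambda>D Q x. 1 / nu G * fm (ff i) (Mfun G b D Q x))"
    by (intro DPs_mult DPs_const DPs_functional[OF DPv_Mfun linear_form])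
  then have p: "DPs (\<lambda>D Q x. phi G (Mfun G b D Q) i x)" by (rule DPs_cong) (simp add: phi_def)
  obtain P where P: "diff_poly ll P" "\<And>D Q x. valid D Q \<Longrightarrow> x \<in> D \<Longrightarrow> chi G (Mfun G b D Q) i x = P x (theta_jet G Q x)"
    using c unfolding DPs_def by metis
  obtain R where R: "diff_poly ll R" "\<And>D Q x. valid D Q \<Longrightarrow> x \<in> D \<Longrightarrow> phi G (Mfun G b D Q) i x = R x (theta_jet G Q x)"
    using p unfolding DPs_def by metis
  show ?thesis using P R unfolding valid_def by (intro exI[of _ P] exI[of _ R]) simp
qed

end

context ds_red
begin

lemma red_solution_chi_derivative:
  assumes "red_solution G b D Q M" "i \<le> ll" "x \<in> D"
  shows "(chi G M i has_vector_derivative 0) (at x)"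
  using assms chi_derivative[of Q i x] unfolding red_solution_iff by auto

lemma red_solution_chi_constant:
  assumes "red_solution G b D Q M" "i \<le> ll" "connected D"
  shows "chi G M i constant_on D"
proof -
  have d: "(chi G M i has_derivative (\<lambda>h. 0)) (at x)" if "x \<in> D" for x
    using red_solution_chi_derivative[OF assms(1,2) that] unfolding has_vector_derivative_def by simp
  show ?thesis
  proof (cases "D = {}")
    case False
    then obtain a where a: "a \<in> D" by blast
    have "chi G M i x = chi G M i a" if "x \<in> D" for x
      by (rule has_derivative_zero_unique_strong_connected[of D "{}" "chi G M i" a "chi G M i a" x])
        (use assms(3) D a that d in \<open>auto intro!: continuous_at_imp_continuous_on has_derivative_continuous intro: has_derivative_at_withinI\<close>)
    then show ?thesis unfolding constant_on_def by blast
  qed (simp add: constant_on_def)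
qed

text \<open>Since phi_i' + theta_i phi_i = - chi_i holds identically, the ODE system says precisely
  that chi_i equals the prescribed constant. Constant chi_i in turn force the derivative of the
  degree 0 component of \<open>M\<close> to vanish, which is (Red).\<close>

lemma red_system_iff:
  assumes Q: "B_curve G D Q" and C: "(\<Sum>i\<le>ll. of_nat (dlab G i) * C i) = cox_c"
  shows "red_solution G b D Q (Mfun G b D Q) \<and> (\<forall>i\<le>ll. \<forall>x\<in>D. chi G (Mfun G b D Q) i x = C i) \<longleftrightarrow>
    (\<forall>i\<le>ll. \<forall>x\<in>D. vector_derivative (phi G (Mfun G b D Q) i) (at x) + theta G Q i x * phi G (Mfun G b D Q) i x + C i = 0)"
proof -
  have v: "vector_derivative (phi G (Mfun G b D Q) i) (at x) + theta G Q i x * phi G (Mfun G b D Q) i x =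
      - chi G (Mfun G b D Q) i x" if "i \<le> ll" "x \<in> D" for i x
    using vector_derivative_at[OF phi_derivative[OF Q that]] by simp
  have "red_solution G b D Q (Mfun G b D Q)" if c: "\<forall>i\<le>ll. \<forall>x\<in>D. chi G (Mfun G b D Q) i x = C i"
    unfolding red_solution_iff
  proof (intro conjI Q refl ballI)
    fix x assume x: "x \<in> D"
    show "cd (Mc Q 0) x = 0"
    proof (rule cd_Mc0_zero[OF Q x])
      fix i assume i: "i \<le> ll"
      have "(chi G (Mfun G b D Q) i has_vector_derivative 0) (at x)"
        by (rule has_vector_derivative_transform_within_open[OF has_vector_derivative_const D x, of "C i"]) (use c i in simp)
      then show "fm (hh i) (cd (Mc Q 0) x) = 0"
        using vector_derivative_unique_at[OF _ chi_derivative[OF Q i x]] by fastforce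
    qed
  qed
  moreover have "(\<forall>i\<le>ll. \<forall>x\<in>D. chi G (Mfun G b D Q) i x = C i) \<longleftrightarrow>
      (\<forall>i\<le>ll. \<forall>x\<in>D. vector_derivative (phi G (Mfun G b D Q) i) (at x) + theta G Q i x * phi G (Mfun G b D Q) i x + C i = 0)"
    by (auto simp: v)
  ultimately show ?thesis by blast
qed

end

context drinfeld_sokolov_data
begin

lemma gauge_cong:
  assumes "\<And>x. x \<in> D \<Longrightarrow> M x = M' x" shows "gauge G D M j = gauge G D M' j"
proof -
  have "restr D (\<lambda>x. sc (xi G M j x) (ff j)) = restr D (\<lambda>x. sc (xi G M' j x) (ff j))"
    unfolding restr_def using assms by (auto simp: xi_def chi_def phi_def)
  then show ?thesis unfolding gauge_def by simp
qed

text \<open>The regular set \<open>E\<close> is open because phi_j is continuous. On it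
  \<open>Q\<close> is replaced by its restriction \<open>R\<close>, and \<open>DPv_local\<close>
  identifies the function \<open>M\<close> built from \<open>R\<close> with the given one, so the
  case without zeros applies.\<close>

lemma backlund_solution:
  assumes fin: "finite {p \<in> pos_exponents G. b p \<noteq> 0}" and D: "open D"
    and sol: "red_solution G b D Q M" and j: "j \<le> ll"
  shows "(\<exists>Qt Mt. backlund G D j Q M Qt Mt) \<and>
    (\<forall>Qt Mt. backlund G D j Q M Qt Mt \<longrightarrow> red_solution G b (regular_set G D M j) Qt Mt \<and>
       (\<forall>i\<le>ll. \<forall>x\<in>regular_set G D M j.
          chi G Mt i x = chi G M i x - aa i j * chi G M j x \<and>
          theta G Qt i x = theta G Q i x + aa j i * (chi G M j x / phi G M j x) \<and>
          phi G Mt i x = 1 / nu G * fm (exp_nil sc (\<lambda>Y. sc (xi G M j x) (br (ff j) Y)) (ff i)) (M x)))"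
proof -
  interpret r: ds_red G D b by (rule ds_red_intro[OF D fin])
  have Q: "B_curve G D Q" and M: "M = Mfun G b D Q" using sol unfolding r.red_solution_iff by auto
  define E where "E = regular_set G D M j"
  have "continuous_on D (phi G M j)"
    using r.phi_derivative[OF Q j] unfolding M
    by (intro continuous_at_imp_continuous_on ballI) (blast intro: has_vector_derivative_continuous)
  then have "open (D \<inter> phi G M j -` (- {0}))" by (rule continuous_open_preimage[OF _ D]) auto
  moreover have "D \<inter> phi G M j -` (- {0}) = E" unfolding E_def regular_set_def by auto
  ultimately have oE: "open E" by simp
  have ED: "E \<subseteq> D" unfolding E_def regular_set_def by auto
  define R where "R = restr E Q"
  have V: "valid D Q" using D Q unfolding valid_def by blast
  have RM: "Mfun G b E R x = M x" if "x \<in> E" for x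
    unfolding R_def M by (rule DPv_local(2)[OF DPv_Mfun V oE ED that])
  have BR: "B_curve G E R"
    using V D Q oE ED smooth_curve_subset[of D Q E] unfolding B_curve_def R_def by (auto simp: restr_def)
  interpret e: ds_red G E b by (rule ds_red_intro[OF oE fin])
  have eqs: "chi G (Mfun G b E R) i x = chi G M i x" "phi G (Mfun G b E R) i x = phi G M i x"
    "xi G (Mfun G b E R) i x = xi G M i x" "theta G R i x = theta G Q i x" if "x \<in> E" for i x
    using RM[OF that] that by (simp_all add: chi_def phi_def xi_def theta_def R_def restr_def)
  interpret B: ds_backlund G E b R j
  proof
    show "B_curve G E R" "j \<le> ll" by (rule BR, rule j)
    show "phi G (Mfun G b E R) j x \<noteq> 0" if "x \<in> E" for x
      using that eqs(2)[OF that] unfolding E_def regular_set_def by simp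
    \<comment> \<open>The equation for \<open>R\<close> on \<open>E\<close> is recovered from the
      vanishing derivatives of the chi_i, which do restrict to \<open>E\<close>.\<close>
    show "curve_deriv G E (e.Mc R 0) x = 0" if x: "x \<in> E" for x
    proof (rule e.cd_Mc0_zero[OF BR x])
      fix i assume i: "i \<le> ll"
      have "(chi G M i has_vector_derivative 0) (at x)"
        by (rule r.red_solution_chi_derivative[OF sol i]) (use x ED in blast)
      then have "(chi G (Mfun G b E R) i has_vector_derivative 0) (at x)"
        by (rule has_vector_derivative_transform_within_open[OF _ oE x]) (simp add: eqs)
      then show "fm (hh i) (curve_deriv G E (e.Mc R 0) x) = 0"
        using vector_derivative_unique_at[OF _ e.chi_derivative[OF BR i x]] by fastforce
    qed
  qed
  have L: "lax_L G E Q = lax_L G E R" "lax_M G E M = lax_M G E (Mfun G b E R)"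
    unfolding lax_L_def lax_M_def R_def[symmetric] using RM by (auto simp: restr_def R_def)
  have c: "restr E (\<lambda>x. sc (a * xi G M j x) v) = restr E (\<lambda>x. sc (a * xi G (Mfun G b E R) j x) v)"
    "restr E (\<lambda>x. sc (chi G M j x / a) v) = restr E (\<lambda>x. sc (chi G (Mfun G b E R) j x / a) v)" for a v
    unfolding restr_def using eqs by auto
  have g: "gauge G E M j = gauge G E (Mfun G b E R) j" by (rule gauge_cong) (simp add: RM)
  have iff: "backlund G D j Q M Qt Mt \<longleftrightarrow> Qt = B.Qt \<and> Mt = Mfun G b E B.Qt" for Qt Mt
    by (rule B.backlund_iff) (simp only: backlund_def Let_def E_def[symmetric] L g c)
  have "chi G (Mfun G b E B.Qt) i x = chi G M i x - aa i j * chi G M j x \<and>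
          theta G B.Qt i x = theta G Q i x + aa j i * (chi G M j x / phi G M j x) \<and>
          phi G (Mfun G b E B.Qt) i x = 1 / nu G * fm (exp_nil sc (\<lambda>Y. sc (xi G M j x) (br (ff j) Y)) (ff i)) (M x)"
    if "i \<le> ll" "x \<in> E" for i x
    using B.chi_Qt[OF that(2,1)] B.theta_Qt[OF that(2,1)] B.phi_Qt[OF that(2,1)] eqs[OF that(2)] RM[OF that(2)] by simp
  then show ?thesis unfolding iff E_def[symmetric] using B.red_Qt by simp
qed

end

theorem theorem5p5:
  fixes G :: "'g::ab_group_add affine_data" and b :: "int \<times> nat \<Rightarrow> complex"
  assumes data: "drinfeld_sokolov_data G"
    and fin: "finite {p \<in> pos_exponents G. b p \<noteq> 0}"
  shows
    "(\<forall>D Q. open D \<and> B_curve G D Q \<longrightarrow> (\<forall>x\<in>D.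
        (\<Sum>i\<le>ell G. of_nat (lab G i) * theta G Q i x) = 0 \<and>
        (\<Sum>i\<le>ell G. of_nat (dlab G i) * chi G (Mfun G b D Q) i x) = of_nat (cox G))) \<and>
     bij_betw (\<lambda>X. \<lambda>i\<in>{1..ell G}. of_nat (dlab G i) / of_nat (lab G i) * form G (coroot G i) X)
       (Bspace G) ({1..ell G} \<rightarrow>\<^sub>E UNIV) \<and>
     (\<forall>i\<le>ell G. \<exists>P R. diff_poly (ell G) P \<and> diff_poly (ell G) R \<and>
        (\<forall>D Q. open D \<and> B_curve G D Q \<longrightarrow> (\<forall>x\<in>D.
           chi G (Mfun G b D Q) i x = P x (theta_jet G Q x) \<and>
           phi G (Mfun G b D Q) i x = R x (theta_jet G Q x)))) \<and>

     (\<forall>D Q M. open D \<and> connected D \<and> red_solution G b D Q M \<longrightarrow>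
        (\<forall>i\<le>ell G. chi G M i constant_on D)) \<and>

     (\<forall>D Q C. open D \<and> B_curve G D Q \<and>
        (\<Sum>i\<le>ell G. of_nat (dlab G i) * C i) = (of_nat (cox G) :: complex) \<longrightarrow>
        (let M = Mfun G b D Q in
          (red_solution G b D Q M \<and> (\<forall>i\<le>ell G. \<forall>x\<in>D. chi G M i x = C i)) \<longleftrightarrow>
          (\<forall>i\<le>ell G. \<forall>x\<in>D.
             vector_derivative (phi G M i) (at x) + theta G Q i x * phi G M i x + C i = 0))) \<and>

     (\<forall>D Q M. open D \<and> red_solution G b D Q M \<longrightarrow>
        (\<forall>j\<le>ell G. (\<exists>x\<in>D. phi G M j x \<noteq> 0) \<longrightarrow>
          (\<exists>Qt Mt. backlund G D j Q M Qt Mt) \<and>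
          (\<forall>Qt Mt. backlund G D j Q M Qt Mt \<longrightarrow>
             red_solution G b (regular_set G D M j) Qt Mt \<and>
             (\<forall>i\<le>ell G. \<forall>x\<in>regular_set G D M j.
                chi G Mt i x = chi G M i x - of_int (cartan G i j) * chi G M j x \<and>
                theta G Qt i x =
                  theta G Q i x + of_int (cartan G j i) * (chi G M j x / phi G M j x) \<and>
                phi G Mt i x = 1 / nu G *
                  form G (exp_nil (scl G) (\<lambda>Y. scl G (xi G M j x) (brk G (chev_f G j) Y)) (chev_f G i))
                    (M x)))))"
proof -
  interpret drinfeld_sokolov_data G by (rule data)
  have red: "ds_red G D b" if "open D" for D by (rule ds_red_intro[OF that fin])
  have sums: "(\<Sum>i\<le>ell G. of_nat (lab G i) * theta G Q i x) = 0 \<and>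
        (\<Sum>i\<le>ell G. of_nat (dlab G i) * chi G (Mfun G b D Q) i x) = of_nat (cox G)"
    if D: "open D" and Q: "B_curve G D Q" for D Q x
  proof -
    interpret ds_red G D b by (rule red[OF D])
    show ?thesis using sum_lab_theta[of Q x, OF B_curve_facts(2)[OF Q]] sum_dlab_chi[OF Q] by simp
  qed
  have const: "chi G M i constant_on D"
    if "open D" "connected D" "red_solution G b D Q M" "i \<le> ell G" for D Q M i
    by (rule ds_red.red_solution_chi_constant[OF red]) (use that in auto)
  have system: "let M = Mfun G b D Q in
          (red_solution G b D Q M \<and> (\<forall>i\<le>ell G. \<forall>x\<in>D. chi G M i x = C i)) \<longleftrightarrow>
          (\<forall>i\<le>ell G. \<forall>x\<in>D.
             vector_derivative (phi G M i) (at x) + theta G Q i x * phi G M i x + C i = 0)"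
    if "open D" "B_curve G D Q" "(\<Sum>i\<le>ell G. of_nat (dlab G i) * C i) = (of_nat (cox G) :: complex)" for D Q C
    unfolding Let_def by (rule ds_red.red_system_iff[OF red[OF that(1)] that(2,3)])
  show ?thesis
    apply (intro conjI)
    subgoal using sums by blast
    subgoal by (rule Bspace_coordinates)
    subgoal using chi_phi_diff_poly[of b] by blast
    subgoal using const by blast
    subgoal using system by blast
    subgoal by (intro allI impI, elim conjE, rule backlund_solution[OF fin])
    done
qed

end
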